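(* Let $g\ge 0$ and $n\ge 1$ be integers. The set $\tilde{\mathscr{A}}_g^n$ of monic square-free polynomials $D\in\mathbb{C}[x]$ of degree $2g+2$ whose Pell-Abel equation $P^2-DQ^2=1$ has a primitive solution of degree $n$ is invariant under the action of the affine group $D(x)\mapsto a^{-\deg D}D(ax+b)$, $a\in\mathbb{C}^*$, $b\in\mathbb{C}$. The quotient $\mathscr{A}_g^n$ of $\tilde{\mathscr{A}}_g^n$ by this action is a smooth orbifold of complex dimension $g$.
   Context: For a monic complex polynomial $D$ of degree $2g+2$ without multiple roots, the Pell-Abel equation is $P^2(x)-D(x)Q^2(x)=1$ with unknown polynomials $P,Q\in\mathbb{C}[x]$. A solution is nontrivial if $\deg P>0$ (the trivial ones are $(\pm1,0)$). If there is a nontrivial solution, there is a unique (up to sign) polynomial $P$ of minimal degree $n=\deg P>0$ among the nontrivial solutions; this solution is called primitive. The space $\tilde{\mathcal H}_g$ of monic square-free polynomials of degree $2g+2$ is $\mathbb{C}^{2g+2}$ (coefficients) minus the discriminant set, a complex manifold on which the roots of $D$ are local coordinates; $\tilde{\mathscr{A}}_g^n\subset\tilde{\mathcal H}_g$ is considered with the induced structure (it may be empty). *)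

theory Defs
  imports
    "HOL-Analysis.Analysis"
    "HOL-Computational_Algebra.Polynomial"
    "HOL-Algebra.Bij"
begin

section \<open>The Pell-Abel equation and the affine action\<close>

definition pell_abel :: "complex poly \<Rightarrow> complex poly \<Rightarrow> complex poly \<Rightarrow> bool" where
  "pell_abel D P Q \<longleftrightarrow> P\<^sup>2 - D * Q\<^sup>2 = 1"

definition primitive_solution :: "complex poly \<Rightarrow> complex poly \<Rightarrow> complex poly \<Rightarrow> bool" where
  "primitive_solution D P Q \<longleftrightarrow>
     pell_abel D P Q \<and> degree P > 0 \<and>
     (\<forall>P' Q'. pell_abel D P' Q' \<and> degree P' > 0 \<longrightarrow> degree P \<le> degree P')"

definition H_tilde :: "nat \<Rightarrow> complex poly set" where
  "H_tilde g = {D. lead_coeff D = 1 \<and> degree D = 2 * g + 2 \<and> rsquarefree D}"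

definition A_tilde :: "nat \<Rightarrow> nat \<Rightarrow> complex poly set" where
  "A_tilde g n = {D \<in> H_tilde g. \<exists>P Q. primitive_solution D P Q \<and> degree P = n}"

definition affine_act :: "complex \<Rightarrow> complex \<Rightarrow> complex poly \<Rightarrow> complex poly" where
  "affine_act a b D = smult (inverse a ^ degree D) (pcompose D [:b, a:])"

definition affine_orbit :: "complex poly \<Rightarrow> complex poly set" where
  "affine_orbit D = {affine_act a b D | a b. a \<noteq> 0}"


section \<open>Holomorphic maps between open subsets of complex coordinate spaces\<close>

text \<open>
  The dimensions must be allowed to be \<open>0\<close> and to depend on numbers, so the space of \<open>m\<close>-tuples of
  complex numbers is realised as the sequences vanishing from index \<open>m\<close> on (as in the library's
  real counterpart \<open>Euclidean_space m\<close>). The product topology on sequences induces on it the usual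
  topology.
\<close>

type_synonym cvec = "nat \<Rightarrow> complex"

definition cspace :: "nat \<Rightarrow> cvec set" where
  "cspace m = {z. \<forall>i\<ge>m. z i = 0}"

definition cdist :: "nat \<Rightarrow> cvec \<Rightarrow> cvec \<Rightarrow> real" where
  "cdist m z w = L2_set (\<lambda>i. cmod (z i - w i)) {..<m}"

definition mat_apply :: "nat \<Rightarrow> nat \<Rightarrow> (nat \<Rightarrow> nat \<Rightarrow> complex) \<Rightarrow> cvec \<Rightarrow> cvec" where
  "mat_apply m k J v = (\<lambda>j. if j < k then (\<Sum>i<m. J j i * v i) else 0)"

text \<open>
  The \<open>k \<times> m\<close> matrix \<open>J\<close> is the complex Frechet derivative of \<open>f\<close> at \<open>z\<close>. Entries of \<open>J\<close> outside
  the index range are irrelevant.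
\<close>

definition has_jacobian ::
    "nat \<Rightarrow> nat \<Rightarrow> (cvec \<Rightarrow> cvec) \<Rightarrow> (nat \<Rightarrow> nat \<Rightarrow> complex) \<Rightarrow> cvec \<Rightarrow> bool" where
  "has_jacobian m k f J z \<longleftrightarrow>
     (\<forall>j<k. ((\<lambda>w. (f w j - f z j - mat_apply m k J (\<lambda>i. w i - z i) j) / of_real (cdist m w z))
              \<longlongrightarrow> 0) (at z within cspace m))"

definition holomorphic_map :: "nat \<Rightarrow> nat \<Rightarrow> cvec set \<Rightarrow> (cvec \<Rightarrow> cvec) \<Rightarrow> bool" where
  "holomorphic_map m k U f \<longleftrightarrow>
     openin (top_of_set (cspace m)) U \<and> f ` U \<subseteq> cspace k \<and> (\<forall>z\<in>U. \<exists>J. has_jacobian m k f J z)"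

definition holomorphic_immersion :: "nat \<Rightarrow> nat \<Rightarrow> cvec set \<Rightarrow> (cvec \<Rightarrow> cvec) \<Rightarrow> bool" where
  "holomorphic_immersion m k U f \<longleftrightarrow>
     holomorphic_map m k U f \<and>
     (\<forall>z\<in>U. \<forall>J. has_jacobian m k f J z \<longrightarrow> inj_on (mat_apply m k J) (cspace m))"

definition holomorphic_submersion :: "nat \<Rightarrow> nat \<Rightarrow> cvec set \<Rightarrow> (cvec \<Rightarrow> cvec) \<Rightarrow> bool" where
  "holomorphic_submersion m k U f \<longleftrightarrow>
     holomorphic_map m k U f \<and>
     (\<forall>z\<in>U. \<forall>J. has_jacobian m k f J z \<longrightarrow> mat_apply m k J ` cspace m = cspace k)"

definition biholomorphism :: "nat \<Rightarrow> cvec set \<Rightarrow> cvec set \<Rightarrow> (cvec \<Rightarrow> cvec) \<Rightarrow> bool" where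
  "biholomorphism m U V h \<longleftrightarrow>
     bij_betw h U V \<and> holomorphic_map m m U h \<and> holomorphic_map m m V (inv_into U h)"


section \<open>Complex submanifolds\<close>

definition submanifold_param ::
    "nat \<Rightarrow> nat \<Rightarrow> cvec set \<Rightarrow> cvec set \<Rightarrow> (cvec \<Rightarrow> cvec) \<Rightarrow> bool" where
  "submanifold_param N d S V \<psi> \<longleftrightarrow>
     holomorphic_immersion d N V \<psi> \<and>
     openin (top_of_set S) (\<psi> ` V) \<and>
     homeomorphic_map (top_of_set V) (top_of_set (\<psi> ` V)) \<psi>"

definition complex_submanifold :: "nat \<Rightarrow> nat \<Rightarrow> cvec set \<Rightarrow> bool" where
  "complex_submanifold N d S \<longleftrightarrow>
     S \<subseteq> cspace N \<and> (\<forall>p\<in>S. \<exists>V \<psi>. submanifold_param N d S V \<psi> \<and> p \<in> \<psi> ` V)"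

text \<open>\<open>f\<close> is a holomorphic submersion of the open subset \<open>W\<close> of the \<open>d\<close>-dimensional submanifold
  \<open>S\<close> to \<open>m\<close>-dimensional complex space.\<close>

definition submanifold_submersion ::
    "nat \<Rightarrow> nat \<Rightarrow> cvec set \<Rightarrow> nat \<Rightarrow> cvec set \<Rightarrow> (cvec \<Rightarrow> cvec) \<Rightarrow> bool" where
  "submanifold_submersion N d S m W f \<longleftrightarrow>
     openin (top_of_set S) W \<and>
     (\<forall>V \<psi>. submanifold_param N d S V \<psi> \<and> \<psi> ` V \<subseteq> W \<longrightarrow> holomorphic_submersion d m V (f \<circ> \<psi>))"


section \<open>Complex orbifolds\<close>

text \<open>
  Charts in the sense of Satake and Thurston: \<open>\<phi>\<close> induces a homeomorphism from \<open>U / \<Gamma>\<close> onto an open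
  subset of \<open>X\<close>, where \<open>\<Gamma>\<close> is a finite group of biholomorphic automorphisms of \<open>U\<close> (elements of
  the group \<open>BijGroup U\<close> are functions restricted to \<open>U\<close>, so \<open>\<Gamma>\<close> acts effectively).
\<close>

type_synonym 'x orbifold_chart = "cvec set \<times> (cvec \<Rightarrow> cvec) set \<times> (cvec \<Rightarrow> 'x)"

definition orbifold_chart :: "nat \<Rightarrow> 'x topology \<Rightarrow> 'x orbifold_chart \<Rightarrow> bool" where
  "orbifold_chart m X = (\<lambda>(U, \<Gamma>, \<phi>).
     openin (top_of_set (cspace m)) U \<and> connected U \<and>
     finite \<Gamma> \<and> subgroup \<Gamma> (BijGroup U) \<and> (\<forall>\<gamma>\<in>\<Gamma>. biholomorphism m U U \<gamma>) \<and>
     openin X (\<phi> ` U) \<and>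
     quotient_map (top_of_set U) (subtopology X (\<phi> ` U)) \<phi> \<and>
     (\<forall>u\<in>U. \<forall>v\<in>U. \<phi> u = \<phi> v \<longleftrightarrow> (\<exists>\<gamma>\<in>\<Gamma>. v = \<gamma> u)))"

definition compatible_charts :: "nat \<Rightarrow> 'x orbifold_chart \<Rightarrow> 'x orbifold_chart \<Rightarrow> bool" where
  "compatible_charts m = (\<lambda>(U, \<Gamma>, \<phi>) (U', \<Gamma>', \<phi>').
     \<forall>u\<in>U. \<forall>u'\<in>U'. \<phi> u = \<phi>' u' \<longrightarrow>
       (\<exists>W W' h. u \<in> W \<and> W \<subseteq> U \<and> u' \<in> W' \<and> W' \<subseteq> U' \<and>
          biholomorphism m W W' h \<and> h u = u' \<and> (\<forall>w\<in>W. \<phi>' (h w) = \<phi> w)))"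

definition complex_orbifold :: "nat \<Rightarrow> 'x topology \<Rightarrow> 'x orbifold_chart set \<Rightarrow> bool" where
  "complex_orbifold m X \<A> \<longleftrightarrow>
     Hausdorff_space X \<and> second_countable X \<and>
     (\<forall>c\<in>\<A>. orbifold_chart m X c) \<and>
     (\<forall>c\<in>\<A>. \<forall>c'\<in>\<A>. compatible_charts m c c') \<and>
     (\<Union>(U, \<Gamma>, \<phi>)\<in>\<A>. \<phi> ` U) = topspace X"

text \<open>
  A map from a complex submanifold to an orbifold is a holomorphic submersion if it lifts locally,
  with any prescribed admissible value at a point, to holomorphic submersions into the charts. When
  the quotient map by a proper action with orbits of codimension \<open>m\<close> has this property, the orbifold
  structure is the one induced on the quotient: charts are then, up to compatibility, the slices
  transversal to the orbits modulo the (effective) action of the stabilisers.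
\<close>

definition orbifold_submersion ::
    "nat \<Rightarrow> nat \<Rightarrow> cvec set \<Rightarrow> nat \<Rightarrow> 'x orbifold_chart set \<Rightarrow> (cvec \<Rightarrow> 'x) \<Rightarrow> bool" where
  "orbifold_submersion N d S m \<A> \<pi> \<longleftrightarrow>
     (\<forall>(U, \<Gamma>, \<phi>)\<in>\<A>. \<forall>u\<in>U. \<forall>p\<in>S. \<pi> p = \<phi> u \<longrightarrow>
        (\<exists>W f. p \<in> W \<and> submanifold_submersion N d S m W f \<and> f ` W \<subseteq> U \<and> f p = u \<and>
               (\<forall>q\<in>W. \<phi> (f q) = \<pi> q)))"


section \<open>The quotient space\<close>

definition quotient_topology :: "'a topology \<Rightarrow> ('a \<Rightarrow> 'b) \<Rightarrow> 'b topology" where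
  "quotient_topology X q =
     topology (\<lambda>V. V \<subseteq> q ` topspace X \<and> openin X {x \<in> topspace X. q x \<in> V})"

lemma openin_quotient_topology:
  "openin (quotient_topology X q) V \<longleftrightarrow>
     V \<subseteq> q ` topspace X \<and> openin X {x \<in> topspace X. q x \<in> V}"
proof -
  have "istopology (\<lambda>V. V \<subseteq> q ` topspace X \<and> openin X {x \<in> topspace X. q x \<in> V})"
    unfolding istopology_def
  proof (intro conjI allI impI; (elim conjE)?)
    fix S T
    assume "openin X {x \<in> topspace X. q x \<in> S}" "openin X {x \<in> topspace X. q x \<in> T}"
    then have "openin X ({x \<in> topspace X. q x \<in> S} \<inter> {x \<in> topspace X. q x \<in> T})"
      by (rule openin_Int)
    then show "openin X {x \<in> topspace X. q x \<in> S \<inter> T}"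
      by (rule back_subst[of "openin X"]) auto
  next
    fix \<K>
    assume *: "\<forall>K\<in>\<K>. K \<subseteq> q ` topspace X \<and> openin X {x \<in> topspace X. q x \<in> K}"
    then show "\<Union>\<K> \<subseteq> q ` topspace X" by blast
    have "openin X (\<Union>K\<in>\<K>. {x \<in> topspace X. q x \<in> K})"
      using * by (intro openin_Union) auto
    then show "openin X {x \<in> topspace X. q x \<in> \<Union>\<K>}"
      by (rule back_subst[of "openin X"]) auto
  qed auto
  then show ?thesis
    by (simp add: quotient_topology_def)
qed

lemma quotient_map_quotient_topology: "quotient_map X (quotient_topology X q) q"
proof -
  have "openin (quotient_topology X q) (q ` topspace X)"
    unfolding openin_quotient_topology
    by (auto intro!: back_subst[of "openin X", OF openin_topspace])
  then have "topspace (quotient_topology X q) = q ` topspace X"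
    by (metis openin_quotient_topology openin_subset openin_topspace subset_antisym)
  then show ?thesis
    by (auto simp: quotient_map_def openin_quotient_topology)
qed

text \<open>Monic polynomials of degree \<open>N\<close> are identified with the vectors of their lower coefficients.\<close>

definition monic_poly :: "nat \<Rightarrow> cvec \<Rightarrow> complex poly" where
  "monic_poly N z = monom 1 N + (\<Sum>i<N. monom (z i) i)"

lemma coeff_monic_poly:
  "coeff (monic_poly N z) i = (if i < N then z i else if i = N then 1 else 0)"
  by (auto simp: monic_poly_def coeff_sum)

lemma bij_betw_monic_poly:
  "bij_betw (monic_poly N) (cspace N) {D. lead_coeff D = 1 \<and> degree D = N}"
proof (rule bij_betw_byWitness[where f' = "\<lambda>D i. if i < N then coeff D i else 0"])
  have "degree (monic_poly N z) = N" for z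
    by (intro antisym degree_le le_degree) (auto simp: coeff_monic_poly)
  then show "monic_poly N ` cspace N \<subseteq> {D. lead_coeff D = 1 \<and> degree D = N}"
    by (auto simp: coeff_monic_poly)
qed (auto simp: cspace_def coeff_monic_poly poly_eq_iff fun_eq_iff coeff_eq_0)

definition A_tilde_coeffs :: "nat \<Rightarrow> nat \<Rightarrow> cvec set" where
  "A_tilde_coeffs g n = {z \<in> cspace (2 * g + 2). monic_poly (2 * g + 2) z \<in> A_tilde g n}"

definition A_proj :: "nat \<Rightarrow> cvec \<Rightarrow> complex poly set" where
  "A_proj g z = affine_orbit (monic_poly (2 * g + 2) z)"

definition A_quot :: "nat \<Rightarrow> nat \<Rightarrow> complex poly set topology" where
  "A_quot g n = quotient_topology (top_of_set (A_tilde_coeffs g n)) (A_proj g)"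

end

theory Submission
  imports
    Defs
    "HOL-Library.Function_Algebras"
    "HOL-Computational_Algebra.Computational_Algebra"
    "HOL-Computational_Algebra.Field_as_Ring"
begin

text \<open>
  Up to scaling, a primitive solution is a pair of monic polynomials with \<open>P\<^sup>2 - D Q\<^sup>2\<close> constant. In the
  coefficients of \<open>(D, P, Q)\<close> these are \<open>2 n - 1\<close> equations with surjective derivative, hence the
  triples form a manifold of dimension \<open>g + 2\<close>. Its projection to \<open>D\<close> is an immersion, injective because
  the solution of a given degree is unique, and it is a homeomorphism onto its image by a compactness
  argument: limits of solutions do not degenerate.

  The centred polynomials whose \<open>k\<close>-th coefficient is \<open>1\<close> form a submanifold of dimension \<open>g\<close> that is
  transversal to the orbits and meets an orbit in the images of a point under the scalings by
  \<open>(2 g + 2 - k)\<close>-th roots of unity. As \<open>D\<close> is not \<open>(x + c)\<^sup>2\<^sup>g\<^sup>+\<^sup>2\<close>, some non-leading coefficient of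
  its centred form does not vanish, so the orbits of these slices cover the space; small pieces of
  them with their stabilisers are the orbifold charts. Normalising one coefficient by an affine map
  depends holomorphically on the polynomial, which yields the transition maps and the submersion.
\<close>

section \<open>Differentiation on complex coordinate spaces\<close>

text \<open>Maps called holomorphic are only required to be complex differentiable at each point,
  whereas solving equations near a solution requires control of differences between any two nearby
  points. The equations here are polynomial, so they possess difference coefficients that are
  continuous in both points; these take over the role of continuous derivatives. The unknowns are
  2g+2+n+(n-g-1) coefficients, and the conditions are the coefficients of P^2 - D Q^2 in degrees 1
  to 2n-1; the top degree cancels because all polynomials are monic, and the constant term stays
  free. The charts must live in the space of D, not in the space of triples, so the section from D
  to its solution has to be continuous. The compactness argument by itself allows the degree of a
  solution to drop in the limit; minimality of n excludes exactly this. For n \<le> g there is no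
  solution at all and the statements concern the empty space.\<close>

definition nm :: "nat \<Rightarrow> cvec \<Rightarrow> real" where
  "nm m v = L2_set (\<lambda>i. cmod (v i)) {..<m}"

text \<open>The centre belongs to the filter, so an eventual property holds at z itself, and
  convergence along it to the value at z is continuity. Dimension 0, where the punctured filter is
  trivial, is then covered uniformly.\<close>

definition nb :: "nat \<Rightarrow> cvec \<Rightarrow> cvec filter" where
  "nb m z = inf (nhds z) (principal (cspace m))"

lemma cdist_nm: "cdist m z w = nm m (z - w)"
  by (simp add: cdist_def nm_def)

lemma nm_ge_0 [simp]: "0 \<le> nm m v"
  by (simp add: nm_def L2_set_nonneg)

lemma nm_triangle: "nm m (v + w) \<le> nm m v + nm m w"
proof -
  have "nm m (v + w) \<le> L2_set (\<lambda>i. cmod (v i) + cmod (w i)) {..<m}"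
    unfolding nm_def by (rule L2_set_mono) (auto intro: norm_triangle_ineq)
  also have "\<dots> \<le> nm m v + nm m w"
    unfolding nm_def by (rule L2_set_triangle_ineq)
  finally show ?thesis .
qed

lemma nm_minus_commute: "nm m (v - w) = nm m (w - v)"
  by (simp add: nm_def norm_minus_commute)

lemma nm_triangle_diff: "nm m (u - w) \<le> nm m (u - v) + nm m (v - w)"
  using nm_triangle[of m "u - v" "v - w"] by simp

lemma nm_triangle_rev: "nm m v - nm m w \<le> nm m (v - w)"
  using nm_triangle[of m "v - w" w] by simp

lemma component_le_nm: "i < m \<Longrightarrow> cmod (v i) \<le> nm m v"
  unfolding nm_def by (rule member_le_L2_set) auto

lemma nm_le_sum: "nm m v \<le> (\<Sum>i<m. cmod (v i))"
  unfolding nm_def by (rule L2_set_le_sum) auto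

lemma nm_zero [simp]: "nm m 0 = 0" "nm m (\<lambda>i. 0) = 0"
  by (auto simp: nm_def L2_set_def)

lemma nm_scale: "nm m (\<lambda>i. c * v i) = cmod c * nm m v"
  unfolding nm_def norm_mult by (simp add: L2_set_right_distrib)

lemma cspaceD: "v \<in> cspace m \<Longrightarrow> i \<ge> m \<Longrightarrow> v i = 0"
  by (simp add: cspace_def)

lemma cspace_diff [intro]: "v \<in> cspace m \<Longrightarrow> w \<in> cspace m \<Longrightarrow> v - w \<in> cspace m"
  by (simp add: cspace_def)

lemma cspace_add [intro]: "v \<in> cspace m \<Longrightarrow> w \<in> cspace m \<Longrightarrow> v + w \<in> cspace m"
  by (simp add: cspace_def)

lemma cspace_scale [intro]: "v \<in> cspace m \<Longrightarrow> (\<lambda>i. c * v i) \<in> cspace m"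
  by (simp add: cspace_def)

lemma zero_in_cspace [simp]: "0 \<in> cspace m"
  by (simp add: cspace_def)

lemma cspace_eqI: "v \<in> cspace m \<Longrightarrow> w \<in> cspace m \<Longrightarrow> (\<And>i. i < m \<Longrightarrow> v i = w i) \<Longrightarrow> v = w"
  using cspaceD[of v m] cspaceD[of w m] by (intro ext) (metis leI)

lemma nm_eq_0_iff: "v \<in> cspace m \<Longrightarrow> nm m v = 0 \<longleftrightarrow> v = 0"
proof
  assume "v \<in> cspace m" "nm m v = 0"
  moreover have "v i = 0" if "i < m" for i
    using component_le_nm[OF that, of v] \<open>nm m v = 0\<close> by simp
  ultimately show "v = 0"
    by (intro cspace_eqI[of v m 0]) auto
qed simp

lemma mat_apply_in_cspace [simp]: "mat_apply m k J v \<in> cspace k"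
  by (simp add: mat_apply_def cspace_def)

lemma mat_apply_diff: "mat_apply m k J (v - w) = mat_apply m k J v - mat_apply m k J w"
  by (auto simp: mat_apply_def fun_eq_iff algebra_simps sum_subtractf)

lemma mat_apply_add: "mat_apply m k J (v + w) = mat_apply m k J v + mat_apply m k J w"
  by (auto simp: mat_apply_def fun_eq_iff algebra_simps sum.distrib)

lemma mat_apply_scale: "mat_apply m k J (\<lambda>i. c * v i) = (\<lambda>j. c * mat_apply m k J v j)"
  by (auto simp: mat_apply_def fun_eq_iff sum_distrib_left algebra_simps)

lemma mat_apply_zero [simp]: "mat_apply m k J 0 = 0"
  by (auto simp: mat_apply_def fun_eq_iff)

lemma tendsto_coord: "((\<lambda>w::cvec. w i) \<longlongrightarrow> z i) (nhds z)"
proof -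
  have "isCont (\<lambda>w::cvec. w i) z"
    using continuous_on_product_coordinates[where ?i = i and 'b = complex]
      continuous_on_eq_continuous_at[OF open_UNIV] by blast
  then show ?thesis by (simp add: isCont_def tendsto_nhds_iff)
qed

text \<open>Only m coordinates vary on \<open>cspace m\<close>, so neighbourhoods of the product
  topology trace the Euclidean ones there. One direction uses a sequence of counterexamples at
  distance below 1/(j+1), which converges coordinatewise and hence in the product topology.\<close>

lemma eventually_nb:
  assumes z: "z \<in> cspace m"
  shows "eventually P (nb m z) \<longleftrightarrow> (\<exists>\<delta>>0. \<forall>w\<in>cspace m. nm m (w - z) < \<delta> \<longrightarrow> P w)"
proof
  assume "eventually P (nb m z)"
  then have ev: "eventually (\<lambda>w. w \<in> cspace m \<longrightarrow> P w) (nhds z)"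
    by (simp add: nb_def eventually_inf_principal)
  show "\<exists>\<delta>>0. \<forall>w\<in>cspace m. nm m (w - z) < \<delta> \<longrightarrow> P w"
  proof (rule ccontr)
    assume neg: "\<not> ?thesis"
    have "\<exists>w. w \<in> cspace m \<and> nm m (w - z) < 1 / Suc j \<and> \<not> P w" for j
      using neg by (metis of_nat_0_less_iff zero_less_Suc zero_less_divide_1_iff)
    then obtain w where w: "\<And>j. w j \<in> cspace m" "\<And>j. nm m (w j - z) < 1 / Suc j" "\<And>j. \<not> P (w j)"
      by metis
    have "(\<lambda>j. w j i) \<longlonglongrightarrow> z i" for i
    proof (cases "i < m")
      case True
      have "(\<lambda>j. w j i - z i) \<longlonglongrightarrow> 0"
      proof (rule Lim_null_comparison)
        show "(\<lambda>j. 1 / real (Suc j)) \<longlonglongrightarrow> 0"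
          by (rule LIMSEQ_Suc[OF lim_1_over_n])
        show "\<forall>\<^sub>F j in sequentially. norm (w j i - z i) \<le> 1 / real (Suc j)"
        proof (intro always_eventually allI)
          fix j
          show "norm (w j i - z i) \<le> 1 / real (Suc j)"
            using component_le_nm[OF True, of "w j - z"] w(2)[of j] by simp
        qed
      qed
      then show ?thesis
        by (simp add: LIM_zero_iff)
    next
      case False
      then show ?thesis using w(1) z by (simp add: cspace_def)
    qed
    then have "w \<longlonglongrightarrow> z"
      using limitin_componentwise[of "\<lambda>_::nat. euclidean::complex topology" UNIV w z sequentially]
      by (simp add: euclidean_product_topology)
    then have "eventually (\<lambda>j. w j \<in> cspace m \<longrightarrow> P (w j)) sequentially"
      by (rule eventually_compose_filterlim[OF ev])
    then show False using w by simp
  qed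
next
  assume "\<exists>\<delta>>0. \<forall>w\<in>cspace m. nm m (w - z) < \<delta> \<longrightarrow> P w"
  then obtain \<delta> where d: "\<delta> > 0" "\<And>w. w \<in> cspace m \<Longrightarrow> nm m (w - z) < \<delta> \<Longrightarrow> P w" by blast
  have "((\<lambda>w. \<Sum>i<m. cmod (w i - z i)) \<longlongrightarrow> (\<Sum>i<m. cmod (z i - z i))) (nhds z)"
    by (intro tendsto_intros tendsto_coord)
  then have "eventually (\<lambda>w. (\<Sum>i<m. cmod (w i - z i)) < \<delta>) (nhds z)"
    using d(1) by (auto simp: order_tendsto_iff)
  then have "eventually (\<lambda>w. w \<in> cspace m \<longrightarrow> P w) (nhds z)"
  proof eventually_elim
    case (elim w)
    then show ?case using d(2)[of w] nm_le_sum[of m "w - z"] by auto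
  qed
  then show "eventually P (nb m z)"
    by (simp add: nb_def eventually_inf_principal)
qed

lemma openin_cspace_iff_nb:
  "openin (top_of_set (cspace m)) U \<longleftrightarrow> U \<subseteq> cspace m \<and> (\<forall>z\<in>U. eventually (\<lambda>w. w \<in> U) (nb m z))"
proof
  assume "openin (top_of_set (cspace m)) U"
  then obtain T where "open T" "U = cspace m \<inter> T" by (auto simp: openin_open)
  then show "U \<subseteq> cspace m \<and> (\<forall>z\<in>U. eventually (\<lambda>w. w \<in> U) (nb m z))"
    by (auto simp: nb_def eventually_inf_principal eventually_nhds)
next
  assume R: "U \<subseteq> cspace m \<and> (\<forall>z\<in>U. eventually (\<lambda>w. w \<in> U) (nb m z))"
  show "openin (top_of_set (cspace m)) U"
  proof (subst openin_subopen, intro ballI)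
    fix z assume "z \<in> U"
    with R obtain T where "open T" "z \<in> T" "\<forall>w\<in>T. w \<in> cspace m \<longrightarrow> w \<in> U"
      unfolding nb_def eventually_inf_principal eventually_nhds by blast
    then show "\<exists>T. openin (top_of_set (cspace m)) T \<and> z \<in> T \<and> T \<subseteq> U"
      using R \<open>z \<in> U\<close> by (intro exI[of _ "cspace m \<inter> T"]) (auto simp: openin_open)
  qed
qed

lemma openin_cspace_iff:
  "openin (top_of_set (cspace m)) U \<longleftrightarrow>
     U \<subseteq> cspace m \<and> (\<forall>z\<in>U. \<exists>\<delta>>0. \<forall>w\<in>cspace m. nm m (w - z) < \<delta> \<longrightarrow> w \<in> U)"
  unfolding openin_cspace_iff_nb by (intro conj_cong refl ball_cong eventually_nb) auto

lemma eventually_nb_self: "eventually P (nb m z) \<Longrightarrow> z \<in> cspace m \<Longrightarrow> P z"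
  by (auto simp: nb_def eventually_inf_principal eventually_nhds)

lemma eventually_nb_cspace: "eventually (\<lambda>w. w \<in> cspace m) (nb m z)"
  by (simp add: nb_def eventually_inf_principal)

lemma tendsto_nb_coord: "((\<lambda>w. w i) \<longlongrightarrow> z i) (nb m z)"
proof -
  have "((\<lambda>w. w i) \<longlongrightarrow> z i) (nhds z)"
    by (rule tendsto_coord)
  then show ?thesis
    by (rule filterlim_mono) (auto simp: nb_def)
qed

lemma filterlim_nb_iff:
  assumes "c \<in> cspace k"
  shows "filterlim f (nb k c) F \<longleftrightarrow>
    eventually (\<lambda>x. f x \<in> cspace k) F \<and> (\<forall>j<k. ((\<lambda>x. f x j) \<longlongrightarrow> c j) F)"
proof
  assume A: "filterlim f (nb k c) F"
  then show "eventually (\<lambda>x. f x \<in> cspace k) F \<and> (\<forall>j<k. ((\<lambda>x. f x j) \<longlongrightarrow> c j) F)"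
    using filterlim_compose[OF tendsto_nb_coord A] eventually_nb_cspace[of k c] A
    by (auto simp: filterlim_iff)
next
  assume A: "eventually (\<lambda>x. f x \<in> cspace k) F \<and> (\<forall>j<k. ((\<lambda>x. f x j) \<longlongrightarrow> c j) F)"
  show "filterlim f (nb k c) F"
    unfolding filterlim_iff
  proof (intro allI impI)
    fix P assume "eventually P (nb k c)"
    then obtain \<delta> where d: "\<delta> > 0" "\<And>w. w \<in> cspace k \<Longrightarrow> nm k (w - c) < \<delta> \<Longrightarrow> P w"
      using eventually_nb[OF assms] by blast
    have "((\<lambda>x. \<Sum>j<k. cmod (f x j - c j)) \<longlongrightarrow> (\<Sum>j<k. cmod (c j - c j))) F"
      using A by (intro tendsto_intros) auto
    then have "eventually (\<lambda>x. (\<Sum>j<k. cmod (f x j - c j)) < \<delta>) F"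
      using d(1) by (auto simp: order_tendsto_iff)
    with conjunct1[OF A] show "eventually (\<lambda>x. P (f x)) F"
    proof eventually_elim
      case (elim x)
      then show ?case using d(2)[of "f x"] nm_le_sum[of k "f x - c"] by auto
    qed
  qed
qed

lemma tendsto_nm_nb: "z \<in> cspace m \<Longrightarrow> ((\<lambda>w. nm m (w - z)) \<longlongrightarrow> 0) (nb m z)"
  unfolding tendsto_iff using eventually_nb[of z m] by (auto simp: dist_real_def)

text \<open>Caratheodory's form of the derivative, for which sums, products and composites are immediate.\<close>

definition has_grad :: "nat \<Rightarrow> (cvec \<Rightarrow> complex) \<Rightarrow> (nat \<Rightarrow> complex) \<Rightarrow> cvec \<Rightarrow> bool" where
  "has_grad m f c z \<longleftrightarrow> (\<exists>\<phi>. (\<forall>i<m. ((\<lambda>w. \<phi> i w) \<longlongrightarrow> c i) (nb m z)) \<and>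
     eventually (\<lambda>w. f w - f z = (\<Sum>i<m. \<phi> i w * (w i - z i))) (nb m z))"

lemma has_gradI:
  assumes "\<And>i. i < m \<Longrightarrow> ((\<lambda>w. \<phi> i w) \<longlongrightarrow> c i) (nb m z)"
    and "eventually (\<lambda>w. f w - f z = (\<Sum>i<m. \<phi> i w * (w i - z i))) (nb m z)"
  shows "has_grad m f c z"
  using assms unfolding has_grad_def by blast

lemma nm_sum_bound: "cmod (\<Sum>i<m. a i * v i) \<le> (\<Sum>i<m. cmod (a i)) * nm m v"
proof -
  have "cmod (\<Sum>i<m. a i * v i) \<le> (\<Sum>i<m. cmod (a i) * nm m v)"
    by (rule sum_norm_le) (auto simp: norm_mult intro!: mult_left_mono component_le_nm)
  then show ?thesis by (simp add: sum_distrib_right)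
qed

text \<open>The two notions agree because a scalar remainder of order o(|h|) can be written as a
  linear form in h with coefficients tending to 0.\<close>

lemma has_grad_frechet:
  assumes z: "z \<in> cspace m"
  shows "has_grad m f c z \<longleftrightarrow>
    (\<forall>\<epsilon>>0. eventually (\<lambda>w. cmod (f w - f z - (\<Sum>i<m. c i * (w i - z i))) \<le> \<epsilon> * nm m (w - z)) (nb m z))"
    (is "_ \<longleftrightarrow> (\<forall>\<epsilon>>0. ?E \<epsilon>)")
proof
  assume "has_grad m f c z"
  then obtain \<phi> where p: "\<And>i. i < m \<Longrightarrow> ((\<lambda>w. \<phi> i w) \<longlongrightarrow> c i) (nb m z)"
    and e: "eventually (\<lambda>w. f w - f z = (\<Sum>i<m. \<phi> i w * (w i - z i))) (nb m z)"
    unfolding has_grad_def by blast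
  show "\<forall>\<epsilon>>0. ?E \<epsilon>"
  proof (intro allI impI)
    fix \<epsilon> :: real assume "\<epsilon> > 0"
    have "((\<lambda>w. \<Sum>i<m. cmod (\<phi> i w - c i)) \<longlongrightarrow> (\<Sum>i<m. cmod (c i - c i))) (nb m z)"
      using p by (intro tendsto_intros) auto
    then have "eventually (\<lambda>w. (\<Sum>i<m. cmod (\<phi> i w - c i)) < \<epsilon>) (nb m z)"
      using \<open>\<epsilon> > 0\<close> by (auto simp: order_tendsto_iff)
    with e show "?E \<epsilon>"
    proof eventually_elim
      case (elim w)
      have "f w - f z - (\<Sum>i<m. c i * (w i - z i)) = (\<Sum>i<m. (\<phi> i w - c i) * (w - z) i)"
        unfolding elim by (simp add: sum_subtractf[symmetric] algebra_simps)
      then have "cmod (f w - f z - (\<Sum>i<m. c i * (w i - z i))) \<le> (\<Sum>i<m. cmod (\<phi> i w - c i)) * nm m (w - z)"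
        using nm_sum_bound[where a = "\<lambda>i. \<phi> i w - c i" and v = "w - z"] by simp
      also have "\<dots> \<le> \<epsilon> * nm m (w - z)"
        using elim by (intro mult_right_mono) auto
      finally show ?case .
    qed
  qed
next
  assume E: "\<forall>\<epsilon>>0. ?E \<epsilon>"
  define rem where "rem w = f w - f z - (\<Sum>i<m. c i * (w i - z i))" for w
  \<comment> \<open>The remainder is spread over the coordinates along the conjugate of h = w - z.
    As \<Sum> cnj (h i) * h i is the squared norm, the form reproduces it exactly, with corrections
    bounded by |rem| / |h|. At w = z division by zero gives the value c i.\<close>
  define \<phi> where "\<phi> i w = c i + cnj (w i - z i) * rem w / of_real ((nm m (w - z))\<^sup>2)" for i w
  show "has_grad m f c z"
  proof (rule has_gradI)
    fix i assume i: "i < m"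
    have "((\<lambda>w. \<phi> i w - c i) \<longlongrightarrow> 0) (nb m z)"
    proof (rule tendstoI)
      fix \<epsilon> :: real assume "\<epsilon> > 0"
      then have "\<epsilon>/2 > 0" by simp
      then have "?E (\<epsilon>/2)" using E by blast
      then show "eventually (\<lambda>w. dist (\<phi> i w - c i) 0 < \<epsilon>) (nb m z)"
      proof eventually_elim
        case (elim w)
        define r where "r = nm m (w - z)"
        have "cmod (w i - z i) \<le> r" using component_le_nm[OF i, of "w - z"] by (simp add: r_def)
        moreover have "cmod (rem w) \<le> \<epsilon>/2 * r" using elim by (simp add: rem_def r_def)
        moreover have "r \<ge> 0" by (simp add: r_def)
        ultimately have "cmod (w i - z i) * cmod (rem w) \<le> r * (\<epsilon>/2 * r)"
          using \<open>\<epsilon> > 0\<close> by (intro mult_mono) auto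
        then have *: "cmod (w i - z i) * cmod (rem w) / r\<^sup>2 \<le> \<epsilon>/2" if "r \<noteq> 0"
          using that by (subst pos_divide_le_eq, simp) (simp add: power2_eq_square mult.assoc mult.left_commute)
        have "cmod (\<phi> i w - c i) = cmod (w i - z i) * cmod (rem w) / r\<^sup>2"
          unfolding \<phi>_def r_def[symmetric] by (simp add: norm_mult norm_divide norm_power flip: complex_cnj_diff)
        also have "\<dots> < \<epsilon>"
        proof (cases "r = 0")
          case False
          then have "cmod (w i - z i) * cmod (rem w) / r\<^sup>2 \<le> \<epsilon>/2" by (rule *)
          then show ?thesis using \<open>\<epsilon> > 0\<close> by linarith
        qed (use \<open>\<epsilon> > 0\<close> in simp)
        finally show ?case by (simp add: dist_norm)
      qed
    qed
    then show "(\<phi> i \<longlongrightarrow> c i) (nb m z)" by (simp add: LIM_zero_iff)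
  next
    have "eventually (\<lambda>w. w \<in> cspace m) (nb m z)" by (rule eventually_nb_cspace)
    moreover have "?E 1" using E zero_less_one by blast
    ultimately show "eventually (\<lambda>w. f w - f z = (\<Sum>i<m. \<phi> i w * (w i - z i))) (nb m z)"
    proof eventually_elim
      case (elim w)
      define r where "r = nm m (w - z)"
      have r: "complex_of_real (r\<^sup>2) = (\<Sum>i<m. cnj (w i - z i) * (w i - z i))"
      proof -
        have "r\<^sup>2 = (\<Sum>i<m. (cmod (w i - z i))\<^sup>2)"
          unfolding r_def nm_def L2_set_def by (simp add: sum_nonneg)
        then have "complex_of_real (r\<^sup>2) = (\<Sum>i<m. complex_of_real ((cmod (w i - z i))\<^sup>2))"
          by simp
        also have "\<dots> = (\<Sum>i<m. cnj (w i - z i) * (w i - z i))"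
          by (intro sum.cong refl) (simp only: complex_norm_square mult.commute)
        finally show ?thesis .
      qed
      show ?case
      proof (cases "r = 0")
        case True
        then have "w - z = 0" using nm_eq_0_iff[of "w - z" m] elim z by (auto simp: r_def)
        then show ?thesis by (simp add: \<phi>_def)
      next
        case False
        have "(\<Sum>i<m. \<phi> i w * (w i - z i)) = (\<Sum>i<m. c i * (w i - z i)) +
          rem w / of_real (r\<^sup>2) * (\<Sum>i<m. cnj (w i - z i) * (w i - z i))"
          unfolding \<phi>_def r_def[symmetric] sum_distrib_left sum.distrib[symmetric]
          by (intro sum.cong) (auto simp: field_simps)
        also have "\<dots> = (\<Sum>i<m. c i * (w i - z i)) + rem w"
          unfolding r[symmetric] using False by simp
        finally show ?thesis by (simp add: rem_def)
      qed
    qed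
  qed
qed

text \<open>Multiplying by the distance removes the quotient, and the remainder vanishes at z. Hence
  the punctured filter of \<open>has_jacobian\<close> may be exchanged for \<open>nb\<close>, and
  each row of J is the gradient of one component.\<close>

lemma has_jacobian_iff_grad:
  assumes z: "z \<in> cspace m"
  shows "has_jacobian m k f J z \<longleftrightarrow> (\<forall>j<k. has_grad m (\<lambda>w. f w j) (J j) z)"
proof -
  have 1: "((\<lambda>w. (h w) / of_real (cdist m w z)) \<longlongrightarrow> 0) (at z within cspace m) \<longleftrightarrow>
     (\<forall>\<epsilon>>0. eventually (\<lambda>w. cmod (h w) \<le> \<epsilon> * nm m (w - z)) (nb m z))"
    if h0: "h z = 0" for h :: "cvec \<Rightarrow> complex"
  proof -
    have ev: "eventually P (at z within cspace m) \<longleftrightarrow> eventually (\<lambda>w. w \<noteq> z \<longrightarrow> P w) (nb m z)" for P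
      unfolding eventually_at_filter nb_def eventually_inf_principal
      by (intro arg_cong2[where f = eventually]) auto
    show ?thesis
    proof
      assume L: "((\<lambda>w. (h w) / of_real (cdist m w z)) \<longlongrightarrow> 0) (at z within cspace m)"
      show "\<forall>\<epsilon>>0. eventually (\<lambda>w. cmod (h w) \<le> \<epsilon> * nm m (w - z)) (nb m z)"
      proof (intro allI impI)
        fix \<epsilon> :: real assume "\<epsilon> > 0"
        then have "eventually (\<lambda>w. w \<noteq> z \<longrightarrow> dist ((h w) / of_real (cdist m w z)) 0 < \<epsilon>) (nb m z)"
          using tendstoD[OF L, THEN ev[THEN iffD1]] by simp
        with eventually_nb_cspace show "eventually (\<lambda>w. cmod (h w) \<le> \<epsilon> * nm m (w - z)) (nb m z)"
        proof eventually_elim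
          case (elim w)
          then have "w \<noteq> z \<Longrightarrow> nm m (w - z) > 0"
            using nm_eq_0_iff[of "w - z" m] z by (auto simp: less_le)
          then show ?case
          proof (cases "w = z")
            case False
            then have "cmod (h w) / nm m (w - z) < \<epsilon>"
              using elim by (simp add: cdist_nm norm_divide)
            then show ?thesis
              using \<open>w \<noteq> z \<Longrightarrow> nm m (w - z) > 0\<close> False by (simp add: pos_divide_less_eq)
          qed (simp add: h0)
        qed
      qed
    next
      assume R: "\<forall>\<epsilon>>0. eventually (\<lambda>w. cmod (h w) \<le> \<epsilon> * nm m (w - z)) (nb m z)"
      show "((\<lambda>w. (h w) / of_real (cdist m w z)) \<longlongrightarrow> 0) (at z within cspace m)"
      proof (rule tendstoI, rule ev[THEN iffD2])
        fix \<epsilon> :: real assume "\<epsilon> > 0"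
        then have "\<epsilon>/2 > 0" by simp
        then have "eventually (\<lambda>w. cmod (h w) \<le> (\<epsilon>/2) * nm m (w - z)) (nb m z)" using R by blast
        with eventually_nb_cspace
        show "eventually (\<lambda>w. w \<noteq> z \<longrightarrow> dist ((h w) / of_real (cdist m w z)) 0 < \<epsilon>) (nb m z)"
        proof eventually_elim
          case (elim w)
          show ?case
          proof
            assume "w \<noteq> z"
            then have "nm m (w - z) > 0"
              using nm_eq_0_iff[of "w - z" m] z elim by (auto simp: less_le)
            then have "cmod (h w) / nm m (w - z) \<le> \<epsilon>/2" using elim by (simp add: pos_divide_le_eq)
            moreover have "dist ((h w) / of_real (cdist m w z)) 0 = cmod (h w) / nm m (w - z)"
              by (simp add: cdist_nm norm_divide dist_norm)
            ultimately show "dist ((h w) / of_real (cdist m w z)) 0 < \<epsilon>"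
              using \<open>\<epsilon> > 0\<close> by linarith
          qed
        qed
      qed
    qed
  qed
  show ?thesis
    unfolding has_jacobian_def
    by (intro all_cong1 imp_cong refl)
      (subst 1; simp add: has_grad_frechet[OF z] mat_apply_def)
qed

section \<open>Calculus rules for gradients and Jacobians\<close>

lemma has_grad_isCont:
  assumes "has_grad m f c z"
  shows "(f \<longlongrightarrow> f z) (nb m z)"
proof -
  obtain \<phi> where p: "\<And>i. i < m \<Longrightarrow> ((\<lambda>w. \<phi> i w) \<longlongrightarrow> c i) (nb m z)"
    and e: "eventually (\<lambda>w. f w - f z = (\<Sum>i<m. \<phi> i w * (w i - z i))) (nb m z)"
    using assms unfolding has_grad_def by blast
  have "((\<lambda>w. f z + (\<Sum>i<m. \<phi> i w * (w i - z i))) \<longlongrightarrow> f z + (\<Sum>i<m. c i * (z i - z i))) (nb m z)"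
    using p by (intro tendsto_intros tendsto_nb_coord) auto
  moreover from e have "eventually (\<lambda>w. f z + (\<Sum>i<m. \<phi> i w * (w i - z i)) = f w) (nb m z)"
    by eventually_elim (metis add.commute diff_add_cancel)
  ultimately show ?thesis
    by (simp add: tendsto_cong)
qed

lemma has_grad_const: "has_grad m (\<lambda>w. a) (\<lambda>i. 0) z"
  by (rule has_gradI[where \<phi> = "\<lambda>i w. 0"]) auto

lemma has_grad_coord: "l < m \<Longrightarrow> has_grad m (\<lambda>w. w l) (\<lambda>i. if i = l then 1 else 0) z"
  by (rule has_gradI[where \<phi> = "\<lambda>i w. if i = l then 1 else 0"])
     (auto simp: if_distrib[of "\<lambda>x. x * _"] cong: if_cong)

lemma has_grad_add:
  assumes "has_grad m f c z" "has_grad m f' c' z"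
  shows "has_grad m (\<lambda>w. f w + f' w) (\<lambda>i. c i + c' i) z"
proof -
  obtain \<phi> \<phi>' where p: "\<And>i. i < m \<Longrightarrow> ((\<lambda>w. \<phi> i w) \<longlongrightarrow> c i) (nb m z)"
     "\<And>i. i < m \<Longrightarrow> ((\<lambda>w. \<phi>' i w) \<longlongrightarrow> c' i) (nb m z)"
    and e: "eventually (\<lambda>w. f w - f z = (\<Sum>i<m. \<phi> i w * (w i - z i))) (nb m z)"
     "eventually (\<lambda>w. f' w - f' z = (\<Sum>i<m. \<phi>' i w * (w i - z i))) (nb m z)"
    using assms unfolding has_grad_def by blast
  show ?thesis
  proof (rule has_gradI)
    show "((\<lambda>w. \<phi> i w + \<phi>' i w) \<longlongrightarrow> c i + c' i) (nb m z)" if "i < m" for i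
      using p that by (intro tendsto_intros) auto
    show "\<forall>\<^sub>F w in nb m z. f w + f' w - (f z + f' z) = (\<Sum>i<m. (\<phi> i w + \<phi>' i w) * (w i - z i))"
      using e
    proof eventually_elim
      case (elim w)
      have "f w + f' w - (f z + f' z) = (f w - f z) + (f' w - f' z)" by simp
      then show ?case unfolding elim by (simp add: distrib_right sum.distrib)
    qed
  qed
qed

lemma has_grad_mult:
  assumes "has_grad m f c z" "has_grad m f' c' z"
  shows "has_grad m (\<lambda>w. f w * f' w) (\<lambda>i. f z * c' i + c i * f' z) z"
proof -
  obtain \<phi> \<phi>' where p: "\<And>i. i < m \<Longrightarrow> ((\<lambda>w. \<phi> i w) \<longlongrightarrow> c i) (nb m z)"
     "\<And>i. i < m \<Longrightarrow> ((\<lambda>w. \<phi>' i w) \<longlongrightarrow> c' i) (nb m z)"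
    and e: "eventually (\<lambda>w. f w - f z = (\<Sum>i<m. \<phi> i w * (w i - z i))) (nb m z)"
     "eventually (\<lambda>w. f' w - f' z = (\<Sum>i<m. \<phi>' i w * (w i - z i))) (nb m z)"
    using assms unfolding has_grad_def by blast
  show ?thesis
  proof (rule has_gradI)
    show "((\<lambda>w. f w * \<phi>' i w + \<phi> i w * f' z) \<longlongrightarrow> f z * c' i + c i * f' z) (nb m z)" if "i < m" for i
      using p that has_grad_isCont[OF assms(1)] by (intro tendsto_intros) auto
    show "\<forall>\<^sub>F w in nb m z. f w * f' w - f z * f' z = (\<Sum>i<m. (f w * \<phi>' i w + \<phi> i w * f' z) * (w i - z i))"
      using e
    proof eventually_elim
      case (elim w)
      have "f w * f' w - f z * f' z = f w * (f' w - f' z) + (f w - f z) * f' z"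
        by (simp add: algebra_simps)
      also have "\<dots> = (\<Sum>i<m. (f w * \<phi>' i w + \<phi> i w * f' z) * (w i - z i))"
        unfolding elim sum_distrib_left sum_distrib_right sum.distrib[symmetric]
        by (intro sum.cong refl) (simp add: algebra_simps)
      finally show ?case .
    qed
  qed
qed

text \<open>The difference coefficients of finitely many components are chosen at once, so that one
  eventual equation describes the whole map; the chain rule and the lifting lemma substitute into
  it.\<close>

lemma has_grad_family:
  fixes f :: "cvec \<Rightarrow> cvec"
  assumes "\<And>j. j < k \<Longrightarrow> has_grad m (\<lambda>w. f w j) (J j) z"
  obtains \<phi> where "\<And>j i. j < k \<Longrightarrow> i < m \<Longrightarrow> (\<phi> j i \<longlongrightarrow> J j i) (nb m z)"
    and "eventually (\<lambda>w. \<forall>j\<in>{..<k}. f w j - f z j = (\<Sum>i<m. \<phi> j i w * (w i - z i))) (nb m z)"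
proof -
  define P where "P j \<phi> \<longleftrightarrow> (\<forall>i<m. (\<phi> i \<longlongrightarrow> J j i) (nb m z)) \<and>
     eventually (\<lambda>w. f w j - f z j = (\<Sum>i<m. \<phi> i w * (w i - z i))) (nb m z)" for j \<phi>
  define \<phi> where "\<phi> j = (SOME \<phi>. P j \<phi>)" for j
  have P: "P j (\<phi> j)" if "j < k" for j
  proof -
    have "\<exists>\<phi>. P j \<phi>" using assms[OF that] unfolding has_grad_def P_def .
    then show ?thesis unfolding \<phi>_def by (rule someI_ex)
  qed
  show ?thesis
  proof (rule that)
    show "(\<phi> j i \<longlongrightarrow> J j i) (nb m z)" if "j < k" "i < m" for j i
      using P[OF that(1)] that(2) by (simp add: P_def)
    show "eventually (\<lambda>w. \<forall>j\<in>{..<k}. f w j - f z j = (\<Sum>i<m. \<phi> j i w * (w i - z i))) (nb m z)"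
      by (rule eventually_ball_finite) (use P in \<open>auto simp: P_def\<close>)
  qed
qed

text \<open>Substituting one system of difference coefficients into the other gives a matrix product
  at nearby points, and the limit of this product is the product of the limits.\<close>

lemma has_grad_chain:
  assumes z: "z \<in> cspace m" and c: "\<psi> z \<in> cspace k"
    and ev: "eventually (\<lambda>w. \<psi> w \<in> cspace k) (nb m z)"
    and J: "\<And>j. j < k \<Longrightarrow> has_grad m (\<lambda>w. \<psi> w j) (J j) z"
    and f: "has_grad k f c (\<psi> z)"
  shows "has_grad m (\<lambda>w. f (\<psi> w)) (\<lambda>i. \<Sum>j<k. c j * J j i) z"
proof -
  have flt: "filterlim \<psi> (nb k (\<psi> z)) (nb m z)"
    using ev has_grad_isCont[OF J] by (simp add: filterlim_nb_iff[OF c])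
  obtain \<phi> where p: "\<And>j. j < k \<Longrightarrow> (\<phi> j \<longlongrightarrow> c j) (nb k (\<psi> z))"
    and e: "eventually (\<lambda>y. f y - f (\<psi> z) = (\<Sum>j<k. \<phi> j y * (y j - \<psi> z j))) (nb k (\<psi> z))"
    using f unfolding has_grad_def by blast
  obtain \<theta> where t: "\<And>j i. j < k \<Longrightarrow> i < m \<Longrightarrow> (\<theta> j i \<longlongrightarrow> J j i) (nb m z)"
    and te': "eventually (\<lambda>w. \<forall>j\<in>{..<k}. \<psi> w j - \<psi> z j = (\<Sum>i<m. \<theta> j i w * (w i - z i))) (nb m z)"
    using has_grad_family[where f = \<psi> and k = k, OF J] by blast
  show ?thesis
  proof (rule has_gradI)
    show "((\<lambda>w. \<Sum>j<k. \<phi> j (\<psi> w) * \<theta> j i w) \<longlongrightarrow> (\<Sum>j<k. c j * J j i)) (nb m z)" if "i < m" for i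
      using that by (intro tendsto_sum tendsto_mult filterlim_compose[OF p flt] t) auto
    show "\<forall>\<^sub>F w in nb m z. f (\<psi> w) - f (\<psi> z) = (\<Sum>i<m. (\<Sum>j<k. \<phi> j (\<psi> w) * \<theta> j i w) * (w i - z i))"
      using te' eventually_compose_filterlim[OF e flt]
    proof eventually_elim
      case (elim w)
      have "f (\<psi> w) - f (\<psi> z) = (\<Sum>j<k. \<phi> j (\<psi> w) * (\<Sum>i<m. \<theta> j i w * (w i - z i)))"
        using elim by simp
      also have "\<dots> = (\<Sum>i<m. (\<Sum>j<k. \<phi> j (\<psi> w) * \<theta> j i w) * (w i - z i))"
        unfolding sum_distrib_left sum_distrib_right
        by (subst sum.swap) (simp add: mult.assoc)
      finally show ?case .
    qed
  qed
qed

lemma has_grad_DERIV: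
  assumes f: "has_grad m f c z" and h: "(h has_field_derivative d) (at (f z))"
  shows "has_grad m (\<lambda>w. h (f w)) (\<lambda>i. d * c i) z"
proof -
  obtain \<phi> where p: "\<And>i. i < m \<Longrightarrow> ((\<lambda>w. \<phi> i w) \<longlongrightarrow> c i) (nb m z)"
    and e: "eventually (\<lambda>w. f w - f z = (\<Sum>i<m. \<phi> i w * (w i - z i))) (nb m z)"
    using f unfolding has_grad_def by blast
  obtain \<gamma> where g: "\<And>y. h y - h (f z) = \<gamma> y * (y - f z)" "isCont \<gamma> (f z)" "\<gamma> (f z) = d"
    using h unfolding CARAT_DERIV by blast
  show ?thesis
  proof (rule has_gradI)
    have "((\<lambda>w. \<gamma> (f w)) \<longlongrightarrow> d) (nb m z)"
      using isCont_tendsto_compose[OF g(2) has_grad_isCont[OF f]] g(3) by simp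
    then show "((\<lambda>w. \<gamma> (f w) * \<phi> i w) \<longlongrightarrow> d * c i) (nb m z)" if "i < m" for i
      using p that by (intro tendsto_intros) auto
    show "\<forall>\<^sub>F w in nb m z. h (f w) - h (f z) = (\<Sum>i<m. \<gamma> (f w) * \<phi> i w * (w i - z i))"
      using e by eventually_elim (simp add: g(1) sum_distrib_left mult.assoc)
  qed
qed

lemma has_grad_cong:
  assumes z: "z \<in> cspace m" and ev: "eventually (\<lambda>w. f w = f' w) (nb m z)" and f: "has_grad m f c z"
  shows "has_grad m f' c z"
proof -
  have 0: "f z = f' z" using eventually_nb_self[OF ev z] .
  obtain \<phi> where p: "\<And>i. i < m \<Longrightarrow> ((\<lambda>w. \<phi> i w) \<longlongrightarrow> c i) (nb m z)"
    and e: "eventually (\<lambda>w. f w - f z = (\<Sum>i<m. \<phi> i w * (w i - z i))) (nb m z)"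
    using f unfolding has_grad_def by blast
  show ?thesis
  proof (rule has_gradI[of m \<phi>, OF p])
    show "\<forall>\<^sub>F w in nb m z. f' w - f' z = (\<Sum>i<m. \<phi> i w * (w i - z i))"
      using ev e by eventually_elim (simp add: 0)
  qed
qed

text \<open>Restricted to a complex line the gradient is the limit of an ordinary quotient. This
  gives uniqueness, and it later identifies gradients of polynomial equations whose difference
  coefficients are only known to exist.\<close>

lemma has_grad_directional:
  assumes z: "z \<in> cspace m" and v: "v \<in> cspace m" and f: "has_grad m f c z"
  shows "((\<lambda>t. (f (\<lambda>i. z i + t * v i) - f z) / t) \<longlongrightarrow> (\<Sum>i<m. c i * v i)) (at 0)"
proof -
  obtain \<phi> where p: "\<And>i. i < m \<Longrightarrow> ((\<lambda>w. \<phi> i w) \<longlongrightarrow> c i) (nb m z)"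
    and e: "eventually (\<lambda>w. f w - f z = (\<Sum>i<m. \<phi> i w * (w i - z i))) (nb m z)"
    using f unfolding has_grad_def by blast
  have flt: "filterlim (\<lambda>t i. z i + t * v i) (nb m z) (at (0::complex))"
    unfolding filterlim_nb_iff[OF z]
  proof (intro conjI allI impI always_eventually)
    show "(\<lambda>i. z i + t * v i) \<in> cspace m" for t
      using z v by (simp add: cspace_def)
    have "((\<lambda>t. z j + t * v j) \<longlongrightarrow> z j + 0 * v j) (at 0)" for j
      by (intro tendsto_intros)
    then show "((\<lambda>t. z j + t * v j) \<longlongrightarrow> z j) (at 0)" for j by simp
  qed
  have "((\<lambda>t. \<Sum>i<m. \<phi> i (\<lambda>i. z i + t * v i) * v i) \<longlongrightarrow> (\<Sum>i<m. c i * v i)) (at 0)"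
    by (intro tendsto_sum tendsto_mult filterlim_compose[OF p flt]) auto
  moreover have "eventually (\<lambda>t. (\<Sum>i<m. \<phi> i (\<lambda>i. z i + t * v i) * v i) = (f (\<lambda>i. z i + t * v i) - f z) / t) (at 0)"
    using eventually_compose_filterlim[OF e flt] eventually_neq_at_within[of 0 0 UNIV]
    by eventually_elim (simp add: sum_divide_distrib mult.assoc[symmetric])
  ultimately show ?thesis
    by (rule Lim_transform_eventually)
qed

lemma has_grad_unique:
  assumes z: "z \<in> cspace m" and v: "v \<in> cspace m" and "has_grad m f c z" "has_grad m f c' z"
  shows "(\<Sum>i<m. c i * v i) = (\<Sum>i<m. c' i * v i)"
  using has_grad_directional[OF z v assms(3)] has_grad_directional[OF z v assms(4)]
  by (rule tendsto_unique[rotated]) simp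

definition mat_mul :: "nat \<Rightarrow> (nat \<Rightarrow> nat \<Rightarrow> complex) \<Rightarrow> (nat \<Rightarrow> nat \<Rightarrow> complex) \<Rightarrow> nat \<Rightarrow> nat \<Rightarrow> complex" where
  "mat_mul k A B = (\<lambda>j i. \<Sum>l<k. A j l * B l i)"

lemma mat_apply_mat_mul:
  "mat_apply m n (mat_mul k A B) v = mat_apply k n A (mat_apply m k B v)"
proof
  fix j
  have "(\<Sum>i<m. (\<Sum>l<k. A j l * B l i) * v i) = (\<Sum>l<k. A j l * (\<Sum>i<m. B l i * v i))"
    unfolding sum_distrib_left sum_distrib_right by (subst sum.swap) (simp add: mult.assoc)
  then show "mat_apply m n (mat_mul k A B) v j = mat_apply k n A (mat_apply m k B v) j"
    by (simp add: mat_apply_def mat_mul_def)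
qed

lemma has_jacobian_chain:
  assumes z: "z \<in> cspace m" and c: "\<psi> z \<in> cspace k"
    and ev: "eventually (\<lambda>w. \<psi> w \<in> cspace k) (nb m z)"
    and J: "has_jacobian m k \<psi> J z" and A: "has_jacobian k n f A (\<psi> z)"
  shows "has_jacobian m n (f \<circ> \<psi>) (mat_mul k A J) z"
  unfolding has_jacobian_iff_grad[OF z]
proof (intro allI impI)
  fix j assume "j < n"
  then have "has_grad k (\<lambda>y. f y j) (A j) (\<psi> z)"
    using A c by (simp add: has_jacobian_iff_grad)
  then show "has_grad m (\<lambda>w. (f \<circ> \<psi>) w j) (mat_mul k A J j) z"
    using has_grad_chain[OF z c ev, of J "\<lambda>y. f y j" "A j"] J z
    by (simp add: has_jacobian_iff_grad mat_mul_def)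
qed

lemma has_jacobian_cong:
  assumes z: "z \<in> cspace m" and ev: "eventually (\<lambda>w. f w = f' w) (nb m z)" and f: "has_jacobian m k f J z"
  shows "has_jacobian m k f' J z"
  unfolding has_jacobian_iff_grad[OF z]
proof (intro allI impI)
  fix j assume "j < k"
  then have "has_grad m (\<lambda>w. f w j) (J j) z" using f z by (simp add: has_jacobian_iff_grad)
  then show "has_grad m (\<lambda>w. f' w j) (J j) z"
    by (rule has_grad_cong[OF z, rotated]) (use ev in \<open>auto elim: eventually_mono\<close>)
qed

lemma has_jacobian_unique:
  assumes z: "z \<in> cspace m" and v: "v \<in> cspace m" and "has_jacobian m k f J z" "has_jacobian m k f J' z"
  shows "mat_apply m k J v = mat_apply m k J' v"
proof
  fix j
  show "mat_apply m k J v j = mat_apply m k J' v j"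
  proof (cases "j < k")
    case True
    then have "has_grad m (\<lambda>w. f w j) (J j) z" "has_grad m (\<lambda>w. f w j) (J' j) z"
      using assms(3,4) z by (simp_all add: has_jacobian_iff_grad)
    from has_grad_unique[OF z v this] show ?thesis by (simp add: mat_apply_def)
  qed (simp add: mat_apply_def)
qed

lemma has_jacobian_continuous:
  assumes z: "z \<in> cspace m" and "f z \<in> cspace k" and "eventually (\<lambda>w. f w \<in> cspace k) (nb m z)"
    and f: "has_jacobian m k f J z"
  shows "filterlim f (nb k (f z)) (nb m z)"
  unfolding filterlim_nb_iff[OF assms(2)]
proof (intro conjI allI impI assms)
  fix j assume "j < k"
  then have "has_grad m (\<lambda>w. f w j) (J j) z" using f z by (simp add: has_jacobian_iff_grad)
  then show "((\<lambda>w. f w j) \<longlongrightarrow> f z j) (nb m z)" by (rule has_grad_isCont)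
qed

lemma has_jacobian_linear: "has_jacobian m k (mat_apply m k A) A z"
  unfolding has_jacobian_def
proof (intro allI impI)
  fix j assume "j < k"
  have "mat_apply m k A w j - mat_apply m k A z j - mat_apply m k A (\<lambda>i. w i - z i) j = 0" for w
    using fun_cong[OF mat_apply_diff[of m k A w z], of j] by (simp add: fun_diff_def)
  then show "((\<lambda>w. (mat_apply m k A w j - mat_apply m k A z j - mat_apply m k A (\<lambda>i. w i - z i) j) /
      complex_of_real (cdist m w z)) \<longlongrightarrow> 0) (at z within cspace m)" by simp
qed

lemma mat_apply_id:
  assumes "v \<in> cspace m" shows "mat_apply m m (\<lambda>j i. if i = j then 1 else 0) v = v"
  using assms by (auto simp: mat_apply_def cspace_def fun_eq_iff if_distrib[of "\<lambda>x. x * _"] cong: if_cong)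

lemma has_jacobian_id: "z \<in> cspace m \<Longrightarrow> has_jacobian m m (\<lambda>w. w) (\<lambda>j i. if i = j then 1 else 0) z"
  by (rule has_jacobian_cong[OF _ _ has_jacobian_linear])
     (auto intro: eventually_mono[OF eventually_nb_cspace] simp: mat_apply_id)

text \<open>A continuous local solution of \<open>\<psi> (c t) = s t\<close> is differentiable as soon as the derivative of
  \<open>\<psi>\<close> at the point has a left inverse; no continuity of that derivative is needed.\<close>

lemma has_jacobian_lift:
  assumes t0: "t0 \<in> cspace m" and v0: "c t0 \<in> cspace d"
    and psi: "has_jacobian d N \<psi> J (c t0)"
    and L: "\<And>v. v \<in> cspace d \<Longrightarrow> mat_apply N d \<Lambda> (mat_apply d N J v) = v"
    and c: "filterlim c (nb d (c t0)) (nb m t0)"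
    and eq: "eventually (\<lambda>t. \<psi> (c t) = s t) (nb m t0)"
    and s: "has_jacobian m N s S t0"
  shows "has_jacobian m d c (mat_mul N \<Lambda> S) t0"
proof -
  obtain \<phi> where p: "\<And>j i. j < N \<Longrightarrow> i < d \<Longrightarrow> (\<phi> j i \<longlongrightarrow> J j i) (nb d (c t0))"
    and pe': "eventually (\<lambda>w. \<forall>j\<in>{..<N}. \<psi> w j - \<psi> (c t0) j = (\<Sum>i<d. \<phi> j i w * (w i - c t0 i))) (nb d (c t0))"
    by (rule has_grad_family[of N d \<psi> J "c t0"]) (use psi v0 in \<open>auto simp: has_jacobian_iff_grad\<close>)
  obtain \<sigma> where q: "\<And>j i. j < N \<Longrightarrow> i < m \<Longrightarrow> (\<sigma> j i \<longlongrightarrow> S j i) (nb m t0)"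
    and qe': "eventually (\<lambda>w. \<forall>j\<in>{..<N}. s w j - s t0 j = (\<Sum>i<m. \<sigma> j i w * (w i - t0 i))) (nb m t0)"
    by (rule has_grad_family[of N m s S t0]) (use s t0 in \<open>auto simp: has_jacobian_iff_grad\<close>)
  have s0: "s t0 = \<psi> (c t0)" using eventually_nb_self[OF eq t0] by simp
  \<comment> \<open>\<Lambda> undoes J exactly, so applying it to the difference of \<psi> at c t
    and c t0 leaves the increment of c plus this error matrix applied to it, and the error matrix
    tends to 0.\<close>
  define \<theta> where "\<theta> l i t = (\<Sum>j<N. \<Lambda> l j * (\<phi> j i (c t) - J j i))" for l i t
  have th: "((\<lambda>t. \<theta> l i t) \<longlongrightarrow> 0) (nb m t0)" if "i < d" for l i
  proof -
    have "((\<lambda>t. \<theta> l i t) \<longlongrightarrow> (\<Sum>j<N. \<Lambda> l j * (J j i - J j i))) (nb m t0)"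
      unfolding \<theta>_def using that
      by (intro tendsto_sum tendsto_mult tendsto_diff tendsto_const filterlim_compose[OF p c]) auto
    then show ?thesis by simp
  qed
  define \<eta> where "\<eta> t = (\<Sum>l<d. \<Sum>i<d. cmod (\<theta> l i t))" for t
  have eta: "(\<eta> \<longlongrightarrow> 0) (nb m t0)"
  proof -
    have "(\<eta> \<longlongrightarrow> (\<Sum>l<d. \<Sum>i<d. cmod 0)) (nb m t0)"
      unfolding \<eta>_def by (intro tendsto_sum tendsto_norm th) auto
    then show ?thesis by simp
  qed
  have eta0: "\<eta> t \<ge> 0" for t by (simp add: \<eta>_def sum_nonneg)
  \<comment> \<open>The candidate for the increment of c up to first order, read off from the known
    right-hand side s.\<close>
  define \<beta> where "\<beta> l t = (\<Sum>j<N. \<Lambda> l j * (s t j - s t0 j))" for l t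
  define B where "B = 1 + (\<Sum>l<d. \<Sum>i<m. cmod (mat_mul N \<Lambda> S l i))"
  have B: "B > 0" unfolding B_def by (intro add_pos_nonneg sum_nonneg) auto
  have grad\<beta>: "has_grad m (\<beta> l) (mat_mul N \<Lambda> S l) t0" for l
  proof (rule has_gradI)
    show "((\<lambda>w. \<Sum>j<N. \<Lambda> l j * \<sigma> j i w) \<longlongrightarrow> mat_mul N \<Lambda> S l i) (nb m t0)" if "i < m" for i
      unfolding mat_mul_def using that by (intro tendsto_sum tendsto_mult tendsto_const q) auto
    show "\<forall>\<^sub>F w in nb m t0. \<beta> l w - \<beta> l t0 = (\<Sum>i<m. (\<Sum>j<N. \<Lambda> l j * \<sigma> j i w) * (w i - t0 i))"
      using qe'
    proof eventually_elim
      case (elim w)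
      have "\<beta> l w - \<beta> l t0 = (\<Sum>j<N. \<Lambda> l j * (\<Sum>i<m. \<sigma> j i w * (w i - t0 i)))"
        using elim by (simp add: \<beta>_def)
      also have "\<dots> = (\<Sum>i<m. (\<Sum>j<N. \<Lambda> l j * \<sigma> j i w) * (w i - t0 i))"
        unfolding sum_distrib_left sum_distrib_right by (subst sum.swap) (simp add: mult.assoc)
      finally show ?case .
    qed
  qed
  define D where "D t = (\<Sum>l<d. cmod (c t l - c t0 l))" for t
  have ev_cs: "eventually (\<lambda>t. c t \<in> cspace d) (nb m t0)"
    using c v0 by (simp add: filterlim_nb_iff)
  have key: "eventually (\<lambda>t. \<forall>l\<in>{..<d}. cmod (c t l - c t0 l - \<beta> l t) \<le> \<eta> t * D t) (nb m t0)"
    using eventually_compose_filterlim[OF pe' c] eq ev_cs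
  proof eventually_elim
    case (elim t)
    show ?case
    proof
      fix l assume "l \<in> {..<d}"
      then have l: "l < d" by simp
      define u where "u = c t - c t0"
      have u: "u \<in> cspace d" using elim v0 by (auto simp: u_def)
      have "\<beta> l t = (\<Sum>j<N. \<Lambda> l j * (\<Sum>i<d. \<phi> j i (c t) * u i))"
        using elim by (simp add: \<beta>_def s0 u_def)
      also have "\<dots> = (\<Sum>j<N. \<Lambda> l j * (\<Sum>i<d. J j i * u i)) + (\<Sum>i<d. \<theta> l i t * u i)"
      proof -
        have "(\<Sum>i<d. \<theta> l i t * u i) = (\<Sum>j<N. \<Lambda> l j * (\<Sum>i<d. (\<phi> j i (c t) - J j i) * u i))"
          unfolding \<theta>_def sum_distrib_left sum_distrib_right by (subst sum.swap) (simp add: mult.assoc)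
        then show ?thesis
          by (simp add: left_diff_distrib sum_subtractf right_diff_distrib)
      qed
      also have "(\<Sum>j<N. \<Lambda> l j * (\<Sum>i<d. J j i * u i)) = u l"
        using fun_cong[OF L[OF u], of l] l by (simp add: mat_apply_def)
      finally have "u l - \<beta> l t = - (\<Sum>i<d. \<theta> l i t * u i)" by simp
      then have "cmod (u l - \<beta> l t) \<le> (\<Sum>i<d. cmod (\<theta> l i t * u i))"
        by (simp add: sum_norm_le)
      also have "\<dots> \<le> (\<Sum>i<d. \<eta> t * cmod (u i))"
      proof (rule sum_mono)
        fix i assume "i \<in> {..<d}"
        then have "cmod (\<theta> l i t) \<le> (\<Sum>i<d. cmod (\<theta> l i t))"
          by (intro member_le_sum) auto
        also have "\<dots> \<le> \<eta> t"
          unfolding \<eta>_def using l by (intro member_le_sum[of l _ "\<lambda>l. \<Sum>i<d. cmod (\<theta> l i t)"]) (auto intro: sum_nonneg)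
        finally show "cmod (\<theta> l i t * u i) \<le> \<eta> t * cmod (u i)"
          by (simp add: norm_mult mult_right_mono)
      qed
      also have "\<dots> = \<eta> t * D t" by (simp add: D_def u_def sum_distrib_left)
      finally show "cmod (c t l - c t0 l - \<beta> l t) \<le> \<eta> t * D t" by (simp add: u_def)
    qed
  qed
  have \<beta>0: "\<beta> l t0 = 0" for l by (simp add: \<beta>_def)
  have bnd: "eventually (\<lambda>t. \<forall>l\<in>{..<d}. cmod (\<beta> l t - (\<Sum>i<m. mat_mul N \<Lambda> S l i * (t i - t0 i))) \<le> \<epsilon> * nm m (t - t0)) (nb m t0)"
    if "\<epsilon> > 0" for \<epsilon>
  proof (rule eventually_ball_finite)
    show "\<forall>l\<in>{..<d}. \<forall>\<^sub>F t in nb m t0. cmod (\<beta> l t - (\<Sum>i<m. mat_mul N \<Lambda> S l i * (t i - t0 i))) \<le> \<epsilon> * nm m (t - t0)"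
    proof
      fix l
      show "\<forall>\<^sub>F t in nb m t0. cmod (\<beta> l t - (\<Sum>i<m. mat_mul N \<Lambda> S l i * (t i - t0 i))) \<le> \<epsilon> * nm m (t - t0)"
        using has_grad_frechet[OF t0, THEN iffD1, OF grad\<beta>, rule_format, OF that, of l] by (simp add: \<beta>0)
    qed
  qed simp
  \<comment> \<open>The factor 2 comes from absorption: once d * \<eta> < 1/2, the term with D t on
    the right is at most D t / 2 and moves to the left. The resulting Lipschitz bound at t0 then
    turns the error \<eta> * D into o(|t - t0|).\<close>
  define C where "C = 2 * (real d + B)"
  have C: "C > 0" using B by (simp add: C_def add_nonneg_pos)
  have Dle: "eventually (\<lambda>t. D t \<le> C * nm m (t - t0)) (nb m t0)"
  proof -
    have "eventually (\<lambda>t. real d * \<eta> t < 1/2) (nb m t0)"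
      by (rule order_tendstoD(2)[OF tendsto_mult[OF tendsto_const[of "real d"] eta]]) simp
    with key bnd[OF zero_less_one] show ?thesis
    proof eventually_elim
      case (elim t)
      have "cmod (c t l - c t0 l) \<le> \<eta> t * D t + nm m (t - t0) + (\<Sum>i<m. cmod (mat_mul N \<Lambda> S l i)) * nm m (t - t0)"
        if "l < d" for l
      proof -
        have "cmod (\<Sum>i<m. mat_mul N \<Lambda> S l i * (t i - t0 i)) \<le> (\<Sum>i<m. cmod (mat_mul N \<Lambda> S l i)) * nm m (t - t0)"
          using nm_sum_bound[where a = "mat_mul N \<Lambda> S l" and v = "t - t0" and m = m] by simp
        moreover have "cmod (c t l - c t0 l - \<beta> l t) \<le> \<eta> t * D t"
          "cmod (\<beta> l t - (\<Sum>i<m. mat_mul N \<Lambda> S l i * (t i - t0 i))) \<le> nm m (t - t0)"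
          using elim that by auto
        moreover have "cmod (c t l - c t0 l) \<le> cmod (c t l - c t0 l - \<beta> l t) +
           cmod (\<beta> l t - (\<Sum>i<m. mat_mul N \<Lambda> S l i * (t i - t0 i))) + cmod (\<Sum>i<m. mat_mul N \<Lambda> S l i * (t i - t0 i))"
          using norm_triangle_ineq[of "c t l - c t0 l - \<beta> l t" "\<beta> l t"]
            norm_triangle_ineq[of "\<beta> l t - (\<Sum>i<m. mat_mul N \<Lambda> S l i * (t i - t0 i))"
              "\<Sum>i<m. mat_mul N \<Lambda> S l i * (t i - t0 i)"]
          by simp
        ultimately show ?thesis by linarith
      qed
      then have "D t \<le> (\<Sum>l<d. \<eta> t * D t + nm m (t - t0) + (\<Sum>i<m. cmod (mat_mul N \<Lambda> S l i)) * nm m (t - t0))"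
        by (subst D_def, intro sum_mono) auto
      also have "\<dots> = (real d * \<eta> t) * D t + (real d + (B - 1)) * nm m (t - t0)"
        by (simp add: sum.distrib B_def sum_distrib_right[symmetric] distrib_right distrib_left)
      also have "\<dots> \<le> 1/2 * D t + (real d + B) * nm m (t - t0)"
        using elim by (intro add_mono mult_right_mono) (auto simp: D_def sum_nonneg)
      finally have "D t \<le> 2 * ((real d + B) * nm m (t - t0))" by simp
      then show ?case by (simp only: C_def mult.assoc)
    qed
  qed
  have est: "\<forall>\<^sub>F w in nb m t0. cmod (c w l - c t0 l - (\<Sum>i<m. mat_mul N \<Lambda> S l i * (w i - t0 i))) \<le> \<epsilon> * nm m (w - t0)"
    if l: "l < d" and e: "\<epsilon> > 0" for l \<epsilon>
  proof -
    have e2: "\<epsilon>/2 > 0" and eC: "\<epsilon> / (2 * C) > 0" using e C by auto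
    have "eventually (\<lambda>t. \<eta> t < \<epsilon> / (2 * C)) (nb m t0)"
      by (rule order_tendstoD(2)[OF eta eC])
    with key bnd[OF e2] Dle
    show ?thesis
    proof eventually_elim
      case (elim t)
      have "D t \<ge> 0" by (simp add: D_def sum_nonneg)
      have "\<eta> t * D t \<le> \<epsilon> / (2 * C) * (C * nm m (t - t0))"
        using elim eta0[of t] \<open>D t \<ge> 0\<close> by (intro mult_mono) auto
      also have "\<dots> = \<epsilon>/2 * nm m (t - t0)" using C by simp
      finally have 1: "cmod (c t l - c t0 l - \<beta> l t) \<le> \<epsilon>/2 * nm m (t - t0)"
        using elim l by force
      have 2: "cmod (\<beta> l t - (\<Sum>i<m. mat_mul N \<Lambda> S l i * (t i - t0 i))) \<le> \<epsilon>/2 * nm m (t - t0)"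
        using elim l by blast
      have "cmod (c t l - c t0 l - (\<Sum>i<m. mat_mul N \<Lambda> S l i * (t i - t0 i))) \<le>
        cmod (c t l - c t0 l - \<beta> l t) + cmod (\<beta> l t - (\<Sum>i<m. mat_mul N \<Lambda> S l i * (t i - t0 i)))"
        using norm_diff_triangle_ineq[of "c t l - c t0 l" "\<Sum>i<m. mat_mul N \<Lambda> S l i * (t i - t0 i)" "\<beta> l t" 0]
          norm_triangle_ineq[of "c t l - c t0 l - \<beta> l t" "\<beta> l t - (\<Sum>i<m. mat_mul N \<Lambda> S l i * (t i - t0 i))"]
        by (simp only: diff_add_cancel add_diff_eq)
      with 1 2 show ?case by linarith
    qed
  qed
  show ?thesis
    using est by (simp add: has_jacobian_iff_grad[OF t0] has_grad_frechet[OF t0])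
qed

section \<open>Matrices and the implicit function theorem\<close>

text \<open>All dimensions share the vector space of sequences, with \<open>cspace m\<close> as
  subspaces; general results on bases and left inverses then apply although m is a term and not a
  type.\<close>

interpretation cv: vector_space "\<lambda>(c::complex) (v::cvec) i. c * v i"
  by unfold_locales (auto simp: fun_eq_iff algebra_simps)

interpretation cvp: vector_space_pair "\<lambda>(c::complex) (v::cvec) i. c * v i" "\<lambda>(c::complex) (v::cvec) i. c * v i"
  by unfold_locales

definition unitv :: "nat \<Rightarrow> cvec" where
  "unitv i = (\<lambda>l. if l = i then 1 else 0)"

lemma unitv_in_cspace: "i < m \<Longrightarrow> unitv i \<in> cspace m"
  by (auto simp: unitv_def cspace_def)

lemma sum_fun_apply: "(\<Sum>i\<in>A. f i) x = (\<Sum>i\<in>A. f i x)" for f :: "'b \<Rightarrow> cvec"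
  by (induction A rule: infinite_finite_induct) auto

lemma cspace_expand: "v \<in> cspace m \<Longrightarrow> v = (\<Sum>i<m. (\<lambda>l. v i * unitv i l))"
  by (auto simp: fun_eq_iff sum_fun_apply unitv_def cspace_def if_distrib[of "\<lambda>x. _ * x"] cong: if_cong)

lemma linear_mat_apply: "Vector_Spaces.linear (\<lambda>(c::complex) (v::cvec) i. c * v i) (\<lambda>c v i. c * v i) (mat_apply m k J)"
  by unfold_locales (simp_all add: mat_apply_add mat_apply_scale)

lemma mat_apply_sum_cols:
  "mat_apply m k J v = (\<Sum>i<m. (\<lambda>j. v i * mat_apply m k J (unitv i) j))"
  by (auto simp: fun_eq_iff sum_fun_apply mat_apply_def unitv_def if_distrib[of "\<lambda>x. _ * x"] mult.commute cong: if_cong)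

lemma subspace_cspace: "cv.subspace (cspace m)"
  by (intro cv.subspaceI) (auto simp: cspace_def)

text \<open>A linear left inverse exists as a function on all sequences; its values on the unit
  vectors of the target are the columns of the matrix.\<close>

lemma mat_left_inverse:
  assumes inj: "inj_on (mat_apply m k J) (cspace m)"
  obtains \<Lambda> where "\<And>v. v \<in> cspace m \<Longrightarrow> mat_apply k m \<Lambda> (mat_apply m k J v) = v"
proof -
  obtain h where h: "Vector_Spaces.linear (\<lambda>(c::complex) (v::cvec) i. c * v i) (\<lambda>c v i. c * v i) h"
    and hf: "\<And>v. v \<in> cspace m \<Longrightarrow> h (mat_apply m k J v) = v"
    using cvp.linear_exists_left_inverse_on[OF linear_mat_apply subspace_cspace inj] by blast
  show ?thesis
  proof (rule that)
    fix v assume v: "v \<in> cspace m"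
    define y where "y = mat_apply m k J v"
    have "y \<in> cspace k" by (simp add: y_def)
    then have "h y = h (\<Sum>j<k. (\<lambda>l. y j * unitv j l))"
      using cspace_expand by metis
    also have "\<dots> = (\<Sum>j<k. (\<lambda>l. y j * h (unitv j) l))"
      by (simp add: cvp.linear_sum[OF h] cvp.linear_scale[OF h])
    finally have hy: "h y l = (\<Sum>j<k. y j * h (unitv j) l)" for l
      by (simp add: sum_fun_apply)
    have "mat_apply k m (\<lambda>l j. h (unitv j) l) y = v"
    proof (rule cspace_eqI[OF mat_apply_in_cspace v])
      fix l assume "l < m"
      then show "mat_apply k m (\<lambda>l j. h (unitv j) l) y l = v l"
        using hy[of l] hf[OF v, folded y_def] by (simp add: mat_apply_def mult.commute)
    qed
    then show "mat_apply k m (\<lambda>l j. h (unitv j) l) (mat_apply m k J v) = v" by (simp add: y_def)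
  qed
qed

lemma independent_unitv: "cv.independent (unitv ` {..<m})"
proof (rule cv.independent_if_scalars_zero)
  fix f x assume s: "(\<Sum>x\<in>unitv ` {..<m}. (\<lambda>i. f x * x i)) = 0" and "x \<in> unitv ` {..<m}"
  then obtain i where i: "i < m" "x = unitv i" by auto
  have inj: "inj_on unitv {..<m}"
    by (rule inj_onI) (metis unitv_def zero_neq_one)
  have "(\<Sum>x\<in>unitv ` {..<m}. (\<lambda>i. f x * x i)) i = (\<Sum>l<m. f (unitv l) * unitv l i)"
    by (simp add: sum_fun_apply sum.reindex[OF inj])
  also have "\<dots> = f (unitv i)"
    using i by (simp add: unitv_def if_distrib[of "\<lambda>x. _ * x"] cong: if_cong)
  finally show "f x = 0" using s i by simp
qed simp

lemma span_unitv: "cv.span (unitv ` {..<m}) = cspace m"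
proof
  show "cv.span (unitv ` {..<m}) \<subseteq> cspace m"
    by (rule cv.span_minimal[OF _ subspace_cspace]) (auto simp: unitv_in_cspace)
  show "cspace m \<subseteq> cv.span (unitv ` {..<m})"
  proof
    fix v :: cvec assume "v \<in> cspace m"
    then have "v = (\<Sum>i<m. (\<lambda>l. v i * unitv i l))" by (rule cspace_expand)
    also have "\<dots> \<in> cv.span (unitv ` {..<m})"
      by (intro cv.span_sum cv.span_scale cv.span_base) auto
    finally show "v \<in> cv.span (unitv ` {..<m})" .
  qed
qed

lemma card_unitv: "card (unitv ` {..<m}) = m"
proof -
  have "inj_on unitv {..<m}"
    by (rule inj_onI) (metis unitv_def zero_neq_one)
  then show ?thesis by (simp add: card_image)
qed

text \<open>Pivot columns are chosen that form a basis of the target. \<open>R\<close> solves with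
  pivot coordinates only, \<open>T\<close> completes prescribed free coordinates to a kernel vector,
  and \<open>T'\<close> reads the free coordinates off again.\<close>

lemma mat_surj_kernel:
  assumes surj: "mat_apply M K L ` cspace M = cspace K"
  obtains R T T' where "K \<le> M"
    "\<And>y. y \<in> cspace K \<Longrightarrow> mat_apply M K L (mat_apply K M R y) = y"
    "\<And>t. mat_apply M K L (mat_apply (M - K) M T t) = 0"
    "\<And>t. t \<in> cspace (M - K) \<Longrightarrow> mat_apply M (M - K) T' (mat_apply (M - K) M T t) = t"
    "\<And>v. v \<in> cspace M \<Longrightarrow> mat_apply M K L v = 0 \<Longrightarrow> mat_apply (M - K) M T (mat_apply M (M - K) T' v) = v"
proof -
  define col where "col i = mat_apply M K L (unitv i)" for i
  obtain B where B: "B \<subseteq> col ` {..<M}" "cv.independent B" "col ` {..<M} \<subseteq> cv.span B"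
    using cv.maximal_independent_subset by blast
  obtain I where I: "I \<subseteq> {..<M}" "inj_on col I" "B = col ` I"
    using B(1) subset_image_inj by metis
  have finI: "finite I" using I(1) finite_subset by blast
  have spanB: "cv.span B = cspace K"
  proof
    show "cv.span B \<subseteq> cspace K"
      using B(1) by (intro cv.span_minimal[OF _ subspace_cspace]) (auto simp: col_def)
    show "cspace K \<subseteq> cv.span B"
    proof
      fix y :: cvec assume "y \<in> cspace K"
      with surj obtain v where "y = mat_apply M K L v" by blast
      also have "\<dots> = (\<Sum>i<M. (\<lambda>j. v i * col i j))"
        unfolding col_def by (rule mat_apply_sum_cols)
      also have "\<dots> \<in> cv.span B"
        using B(3) by (intro cv.span_sum cv.span_scale) auto
      finally show "y \<in> cv.span B" .
    qed
  qed
  have "card B = card (unitv ` {..<K})"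
  proof (rule antisym)
    show "card B \<le> card (unitv ` {..<K})"
      using cv.independent_span_bound[of "unitv ` {..<K}" B] B(2) spanB cv.span_superset[of B]
      by (simp add: span_unitv)
    show "card (unitv ` {..<K}) \<le> card B"
      using cv.independent_span_bound[of B "unitv ` {..<K}"] independent_unitv[of K] spanB
        cv.span_superset[of "unitv ` {..<K}"] finI I(3) by (simp add: span_unitv)
  qed
  then have cardI: "card I = K"
    using I by (simp add: card_unitv card_image)
  have KM: "K \<le> M" using card_mono[OF _ I(1)] cardI by simp
  have sumI: "mat_apply M K L u = (\<Sum>i\<in>I. (\<lambda>j. u i * col i j))" if "\<And>i. i \<notin> I \<Longrightarrow> u i = 0" for u
    unfolding mat_apply_sum_cols[of M K L u] col_def
    by (rule sum.mono_neutral_right) (use I that in \<open>auto simp: fun_eq_iff\<close>)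
  \<comment> \<open>A kernel vector supported on the pivots is a linear relation between independent
    columns. Injectivity of \<open>col\<close> on I lets the coefficients be indexed by the
    columns.\<close>
  have kerI: "u = 0" if u: "\<And>i. i \<notin> I \<Longrightarrow> u i = 0" and 0: "mat_apply M K L u = 0" for u
  proof
    fix i
    show "u i = 0 i"
    proof (cases "i \<in> I")
      case True
      have "(\<Sum>b\<in>B. (\<lambda>j. u (the_inv_into I col b) * b j)) = (\<Sum>i\<in>I. (\<lambda>j. u i * col i j))"
        unfolding I(3) using I(2) by (simp add: sum.reindex the_inv_into_f_f)
      also have "\<dots> = 0" using sumI[OF u] 0 by simp
      finally have "u (the_inv_into I col (col i)) = 0"
        by (intro cv.independentD[OF B(2), where u = "\<lambda>b. u (the_inv_into I col b)" and t = B])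
           (use True I finI in auto)
      then show ?thesis using True I(2) by (simp add: the_inv_into_f_f)
    qed (simp add: u)
  qed
  have "\<exists>r. (\<forall>i. i \<notin> I \<longrightarrow> r i = 0) \<and> mat_apply M K L r = y" if "y \<in> cspace K" for y
  proof -
    have "y \<in> cv.span B" using that spanB by simp
    then obtain u where u: "y = (\<Sum>b\<in>B. (\<lambda>j. u b * b j))"
      using cv.span_finite[of B] finI I(3) by auto
    define r where "r i = (if i \<in> I then u (col i) else 0)" for i
    have "mat_apply M K L r = (\<Sum>i\<in>I. (\<lambda>j. r i * col i j))" by (rule sumI) (simp add: r_def)
    also have "\<dots> = y" unfolding u I(3) using I(2) by (simp add: sum.reindex r_def)
    finally show ?thesis by (intro exI[of _ r]) (simp add: r_def)
  qed
  then have "\<forall>y\<in>cspace K. \<exists>r. (\<forall>i. i \<notin> I \<longrightarrow> r i = 0) \<and> mat_apply M K L r = y" by blast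
  from bchoice[OF this] obtain r where r: "\<And>y i. y \<in> cspace K \<Longrightarrow> i \<notin> I \<Longrightarrow> r y i = 0"
    "\<And>y. y \<in> cspace K \<Longrightarrow> mat_apply M K L (r y) = y" by blast
  define R where "R i j = r (unitv j) i" for i j
  have R0: "mat_apply K M R y i = 0" if "i \<notin> I" for y i
    using that r(1)[OF unitv_in_cspace] by (simp add: mat_apply_def R_def)
  have LR: "mat_apply M K L (mat_apply K M R y) = y" if y: "y \<in> cspace K" for y
  proof -
    have "mat_apply K M R y = (\<Sum>j<K. (\<lambda>i. y j * r (unitv j) i))"
    proof
      fix i
      have "r (unitv j) i = 0" if "j < K" "\<not> i < M" for j
        using r(1)[OF unitv_in_cspace[OF that(1)], of i] that I(1) by auto
      then show "mat_apply K M R y i = (\<Sum>j<K. (\<lambda>i. y j * r (unitv j) i)) i"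
        by (auto simp: sum_fun_apply mat_apply_def R_def mult.commute intro!: sum.neutral)
    qed
    then have "mat_apply M K L (mat_apply K M R y) = (\<Sum>j<K. (\<lambda>l. y j * mat_apply M K L (r (unitv j)) l))"
      by (simp add: cvp.linear_sum[OF linear_mat_apply] cvp.linear_scale[OF linear_mat_apply])
    also have "\<dots> = (\<Sum>j<K. (\<lambda>l. y j * unitv j l))"
      by (intro sum.cong refl) (simp add: r(2) unitv_in_cspace)
    also have "\<dots> = y" using cspace_expand[OF y] by simp
    finally show ?thesis .
  qed
  define d where "d = M - K"
  have "card ({..<M} - I) = d"
    using I(1) finI cardI by (simp add: card_Diff_subset d_def)
  then obtain h where h: "bij_betw h {..<d} ({..<M} - I)"
    using ex_bij_betw_nat_finite[of "{..<M} - I"] by (auto simp: atLeast0LessThan)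
  have hI: "h l < M" "h l \<notin> I" if "l < d" for l
    using bij_betwE[OF h] that by auto
  have h_inj: "h l = h l' \<longleftrightarrow> l = l'" if "l < d" "l' < d" for l l'
    using bij_betw_imp_inj_on[OF h] that by (auto simp: inj_on_def)
  define E where "E i l = (if i = h l then 1 else 0 :: complex)" for i l
  \<comment> \<open>\<open>E\<close> embeds the free coordinates. Subtracting R L E corrects the
    pivot coordinates, the only ones in which \<open>R\<close> takes nonzero values, so the free
    ones stay as prescribed.\<close>
  define T where "T i l = E i l - mat_mul K R (mat_mul M L E) i l" for i l
  define T' where "T' l i = (if i = h l then 1 else 0 :: complex)" for l i
  have Tap: "mat_apply d M T t = mat_apply d M E t - mat_apply K M R (mat_apply M K L (mat_apply d M E t))" for t
  proof -
    have "mat_apply d M T t = mat_apply d M E t - mat_apply d M (mat_mul K R (mat_mul M L E)) t"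
      by (auto simp: fun_eq_iff mat_apply_def T_def left_diff_distrib sum_subtractf)
    then show ?thesis by (simp add: mat_apply_mat_mul)
  qed
  have T'ap: "mat_apply M d T' v l = v (h l)" if "l < d" for v l
    using that hI(1)[OF that] by (simp add: mat_apply_def T'_def if_distrib[of "\<lambda>x. x * _"] cong: if_cong)
  have Eap: "mat_apply d M E t (h l) = t l" if "l < d" for t l
  proof -
    have "mat_apply d M E t (h l) = (\<Sum>i<d. (if i = l then 1 else 0) * t i)"
      using hI(1)[OF that] h_inj that unfolding mat_apply_def E_def by (auto intro!: sum.cong)
    then show ?thesis using that by (simp add: if_distrib[of "\<lambda>x. x * _"] cong: if_cong)
  qed
  have LT: "mat_apply M K L (mat_apply d M T t) = 0" for t
    by (simp add: Tap mat_apply_diff LR)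
  have T'T: "mat_apply M d T' (mat_apply d M T t) = t" if "t \<in> cspace d" for t
    by (rule cspace_eqI[OF mat_apply_in_cspace that]) (simp add: T'ap Tap Eap R0 hI)
  have TT': "mat_apply d M T (mat_apply M d T' v) = v" if v: "v \<in> cspace M" "mat_apply M K L v = 0" for v
  proof -
    define w where "w = mat_apply d M T (mat_apply M d T' v) - v"
    have "mat_apply M K L w = 0" by (simp add: w_def mat_apply_diff LT v)
    moreover have "w i = 0" if "i \<notin> I" for i
    proof (cases "i < M")
      case True
      then obtain l where l: "l < d" "i = h l"
        using h \<open>i \<notin> I\<close> by (auto simp: bij_betw_def image_iff set_eq_iff)
      have "mat_apply M d T' w l = 0"
        by (simp add: w_def mat_apply_diff T'T)
      then show ?thesis using T'ap l by simp
    next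
      case False
      then show ?thesis using v(1) by (simp add: w_def mat_apply_def cspace_def)
    qed
    ultimately have "w = 0" using kerI[of w] by blast
    then show ?thesis by (simp add: w_def)
  qed
  show ?thesis
    by (rule that[of R T T']) (fact KM LR LT[unfolded d_def] T'T[unfolded d_def] TT'[unfolded d_def])+
qed

text \<open>Tychonoff's theorem. Boxes whose factors are {0} from some index on supply compactness
  of closed balls and of bounded sets of polynomials of bounded degree.\<close>

lemma compact_product_box:
  assumes "\<And>i. compact (S i)"
  shows "compact {f::cvec. \<forall>i. f i \<in> S i}"
proof -
  have "compactin (product_topology (\<lambda>_::nat. euclidean) UNIV) (PiE UNIV S)"
    using assms by (simp add: compactin_PiE compactin_euclidean_iff)
  moreover have "PiE UNIV S = {f. \<forall>i. f i \<in> S i}" by (auto simp: PiE_def Pi_def)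
  ultimately show ?thesis by (simp add: euclidean_product_topology compactin_euclidean_iff)
qed

section \<open>The implicit function theorem\<close>

lemma filterlim_nb_nm:
  assumes "c \<in> cspace k"
  shows "filterlim f (nb k c) F \<longleftrightarrow>
    eventually (\<lambda>x. f x \<in> cspace k) F \<and> ((\<lambda>x. nm k (f x - c)) \<longlongrightarrow> 0) F"
proof
  assume A: "filterlim f (nb k c) F"
  then show "eventually (\<lambda>x. f x \<in> cspace k) F \<and> ((\<lambda>x. nm k (f x - c)) \<longlongrightarrow> 0) F"
    using filterlim_compose[OF tendsto_nm_nb[OF assms] A] filterlim_nb_iff[OF assms, of f F] by simp
next
  assume A: "eventually (\<lambda>x. f x \<in> cspace k) F \<and> ((\<lambda>x. nm k (f x - c)) \<longlongrightarrow> 0) F"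
  have "((\<lambda>x. f x j) \<longlongrightarrow> c j) F" if "j < k" for j
  proof -
    have "((\<lambda>x. f x j - c j) \<longlongrightarrow> 0) F"
    proof (rule Lim_null_comparison)
      show "((\<lambda>x. nm k (f x - c)) \<longlongrightarrow> 0) F" using A by simp
      show "\<forall>\<^sub>F x in F. norm (f x j - c j) \<le> nm k (f x - c)"
        using component_le_nm[OF that, of "f x - c" for x] by simp
    qed
    then show ?thesis by (simp add: LIM_zero_iff)
  qed
  with A show "filterlim f (nb k c) F" by (simp add: filterlim_nb_iff[OF assms])
qed

lemma continuous_on_nb:
  assumes "S \<subseteq> cspace m" "\<And>x. x \<in> S \<Longrightarrow> (f \<longlongrightarrow> f x) (nb m x)"
  shows "continuous_on S f"
  unfolding continuous_on_def
proof
  fix x assume "x \<in> S"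
  have "at x within S \<le> nb m x"
    unfolding at_within_def nb_def using assms(1) by (intro inf_mono) auto
  then show "(f \<longlongrightarrow> f x) (at x within S)"
    using assms(2)[OF \<open>x \<in> S\<close>] by (rule tendsto_mono)
qed

lemma nm_mat_apply_le: "nm k (mat_apply m k J v) \<le> (\<Sum>j<k. \<Sum>i<m. cmod (J j i)) * nm m v"
proof -
  have "nm k (mat_apply m k J v) \<le> (\<Sum>j<k. cmod (mat_apply m k J v j))" by (rule nm_le_sum)
  also have "\<dots> \<le> (\<Sum>j<k. (\<Sum>i<m. cmod (J j i)) * nm m v)"
    by (intro sum_mono) (simp add: mat_apply_def nm_sum_bound)
  finally show ?thesis by (simp add: sum_distrib_right)
qed

text \<open>With a right inverse \<open>R\<close> of the derivative \<open>L\<close> of \<open>F\<close> at \<open>p\<close>, the map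
  \<open>G = id + R (F - L)\<close> is a small perturbation of the identity near \<open>p\<close> and satisfies \<open>L G = F\<close>. It
  therefore straightens the zero set of \<open>F\<close> to the kernel of \<open>L\<close>. That \<open>G\<close> is onto a neighbourhood
  follows by minimising the distance to the prescribed value over a closed ball.\<close>

lemma implicit_parametrization:
  fixes F :: "cvec \<Rightarrow> cvec" and \<Phi> :: "cvec \<Rightarrow> cvec \<Rightarrow> nat \<Rightarrow> nat \<Rightarrow> complex"
  assumes p: "p \<in> cspace M"
    and Phi: "\<And>x y j. x \<in> cspace M \<Longrightarrow> y \<in> cspace M \<Longrightarrow> j < K \<Longrightarrow>
       F x j - F y j = (\<Sum>i<M. \<Phi> x y j i * (x i - y i))"
    and cont: "\<And>j i. j < K \<Longrightarrow> i < M \<Longrightarrow> continuous_on UNIV (\<lambda>(x, y). \<Phi> x y j i)"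
    and F0: "\<And>j. j < K \<Longrightarrow> F p j = 0"
    and surj: "mat_apply M K (\<Phi> p p) ` cspace M = cspace K"
    and d_def: "d = M - K"
    and O: "eventually Ok (nb M p)"
  obtains V \<psi> \<rho> where "openin (top_of_set (cspace d)) V" "K \<le> M"
    "\<forall>t\<in>V. \<psi> t \<in> cspace M \<and> Ok (\<psi> t) \<and> (\<forall>j<K. F (\<psi> t) j = 0)"
    "p \<in> \<psi> ` V"
    "\<forall>x\<in>\<psi> ` V. eventually (\<lambda>x. (\<forall>j<K. F x j = 0) \<longrightarrow> x \<in> \<psi> ` V) (nb M x)"
    "\<forall>t\<in>V. \<rho> (\<psi> t) = t \<and> filterlim \<rho> (nb d t) (nb M (\<psi> t))"
    "\<forall>t\<in>V. \<exists>J. has_jacobian d M \<psi> J t"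
    "\<forall>t\<in>V. \<forall>J. has_jacobian d M \<psi> J t \<longrightarrow> inj_on (mat_apply d M J) (cspace d) \<and>
       (\<forall>v\<in>cspace d. mat_apply M K (\<Phi> (\<psi> t) (\<psi> t)) (mat_apply d M J v) = 0)"
proof -
  define L where "L = \<Phi> p p"
  obtain R T T' where KM: "K \<le> M"
    and LR: "\<And>y. y \<in> cspace K \<Longrightarrow> mat_apply M K L (mat_apply K M R y) = y"
    and LT: "\<And>t. mat_apply M K L (mat_apply d M T t) = 0"
    and T'T: "\<And>t. t \<in> cspace d \<Longrightarrow> mat_apply M d T' (mat_apply d M T t) = t"
    and TT': "\<And>v. v \<in> cspace M \<Longrightarrow> mat_apply M K L v = 0 \<Longrightarrow> mat_apply d M T (mat_apply M d T' v) = v"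
    using mat_surj_kernel[OF surj[folded L_def], folded d_def] by blast
  define Fv where "Fv x = (\<lambda>j. if j < K then F x j else 0)" for x
  define G where "G x = x + mat_apply K M R (Fv x - mat_apply M K L x)" for x
  \<comment> \<open>Differences of G are those of the identity plus \<open>H\<close>, and H p p = 0
    because \<open>L\<close> is the derivative at p. Near p this makes G and its inverse Lipschitz
    with constant 2.\<close>
  define H where "H x y = mat_mul K R (\<lambda>j l. \<Phi> x y j l - L j l)" for x y
  define B where "B x y = (\<Sum>i<M. \<Sum>l<M. cmod (H x y i l))" for x y
  have Fvc: "Fv x \<in> cspace K" for x by (simp add: Fv_def cspace_def)
  have Gc: "G x \<in> cspace M" if "x \<in> cspace M" for x
    using that by (auto simp: G_def)
  have LG: "mat_apply M K L (G x) = Fv x" for x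
    by (simp add: G_def mat_apply_add LR Fvc cspace_diff)
  have Fdiff: "Fv x - Fv y = mat_apply M K (\<Phi> x y) (x - y)" if "x \<in> cspace M" "y \<in> cspace M" for x y
    using Phi[OF that] by (auto simp: fun_eq_iff Fv_def mat_apply_def)
  have Gdiff: "G x - G y = (x - y) + mat_apply M M (H x y) (x - y)" if "x \<in> cspace M" "y \<in> cspace M" for x y
  proof -
    have "mat_apply M M (H x y) (x - y) = mat_apply K M R (mat_apply M K (\<lambda>j l. \<Phi> x y j l - L j l) (x - y))"
      unfolding H_def by (rule mat_apply_mat_mul)
    also have "mat_apply M K (\<lambda>j l. \<Phi> x y j l - L j l) (x - y) = (Fv x - Fv y) - mat_apply M K L (x - y)"
      unfolding Fdiff[OF that] by (auto simp: fun_eq_iff mat_apply_def left_diff_distrib sum_subtractf)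
    finally have "mat_apply M M (H x y) (x - y) = mat_apply K M R (Fv x) - mat_apply K M R (Fv y) -
        (mat_apply K M R (mat_apply M K L x) - mat_apply K M R (mat_apply M K L y))"
      by (simp only: mat_apply_diff)
    note e = this
    show ?thesis unfolding e by (simp add: G_def mat_apply_diff)
  qed
  have contH: "((\<lambda>x. H (f x) (h x) i l) \<longlongrightarrow> H a b i l) F'"
    if "l < M" "(f \<longlongrightarrow> a) F'" "(h \<longlongrightarrow> b) F'" for f h a b i l and F' :: "'q filter"
    unfolding H_def mat_mul_def
  proof (intro tendsto_sum tendsto_mult tendsto_diff tendsto_const)
    fix j assume "j \<in> {..<K}"
    then have "isCont (\<lambda>(x, y). \<Phi> x y j l) (a, b)"
      using cont[of j l] that(1) continuous_on_eq_continuous_at[OF open_UNIV] by blast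
    from isCont_tendsto_compose[OF this tendsto_Pair[OF that(2,3)]]
    show "((\<lambda>x. \<Phi> (f x) (h x) j l) \<longlongrightarrow> \<Phi> a b j l) F'" by simp
  qed
  have idnb: "((\<lambda>x. x) \<longlongrightarrow> x) (nb M x)" for x
    by (simp add: nb_def filterlim_def filtermap_ident)
  have Hpp: "H p p i l = 0" for i l
    by (simp add: H_def mat_mul_def L_def)
  have "((\<lambda>w. B (fst w) (snd w)) \<longlongrightarrow> (\<Sum>i<M. \<Sum>l<M. cmod (H p p i l))) (nb M p \<times>\<^sub>F nb M p)"
    unfolding B_def
    by (intro tendsto_sum tendsto_norm contH filterlim_compose[OF idnb filterlim_fst] filterlim_compose[OF idnb filterlim_snd]) auto
  then have "eventually (\<lambda>w. B (fst w) (snd w) < 1/2) (nb M p \<times>\<^sub>F nb M p)"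
    by (rule order_tendstoD) (simp add: Hpp)
  then obtain P1 P2 where P12: "eventually P1 (nb M p)" "eventually P2 (nb M p)"
    "\<And>x y. P1 x \<Longrightarrow> P2 y \<Longrightarrow> B x y < 1/2"
    unfolding eventually_prod_filter by auto
  have "eventually (\<lambda>x. P1 x \<and> P2 x \<and> Ok x) (nb M p)"
    using P12(1,2) O by eventually_elim simp
  then obtain r where r: "r > 0" and rP: "\<And>w. w \<in> cspace M \<Longrightarrow> nm M (w - p) < r \<Longrightarrow> P1 w \<and> P2 w \<and> Ok w"
    unfolding eventually_nb[OF p] by blast
  have HB: "nm M (mat_apply M M (H x y) v) \<le> 1/2 * nm M v"
    if "x \<in> cspace M" "nm M (x - p) < r" "y \<in> cspace M" "nm M (y - p) < r" for x y v
  proof -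
    have "B x y < 1/2" using rP[OF that(1,2)] rP[OF that(3,4)] P12(3) by blast
    then have "B x y * nm M v \<le> 1/2 * nm M v" by (intro mult_right_mono) auto
    then show ?thesis
      using nm_mat_apply_le[of M M "H x y" v] by (simp add: B_def)
  qed
  have Glow: "nm M (x - y) \<le> 2 * nm M (G x - G y)" and Gup: "nm M (G x - G y) \<le> 2 * nm M (x - y)"
    and Gid: "nm M (G x - G y - (x - y)) \<le> 1/2 * nm M (x - y)"
    if "x \<in> cspace M" "nm M (x - p) < r" "y \<in> cspace M" "nm M (y - p) < r" for x y
  proof -
    have "G x - G y - (x - y) = mat_apply M M (H x y) (x - y)" by (simp add: Gdiff that)
    then show 1: "nm M (G x - G y - (x - y)) \<le> 1/2 * nm M (x - y)" using HB[OF that] by simp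
    show "nm M (x - y) \<le> 2 * nm M (G x - G y)"
      using nm_triangle_rev[of M "x - y" "G x - G y"] 1 nm_minus_commute[of M "G x - G y" "x - y"] by linarith
    show "nm M (G x - G y) \<le> 2 * nm M (x - y)"
      using nm_triangle[of M "G x - G y - (x - y)" "x - y", unfolded diff_add_cancel] 1 nm_ge_0[of M "x - y"]
      by linarith
  qed
  \<comment> \<open>Halving keeps the closed ball of radius s, over which the distance is minimised,
    inside the open ball where the estimates hold.\<close>
  define s where "s = r / 2"
  have s: "s > 0" "s < r" using r by (auto simp: s_def)
  have pp: "nm M (p - p) = 0" by simp
  have Gcont: "((\<lambda>w. nm M (G w - G x)) \<longlongrightarrow> 0) (nb M x)" if x: "x \<in> cspace M" "nm M (x - p) < r" for x
  proof (rule Lim_null_comparison)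
    show "((\<lambda>w. 2 * nm M (w - x)) \<longlongrightarrow> 0) (nb M x)"
      using tendsto_mult[OF tendsto_const[of 2] tendsto_nm_nb[OF x(1)]] by simp
    have "eventually (\<lambda>w. nm M (w - x) < r - nm M (x - p)) (nb M x)"
      using x(2) by (intro order_tendstoD(2)[OF tendsto_nm_nb[OF x(1)]]) simp
    with eventually_nb_cspace show "\<forall>\<^sub>F w in nb M x. norm (nm M (G w - G x)) \<le> 2 * nm M (w - x)"
    proof eventually_elim
      case (elim w)
      then have "nm M (w - p) < r" using nm_triangle_diff[of M w p x] by linarith
      then show ?case using Gup[of w x] elim x by simp
    qed
  qed
  \<comment> \<open>Let \<eta> be the distance from y to G p. A minimiser x lies within 4 \<eta> of
    p, and adding the residual h = y - G x costs at most another \<eta>: hence the 5. As G is close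
    to the identity, the residual at x + h is at most half of h, so minimality forces h = 0.\<close>
  have Gsurj: "\<exists>x\<in>cspace M. nm M (x - p) < s \<and> G x = y" if y: "y \<in> cspace M" "nm M (y - G p) < s / 5" for y
  proof -
    define S where "S = {x \<in> cspace M. nm M (x - p) \<le> s}"
    have inS: "x \<in> cspace M" "nm M (x - p) < r" if "x \<in> S" for x using that s by (auto simp: S_def)
    have contnm: "continuous_on UNIV (\<lambda>x::cvec. nm M (x - p))"
      unfolding nm_def L2_set_def minus_apply
      by (intro continuous_on_real_sqrt continuous_on_sum continuous_on_power continuous_on_norm
          continuous_on_diff continuous_on_const continuous_on_product_coordinates)
    have "compact S"
    proof -
      define bx where "bx = {f::cvec. \<forall>i. f i \<in> (if i < M then cball (p i) s else {0})}"
      have "compact bx" unfolding bx_def by (rule compact_product_box) auto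
      moreover have "closed {x::cvec. nm M (x - p) \<le> s}"
        using contnm by (intro closed_Collect_le) (auto intro: continuous_intros)
      moreover have "S = bx \<inter> {x. nm M (x - p) \<le> s}"
      proof -
        have "cmod (x i - p i) \<le> s" if "nm M (x - p) \<le> s" "i < M" for x i
          using component_le_nm[OF that(2), of "x - p"] that(1) by simp
        then show ?thesis
          by (auto simp: S_def bx_def cspace_def dist_norm norm_minus_commute split: if_splits)
      qed
      ultimately show ?thesis by (simp add: compact_Int_closed)
    qed
    moreover have "p \<in> S" using p s by (simp add: S_def)
    moreover have "continuous_on S (\<lambda>x. nm M (G x - y))"
    proof (rule continuous_on_nb[of _ M])
      show "S \<subseteq> cspace M" by (auto simp: S_def)
      fix x assume "x \<in> S"
      note x = inS[OF this]
      have "((\<lambda>w. nm M (G w - y) - nm M (G x - y)) \<longlongrightarrow> 0) (nb M x)"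
      proof (rule Lim_null_comparison[OF _ Gcont[OF x]])
        show "\<forall>\<^sub>F w in nb M x. norm (nm M (G w - y) - nm M (G x - y)) \<le> nm M (G w - G x)"
        proof (intro always_eventually allI)
          fix w
          show "norm (nm M (G w - y) - nm M (G x - y)) \<le> nm M (G w - G x)"
            using nm_triangle_diff[of M "G w" y "G x"] nm_triangle_diff[of M "G x" y "G w"]
              nm_minus_commute[of M "G x" "G w"] by (simp add: abs_le_iff)
        qed
      qed
      then show "((\<lambda>x. nm M (G x - y)) \<longlongrightarrow> nm M (G x - y)) (nb M x)" by (simp add: LIM_zero_iff)
    qed
    ultimately obtain x where x: "x \<in> S" and xmin: "\<And>w. w \<in> S \<Longrightarrow> nm M (G x - y) \<le> nm M (G w - y)"
      using continuous_attains_inf[of S "\<lambda>x. nm M (G x - y)"] by blast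
    note xr = inS[OF x]
    define h where "h = y - G x"
    define \<eta> where "\<eta> = nm M (y - G p)"
    have h1: "nm M h \<le> \<eta>"
      using xmin[OF \<open>p \<in> S\<close>] by (simp add: h_def \<eta>_def nm_minus_commute[of M y])
    have "nm M (x - p) \<le> 2 * nm M (G x - G p)" using Glow[OF xr p] r by simp
    also have "\<dots> \<le> 2 * (nm M h + \<eta>)"
      using nm_triangle_diff[of M "G x" "G p" y] nm_minus_commute[of M "G x" y] by (simp add: h_def \<eta>_def)
    finally have x4: "nm M (x - p) \<le> 4 * \<eta>" using h1 by simp
    have hc: "h \<in> cspace M" using y xr Gc by (auto simp: h_def)
    have "nm M (x + h - p) \<le> nm M (x - p) + nm M h"
      using nm_triangle[of M "x - p" h] by (simp add: algebra_simps)
    also have "\<dots> \<le> 5 * \<eta>" using x4 h1 by simp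
    also have "\<dots> < s" using y by (simp add: \<eta>_def)
    finally have xh: "x + h \<in> S" using xr hc by (auto simp: S_def)
    have "nm M h \<le> nm M (G (x + h) - y)"
      using xmin[OF xh] by (simp add: h_def nm_minus_commute)
    also have "G (x + h) - y = G (x + h) - G x - (x + h - x)"
      by (simp add: h_def)
    also have "nm M \<dots> \<le> 1/2 * nm M (x + h - x)"
      by (rule Gid) (use inS[OF xh] xr in auto)
    finally have "nm M h = 0" using nm_ge_0[of M h] by simp
    then have "h = 0" using hc nm_eq_0_iff by blast
    then have "G x = y" by (simp add: h_def)
    moreover have "nm M (x - p) < s"
      using x4 y(2) nm_ge_0[of M "y - G p"] unfolding \<eta>_def by linarith
    ultimately show ?thesis using xr by blast
  qed
  define U where "U = {x \<in> cspace M. nm M (x - p) < s \<and> nm M (G x - G p) < s / 5}"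
  have UD: "x \<in> cspace M" "nm M (x - p) < r" "Ok x" if "x \<in> U" for x
    using that s rP[of x] by (auto simp: U_def)
  have Ginj: "x = y" if "x \<in> U" "y \<in> U" "G x = G y" for x y
  proof -
    have "nm M (x - y) = 0" using Glow[OF UD(1,2)[OF that(1)] UD(1,2)[OF that(2)]] that(3) nm_ge_0[of M "x - y"] by simp
    moreover have "x - y \<in> cspace M" using UD(1) that by auto
    ultimately have "x - y = 0" using nm_eq_0_iff by blast
    then show ?thesis by simp
  qed
  have Uopen: "eventually (\<lambda>w. w \<in> U) (nb M x)" if "x \<in> U" for x
  proof -
    note x = UD[OF that]
    have "eventually (\<lambda>w. nm M (w - x) < s - nm M (x - p)) (nb M x)"
      using that by (intro order_tendstoD(2)[OF tendsto_nm_nb[OF x(1)]]) (simp add: U_def)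
    moreover have "eventually (\<lambda>w. nm M (G w - G x) < s / 5 - nm M (G x - G p)) (nb M x)"
      using that by (intro order_tendstoD(2)[OF Gcont[OF x(1,2)]]) (simp add: U_def)
    ultimately show ?thesis
      using eventually_nb_cspace
    proof eventually_elim
      case (elim w)
      then show ?case
        using nm_triangle_diff[of M w p x] nm_triangle_diff[of M "G w" "G p" "G x"] by (simp add: U_def)
    qed
  qed
  \<comment> \<open>The parameters are kernel coordinates t, and \<psi> t will be the unique point
    of U that G sends to the kernel vector T t.\<close>
  define V where "V = {t \<in> cspace d. nm M (mat_apply d M T t - G p) < s / 5}"
  define \<psi> where "\<psi> t = (SOME x. x \<in> U \<and> G x = mat_apply d M T t)" for t
  have psi: "\<psi> t \<in> U" "G (\<psi> t) = mat_apply d M T t" if "t \<in> V" for t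
  proof -
    have "\<exists>x. x \<in> U \<and> G x = mat_apply d M T t"
    proof -
      have Tt: "nm M (mat_apply d M T t - G p) < s / 5" using that by (simp add: V_def)
      obtain x where "x \<in> cspace M" "nm M (x - p) < s" "G x = mat_apply d M T t"
        using Gsurj[OF mat_apply_in_cspace Tt] by blast
      then show ?thesis using Tt by (intro exI[of _ x]) (simp add: U_def)
    qed
    from someI_ex[OF this] show "\<psi> t \<in> U" "G (\<psi> t) = mat_apply d M T t"
      unfolding \<psi>_def by auto
  qed
  have psi_eq: "\<psi> t = x" if "x \<in> U" "G x = mat_apply d M T t" "t \<in> V" for x t
    using psi[OF that(3)] that Ginj by metis
  have V_sub: "V \<subseteq> cspace d" by (auto simp: V_def)
  define \<rho> where "\<rho> x = mat_apply M d T' (G x)" for x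
  \<comment> \<open>By L G = F, a point x of U is a zero of F exactly when G x lies in the kernel of
    L, that is, in the range of T.\<close>
  have zero_in: "x \<in> \<psi> ` V \<longleftrightarrow> x \<in> U \<and> (\<forall>j<K. F x j = 0)" for x
  proof
    assume "x \<in> \<psi> ` V"
    then obtain t where t: "t \<in> V" "x = \<psi> t" by blast
    have "Fv x = 0" using LG[of x] psi(2)[OF t(1)] t(2) LT by simp
    have "F x j = 0" if "j < K" for j
      using fun_cong[OF \<open>Fv x = 0\<close>, of j] that by (simp add: Fv_def)
    then show "x \<in> U \<and> (\<forall>j<K. F x j = 0)"
      using psi(1)[OF t(1)] t(2) by simp
  next
    assume x: "x \<in> U \<and> (\<forall>j<K. F x j = 0)"
    then have "Fv x = 0" by (auto simp: Fv_def)
    then have TG: "mat_apply d M T (\<rho> x) = G x"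
      unfolding \<rho>_def using x LG[of x] UD(1) Gc by (intro TT') auto
    have "\<rho> x \<in> V" using x TG by (simp add: V_def U_def \<rho>_def)
    moreover have "\<psi> (\<rho> x) = x" using x TG \<open>\<rho> x \<in> V\<close> by (intro psi_eq) auto
    ultimately show "x \<in> \<psi> ` V" by (metis imageI)
  qed
  have Vopen: "openin (top_of_set (cspace d)) V"
    unfolding openin_cspace_iff_nb
  proof (intro conjI ballI)
    fix t assume t: "t \<in> V"
    then have tc: "t \<in> cspace d" using V_sub by auto
    have "((\<lambda>w. nm M (mat_apply d M T w - mat_apply d M T t)) \<longlongrightarrow> 0) (nb d t)"
    proof (rule Lim_null_comparison)
      show "((\<lambda>w. (\<Sum>j<M. \<Sum>i<d. cmod (T j i)) * nm d (w - t)) \<longlongrightarrow> 0) (nb d t)"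
        using tendsto_mult[OF tendsto_const tendsto_nm_nb[OF tc], of "\<Sum>j<M. \<Sum>i<d. cmod (T j i)"] by simp
      show "\<forall>\<^sub>F w in nb d t. norm (nm M (mat_apply d M T w - mat_apply d M T t)) \<le> (\<Sum>j<M. \<Sum>i<d. cmod (T j i)) * nm d (w - t)"
      proof (intro always_eventually allI)
        fix w
        show "norm (nm M (mat_apply d M T w - mat_apply d M T t)) \<le> (\<Sum>j<M. \<Sum>i<d. cmod (T j i)) * nm d (w - t)"
          using nm_mat_apply_le[of M d T "w - t"] by (simp add: mat_apply_diff)
      qed
    qed
    then have "eventually (\<lambda>w. nm M (mat_apply d M T w - mat_apply d M T t) < s/5 - nm M (mat_apply d M T t - G p)) (nb d t)"
      using t by (intro order_tendstoD(2)) (auto simp: V_def)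
    with eventually_nb_cspace show "eventually (\<lambda>w. w \<in> V) (nb d t)"
    proof eventually_elim
      case (elim w)
      then show ?case
        using nm_triangle_diff[of M "mat_apply d M T w" "G p" "mat_apply d M T t"] by (simp add: V_def)
    qed
  qed (rule V_sub)
  have Glim: "filterlim G (nb M (G x)) (nb M x)" if "x \<in> U" for x
    using Gcont[OF UD(1,2)[OF that]] UD(1)[OF that] Gc
    by (auto simp: filterlim_nb_nm intro: eventually_mono[OF eventually_nb_cspace])
  have lin_lim: "filterlim (mat_apply a b A) (nb b (mat_apply a b A v)) (nb a v)" if "v \<in> cspace a" for a b A v
    using has_jacobian_continuous[OF that _ _ has_jacobian_linear[of a b A v]] by simp
  have psi_lim: "filterlim \<psi> (nb M (\<psi> t)) (nb d t)" if t: "t \<in> V" for t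
  proof -
    have tc: "t \<in> cspace d" using V_sub t by auto
    have evV: "eventually (\<lambda>u. u \<in> V) (nb d t)" using Vopen t by (auto simp: openin_cspace_iff_nb)
    have 1: "eventually (\<lambda>u. \<psi> u \<in> cspace M) (nb d t)"
      using evV by eventually_elim (use psi UD in blast)
    have "((\<lambda>u. nm M (mat_apply d M T u - mat_apply d M T t)) \<longlongrightarrow> 0) (nb d t)"
      using lin_lim[OF tc, of M T] by (simp add: filterlim_nb_nm)
    then have 2: "((\<lambda>u. 2 * nm M (mat_apply d M T u - mat_apply d M T t)) \<longlongrightarrow> 0) (nb d t)"
      using tendsto_mult_right_zero by blast
    have "((\<lambda>u. nm M (\<psi> u - \<psi> t)) \<longlongrightarrow> 0) (nb d t)"
    proof (rule Lim_null_comparison[OF _ 2])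
      show "\<forall>\<^sub>F u in nb d t. norm (nm M (\<psi> u - \<psi> t)) \<le> 2 * nm M (mat_apply d M T u - mat_apply d M T t)"
        using evV
      proof eventually_elim
        case (elim u)
        show ?case using Glow[OF UD(1,2)[OF psi(1)[OF elim]] UD(1,2)[OF psi(1)[OF t]]]
          by (simp add: psi elim t)
      qed
    qed
    with 1 show ?thesis using psi(1)[OF t] UD(1) by (simp add: filterlim_nb_nm)
  qed
  \<comment> \<open>The derivative of G at x is id + H x x. The derivative of \<psi> is then
    obtained by lifting the linear map T through G.\<close>
  define GJ where "GJ x = (\<lambda>i l. (if l = i then 1 else 0) + H x x i l)" for x
  have Gjac: "has_jacobian M M G (GJ x) x" if x: "x \<in> cspace M" for x
    unfolding has_jacobian_iff_grad[OF x]
  proof (intro allI impI, rule has_gradI)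
    fix i l assume "i < M" "l < M"
    show "((\<lambda>w. (if l = i then 1 else 0) + H w x i l) \<longlongrightarrow> GJ x i l) (nb M x)"
      unfolding GJ_def using \<open>l < M\<close> by (intro tendsto_intros contH idnb) auto
  next
    fix i assume i: "i < M"
    show "\<forall>\<^sub>F w in nb M x. G w i - G x i = (\<Sum>l<M. ((if l = i then 1 else 0) + H w x i l) * (w l - x l))"
      using eventually_nb_cspace
    proof eventually_elim
      case (elim w)
      have "(G w - G x) i = (w i - x i) + (\<Sum>l<M. H w x i l * (w l - x l))"
        unfolding Gdiff[OF elim x] using i by (simp add: mat_apply_def)
      then show ?case
        using i by (simp add: distrib_right sum.distrib if_distrib[of "\<lambda>x. x * _"] cong: if_cong)
    qed
  qed
  have GJap: "mat_apply M M (GJ x) v = v + mat_apply M M (H x x) v" if "v \<in> cspace M" for x v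
  proof -
    have "mat_apply M M (GJ x) v = mat_apply M M (\<lambda>i l. if l = i then 1 else 0) v + mat_apply M M (H x x) v"
      by (auto simp: fun_eq_iff mat_apply_def GJ_def distrib_right sum.distrib)
    then show ?thesis using mat_apply_id[OF that] by simp
  qed
  \<comment> \<open>A vector v in the kernel satisfies v = - H v, and H at most halves
    norms.\<close>
  have GJinj: "inj_on (mat_apply M M (GJ x)) (cspace M)" if "x \<in> U" for x
  proof (rule inj_onI)
    fix v w assume v: "v \<in> cspace M" "w \<in> cspace M" and eq: "mat_apply M M (GJ x) v = mat_apply M M (GJ x) w"
    have vw: "v - w \<in> cspace M" using v by auto
    have "mat_apply M M (GJ x) (v - w) = 0" using eq by (simp add: mat_apply_diff)
    then have "v - w = - mat_apply M M (H x x) (v - w)" using GJap[OF vw, of x] by (simp add: eq_neg_iff_add_eq_0)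
    then have "nm M (v - w) = nm M (mat_apply M M (H x x) (v - w))"
      using nm_minus_commute[of M 0] by (metis diff_0 diff_zero)
    also have "\<dots> \<le> 1/2 * nm M (v - w)" using HB UD that by blast
    finally have "nm M (v - w) = 0" using nm_ge_0[of M "v - w"] by simp
    then have "v - w = 0" using nm_eq_0_iff vw by blast
    then show "v = w" by simp
  qed
  have psi_ev: "eventually (\<lambda>u. \<psi> u \<in> cspace M) (nb d t)" if "t \<in> V" for t
    using psi_lim[OF that] UD(1)[OF psi(1)[OF that]] by (simp add: filterlim_nb_iff)
  have evV: "eventually (\<lambda>u. u \<in> V) (nb d t)" if "t \<in> V" for t
    using Vopen that by (auto simp: openin_cspace_iff_nb)
  have psi_jac: "\<exists>J. has_jacobian d M \<psi> J t" if t: "t \<in> V" for t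
  proof -
    have tc: "t \<in> cspace d" and xc: "\<psi> t \<in> cspace M"
      using t V_sub UD(1)[OF psi(1)[OF t]] by auto
    obtain \<Lambda> where Lam: "\<And>v. v \<in> cspace M \<Longrightarrow> mat_apply M M \<Lambda> (mat_apply M M (GJ (\<psi> t)) v) = v"
      using mat_left_inverse[OF GJinj[OF psi(1)[OF t]]] by blast
    have ev: "\<forall>\<^sub>F u in nb d t. G (\<psi> u) = mat_apply d M T u"
      using evV[OF t] by (rule eventually_mono) (rule psi(2))
    have "has_jacobian d M \<psi> (mat_mul M \<Lambda> T) t"
      by (rule has_jacobian_lift[OF tc xc Gjac[OF xc] Lam psi_lim[OF t] ev has_jacobian_linear])
    then show ?thesis by (rule exI[of _ "mat_mul M \<Lambda> T"])
  qed
  have psi_inj: "inj_on (mat_apply d M J) (cspace d)" if t: "t \<in> V" and J: "has_jacobian d M \<psi> J t" for t J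
  proof (rule inj_onI)
    fix v w assume v: "v \<in> cspace d" "w \<in> cspace d" and eq: "mat_apply d M J v = mat_apply d M J w"
    have tc: "t \<in> cspace d" using V_sub t by auto
    have "has_jacobian d M (G \<circ> \<psi>) (mat_mul M (GJ (\<psi> t)) J) t"
      using has_jacobian_chain[OF tc _ psi_ev[OF t] J Gjac] UD(1)[OF psi(1)[OF t]] by blast
    then have "has_jacobian d M (mat_apply d M T) (mat_mul M (GJ (\<psi> t)) J) t"
      by (rule has_jacobian_cong[OF tc, rotated]) (use evV[OF t] psi(2) in \<open>auto elim!: eventually_mono\<close>)
    then have "mat_apply d M T u = mat_apply M M (GJ (\<psi> t)) (mat_apply d M J u)" if "u \<in> cspace d" for u
      using has_jacobian_unique[OF tc that has_jacobian_linear] by (simp add: mat_apply_mat_mul)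
    then have "mat_apply d M T v = mat_apply d M T w" using v eq by simp
    then show "v = w" using T'T v by metis
  qed
  \<comment> \<open>This is the derivative of the identity F (\<psi> t) = 0, by the chain
    rule.\<close>
  have psi_ker: "mat_apply M K (\<Phi> (\<psi> t) (\<psi> t)) (mat_apply d M J v) = 0"
    if t: "t \<in> V" and J: "has_jacobian d M \<psi> J t" and v: "v \<in> cspace d" for t J v
  proof -
    have tc: "t \<in> cspace d" using V_sub t by auto
    note xc = UD(1)[OF psi(1)[OF t]]
    have Fjac: "has_jacobian M K Fv (\<Phi> (\<psi> t) (\<psi> t)) (\<psi> t)"
      unfolding has_jacobian_iff_grad[OF xc]
    proof (intro allI impI, rule has_gradI)
      fix j i assume "j < K" "i < M"
      then have "isCont (\<lambda>(x, y). \<Phi> x y j i) (\<psi> t, \<psi> t)"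
        using cont[of j i] continuous_on_eq_continuous_at[OF open_UNIV] by blast
      from isCont_tendsto_compose[OF this tendsto_Pair[OF idnb tendsto_const]]
      show "((\<lambda>w. \<Phi> w (\<psi> t) j i) \<longlongrightarrow> \<Phi> (\<psi> t) (\<psi> t) j i) (nb M (\<psi> t))" by simp
    next
      fix j assume "j < K"
      then show "\<forall>\<^sub>F w in nb M (\<psi> t). Fv w j - Fv (\<psi> t) j = (\<Sum>i<M. \<Phi> w (\<psi> t) j i * (w i - \<psi> t i))"
        using Phi xc by (auto simp: Fv_def intro: eventually_mono[OF eventually_nb_cspace])
    qed
    have "has_jacobian d K (Fv \<circ> \<psi>) (mat_mul M (\<Phi> (\<psi> t) (\<psi> t)) J) t"
      using has_jacobian_chain[OF tc xc psi_ev[OF t] J Fjac] .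
    moreover have "\<forall>\<^sub>F u in nb d t. (Fv \<circ> \<psi>) u = mat_apply d K (\<lambda>_ _. 0) u"
      using evV[OF t]
    proof eventually_elim
      case (elim u)
      have "F (\<psi> u) j = 0" if "j < K" for j
        using zero_in[THEN iffD1, OF imageI[OF elim]] that by simp
      then show ?case by (auto simp: Fv_def mat_apply_def fun_eq_iff)
    qed
    ultimately have "has_jacobian d K (mat_apply d K (\<lambda>_ _. 0)) (mat_mul M (\<Phi> (\<psi> t) (\<psi> t)) J) t"
      using has_jacobian_cong[OF tc] by blast
    from has_jacobian_unique[OF tc v this has_jacobian_linear]
    show ?thesis by (simp add: mat_apply_mat_mul) (auto simp: mat_apply_def fun_eq_iff)
  qed
  have c1: "p \<in> \<psi> ` V" by (rule zero_in[THEN iffD2]) (use F0 p s in \<open>simp add: U_def\<close>)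
  have c2: "eventually (\<lambda>x. (\<forall>j<K. F x j = 0) \<longrightarrow> x \<in> \<psi> ` V) (nb M x)" if "x \<in> \<psi> ` V" for x
  proof -
    have "x \<in> U" using zero_in[THEN iffD1, OF that] by (rule conjunct1)
    show ?thesis
      using Uopen[OF \<open>x \<in> U\<close>]
    proof (rule eventually_mono)
      fix w assume "w \<in> U"
      then show "(\<forall>j<K. F w j = 0) \<longrightarrow> w \<in> \<psi> ` V" using zero_in[of w] by simp
    qed
  qed
  have c3: "\<rho> (\<psi> t) = t" if "t \<in> V" for t
    using that V_sub by (simp add: \<rho>_def psi T'T subsetD)
  have c4: "filterlim \<rho> (nb d t) (nb M (\<psi> t))" if "t \<in> V" for t
  proof -
    have "filterlim (\<lambda>x. mat_apply M d T' (G x)) (nb d (mat_apply M d T' (G (\<psi> t)))) (nb M (\<psi> t))"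
      by (rule filterlim_compose[OF lin_lim[OF Gc[OF UD(1)[OF psi(1)[OF that]]]] Glim[OF psi(1)[OF that]]])
    then show ?thesis using c3[OF that] unfolding \<rho>_def[abs_def] by simp
  qed
  have c5: "F (\<psi> t) j = 0" if "t \<in> V" "j < K" for t j
    using zero_in[THEN iffD1, OF imageI[OF that(1)]] that(2) by simp
  have c6: "\<psi> t \<in> cspace M" "Ok (\<psi> t)" if "t \<in> V" for t
    using UD[OF psi(1)[OF that]] by auto
  have o1: "\<forall>t\<in>V. \<psi> t \<in> cspace M \<and> Ok (\<psi> t) \<and> (\<forall>j<K. F (\<psi> t) j = 0)"
    using c6 c5 by simp
  have o2: "\<forall>x\<in>\<psi> ` V. eventually (\<lambda>x. (\<forall>j<K. F x j = 0) \<longrightarrow> x \<in> \<psi> ` V) (nb M x)"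
    by (intro ballI c2)
  have o3: "\<forall>t\<in>V. \<rho> (\<psi> t) = t \<and> filterlim \<rho> (nb d t) (nb M (\<psi> t))"
    by (intro ballI conjI c3 c4)
  have o4: "\<forall>t\<in>V. \<exists>J. has_jacobian d M \<psi> J t"
    by (intro ballI psi_jac)
  have o5: "\<forall>t\<in>V. \<forall>J. has_jacobian d M \<psi> J t \<longrightarrow> inj_on (mat_apply d M J) (cspace d) \<and>
       (\<forall>v\<in>cspace d. mat_apply M K (\<Phi> (\<psi> t) (\<psi> t)) (mat_apply d M J v) = 0)"
    by (intro ballI allI impI conjI psi_inj psi_ker)
  show ?thesis
    by (rule that[OF Vopen KM o1 c1 o2 o3 o4 o5])
qed

section \<open>Monic solutions of the Pell-Abel equation\<close>

text \<open>Dividing \<open>P\<close> and \<open>Q\<close> by their leading coefficients turns the right-hand side \<open>1\<close> into a constant,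
  which is automatically non-zero because \<open>D\<close> is square-free. In exchange the solution of a given degree
  becomes unique.\<close>

definition monic_solution :: "nat \<Rightarrow> nat \<Rightarrow> complex poly \<Rightarrow> complex poly \<Rightarrow> complex poly \<Rightarrow> bool" where
  "monic_solution g n D P Q \<longleftrightarrow> g < n \<and> lead_coeff P = 1 \<and> degree P = n \<and>
     lead_coeff Q = 1 \<and> degree Q = n - g - 1 \<and> degree (P\<^sup>2 - D * Q\<^sup>2) = 0"

lemma H_tildeD:
  assumes "D \<in> H_tilde g"
  shows "lead_coeff D = 1" "degree D = 2 * g + 2" "rsquarefree D" "D \<noteq> 0"
  using assms by (auto simp: H_tilde_def)

lemma poly_has_root: "degree p > 0 \<Longrightarrow> \<exists>z::complex. poly p z = 0"
  using fundamental_theorem_of_algebra[of p] constant_degree[of p] by auto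

lemma rsquarefree_no_square:
  assumes "rsquarefree D" "h * h dvd (D :: complex poly)" shows "is_unit h"
proof (rule ccontr)
  assume nu: "\<not> is_unit h"
  obtain w where w: "D = h * h * w" using assms(2) by blast
  have "D \<noteq> 0" using assms(1) by (simp add: rsquarefree_def)
  then have "h \<noteq> 0" using w by auto
  then have "degree h > 0" using nu by (simp add: is_unit_iff_degree)
  then obtain r where "poly h r = 0" using poly_has_root by blast
  then have "poly D r = 0" "poly (pderiv D) r = 0" unfolding w by (simp_all add: pderiv_mult)
  then show False using assms(1) unfolding rsquarefree_roots by blast
qed

text \<open>At a root of the square-free D, the order of D Q^2 would be odd and that of P^2
  even.\<close>

lemma norm_zero_imp_zero:
  assumes D: "D \<in> H_tilde g" and eq: "P\<^sup>2 = D * Q\<^sup>2"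
  shows "P = 0" "Q = 0"
proof -
  have "Q = 0"
  proof (rule ccontr)
    assume Q: "Q \<noteq> 0"
    obtain r where r: "poly D r = 0" using poly_has_root[of D] H_tildeD(2)[OF D] by auto
    have "order r D = 0 \<or> order r D = 1"
      using H_tildeD(3)[OF D] unfolding rsquarefree_def by blast
    moreover have "order r D \<noteq> 0" using H_tildeD(4)[OF D] r order_root by blast
    ultimately have "order r D = 1" by blast
    moreover have "D * Q\<^sup>2 \<noteq> 0" using Q H_tildeD(4)[OF D] by simp
    then have "P \<noteq> 0" using eq by auto
    have "order r (P\<^sup>2) = 2 * order r P" "order r (Q\<^sup>2) = 2 * order r Q"
      using Q \<open>P \<noteq> 0\<close> by (simp_all add: power2_eq_square order_mult)
    moreover have "order r (D * Q\<^sup>2) = order r D + order r (Q\<^sup>2)"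
      by (rule order_mult) fact
    ultimately have "2 * order r P = Suc (2 * order r Q)" using eq by simp
    then show False by presburger
  qed
  then show "Q = 0" "P = 0" using eq by auto
qed

lemma monic_solution_const:
  assumes D: "D \<in> H_tilde g" and s: "monic_solution g n D P Q"
  obtains c where "c \<noteq> 0" "P\<^sup>2 - D * Q\<^sup>2 = [:c:]"
proof -
  obtain c where c: "P\<^sup>2 - D * Q\<^sup>2 = [:c:]"
    using s degree_eq_zeroE unfolding monic_solution_def by blast
  have "c \<noteq> 0"
  proof
    assume "c = 0"
    then have "P\<^sup>2 = D * Q\<^sup>2" using c by simp
    then have "P = 0" using norm_zero_imp_zero[OF D] by blast
    then show False using s by (auto simp: monic_solution_def)
  qed
  then show ?thesis using that c by blast
qed

text \<open>The difference is constant while D Q^2 has degree at least 2, so P^2 and D Q^2 have the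
  same leading term. The leading coefficients of P and Q themselves agree only up to sign.\<close>

lemma degree_norm_const:
  fixes D P Q :: "complex poly"
  assumes D: "D \<in> H_tilde g" and c: "P\<^sup>2 - D * Q\<^sup>2 = [:c:]" and Q: "Q \<noteq> 0"
  shows "degree P = g + 1 + degree Q" "(lead_coeff P)\<^sup>2 = (lead_coeff Q)\<^sup>2"
proof -
  have eq: "P\<^sup>2 = D * Q\<^sup>2 + [:c:]" using c by (simp add: algebra_simps)
  have dq: "degree (D * Q\<^sup>2) = 2 * g + 2 + 2 * degree Q"
    using Q H_tildeD[OF D] by (simp add: degree_mult_eq degree_power_eq)
  then have lt: "degree [:c:] < degree (D * Q\<^sup>2)" by simp
  have P: "P \<noteq> 0"
  proof
    assume "P = 0"
    then have "D * Q\<^sup>2 + [:c:] = 0" using eq by simp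
    then have "D * Q\<^sup>2 = - [:c:]" by (simp only: eq_neg_iff_add_eq_0)
    then show False using dq by simp
  qed
  have "degree (P\<^sup>2) = degree (D * Q\<^sup>2)" unfolding eq by (rule degree_add_eq_left) (rule lt)
  then show "degree P = g + 1 + degree Q" using dq P by (simp add: degree_power_eq)
  have "lead_coeff (P\<^sup>2) = lead_coeff (D * Q\<^sup>2)"
    using lead_coeff_add_le[OF lt] unfolding eq by (simp only: add.commute)
  then show "(lead_coeff P)\<^sup>2 = (lead_coeff Q)\<^sup>2"
    using H_tildeD(1)[OF D] by (simp add: lead_coeff_mult lead_coeff_power)
qed

text \<open>P and Q are divided by different numbers, but these have the same square, so the whole
  norm is divided by that square and remains constant.\<close>

lemma const_norm_imp_monic_solution:
  assumes D: "D \<in> H_tilde g" and c: "P\<^sup>2 - D * Q\<^sup>2 = [:c:]" and Q: "Q \<noteq> 0"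
  shows "monic_solution g (degree P) D (smult (1 / lead_coeff P) P) (smult (1 / lead_coeff Q) Q)"
proof -
  note deg = degree_norm_const[OF D c Q]
  have P: "P \<noteq> 0" using deg by auto
  let ?p = "lead_coeff P" and ?q = "lead_coeff Q"
  have "(smult (1/?p) P)\<^sup>2 - D * (smult (1/?q) Q)\<^sup>2 = smult (1/?p\<^sup>2) (P\<^sup>2) - smult (1/?q\<^sup>2) (D * Q\<^sup>2)"
    by (simp add: smult_power power_one_over)
  also have "\<dots> = smult (1/?p\<^sup>2) (P\<^sup>2 - D * Q\<^sup>2)"
    unfolding deg(2)[symmetric] by (simp add: smult_diff_right)
  also have "\<dots> = [:c / ?p\<^sup>2:]" unfolding c by simp
  finally show ?thesis
    unfolding monic_solution_def lead_coeff_smult degree_smult_eq using deg(1) P Q leading_coeff_neq_0[OF P] by simp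
qed

lemma pell_abel_imp_monic_solution:
  assumes D: "D \<in> H_tilde g" and pa: "pell_abel D P Q" "degree P > 0"
  shows "\<exists>P' Q'. monic_solution g (degree P) D P' Q'"
proof -
  have c: "P\<^sup>2 - D * Q\<^sup>2 = [:1:]" using pa by (simp add: pell_abel_def one_pCons)
  have "Q \<noteq> 0"
  proof
    assume "Q = 0"
    then have "degree (P\<^sup>2) = 0" using c by simp
    moreover have "P \<noteq> 0" using pa by auto
    ultimately show False using pa by (simp add: degree_power_eq)
  qed
  from const_norm_imp_monic_solution[OF D c this] show ?thesis by blast
qed

text \<open>Dividing P and Q by a square root of the nonzero constant restores the right-hand side
  1.\<close>

lemma monic_solution_imp_pell_abel:
  assumes D: "D \<in> H_tilde g" and s: "monic_solution g k D P Q"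
  shows "\<exists>P' Q'. pell_abel D P' Q' \<and> degree P' = k"
proof -
  obtain c where c: "c \<noteq> 0" "P\<^sup>2 - D * Q\<^sup>2 = [:c:]" using monic_solution_const[OF assms] .
  define r where "r = csqrt c"
  have r: "r\<^sup>2 = c" "r \<noteq> 0" using c(1) by (auto simp: r_def)
  have "(smult (1/r) P)\<^sup>2 - D * (smult (1/r) Q)\<^sup>2 = smult (1/r\<^sup>2) (P\<^sup>2 - D * Q\<^sup>2)"
    by (simp add: smult_power power_one_over smult_diff_right)
  also have "\<dots> = 1" unfolding c(2) r(1) using c(1) by (simp add: one_pCons)
  finally show ?thesis
    using r s by (intro exI[of _ "smult (1/r) P"] exI[of _ "smult (1/r) Q"]) (simp add: pell_abel_def monic_solution_def)
qed

text \<open>The passage between solutions and their monic forms preserves the degree in both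
  directions, and a monic form always has positive degree; so minimality may be tested on monic
  forms.\<close>

lemma A_tilde_iff:
  assumes "n \<ge> 1"
  shows "D \<in> A_tilde g n \<longleftrightarrow> D \<in> H_tilde g \<and> (\<exists>P Q. monic_solution g n D P Q) \<and>
    (\<forall>k P Q. k < n \<longrightarrow> \<not> monic_solution g k D P Q)"
proof
  assume "D \<in> A_tilde g n"
  then obtain P Q where D: "D \<in> H_tilde g" and p: "primitive_solution D P Q" "degree P = n"
    by (auto simp: A_tilde_def)
  have "\<not> monic_solution g k D P' Q'" if "k < n" for k P' Q'
  proof
    assume s: "monic_solution g k D P' Q'"
    then obtain P'' Q'' where "pell_abel D P'' Q''" "degree P'' = k"
      using monic_solution_imp_pell_abel[OF D s] by blast
    moreover have "k > 0" using s by (auto simp: monic_solution_def)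
    ultimately have "n \<le> k" using p unfolding primitive_solution_def by auto
    then show False using that by simp
  qed
  moreover have "\<exists>P Q. monic_solution g n D P Q"
    using p pell_abel_imp_monic_solution[OF D, of P Q] by (auto simp: primitive_solution_def)
  ultimately show "D \<in> H_tilde g \<and> (\<exists>P Q. monic_solution g n D P Q) \<and>
    (\<forall>k P Q. k < n \<longrightarrow> \<not> monic_solution g k D P Q)" using D by blast
next
  assume A: "D \<in> H_tilde g \<and> (\<exists>P Q. monic_solution g n D P Q) \<and>
    (\<forall>k P Q. k < n \<longrightarrow> \<not> monic_solution g k D P Q)"
  then have D: "D \<in> H_tilde g" by blast
  obtain P Q where p: "pell_abel D P Q" "degree P = n"
    using A monic_solution_imp_pell_abel[OF D] by blast
  have "degree P \<le> degree P'" if "pell_abel D P' Q'" "degree P' > 0" for P' Q'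
    using pell_abel_imp_monic_solution[OF D that] A p(2) by (meson not_le)
  then show "D \<in> A_tilde g n"
    using D p assms by (auto simp: A_tilde_def primitive_solution_def)
qed

text \<open>A common divisor of P and D Q divides P^2 - D Q^2, which is a nonzero constant.\<close>

lemma monic_solution_coprime:
  assumes D: "D \<in> H_tilde g" and s: "monic_solution g n D P Q"
  shows "coprime P (D * Q)"
proof -
  obtain c where c: "c \<noteq> 0" "P\<^sup>2 - D * Q\<^sup>2 = [:c:]" using monic_solution_const[OF assms] .
  show ?thesis
  proof (rule coprimeI)
    fix h assume "h dvd P" "h dvd D * Q"
    then have "h dvd P * P - (D * Q) * Q" by (blast intro: dvd_diff dvd_mult2)
    also have "P * P - (D * Q) * Q = [:c:]" using c(2) by (simp add: power2_eq_square mult.assoc)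
    finally have "h dvd [:c:]" .
    moreover have "is_unit [:c:]" using c(1) by (simp add: is_unit_iff_degree)
    ultimately show "is_unit h" by (rule dvd_trans)
  qed
qed

text \<open>Differentiation gives 2 P P' = Q (D' Q + 2 D Q'). Being coprime to P, Q divides P', with
  a quotient R of degree (n-1) - (n-g-1) = g. R / sqrt D is the logarithmic derivative of P + Q sqrt
  D. Both the linearisation and the limit argument rest on R having fixed degree and leading
  coefficient.\<close>

lemma monic_solution_pderiv:
  assumes D: "D \<in> H_tilde g" and s: "monic_solution g n D P Q"
  obtains R where "pderiv P = Q * R" "2 * P * R = pderiv D * Q + 2 * D * pderiv Q"
    "degree R = g" "lead_coeff R = of_nat n"
proof -
  obtain c where c: "c \<noteq> 0" "P\<^sup>2 - D * Q\<^sup>2 = [:c:]" using monic_solution_const[OF assms] .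
  have n: "g < n" "degree P = n" "lead_coeff P = 1" "degree Q = n - g - 1" "lead_coeff Q = 1"
    using s by (auto simp: monic_solution_def)
  have Q0: "Q \<noteq> 0" using n by auto
  have "pderiv (P\<^sup>2 - D * Q\<^sup>2) = 0" unfolding c(2) by (simp add: pderiv_pCons)
  then have eq: "2 * P * pderiv P = Q * (pderiv D * Q + 2 * D * pderiv Q)"
    by (simp add: power2_eq_square pderiv_diff pderiv_mult algebra_simps)
  have "coprime Q P"
    using monic_solution_coprime[OF D s] by (simp add: coprime_commute)
  have "Q dvd P * (2 * pderiv P)" using eq by (metis dvd_triv_left mult.assoc mult.commute)
  then have "Q dvd 2 * pderiv P" using \<open>coprime Q P\<close> by (simp add: coprime_dvd_mult_right_iff)
  then have "Q dvd smult (1/2) (2 * pderiv P)" by (rule dvd_smult)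
  moreover have "smult (1/2) (2 * pderiv P) = pderiv P"
    by (simp add: poly_eq_iff numeral_poly)
  ultimately obtain R where R: "pderiv P = Q * R" by auto
  have "Q * (2 * P * R) = Q * (pderiv D * Q + 2 * D * pderiv Q)"
    using eq unfolding R by (simp add: algebra_simps)
  then have 2: "2 * P * R = pderiv D * Q + 2 * D * pderiv Q" using Q0 by simp
  have lP: "lead_coeff (pderiv P) = of_nat n" "degree (pderiv P) = n - 1"
    using n by (simp_all add: degree_pderiv coeff_pderiv)
  have "pderiv P \<noteq> 0" using lP n(1) by (metis leading_coeff_0_iff not_less0 of_nat_eq_0_iff)
  then have R0: "R \<noteq> 0" using R by auto
  have "degree Q + degree R = n - 1" using lP(2) unfolding R using Q0 R0 by (simp add: degree_mult_eq)
  then have "degree R = g" using n by simp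
  moreover have "lead_coeff R = of_nat n"
    using lP(1) n unfolding R by (simp add: lead_coeff_mult)
  ultimately show ?thesis using that R 2 by blast
qed

definition dlt :: "complex poly \<Rightarrow> nat \<Rightarrow> bool" where
  "dlt p m \<longleftrightarrow> p = 0 \<or> degree p < m"

lemma dlt_iff_coeff: "dlt p m \<longleftrightarrow> (\<forall>i\<ge>m. coeff p i = 0)"
proof
  assume "dlt p m"
  then show "\<forall>i\<ge>m. coeff p i = 0" by (auto simp: dlt_def coeff_eq_0)
next
  assume c: "\<forall>i\<ge>m. coeff p i = 0"
  show "dlt p m"
  proof (rule ccontr)
    assume "\<not> dlt p m"
    then have "p \<noteq> 0" "degree p \<ge> m" by (auto simp: dlt_def)
    then show False using c leading_coeff_0_iff by blast
  qed
qed

lemma dlt_add: "dlt p m \<Longrightarrow> dlt q m \<Longrightarrow> dlt (p + q) m"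
  and dlt_diff: "dlt p m \<Longrightarrow> dlt q m \<Longrightarrow> dlt (p - q) m"
  and dlt_smult: "dlt p m \<Longrightarrow> dlt (smult c p) m"
  and dlt_minus: "dlt p m \<Longrightarrow> dlt (- p) m"
  by (simp_all add: dlt_iff_coeff)

lemma dlt_mono: "dlt p m \<Longrightarrow> m \<le> m' \<Longrightarrow> dlt p m'"
  by (auto simp: dlt_def)

lemma dlt_mult: "dlt p m \<Longrightarrow> degree q \<le> k \<Longrightarrow> m + k \<le> l \<Longrightarrow> dlt (q * p) l"
  using degree_mult_le[of q p] by (auto simp: dlt_def)

lemma dlt_cancel: "dlt (q * p) (degree q + m) \<Longrightarrow> q \<noteq> 0 \<Longrightarrow> dlt p m"
  by (cases "p = 0") (auto simp: dlt_def degree_mult_eq)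

section \<open>Range and kernel of the linearised equation\<close>

lemma poly_congruence_solve:
  fixes A B Z :: "complex poly"
  assumes "coprime A B" "B \<noteq> 0"
  obtains S X where "dlt S (degree B)" "A * S - Z = B * X"
proof -
  obtain u v where uv: "u * A + v * B = 1"
    using bezout_coefficients_fst_snd[of A B] assms(1) by (metis coprime_imp_gcd_eq_1)
  define S where "S = (u * Z) mod B"
  have "A * S - Z = A * (u * Z - B * (u * Z div B)) - (u * A + v * B) * Z"
    unfolding uv S_def minus_mult_div_eq_mod by simp
  also have "\<dots> = B * (- A * (u * Z div B) - v * Z)" by (simp add: algebra_simps)
  finally show ?thesis
    using that[of S] degree_mod_less[OF assms(2), of "u * Z"] by (auto simp: S_def dlt_def)
qed

text \<open>The equation is solved modulo \<open>Q\<close>, then modulo \<open>G = gcd D Q\<close> and modulo \<open>D / G\<close>. The unknowns suffice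
  since \<open>2 P R = D' Q + 2 D Q'\<close> with \<open>deg R = g\<close> forces \<open>G\<close> to divide \<open>R\<close>, so that \<open>deg G \<le> g\<close>.\<close>

lemma linearization_surjective:
  assumes D: "D \<in> H_tilde g" and s: "monic_solution g n D P Q" and Y: "dlt Y (2 * n)"
  obtains Dd Pd Qd where "dlt Dd (2 * g + 2)" "dlt Pd n" "dlt Qd (n - g - 1)"
    "2 * P * Pd - Dd * Q\<^sup>2 - 2 * D * Q * Qd = Y"
proof -
  note cop = monic_solution_coprime[OF D s]
  have n: "g < n" "degree P = n" "lead_coeff P = 1" "degree Q = n - g - 1" "lead_coeff Q = 1"
    using s by (auto simp: monic_solution_def)
  define m where "m = n - g - 1"
  have m: "degree Q = m" "n = m + g + 1" using n by (auto simp: m_def)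
  have Q0: "Q \<noteq> 0" and P0: "P \<noteq> 0" using n by auto
  have dD: "degree D = 2 * g + 2" and D0: "D \<noteq> 0" using H_tildeD[OF D] by auto
  have two: "coprime (2 * A) B \<longleftrightarrow> coprime A B" for A B :: "complex poly"
  proof -
    have "is_unit (2 :: complex poly)" by (simp add: is_unit_iff_degree numeral_poly)
    then show ?thesis by (simp add: is_unit_left_imp_coprime coprime_mult_left_iff)
  qed
  have d2P: "degree (2 * P) = n" using n by (simp add: numeral_poly)
  \<comment> \<open>Modulo Q the equation only involves the variation of P, and 2 P is invertible
    there. After division by Q the remaining right-hand side has degree below 2 n - m = n + g +
    1.\<close>
  have "coprime (2 * P) Q" unfolding two using cop by simp
  from poly_congruence_solve[OF this Q0] obtain P1 X1 where
    P1: "dlt P1 m" "2 * P * P1 - Y = Q * X1" unfolding m by blast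
  define Y1 where "Y1 = - X1"
  have Y1: "Y = 2 * P * P1 + Q * Y1" using P1(2) by (simp add: Y1_def algebra_simps)
  have "dlt (Q * X1) (degree Q + (n + g + 1))"
    unfolding P1(2)[symmetric] using Y m d2P
    by (intro dlt_diff dlt_mult[OF P1(1)]) (auto intro: dlt_mono)
  then have dY1: "dlt Y1 (n + g + 1)" unfolding Y1_def using dlt_cancel Q0 dlt_minus by blast
  define G where "G = gcd D Q"
  obtain R where R: "2 * P * R = pderiv D * Q + 2 * D * pderiv Q" "degree R = g" "lead_coeff R = of_nat n"
    using monic_solution_pderiv[OF D s] by metis
  have G0: "G \<noteq> 0" using D0 by (simp add: G_def)
  have GD: "G dvd D" and GQ: "G dvd Q" by (auto simp: G_def)
  have copG: "coprime (2 * P) G"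
    unfolding two using cop GQ by (meson coprime_divisors dvd_refl dvd_mult)
  have dG: "degree G \<le> g"
  proof -
    have "G dvd 2 * P * R" unfolding R(1) using GD GQ by (simp add: dvd_mult dvd_mult2)
    then have "G dvd R" using copG by (simp add: coprime_dvd_mult_right_iff coprime_commute)
    moreover have "R \<noteq> 0" using R(3) n(1) by auto
    ultimately show ?thesis using R(2) dvd_imp_degree_le by metis
  qed
  obtain D1 where D1: "D = G * D1" using GD by blast
  obtain Q1 where Q1: "Q = G * Q1" using GQ by blast
  have D10: "D1 \<noteq> 0" and Q10: "Q1 \<noteq> 0" using D0 Q0 D1 Q1 by auto
  have dD1: "degree G + degree D1 = 2 * g + 2" using dD unfolding D1 using G0 D10 by (simp add: degree_mult_eq)
  have dQ1: "degree G + degree Q1 = m" using m(1) unfolding Q1 using G0 Q10 by (simp add: degree_mult_eq)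
  from poly_congruence_solve[OF copG G0] obtain S X2 where
    S: "dlt S (degree G)" "2 * P * S - Y1 = G * X2" by blast
  define W where "W = - X2"
  have W: "Y1 = 2 * P * S + G * W" using S(2) by (simp add: W_def algebra_simps)
  have "dlt (G * X2) (degree G + (n + g + 1 - degree G))"
    unfolding S(2)[symmetric] using dY1 dG d2P
    by (intro dlt_diff dlt_mult[OF S(1)]) (auto intro: dlt_mono)
  then have dW: "dlt W (n + g + 1 - degree G)" unfolding W_def using dlt_cancel G0 dlt_minus by blast
  \<comment> \<open>A common factor h of D / G and Q / G divides G as well, so h * h divides D,
    against square-freeness.\<close>
  have "coprime Q1 D1"
  proof (rule coprimeI)
    fix h assume h: "h dvd Q1" "h dvd D1"
    then have "h dvd G" unfolding G_def by (metis D1 Q1 dvd_mult gcd_greatest)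
    then have "h * h dvd D" unfolding D1 using h(2) by (rule mult_dvd_mono)
    then show "is_unit h" using rsquarefree_no_square H_tildeD(3)[OF D] by blast
  qed
  \<comment> \<open>What is left reads Q1 * Dd = - W modulo D1. The quotient X supplies the
    variation of Q, up to the factor -1/2.\<close>
  from poly_congruence_solve[OF this D10, of "- W"] obtain Dd X where
    Dd: "dlt Dd (degree D1)" "Q1 * Dd + W = D1 * X" by (metis diff_minus_eq_add)
  have "dlt (D1 * X) (degree D1 + m)"
    unfolding Dd(2)[symmetric] using dD1 dQ1 m dG
    by (intro dlt_add dlt_mult[OF Dd(1)] dlt_mono[OF dW]) auto
  then have dX: "dlt X m" using dlt_cancel D10 by blast
  have "Y = 2 * P * (P1 + Q * S) - Dd * Q\<^sup>2 - 2 * D * Q * smult (-1/2) X"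
  proof -
    have W': "W = D1 * X - Q1 * Dd" using Dd(2) by (simp add: algebra_simps)
    have "2 * smult (-1/2) X = - X" by (simp add: poly_eq_iff numeral_poly)
    then have h: "2 * D * Q * smult (-1/2) X = - (D * Q * X)"
      by (metis (no_types, lifting) mult.assoc mult.commute mult_minus_right)
    have "Y = 2 * P * (P1 + Q * S) + Q * (G * D1 * X - G * Q1 * Dd)"
      unfolding Y1 W W' by (simp add: algebra_simps)
    also have "\<dots> = 2 * P * (P1 + Q * S) + Q * (D * X - Q * Dd)"
      unfolding D1[symmetric] Q1[symmetric] by simp
    finally show ?thesis unfolding h by (simp add: algebra_simps power2_eq_square)
  qed
  moreover have "dlt (P1 + Q * S) n"
    using P1(1) m dG by (intro dlt_add dlt_mult[OF S(1)]) (auto intro: dlt_mono)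
  moreover have "dlt Dd (2 * g + 2)" using Dd(1) dD1 by (auto intro: dlt_mono)
  ultimately show ?thesis
    using that dlt_smult[OF dX] unfolding m_def by metis
qed

text \<open>Infinitesimal uniqueness: for fixed D the solution cannot move. Eliminating the constant
  e between the linearised equation and the equation itself leaves P A = D Q B. So D Q, of degree n
  + g + 1, divides A, of degree at most n, and A = 0.\<close>

lemma linearization_kernel:
  assumes D: "D \<in> H_tilde g" and s: "monic_solution g n D P Q"
    and d: "dlt Pd n" "dlt Qd (n - g - 1)"
    and E: "2 * P * Pd - 2 * D * Q * Qd = [:e:]"
  shows "Pd = 0" "Qd = 0"
proof -
  obtain c where c: "c \<noteq> 0" "P\<^sup>2 - D * Q\<^sup>2 = [:c:]" using monic_solution_const[OF D s] .
  note cop = monic_solution_coprime[OF D s]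
  have n: "g < n" "degree P = n" "lead_coeff P = 1" "degree Q = n - g - 1" "lead_coeff Q = 1"
    using s by (auto simp: monic_solution_def)
  have Q0: "Q \<noteq> 0" using n by auto
  have dD: "degree D = 2 * g + 2" and D0: "D \<noteq> 0" using H_tildeD[OF D] by auto
  define A where "A = smult c (2 * Pd) - smult e P"
  define B where "B = smult c (2 * Qd) - smult e Q"
  have "P * A - D * Q * B = smult c (2 * P * Pd - 2 * D * Q * Qd) - smult e (P\<^sup>2 - D * Q\<^sup>2)"
    by (simp add: A_def B_def algebra_simps power2_eq_square smult_diff_right)
  also have "\<dots> = 0" unfolding E c(2) by simp
  finally have PA: "P * A = D * Q * B" by simp
  then have "D * Q dvd P * A" by simp
  then have dvdA: "D * Q dvd A"
    using cop by (simp add: coprime_dvd_mult_right_iff coprime_commute)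
  have "A = 0"
  proof (rule ccontr)
    assume "A \<noteq> 0"
    then have "degree (D * Q) \<le> degree A" using dvdA dvd_imp_degree_le by blast
    moreover have "degree A \<le> n"
    proof -
      have "dlt A (Suc n)" unfolding A_def using d(1) n(2)
        by (intro dlt_diff dlt_smult) (auto simp: dlt_iff_coeff coeff_eq_0 numeral_poly)
      then show ?thesis by (auto simp: dlt_def)
    qed
    ultimately show False using D0 Q0 dD n by (simp add: degree_mult_eq)
  qed
  \<comment> \<open>The variation of P has degree below n and P is monic, so the coefficient of
    degree n isolates e.\<close>
  moreover have "coeff A n = - e"
    using d(1) n(2,3) by (simp add: A_def dlt_iff_coeff numeral_poly)
  ultimately have "e = 0" by simp
  then show "Pd = 0" using \<open>A = 0\<close> c(1) by (simp add: A_def)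
  then have "D * Q * Qd = 0" using E \<open>e = 0\<close> by (simp add: mult.assoc)
  then show "Qd = 0" using D0 Q0 by simp
qed

text \<open>The product (P Q' - P' Q) (P Q' + P' Q) is a combination of the squares of Q and Q', of
  degree at most 2 m with m = n - g - 1. Since all four polynomials are monic, nothing cancels in
  the second factor: its degree is n + m > 2 m. Hence the first factor is 0, and coprimality does
  the rest.\<close>

lemma monic_solution_unique:
  assumes D: "D \<in> H_tilde g" and s: "monic_solution g n D P Q" and s': "monic_solution g n D P' Q'"
  shows "P = P'" "Q = Q'"
proof -
  obtain c where c: "P\<^sup>2 - D * Q\<^sup>2 = [:c:]" using monic_solution_const[OF D s] .
  obtain c' where c': "P'\<^sup>2 - D * Q'\<^sup>2 = [:c':]" using monic_solution_const[OF D s'] .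
  have n: "g < n" "degree P = n" "lead_coeff P = 1" "degree Q = n - g - 1" "lead_coeff Q = 1"
    and n': "degree P' = n" "lead_coeff P' = 1" "degree Q' = n - g - 1" "lead_coeff Q' = 1"
    using s s' by (auto simp: monic_solution_def)
  define m where "m = n - g - 1"
  have m: "degree Q = m" "degree Q' = m" "m < n" using n n' by (auto simp: m_def)
  have nz: "P \<noteq> 0" "Q \<noteq> 0" "P' \<noteq> 0" "Q' \<noteq> 0" using n n' by auto
  have "(P * Q' - P' * Q) * (P * Q' + P' * Q) = P\<^sup>2 * Q'\<^sup>2 - P'\<^sup>2 * Q\<^sup>2"
    by (simp add: algebra_simps power2_eq_square)
  also have "\<dots> = (D * Q\<^sup>2 + [:c:]) * Q'\<^sup>2 - (D * Q'\<^sup>2 + [:c':]) * Q\<^sup>2"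
    using c c' by (simp add: algebra_simps)
  also have "\<dots> = smult c (Q'\<^sup>2) - smult c' (Q\<^sup>2)" by (simp add: algebra_simps)
  finally have eq: "(P * Q' - P' * Q) * (P * Q' + P' * Q) = smult c (Q'\<^sup>2) - smult c' (Q\<^sup>2)" .
  have small: "degree (smult c (Q'\<^sup>2) - smult c' (Q\<^sup>2)) \<le> 2 * m"
    using m by (intro degree_diff_le order.trans[OF degree_smult_le]) (auto simp: degree_power_eq nz)
  have lead: "coeff (P * Q' + P' * Q) (n + m) = 2"
    using coeff_mult_degree_sum[of P Q'] coeff_mult_degree_sum[of P' Q] n n' m by simp
  have ge: "degree (P * Q' + P' * Q) \<ge> n + m" by (rule le_degree) (use lead in simp)
  have ne: "P * Q' + P' * Q \<noteq> 0" using lead by (metis coeff_0 zero_neq_numeral)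
  have "P * Q' - P' * Q = 0"
  proof (rule ccontr)
    assume "P * Q' - P' * Q \<noteq> 0"
    then have "degree ((P * Q' - P' * Q) * (P * Q' + P' * Q)) \<ge> n + m"
      using degree_mult_eq[OF _ ne] ge by simp
    then show False using small m(3) unfolding eq by simp
  qed
  then have PQ: "P * Q' = P' * Q" by simp
  have "coprime Q P" "coprime Q' P'"
    using monic_solution_coprime[OF D s] monic_solution_coprime[OF D s'] by (simp_all add: coprime_commute)
  then have "Q dvd Q'" "Q' dvd Q"
    using PQ by (metis coprime_dvd_mult_right_iff dvd_triv_right)+
  then obtain w where w: "Q' = Q * w" by blast
  then have "w \<noteq> 0" "degree w = 0" using nz m by (auto simp: degree_mult_eq)
  moreover have "lead_coeff w = 1" using n(5) n'(4) unfolding w by (simp add: lead_coeff_mult)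
  ultimately have "w = 1" by (metis degree_eq_zeroE lead_coeff_pCons(2) one_pCons)
  then show "Q = Q'" using w by simp
  then show "P = P'" using PQ nz by simp
qed

section \<open>Limits of solutions\<close>

definition pconv :: "(nat \<Rightarrow> complex poly) \<Rightarrow> complex poly \<Rightarrow> bool" where
  "pconv p q \<longleftrightarrow> (\<forall>i. (\<lambda>j. coeff (p j) i) \<longlonglongrightarrow> coeff q i)"

lemma pconv_mult: "pconv p q \<Longrightarrow> pconv p' q' \<Longrightarrow> pconv (\<lambda>j. p j * p' j) (q * q')"
  unfolding pconv_def coeff_mult by (intro allI tendsto_sum tendsto_mult) auto

lemma pconv_add: "pconv p q \<Longrightarrow> pconv p' q' \<Longrightarrow> pconv (\<lambda>j. p j + p' j) (q + q')"
  unfolding pconv_def coeff_add by (intro allI tendsto_add) auto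

lemma pconv_diff: "pconv p q \<Longrightarrow> pconv p' q' \<Longrightarrow> pconv (\<lambda>j. p j - p' j) (q - q')"
  unfolding pconv_def coeff_diff by (intro allI tendsto_diff) auto

lemma pconv_pderiv: "pconv p q \<Longrightarrow> pconv (\<lambda>j. pderiv (p j)) (pderiv q)"
  unfolding pconv_def coeff_pderiv by (intro allI tendsto_mult tendsto_const) auto

lemma pconv_const: "pconv (\<lambda>j. p) p"
  by (simp add: pconv_def)

lemma pconv_subseq: "pconv p q \<Longrightarrow> strict_mono \<sigma> \<Longrightarrow> pconv (\<lambda>j. p (\<sigma> j)) q"
  unfolding pconv_def using LIMSEQ_subseq_LIMSEQ[of _ _ \<sigma>] by (auto simp: o_def)

text \<open>Sequential compactness of a box of coefficient sequences; the degree bound is encoded by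
  factors {0} beyond n.\<close>

lemma pconv_extract:
  assumes "\<And>j i. cmod (coeff (p j) i) \<le> 1" "\<And>j. degree (p j) \<le> n"
  obtains \<sigma> q where "strict_mono (\<sigma> :: nat \<Rightarrow> nat)" "degree q \<le> n" "pconv (\<lambda>j. p (\<sigma> j)) q"
proof -
  define bx where "bx = {f::cvec. \<forall>i. f i \<in> (if i \<le> n then cball 0 1 else {0})}"
  have "compact bx" unfolding bx_def by (rule compact_product_box) auto
  then have "seq_compact bx" by (rule compact_imp_seq_compact)
  moreover have "coeff (p j) \<in> bx" for j
    using assms(1)[of j] assms(2)[of j] by (auto simp: bx_def coeff_eq_0)
  ultimately obtain l \<sigma> where l: "l \<in> bx" "strict_mono (\<sigma> :: nat \<Rightarrow> nat)" "((\<lambda>j. coeff (p j)) \<circ> \<sigma>) \<longlonglongrightarrow> l"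
    using seq_compactE[of bx "\<lambda>j. coeff (p j)"] by blast
  have l0: "l i = 0" if "n < i" for i
  proof -
    have "l i \<in> (if i \<le> n then cball 0 1 else {0})" using l(1) unfolding bx_def by blast
    then show ?thesis using that by simp
  qed
  define q where "q = (\<Sum>i\<le>n. monom (l i) i)"
  have q: "coeff q i = l i" for i
    using l0[of i] by (auto simp: q_def coeff_sum)
  have "degree q \<le> n"
    using l0 by (intro degree_le) (auto simp: q)
  moreover have "pconv (\<lambda>j. p (\<sigma> j)) q"
    unfolding pconv_def q using filterlim_compose[OF tendsto_coord l(3)] by (simp add: o_def)
  ultimately show ?thesis using that l(2) by blast
qed

definition csum :: "nat \<Rightarrow> complex poly \<Rightarrow> real" where
  "csum n p = (\<Sum>i\<le>n. cmod (coeff p i))"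

lemma coeff_le_csum: "degree p \<le> n \<Longrightarrow> cmod (coeff p i) \<le> csum n p"
  unfolding csum_def by (cases "i \<le> n") (auto intro: member_le_sum simp: coeff_eq_0 sum_nonneg)

lemma csum_nonneg: "0 \<le> csum n p"
  by (simp add: csum_def sum_nonneg)

lemma csum_smult: "csum n (smult c p) = cmod c * csum n p"
  by (simp add: csum_def norm_mult sum_distrib_left)

lemma csum_pconv: "pconv p q \<Longrightarrow> (\<lambda>j. csum n (p j)) \<longlonglongrightarrow> csum n q"
  unfolding pconv_def csum_def by (intro tendsto_sum tendsto_norm) auto

lemma csum_zero [simp]: "csum n 0 = 0"
  by (simp add: csum_def)

text \<open>After normalisation the solutions have a convergent subsequence. The limit has a non-zero second
  component because of the relation \<open>2 P R = D' Q + 2 D Q'\<close>, in which \<open>R\<close> cannot tend to zero: this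
  prevents the solutions from degenerating to the trivial one.\<close>

lemma monic_solution_limit:
  assumes D: "D \<in> H_tilde g" and Dj: "\<And>j. Ds j \<in> H_tilde g" and conv: "pconv Ds D"
    and s: "\<And>j. monic_solution g k (Ds j) (P j) (Q j)"
  obtains \<sigma> P' Q' k' where "strict_mono (\<sigma> :: nat \<Rightarrow> nat)" "k' \<le> k" "monic_solution g k' D P' Q'"
    "k' = k \<longrightarrow> pconv (\<lambda>j. P (\<sigma> j)) P' \<and> pconv (\<lambda>j. Q (\<sigma> j)) Q'"
proof -
  have n: "g < k" "degree (P j) = k" "coeff (P j) k = 1" "degree (Q j) = k - g - 1" "coeff (Q j) (k - g - 1) = 1" for j
    using s[of j] by (auto simp: monic_solution_def)
  have "\<exists>R. 2 * P j * R = pderiv (Ds j) * Q j + 2 * Ds j * pderiv (Q j) \<and> degree R = g \<and> lead_coeff R = of_nat k" for j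
    using monic_solution_pderiv[OF Dj s] by metis
  then obtain R where R: "\<And>j. 2 * P j * R j = pderiv (Ds j) * Q j + 2 * Ds j * pderiv (Q j)"
    "\<And>j. degree (R j) = g" "\<And>j. lead_coeff (R j) = of_nat k" by metis
  \<comment> \<open>P and Q are scaled by a common factor, which keeps P^2 - D Q^2 constant, and R
    by a factor of its own. In the limit P' and Q' are then not both zero, and R' is not
    zero.\<close>
  define \<alpha> where "\<alpha> j = csum k (P j) + csum k (Q j)" for j
  define \<rho> where "\<rho> j = csum g (R j)" for j
  have l1: "\<alpha> j \<ge> 1" for j
    using coeff_le_csum[of "P j" k k] n(2,3)[of j] csum_nonneg[of k "Q j"] by (simp add: \<alpha>_def)
  have r1: "\<rho> j \<ge> 1" for j
    using coeff_le_csum[of "R j" g g] R(2,3)[of j] n(1) by (simp add: \<rho>_def)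
  define sP where "sP j = smult (of_real (1 / \<alpha> j)) (P j)" for j
  define sQ where "sQ j = smult (of_real (1 / \<alpha> j)) (Q j)" for j
  define sR where "sR j = smult (of_real (1 / \<rho> j)) (R j)" for j
  have bP: "cmod (coeff (sP j) i) \<le> 1" "cmod (coeff (sQ j) i) \<le> 1" "cmod (coeff (sR j) i) \<le> 1" for j i
  proof -
    have "cmod (coeff (P j) i) \<le> \<alpha> j" "cmod (coeff (Q j) i) \<le> \<alpha> j" "cmod (coeff (R j) i) \<le> \<rho> j"
      using coeff_le_csum[of "P j" k i] coeff_le_csum[of "Q j" k i] coeff_le_csum[of "R j" g i] n(2,4)[of j] R(2)[of j]
        csum_nonneg[of k "P j"] csum_nonneg[of k "Q j"] by (simp_all add: \<alpha>_def \<rho>_def)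
    then show "cmod (coeff (sP j) i) \<le> 1" "cmod (coeff (sQ j) i) \<le> 1" "cmod (coeff (sR j) i) \<le> 1"
      using l1[of j] r1[of j] by (simp_all add: sP_def sQ_def sR_def norm_mult norm_divide)
  qed
  have dP: "degree (sP j) \<le> k" "degree (sQ j) \<le> k" "degree (sR j) \<le> g" for j
    using n(2,4)[of j] R(2)[of j] by (auto simp: sP_def sQ_def sR_def)
  obtain \<sigma>1 P' where 1: "strict_mono \<sigma>1" "degree P' \<le> k" "pconv (\<lambda>j. sP (\<sigma>1 j)) P'"
    by (rule pconv_extract[of sP k, OF bP(1) dP(1)])
  obtain \<sigma>2 Q' where 2: "strict_mono \<sigma>2" "degree Q' \<le> k" "pconv (\<lambda>j. sQ (\<sigma>1 (\<sigma>2 j))) Q'"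
    by (rule pconv_extract[of "\<lambda>j. sQ (\<sigma>1 j)" k, OF bP(2) dP(2)])
  obtain \<sigma>3 R' where 3: "strict_mono \<sigma>3" "pconv (\<lambda>j. sR (\<sigma>1 (\<sigma>2 (\<sigma>3 j)))) R'"
    by (rule pconv_extract[of "\<lambda>j. sR (\<sigma>1 (\<sigma>2 j))" g, OF bP(3) dP(3)])
  define \<sigma> where "\<sigma> j = \<sigma>1 (\<sigma>2 (\<sigma>3 j))" for j
  have sm: "strict_mono \<sigma>"
    using 1(1) 2(1) 3(1) unfolding \<sigma>_def strict_mono_def by blast
  have cP: "pconv (\<lambda>j. sP (\<sigma> j)) P'" and cQ: "pconv (\<lambda>j. sQ (\<sigma> j)) Q'" and cR: "pconv (\<lambda>j. sR (\<sigma> j)) R'"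
    using pconv_subseq[OF pconv_subseq[OF 1(3) 2(1)] 3(1)] pconv_subseq[OF 2(3) 3(1)] 3(2)
    by (simp_all add: \<sigma>_def)
  have cD: "pconv (\<lambda>j. Ds (\<sigma> j)) D" using pconv_subseq[OF conv sm] .
  have "csum k P' + csum k Q' = 1"
  proof -
    have "(\<lambda>j. csum k (sP (\<sigma> j)) + csum k (sQ (\<sigma> j))) \<longlonglongrightarrow> csum k P' + csum k Q'"
      by (intro tendsto_add csum_pconv cP cQ)
    moreover have "csum k (sP j) + csum k (sQ j) = 1" for j
    proof -
      have "csum k (sP j) + csum k (sQ j) = 1 / \<alpha> j * \<alpha> j"
      proof -
        have "cmod (of_real (1 / \<alpha> j)) = 1 / \<alpha> j" using l1[of j] by (simp add: norm_divide)
        then show ?thesis unfolding sP_def sQ_def csum_smult by (simp only: distrib_left[symmetric] \<alpha>_def)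
      qed
      then show ?thesis using l1[of j] by simp
    qed
    ultimately show ?thesis by (simp add: LIMSEQ_const_iff)
  qed
  then have PQ: "P' \<noteq> 0 \<or> Q' \<noteq> 0" by auto
  have R0: "R' \<noteq> 0"
  proof -
    have "csum g (sR j) = 1" for j
      unfolding sR_def csum_smult using r1[of j] by (simp add: \<rho>_def norm_divide)
    then have "csum g R' = 1"
      using csum_pconv[OF cR, of g] by (simp add: LIMSEQ_const_iff)
    then show ?thesis by auto
  qed
  have "coeff (P'\<^sup>2 - D * Q'\<^sup>2) i = 0" if "i > 0" for i
  proof -
    have "pconv (\<lambda>j. (sP (\<sigma> j))\<^sup>2 - Ds (\<sigma> j) * (sQ (\<sigma> j))\<^sup>2) (P'\<^sup>2 - D * Q'\<^sup>2)"
      unfolding power2_eq_square by (intro pconv_diff pconv_mult cP cQ cD)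
    then have "(\<lambda>j. coeff ((sP (\<sigma> j))\<^sup>2 - Ds (\<sigma> j) * (sQ (\<sigma> j))\<^sup>2) i) \<longlonglongrightarrow> coeff (P'\<^sup>2 - D * Q'\<^sup>2) i"
      by (simp only: pconv_def)
    moreover have "coeff ((sP j)\<^sup>2 - Ds j * (sQ j)\<^sup>2) i = 0" for j
    proof -
      have "(sP j)\<^sup>2 - Ds j * (sQ j)\<^sup>2 = smult ((of_real (1 / \<alpha> j))\<^sup>2) ((P j)\<^sup>2 - Ds j * (Q j)\<^sup>2)"
        by (simp add: sP_def sQ_def smult_power smult_diff_right)
      moreover have "coeff ((P j)\<^sup>2 - Ds j * (Q j)\<^sup>2) i = 0"
        using s[of j] that by (intro coeff_eq_0) (auto simp: monic_solution_def)
      ultimately show ?thesis by simp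
    qed
    ultimately have "(\<lambda>j. 0) \<longlonglongrightarrow> coeff (P'\<^sup>2 - D * Q'\<^sup>2) i"
      by (simp only:)
    then show ?thesis by (simp only: LIMSEQ_const_iff)
  qed
  then have "degree (P'\<^sup>2 - D * Q'\<^sup>2) = 0" by (metis le_degree leading_coeff_0_iff degree_0 gr0I)
  then obtain c where c: "P'\<^sup>2 - D * Q'\<^sup>2 = [:c:]" using degree_eq_zeroE by blast
  have Q0: "Q' \<noteq> 0"
  proof
    \<comment> \<open>The scaled right-hand side D' Q + 2 D Q' would tend to 0, hence 2 P' R' = 0 in
      the limit. As R' is nonzero, P' would vanish too, against the joint normalisation.\<close>
    assume Q': "Q' = 0"
    have "pconv (\<lambda>j. pderiv (Ds (\<sigma> j)) * sQ (\<sigma> j) + 2 * Ds (\<sigma> j) * pderiv (sQ (\<sigma> j))) (pderiv D * Q' + 2 * D * pderiv Q')"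
      by (intro pconv_add pconv_mult pconv_pderiv pconv_const cD cQ)
    then have rhs: "pconv (\<lambda>j. pderiv (Ds (\<sigma> j)) * sQ (\<sigma> j) + 2 * Ds (\<sigma> j) * pderiv (sQ (\<sigma> j))) 0"
      using Q' by simp
    have lhs: "pconv (\<lambda>j. 2 * sP (\<sigma> j) * sR (\<sigma> j)) (2 * P' * R')"
      by (intro pconv_mult pconv_const cP cR)
    have "coeff (2 * P' * R') i = 0" for i
    proof -
      have sPR: "2 * sP j * sR j = smult (of_real (1 / \<rho> j)) (pderiv (Ds j) * sQ j + 2 * Ds j * pderiv (sQ j))" for j
      proof -
        have "2 * sP j * sR j = smult (of_real (1 / \<rho> j)) (smult (of_real (1 / \<alpha> j)) (2 * P j * R j))"
          by (simp add: sP_def sR_def mult.commute)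
        then show ?thesis unfolding R(1) sQ_def by (simp add: smult_add_right pderiv_smult)
      qed
      \<comment> \<open>Scaling R contributes the extra factor 1 / \<rho> j, which is at most 1: the
        leading coefficient of R j is k, and k \<ge> 1.\<close>
      then have le: "cmod (coeff (2 * sP j * sR j) i) \<le> cmod (coeff (pderiv (Ds j) * sQ j + 2 * Ds j * pderiv (sQ j)) i)" for j
      proof -
        have "x / \<rho> j \<le> x" if "x \<ge> 0" for x
          using r1[of j] that by (simp add: pos_divide_le_eq mult_le_cancel_left1)
        then show ?thesis
          unfolding sPR coeff_smult norm_mult using r1[of j] by (simp add: norm_divide)
      qed
      have "(\<lambda>j. coeff (pderiv (Ds (\<sigma> j)) * sQ (\<sigma> j) + 2 * Ds (\<sigma> j) * pderiv (sQ (\<sigma> j))) i) \<longlonglongrightarrow> 0"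
        using rhs by (simp only: pconv_def coeff_0)
      from tendsto_norm_zero[OF this]
      have 0: "(\<lambda>j. coeff (2 * sP (\<sigma> j) * sR (\<sigma> j)) i) \<longlonglongrightarrow> 0"
      proof (rule Lim_null_comparison[rotated])
        show "\<forall>\<^sub>F j in sequentially. norm (coeff (2 * sP (\<sigma> j) * sR (\<sigma> j)) i) \<le>
            norm (coeff (pderiv (Ds (\<sigma> j)) * sQ (\<sigma> j) + 2 * Ds (\<sigma> j) * pderiv (sQ (\<sigma> j))) i)"
          by (intro always_eventually allI le)
      qed
      have "(\<lambda>j. coeff (2 * sP (\<sigma> j) * sR (\<sigma> j)) i) \<longlonglongrightarrow> coeff (2 * P' * R') i"
        using lhs by (simp only: pconv_def)
      from LIMSEQ_unique[OF this 0] show ?thesis .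
    qed
    then have "2 * P' * R' = 0" by (simp add: poly_eq_iff)
    then have "P' = 0" using R0 by (simp add: numeral_poly)
    then show False using PQ Q' by simp
  qed
  define p where "p = lead_coeff P'"
  define q where "q = lead_coeff Q'"
  have sol: "monic_solution g (degree P') D (smult (1 / p) P') (smult (1 / q) Q')"
    using const_norm_imp_monic_solution[OF D c Q0] by (simp add: p_def q_def)
  have "q \<noteq> 0" using Q0 by (simp add: q_def)
  have "P' \<noteq> 0" using degree_norm_const(1)[OF D c Q0] by auto
  then have "p \<noteq> 0" by (simp add: p_def)
  have dQ: "degree Q' = degree P' - g - 1" using degree_norm_const(1)[OF D c Q0] by simp
  \<comment> \<open>If the degree does not drop, the limit of the scaled leading coefficients is
    nonzero, and dividing by them undoes the unknown scaling.\<close>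
  have pc: "pconv (\<lambda>j. P (\<sigma> j)) (smult (1 / p) P')" if "degree P' = k"
    unfolding pconv_def
  proof
    fix i
    have "(\<lambda>j. coeff (sP (\<sigma> j)) i / coeff (sP (\<sigma> j)) k) \<longlonglongrightarrow> coeff P' i / coeff P' k"
      using cP \<open>p \<noteq> 0\<close> that unfolding pconv_def p_def by (intro tendsto_divide) auto
    moreover have "coeff (sP j) i / coeff (sP j) k = coeff (P j) i" for j
      using n(3)[of j] l1[of j] by (simp add: sP_def)
    ultimately show "(\<lambda>j. coeff (P (\<sigma> j)) i) \<longlonglongrightarrow> coeff (smult (1 / p) P') i"
      using that by (simp add: p_def)
  qed
  have qc: "pconv (\<lambda>j. Q (\<sigma> j)) (smult (1 / q) Q')" if "degree P' = k"
    unfolding pconv_def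
  proof
    fix i
    have "(\<lambda>j. coeff (sQ (\<sigma> j)) i / coeff (sQ (\<sigma> j)) (k - g - 1)) \<longlonglongrightarrow> coeff Q' i / coeff Q' (k - g - 1)"
      using cQ \<open>q \<noteq> 0\<close> that dQ unfolding pconv_def q_def by (intro tendsto_divide) auto
    moreover have "coeff (sQ j) i / coeff (sQ j) (k - g - 1) = coeff (Q j) i" for j
      using n(5)[of j] l1[of j] by (simp add: sQ_def)
    ultimately show "(\<lambda>j. coeff (Q (\<sigma> j)) i) \<longlonglongrightarrow> coeff (smult (1 / q) Q') i"
      using that dQ by (simp add: q_def)
  qed
  show ?thesis by (rule that[OF sm 1(2) sol]) (simp add: pc qc)
qed

section \<open>Square-freeness is an open condition\<close>

lemma poly_eq_sum_coeff: "degree p \<le> n \<Longrightarrow> poly p x = (\<Sum>i\<le>n. coeff p i * x ^ i)" for x :: complex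
proof -
  assume "degree p \<le> n"
  have "poly p x = (\<Sum>i\<le>degree p. coeff p i * x ^ i)" by (rule poly_altdef)
  also have "\<dots> = (\<Sum>i\<le>n. coeff p i * x ^ i)"
    using \<open>degree p \<le> n\<close> by (intro sum.mono_neutral_left) (auto simp: coeff_eq_0)
  finally show ?thesis .
qed

lemma pconv_poly:
  assumes "pconv p q" "\<And>j. degree (p j) \<le> n" "degree q \<le> n" "x \<longlonglongrightarrow> y"
  shows "(\<lambda>j. poly (p j) (x j)) \<longlonglongrightarrow> poly q y"
  unfolding poly_eq_sum_coeff[OF assms(2)] poly_eq_sum_coeff[OF assms(3)]
  using assms(1,4) unfolding pconv_def by (intro tendsto_intros) auto

text \<open>A Cauchy bound: outside the unit disc every lower term is at most its coefficient times
  |r|^(n-1), so |r| is at most the sum of these coefficients. It keeps multiple roots of a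
  convergent sequence of polynomials bounded.\<close>

lemma monic_root_bound:
  assumes "lead_coeff p = 1" "poly p r = 0"
  shows "cmod r \<le> 1 + csum (degree p) p"
proof (cases "cmod r \<le> 1")
  case True
  then show ?thesis using csum_nonneg[of "degree p" p] by simp
next
  case False
  define n where "n = degree p"
  have "n > 0"
  proof (rule ccontr)
    assume "\<not> n > 0"
    then have "p = [:1:]" using assms(1) by (metis degree_eq_zeroE lead_coeff_pCons(2) n_def neq0_conv)
    then show False using assms(2) by simp
  qed
  have "0 = (\<Sum>i\<le>n. coeff p i * r ^ i)" using assms(2) by (simp add: poly_altdef n_def)
  also have "\<dots> = (\<Sum>i<n. coeff p i * r ^ i) + r ^ n"
    using assms(1) by (simp add: lessThan_Suc_atMost[symmetric] n_def)
  finally have e: "cmod (r ^ n) = cmod (\<Sum>i<n. coeff p i * r ^ i)"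
    by (metis add_eq_0_iff norm_minus_cancel)
  have pw: "cmod (r ^ n) = cmod r * cmod r ^ (n - 1)"
    using \<open>n > 0\<close> by (cases n) (simp_all add: norm_mult norm_power)
  have "cmod r * cmod r ^ (n - 1) = cmod (\<Sum>i<n. coeff p i * r ^ i)"
    using e pw by (simp only:)
  also have "\<dots> \<le> (\<Sum>i<n. cmod (coeff p i) * cmod r ^ (n - 1))"
  proof (rule sum_norm_le)
    fix i assume "i \<in> {..<n}"
    then have "cmod r ^ i \<le> cmod r ^ (n - 1)" using False by (intro power_increasing) auto
    then show "cmod (coeff p i * r ^ i) \<le> cmod (coeff p i) * cmod r ^ (n - 1)"
      by (simp add: norm_mult norm_power mult_left_mono)
  qed
  also have "\<dots> \<le> csum n p * cmod r ^ (n - 1)"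
    unfolding csum_def sum_distrib_right[symmetric]
    by (intro mult_right_mono sum_mono2) auto
  finally have "cmod r * cmod r ^ (n - 1) \<le> csum n p * cmod r ^ (n - 1)"
    .
  moreover have "cmod r ^ (n - 1) > 0" using False by (intro zero_less_power) linarith
  ultimately have "cmod r \<le> csum n p" by (rule mult_right_le_imp_le)
  then show ?thesis by (simp add: n_def)
qed

text \<open>Multiple roots of the approximating polynomials stay bounded, and any accumulation point
  of them is a multiple root of the limit.\<close>

lemma H_tilde_limit:
  assumes conv: "pconv Ds D" and Dj: "\<And>j. lead_coeff (Ds j) = 1" "\<And>j. degree (Ds j) = 2 * g + 2"
    and nH: "\<And>j. Ds j \<notin> H_tilde g" and D: "degree D = 2 * g + 2"
  shows "D \<notin> H_tilde g"
proof
  assume H: "D \<in> H_tilde g"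
  have "\<exists>r. poly (Ds j) r = 0 \<and> poly (pderiv (Ds j)) r = 0" for j
    using nH[of j] Dj[of j] unfolding H_tilde_def rsquarefree_roots by blast
  then have "\<forall>j. \<exists>r. poly (Ds j) r = 0 \<and> poly (pderiv (Ds j)) r = 0" by blast
  from choice[OF this] obtain r where r: "\<And>j. poly (Ds j) (r j) = 0" "\<And>j. poly (pderiv (Ds j)) (r j) = 0"
    by blast
  have "(\<lambda>j. csum (2 * g + 2) (Ds j)) \<longlonglongrightarrow> csum (2 * g + 2) D" by (rule csum_pconv[OF conv])
  then have "Bseq (\<lambda>j. csum (2 * g + 2) (Ds j))"
    using convergentI convergent_imp_Bseq by blast
  then obtain B where "\<forall>j. norm (csum (2 * g + 2) (Ds j)) \<le> B" by (rule BseqE)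
  then have B: "\<bar>csum (2 * g + 2) (Ds j)\<bar> \<le> B" for j by simp
  have "cmod (r j) \<le> 1 + B" for j
    using monic_root_bound[OF Dj(1) r(1), of j] B[of j] Dj(2)[of j] by simp
  then have "bounded (range r)" unfolding bounded_iff by blast
  then obtain l \<sigma> where l: "strict_mono (\<sigma> :: nat \<Rightarrow> nat)" "(r \<circ> \<sigma>) \<longlonglongrightarrow> l"
    using bounded_imp_convergent_subsequence[of r] by blast
  have c: "pconv (\<lambda>j. Ds (\<sigma> j)) D" by (rule pconv_subseq[OF conv l(1)])
  have l': "(\<lambda>j. r (\<sigma> j)) \<longlonglongrightarrow> l" using l(2) by (simp add: o_def)
  have "(\<lambda>j. poly (Ds (\<sigma> j)) (r (\<sigma> j))) \<longlonglongrightarrow> poly D l"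
    by (rule pconv_poly[OF c _ _ l', of "2 * g + 2"]) (simp_all add: Dj D)
  then have "poly D l = 0" using r by (simp add: LIMSEQ_const_iff)
  moreover have "(\<lambda>j. poly (pderiv (Ds (\<sigma> j))) (r (\<sigma> j))) \<longlonglongrightarrow> poly (pderiv D) l"
    by (rule pconv_poly[OF pconv_pderiv[OF c] _ _ l', of "2 * g + 2"]) (simp_all add: Dj D degree_pderiv)
  then have "poly (pderiv D) l = 0" using r by (simp add: LIMSEQ_const_iff)
  moreover have "rsquarefree D" using H by (simp add: H_tilde_def)
  ultimately show False using rsquarefree_roots[of D] by simp
qed

section \<open>The space of polynomials with a primitive solution as a submanifold\<close>

lemma nb_sequence:
  assumes z: "z \<in> cspace m" and ne: "\<not> eventually P (nb m z)"
  obtains w where "\<And>j::nat. w j \<in> cspace m" "\<And>j. \<not> P (w j)" "\<And>i. (\<lambda>j. w j i) \<longlonglongrightarrow> z i"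
proof -
  have "\<exists>w. w \<in> cspace m \<and> nm m (w - z) < 1 / real (Suc j) \<and> \<not> P w" for j
  proof -
    have "1 / real (Suc j) > 0" by simp
    then show ?thesis using ne unfolding eventually_nb[OF z] by blast
  qed
  then have "\<forall>j. \<exists>w. w \<in> cspace m \<and> nm m (w - z) < 1 / real (Suc j) \<and> \<not> P w" by blast
  from choice[OF this] obtain w where w: "\<And>j. w j \<in> cspace m" "\<And>j. nm m (w j - z) < 1 / real (Suc j)" "\<And>j. \<not> P (w j)"
    by blast
  have "(\<lambda>j. nm m (w j - z)) \<longlonglongrightarrow> 0"
  proof (rule Lim_null_comparison)
    show "(\<lambda>j. 1 / real (Suc j)) \<longlonglongrightarrow> 0" by (rule LIMSEQ_Suc[OF lim_1_over_n])
    show "\<forall>\<^sub>F j in sequentially. norm (nm m (w j - z)) \<le> 1 / real (Suc j)"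
    proof (intro always_eventually allI)
      fix j show "norm (nm m (w j - z)) \<le> 1 / real (Suc j)" using w(2)[of j] by simp
    qed
  qed
  then have f: "filterlim w (nb m z) sequentially"
    unfolding filterlim_nb_nm[OF z] using w(1) by simp
  have "(\<lambda>j. w j i) \<longlonglongrightarrow> z i" for i
    using filterlim_compose[OF tendsto_nb_coord f] .
  with w show ?thesis using that by blast
qed

lemma degree_monic_poly [simp]: "degree (monic_poly N z) = N"
  by (intro antisym degree_le le_degree) (auto simp: coeff_monic_poly)

lemma coeff_monic_poly_self [simp]: "coeff (monic_poly N z) N = 1"
  by (simp add: coeff_monic_poly)

lemma lead_monic_poly: "lead_coeff (monic_poly N z) = 1"
  by simp

lemma pconv_monic_poly:
  "(\<And>i. i < N \<Longrightarrow> (\<lambda>j. w j i) \<longlonglongrightarrow> z i) \<Longrightarrow> pconv (\<lambda>j. monic_poly N (w j)) (monic_poly N z)"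
  unfolding pconv_def coeff_monic_poly by auto

lemma monic_poly_eqI:
  assumes "lead_coeff p = 1" "degree p = N" "\<And>i. i < N \<Longrightarrow> z i = coeff p i"
  shows "monic_poly N z = p"
  using assms by (auto simp: poly_eq_iff coeff_monic_poly coeff_eq_0)

text \<open>There is no solution of degree less than \<open>n\<close>. This condition is open, so it does not affect the local
  structure of the set.\<close>

definition reduced :: "nat \<Rightarrow> nat \<Rightarrow> cvec \<Rightarrow> bool" where
  "reduced g n w \<longleftrightarrow> monic_poly (2 * g + 2) w \<in> H_tilde g \<and>
     (\<forall>k\<in>{..<n}. \<not> (\<exists>P Q. monic_solution g k (monic_poly (2 * g + 2) w) P Q))"

lemma A_tilde_coeffs_iff:
  assumes "n \<ge> 1"
  shows "z \<in> A_tilde_coeffs g n \<longleftrightarrow> z \<in> cspace (2 * g + 2) \<and> reduced g n z \<and>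
    (\<exists>P Q. monic_solution g n (monic_poly (2 * g + 2) z) P Q)"
  unfolding A_tilde_coeffs_def A_tilde_iff[OF assms] reduced_def by blast

text \<open>If solutions of some degree k < n existed arbitrarily close by, their limit would give
  the central polynomial a solution of degree at most k. Only finitely many k have to be
  excluded.\<close>

lemma reduced_open:
  assumes "reduced g n z" and z: "z \<in> cspace (2 * g + 2)"
  shows "eventually (reduced g n) (nb (2 * g + 2) z)"
proof -
  let ?D = "\<lambda>w. monic_poly (2 * g + 2) w"
  have H: "?D z \<in> H_tilde g" using assms(1) by (simp add: reduced_def)
  have 1: "eventually (\<lambda>w. ?D w \<in> H_tilde g) (nb (2 * g + 2) z)"
  proof (rule ccontr)
    assume "\<not> ?thesis"
    from nb_sequence[OF z this] obtain w where w: "\<And>j::nat. w j \<in> cspace (2 * g + 2)" "\<And>j. ?D (w j) \<notin> H_tilde g"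
      "\<And>i. (\<lambda>j. w j i) \<longlonglongrightarrow> z i" by metis
    have "?D z \<notin> H_tilde g"
      by (rule H_tilde_limit[OF pconv_monic_poly[OF w(3)] _ _ w(2)]) simp_all
    then show False using H by simp
  qed
  have "eventually (\<lambda>w. \<forall>k\<in>{..<n}. ?D w \<in> H_tilde g \<longrightarrow> \<not> (\<exists>P Q. monic_solution g k (?D w) P Q)) (nb (2 * g + 2) z)"
  proof (rule eventually_ball_finite)
    show "\<forall>k\<in>{..<n}. eventually (\<lambda>w. ?D w \<in> H_tilde g \<longrightarrow> \<not> (\<exists>P Q. monic_solution g k (?D w) P Q)) (nb (2 * g + 2) z)"
    proof
      fix k assume k: "k \<in> {..<n}"
      show "eventually (\<lambda>w. ?D w \<in> H_tilde g \<longrightarrow> \<not> (\<exists>P Q. monic_solution g k (?D w) P Q)) (nb (2 * g + 2) z)"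
      proof (rule ccontr)
        assume "\<not> ?thesis"
        from nb_sequence[OF z this] obtain w where w: "\<And>j::nat. w j \<in> cspace (2 * g + 2)"
          "\<And>j. \<not> (?D (w j) \<in> H_tilde g \<longrightarrow> \<not> (\<exists>P Q. monic_solution g k (?D (w j)) P Q))"
          "\<And>i. (\<lambda>j. w j i) \<longlonglongrightarrow> z i" by metis
        have wH: "?D (w j) \<in> H_tilde g" for j using w(2) by blast
        have "\<forall>j. \<exists>PQ. monic_solution g k (?D (w j)) (fst PQ) (snd PQ)" using w(2) by (metis fst_conv snd_conv)
        from choice[OF this] obtain PQ where PQ: "\<And>j. monic_solution g k (?D (w j)) (fst (PQ j)) (snd (PQ j))" by blast
        obtain P' Q' k' where "k' \<le> k" "monic_solution g k' (?D z) P' Q'"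
          by (rule monic_solution_limit[OF H wH pconv_monic_poly[OF w(3)] PQ])
        then show False using assms(1) k unfolding reduced_def by (meson lessThan_iff order_le_less_trans)
      qed
    qed
  qed simp
  with 1 show ?thesis by eventually_elim (simp add: reduced_def)
qed

text \<open>The lower coefficients of D, P and Q are stored one after the other. For g < n the total
  is 2 n + g + 1, which leaves g + 2 after 2 n - 1 equations and g after 2 n + 1.\<close>

definition sol_dim :: "nat \<Rightarrow> nat \<Rightarrow> nat" where
  "sol_dim g n = 2 * g + 2 + n + (n - g - 1)"

definition dec_P :: "nat \<Rightarrow> nat \<Rightarrow> cvec \<Rightarrow> complex poly" where
  "dec_P g n x = monic_poly n (\<lambda>i. x (2 * g + 2 + i))"

definition dec_Q :: "nat \<Rightarrow> nat \<Rightarrow> cvec \<Rightarrow> complex poly" where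
  "dec_Q g n x = monic_poly (n - g - 1) (\<lambda>i. x (2 * g + 2 + n + i))"

definition lift_with :: "nat \<Rightarrow> nat \<Rightarrow> cvec \<Rightarrow> complex poly \<Rightarrow> complex poly \<Rightarrow> cvec" where
  "lift_with g n z P Q = (\<lambda>i. if i < 2 * g + 2 then z i else if i < 2 * g + 2 + n then coeff P (i - (2 * g + 2))
      else if i < sol_dim g n then coeff Q (i - (2 * g + 2 + n)) else 0)"

definition truncate :: "nat \<Rightarrow> cvec \<Rightarrow> cvec" where
  "truncate N x = (\<lambda>i. if i < N then x i else 0)"

lemma truncate_in_cspace [simp]: "truncate N x \<in> cspace N"
  by (simp add: truncate_def cspace_def)

lemma monic_poly_truncate [simp]: "monic_poly N (truncate N x) = monic_poly N x"
  by (simp add: poly_eq_iff coeff_monic_poly truncate_def)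

lemma lift_with_in_cspace [simp]: "lift_with g n z P Q \<in> cspace (sol_dim g n)"
  by (auto simp: lift_with_def cspace_def sol_dim_def)

lemma truncate_lift: "z \<in> cspace (2 * g + 2) \<Longrightarrow> truncate (2 * g + 2) (lift_with g n z P Q) = z"
  by (auto simp: truncate_def lift_with_def cspace_def fun_eq_iff)

lemma lift_with_dec:
  assumes "x \<in> cspace (sol_dim g n)"
  shows "lift_with g n (truncate (2 * g + 2) x) (dec_P g n x) (dec_Q g n x) = x"
proof
  fix i
  consider "i < 2 * g + 2" | l where "i = 2 * g + 2 + l" "l < n" | l where "i = 2 * g + 2 + n + l" "l < n - g - 1"
    | "sol_dim g n \<le> i"
  proof -
    have "i < 2 * g + 2 \<or> (\<exists>l<n. i = 2 * g + 2 + l) \<or> (\<exists>l<n - g - 1. i = 2 * g + 2 + n + l) \<or> sol_dim g n \<le> i"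
      unfolding sol_dim_def by presburger
    then show thesis using that by blast
  qed
  then show "lift_with g n (truncate (2 * g + 2) x) (dec_P g n x) (dec_Q g n x) i = x i"
  proof cases
    case 4
    then show ?thesis using assms by (simp add: lift_with_def sol_dim_def cspace_def)
  qed (simp_all add: lift_with_def truncate_def dec_P_def dec_Q_def coeff_monic_poly sol_dim_def)
qed

lemma dec_lift_with:
  assumes "monic_solution g n D P Q"
  shows "dec_P g n (lift_with g n z P Q) = P" "dec_Q g n (lift_with g n z P Q) = Q"
  using assms unfolding dec_P_def dec_Q_def
  by (auto intro!: monic_poly_eqI simp: lift_with_def monic_solution_def sol_dim_def)

text \<open>The inverse of the projection from the solution set to D. Where D is square-free and has
  a solution of degree n, \<open>SOME\<close> picks the only one.\<close>

definition the_lift :: "nat \<Rightarrow> nat \<Rightarrow> cvec \<Rightarrow> cvec" where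
  "the_lift g n z = (let PQ = (SOME PQ. monic_solution g n (monic_poly (2 * g + 2) z) (fst PQ) (snd PQ))
     in lift_with g n z (fst PQ) (snd PQ))"

lemma the_lift_eq:
  assumes "monic_poly (2 * g + 2) z \<in> H_tilde g" and s: "monic_solution g n (monic_poly (2 * g + 2) z) P Q"
  shows "the_lift g n z = lift_with g n z P Q"
proof -
  define PQ where "PQ = (SOME PQ. monic_solution g n (monic_poly (2 * g + 2) z) (fst PQ) (snd PQ))"
  have "\<exists>PQ. monic_solution g n (monic_poly (2 * g + 2) z) (fst PQ) (snd PQ)"
    using s by (intro exI[of _ "(P, Q)"]) simp
  from someI_ex[OF this] have "monic_solution g n (monic_poly (2 * g + 2) z) (fst PQ) (snd PQ)"
    unfolding PQ_def .
  from monic_solution_unique[OF assms(1) this s] have "fst PQ = P" "snd PQ = Q" by auto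
  then show ?thesis unfolding the_lift_def PQ_def[symmetric] by (simp add: Let_def)
qed

text \<open>Every subsequence of the solutions has a further subsequence that converges to a
  solution for the limit polynomial. That solution cannot have degree below n, so by uniqueness it
  is the expected one, and the whole sequence converges.\<close>

lemma the_lift_continuous:
  assumes n: "n \<ge> 1"
  shows "continuous_on (A_tilde_coeffs g n) (\<lambda>z. the_lift g n z i)"
proof (rule continuous_on_sequentiallyI)
  fix u :: "nat \<Rightarrow> cvec" and a assume u: "\<forall>j. u j \<in> A_tilde_coeffs g n" and a: "a \<in> A_tilde_coeffs g n" and ua: "u \<longlonglongrightarrow> a"
  let ?D = "\<lambda>w. monic_poly (2 * g + 2) w"
  have aH: "?D a \<in> H_tilde g" and ar: "reduced g n a" and uH: "\<And>j. ?D (u j) \<in> H_tilde g"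
    using a u unfolding A_tilde_coeffs_iff[OF n] reduced_def by blast+
  obtain P Q where PQ: "monic_solution g n (?D a) P Q"
    using a unfolding A_tilde_coeffs_iff[OF n] by blast
  have "\<forall>j. \<exists>PQ. monic_solution g n (?D (u j)) (fst PQ) (snd PQ)"
    using u unfolding A_tilde_coeffs_iff[OF n] by (metis fst_conv snd_conv)
  from choice[OF this] obtain pq where pq: "\<And>j. monic_solution g n (?D (u j)) (fst (pq j)) (snd (pq j))" by blast
  have uc: "(\<lambda>j. u j l) \<longlonglongrightarrow> a l" for l
    using filterlim_compose[OF tendsto_coord ua] .
  define f where "f j = the_lift g n (u j) i" for j
  have f: "f j = lift_with g n (u j) (fst (pq j)) (snd (pq j)) i" for j
    unfolding f_def using the_lift_eq[OF uH pq] by simp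
  have la: "the_lift g n a = lift_with g n a P Q" by (rule the_lift_eq[OF aH PQ])
  have sub: "\<exists>\<sigma>'. strict_mono \<sigma>' \<and> (\<lambda>j. f (\<sigma> (\<sigma>' j))) \<longlonglongrightarrow> the_lift g n a i"
    if sm: "strict_mono (\<sigma> :: nat \<Rightarrow> nat)" for \<sigma>
  proof -
    have c: "pconv (\<lambda>j. ?D (u (\<sigma> j))) (?D a)"
      using pconv_subseq[OF pconv_monic_poly[of "2 * g + 2" u a, OF uc] sm] .
    obtain \<sigma>' P' Q' k' where s': "strict_mono (\<sigma>' :: nat \<Rightarrow> nat)" "k' \<le> n" "monic_solution g k' (?D a) P' Q'"
       "k' = n \<longrightarrow> pconv (\<lambda>j. fst (pq (\<sigma> (\<sigma>' j)))) P' \<and> pconv (\<lambda>j. snd (pq (\<sigma> (\<sigma>' j)))) Q'"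
      by (rule monic_solution_limit[where Ds = "\<lambda>j. ?D (u (\<sigma> j))" and P = "\<lambda>j. fst (pq (\<sigma> j))"
            and Q = "\<lambda>j. snd (pq (\<sigma> j))", OF aH uH c pq])
    have k': "k' = n"
    proof (rule ccontr)
      assume "k' \<noteq> n"
      then have "k' \<in> {..<n}" using s'(2) by simp
      then show False using ar s'(3) unfolding reduced_def by blast
    qed
    have PQ': "P' = P" "Q' = Q" using monic_solution_unique[OF aH s'(3)[unfolded k'] PQ] by auto
    have cP: "(\<lambda>j. coeff (fst (pq (\<sigma> (\<sigma>' j)))) l) \<longlonglongrightarrow> coeff P l"
      and cQ: "(\<lambda>j. coeff (snd (pq (\<sigma> (\<sigma>' j)))) l) \<longlonglongrightarrow> coeff Q l" for l
      using s'(4) k' unfolding PQ' pconv_def by auto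
    have "strict_mono (\<lambda>j. \<sigma> (\<sigma>' j))" using sm s'(1) by (simp add: strict_mono_def)
    then have cu: "(\<lambda>j. u (\<sigma> (\<sigma>' j)) l) \<longlonglongrightarrow> a l" for l
      using LIMSEQ_subseq_LIMSEQ[OF uc, of "\<lambda>j. \<sigma> (\<sigma>' j)" l] by (simp add: o_def)
    have "(\<lambda>j. f (\<sigma> (\<sigma>' j))) \<longlonglongrightarrow> the_lift g n a i"
      unfolding f la lift_with_def using cP cQ cu by auto
    then show ?thesis using s'(1) by blast
  qed
  have "f \<longlonglongrightarrow> the_lift g n a i"
  proof (rule tendstoI, rule ccontr)
    fix e :: real assume "e > 0" and "\<not> (\<forall>\<^sub>F j in sequentially. dist (f j) (the_lift g n a i) < e)"
    from not_eventually_sequentiallyD[OF this(2)] obtain \<sigma> :: "nat \<Rightarrow> nat"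
      where s: "strict_mono \<sigma>" "\<forall>j. \<not> dist (f (\<sigma> j)) (the_lift g n a i) < e" by blast
    from sub[OF s(1)] obtain \<sigma>' where "(\<lambda>j. f (\<sigma> (\<sigma>' j))) \<longlonglongrightarrow> the_lift g n a i" by blast
    from tendstoD[OF this \<open>e > 0\<close>] have "\<forall>\<^sub>F j::nat in sequentially. False" using s(2) by simp
    then show False by simp
  qed
  then show "(\<lambda>j. the_lift g n (u j) i) \<longlonglongrightarrow> the_lift g n a i" unfolding f_def[abs_def] .
qed

text \<open>Strict differentiability, in a form that polynomial functions satisfy globally.\<close>

definition strictly_diff :: "nat \<Rightarrow> (cvec \<Rightarrow> complex) \<Rightarrow> bool" where
  "strictly_diff M f \<longleftrightarrow> continuous_on UNIV f \<and>
     (\<exists>\<phi>. (\<forall>i<M. continuous_on UNIV (\<lambda>(x, y). \<phi> x y i)) \<and>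
       (\<forall>x\<in>cspace M. \<forall>y\<in>cspace M. f x - f y = (\<Sum>i<M. \<phi> x y i * (x i - y i))))"

lemma strictly_diffI:
  assumes "continuous_on UNIV f" "\<And>i. i < M \<Longrightarrow> continuous_on UNIV (\<lambda>(x, y). \<phi> x y i)"
    "\<And>x y. x \<in> cspace M \<Longrightarrow> y \<in> cspace M \<Longrightarrow> f x - f y = (\<Sum>i<M. \<phi> x y i * (x i - y i))"
  shows "strictly_diff M f"
  unfolding strictly_diff_def using assms by blast

lemma strictly_diffE:
  assumes "strictly_diff M f"
  obtains \<phi> where "continuous_on UNIV f" "\<forall>i<M. continuous_on UNIV (\<lambda>(x, y). \<phi> x y i)"
    "\<forall>x\<in>cspace M. \<forall>y\<in>cspace M. f x - f y = (\<Sum>i<M. \<phi> x y i * (x i - y i))"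
  using assms unfolding strictly_diff_def by blast

lemma strictly_diff_const: "strictly_diff M (\<lambda>x. c)"
  by (rule strictly_diffI[where \<phi> = "\<lambda>_ _ _. 0"]) (auto intro: continuous_on_const)

lemma strictly_diff_coord: "l < M \<Longrightarrow> strictly_diff M (\<lambda>x. x l)"
  by (rule strictly_diffI[where \<phi> = "\<lambda>_ _ i. if i = l then 1 else 0"])
     (auto intro: continuous_on_const simp: if_distrib[of "\<lambda>x. x * _"] case_prod_unfold cong: if_cong)

lemma strictly_diff_add:
  assumes "strictly_diff M f" "strictly_diff M f'"
  shows "strictly_diff M (\<lambda>x. f x + f' x)"
proof -
  from assms(1) obtain \<phi> where 1: "continuous_on UNIV f" "\<forall>i<M. continuous_on UNIV (\<lambda>(x, y). \<phi> x y i)"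
    "\<forall>x\<in>cspace M. \<forall>y\<in>cspace M. f x - f y = (\<Sum>i<M. \<phi> x y i * (x i - y i))"
    by (rule strictly_diffE)
  from assms(2) obtain \<phi>' where 2: "continuous_on UNIV f'" "\<forall>i<M. continuous_on UNIV (\<lambda>(x, y). \<phi>' x y i)"
    "\<forall>x\<in>cspace M. \<forall>y\<in>cspace M. f' x - f' y = (\<Sum>i<M. \<phi>' x y i * (x i - y i))"
    by (rule strictly_diffE)
  show ?thesis
  proof (rule strictly_diffI)
    show "continuous_on UNIV (\<lambda>x. f x + f' x)" using 1(1) 2(1) by (rule continuous_on_add)
    show "continuous_on UNIV (\<lambda>(x, y). \<phi> x y i + \<phi>' x y i)" if "i < M" for i
      using 1(2)[rule_format, OF that] 2(2)[rule_format, OF that] unfolding case_prod_unfold by (rule continuous_on_add)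
    fix x y :: cvec assume xy: "x \<in> cspace M" "y \<in> cspace M"
    have "f x + f' x - (f y + f' y) = (f x - f y) + (f' x - f' y)" by simp
    then show "f x + f' x - (f y + f' y) = (\<Sum>i<M. (\<phi> x y i + \<phi>' x y i) * (x i - y i))"
      unfolding 1(3)[rule_format, OF xy] 2(3)[rule_format, OF xy] by (simp add: distrib_right sum.distrib)
  qed
qed

lemma strictly_diff_mult:
  assumes "strictly_diff M f" "strictly_diff M f'"
  shows "strictly_diff M (\<lambda>x. f x * f' x)"
proof -
  from assms(1) obtain \<phi> where 1: "continuous_on UNIV f" "\<forall>i<M. continuous_on UNIV (\<lambda>(x, y). \<phi> x y i)"
    "\<forall>x\<in>cspace M. \<forall>y\<in>cspace M. f x - f y = (\<Sum>i<M. \<phi> x y i * (x i - y i))"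
    by (rule strictly_diffE)
  from assms(2) obtain \<phi>' where 2: "continuous_on UNIV f'" "\<forall>i<M. continuous_on UNIV (\<lambda>(x, y). \<phi>' x y i)"
    "\<forall>x\<in>cspace M. \<forall>y\<in>cspace M. f' x - f' y = (\<Sum>i<M. \<phi>' x y i * (x i - y i))"
    by (rule strictly_diffE)
  show ?thesis
  proof (rule strictly_diffI)
    show "continuous_on UNIV (\<lambda>x. f x * f' x)" using 1(1) 2(1) by (rule continuous_on_mult)
    have c1: "continuous_on UNIV (\<lambda>p::cvec \<times> cvec. f (fst p))"
      by (rule continuous_on_compose2[OF 1(1) continuous_on_fst[OF continuous_on_id]]) auto
    have c2: "continuous_on UNIV (\<lambda>p::cvec \<times> cvec. f' (snd p))"
      by (rule continuous_on_compose2[OF 2(1) continuous_on_snd[OF continuous_on_id]]) auto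
    show "continuous_on UNIV (\<lambda>(x, y). f x * \<phi>' x y i + \<phi> x y i * f' y)" if "i < M" for i
      using 1(2)[rule_format, OF that] 2(2)[rule_format, OF that] unfolding case_prod_unfold
      by (intro continuous_on_add continuous_on_mult c1 c2)
    fix x y :: cvec assume xy: "x \<in> cspace M" "y \<in> cspace M"
    have "f x * f' x - f y * f' y = f x * (f' x - f' y) + (f x - f y) * f' y"
      by (simp add: algebra_simps)
    also have "\<dots> = (\<Sum>i<M. (f x * \<phi>' x y i + \<phi> x y i * f' y) * (x i - y i))"
      unfolding 1(3)[rule_format, OF xy] 2(3)[rule_format, OF xy] sum_distrib_left sum_distrib_right sum.distrib[symmetric]
      by (intro sum.cong refl) (simp add: algebra_simps)
    finally show "f x * f' x - f y * f' y = (\<Sum>i<M. (f x * \<phi>' x y i + \<phi> x y i * f' y) * (x i - y i))" .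
  qed
qed

lemma strictly_diff_minus: "strictly_diff M f \<Longrightarrow> strictly_diff M f' \<Longrightarrow> strictly_diff M (\<lambda>x. f x - f' x)"
  using strictly_diff_add[of M f "\<lambda>x. (-1) * f' x"] strictly_diff_mult[OF strictly_diff_const[of M "-1"], of f'] by simp

lemma strictly_diff_sum: "(\<And>i. i \<in> A \<Longrightarrow> strictly_diff M (f i)) \<Longrightarrow> strictly_diff M (\<lambda>x. \<Sum>i\<in>A. f i x)"
  by (induction A rule: infinite_finite_induct) (auto intro: strictly_diff_const strictly_diff_add)

lemma strictly_diff_coeff_mult:
  assumes "\<And>l. strictly_diff M (\<lambda>x. coeff (p x) l)" "\<And>l. strictly_diff M (\<lambda>x. coeff (q x) l)"
  shows "strictly_diff M (\<lambda>x. coeff (p x * q x) l)"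
  unfolding coeff_mult by (intro strictly_diff_sum strictly_diff_mult assms)

text \<open>The last two equations, present only for \<open>K = 2 n + 1\<close>, cut out the slice of centred polynomials with
  \<open>k\<close>-th coefficient \<open>1\<close>.\<close>

definition pell_system :: "nat \<Rightarrow> nat \<Rightarrow> nat \<Rightarrow> cvec \<Rightarrow> nat \<Rightarrow> complex" where
  "pell_system g n k x j = (if j < 2 * n - 1
     then coeff ((dec_P g n x)\<^sup>2 - monic_poly (2 * g + 2) x * (dec_Q g n x)\<^sup>2) (j + 1)
     else if j = 2 * n - 1 then x (2 * g + 1) else x k - 1)"

lemma strictly_diff_pell_system:
  assumes "k < 2 * g + 2"
  shows "strictly_diff (sol_dim g n) (\<lambda>x. pell_system g n k x j)"
proof -
  have c: "strictly_diff (sol_dim g n) (\<lambda>x. coeff (monic_poly N (\<lambda>i. x (a + i))) l)"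
    if "a + N \<le> sol_dim g n" for a N l
    using that by (cases "l < N") (auto simp: coeff_monic_poly intro: strictly_diff_const strictly_diff_coord)
  have D: "strictly_diff (sol_dim g n) (\<lambda>x. coeff (monic_poly (2 * g + 2) x) l)" for l
    using c[of 0 "2 * g + 2" l] by (simp add: sol_dim_def)
  have P: "strictly_diff (sol_dim g n) (\<lambda>x. coeff (dec_P g n x) l)" for l
    unfolding dec_P_def by (rule c) (simp add: sol_dim_def)
  have Q: "strictly_diff (sol_dim g n) (\<lambda>x. coeff (dec_Q g n x) l)" for l
    unfolding dec_Q_def by (rule c) (simp add: sol_dim_def)
  consider "j < 2 * n - 1" | "j = 2 * n - 1" | "j > 2 * n - 1" by linarith
  then show ?thesis
  proof cases
    case 1
    then have "(\<lambda>x. pell_system g n k x j) = (\<lambda>x. coeff (dec_P g n x * dec_P g n x) (j + 1)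
        - coeff (monic_poly (2 * g + 2) x * (dec_Q g n x * dec_Q g n x)) (j + 1))"
      unfolding pell_system_def power2_eq_square by (simp only: if_True coeff_diff)
    then show ?thesis
      by (simp only:) (intro strictly_diff_minus strictly_diff_coeff_mult D P Q)
  next
    case 2
    then show ?thesis by (simp add: pell_system_def strictly_diff_coord sol_dim_def)
  next
    case 3
    have "strictly_diff (sol_dim g n) (\<lambda>x. x k - 1)"
      using assms by (intro strictly_diff_minus strictly_diff_const strictly_diff_coord) (simp add: sol_dim_def)
    then show ?thesis using 3 by (simp add: pell_system_def)
  qed
qed

text \<open>P^2 and D Q^2 are monic of degree 2 n, so their difference vanishes in degree 2 n and
  above. Being constant is a condition on the degrees 1 to 2 n - 1 only, whence the shift j +
  1.\<close>

lemma monic_solution_iff_pell_system: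
  assumes "g < n"
  shows "monic_solution g n (monic_poly (2 * g + 2) x) (dec_P g n x) (dec_Q g n x) \<longleftrightarrow>
    (\<forall>j<2 * n - 1. pell_system g n k x j = 0)"
proof -
  let ?E = "(dec_P g n x)\<^sup>2 - monic_poly (2 * g + 2) x * (dec_Q g n x)\<^sup>2"
  have dP: "degree (dec_P g n x) = n" "coeff (dec_P g n x) n = 1"
    and dQ: "degree (dec_Q g n x) = n - g - 1" "coeff (dec_Q g n x) (n - g - 1) = 1"
    by (simp_all add: dec_P_def dec_Q_def)
  have nz: "dec_Q g n x \<noteq> 0" "monic_poly (2 * g + 2) x \<noteq> 0" "dec_P g n x \<noteq> 0"
    using dP(2) dQ(2) coeff_monic_poly_self[of "2 * g + 2" x] by (metis coeff_0 zero_neq_one)+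
  have d1: "degree ((dec_P g n x)\<^sup>2) = 2 * n" and d2: "degree (monic_poly (2 * g + 2) x * (dec_Q g n x)\<^sup>2) = 2 * n"
    using nz assms by (simp_all add: degree_power_eq dP dQ degree_mult_eq)
  have l1: "lead_coeff ((dec_P g n x)\<^sup>2) = 1" "lead_coeff (monic_poly (2 * g + 2) x * (dec_Q g n x)\<^sup>2) = 1"
    unfolding lead_coeff_mult lead_coeff_power dP dQ lead_monic_poly by simp_all
  have top: "coeff ?E i = 0" if "i \<ge> 2 * n" for i
    using l1 d1 d2 that by (cases "i = 2 * n") (simp_all add: coeff_eq_0)
  have "degree ?E = 0 \<longleftrightarrow> (\<forall>j<2 * n - 1. coeff ?E (j + 1) = 0)"
  proof
    assume "degree ?E = 0"
    then show "\<forall>j<2 * n - 1. coeff ?E (j + 1) = 0" by (simp add: coeff_eq_0 del: coeff_diff)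
  next
    assume R: "\<forall>j<2 * n - 1. coeff ?E (j + 1) = 0"
    have "coeff ?E i = 0" if "i > 0" for i
    proof (cases "i \<ge> 2 * n")
      case False
      then have "i - 1 < 2 * n - 1" "i - 1 + 1 = i" using that by auto
      then show ?thesis using R by metis
    qed (rule top)
    then show "degree ?E = 0" by (metis bot_nat_0.extremum degree_le le_antisym)
  qed
  then show ?thesis
    using assms unfolding monic_solution_def dP dQ pell_system_def by simp
qed

section \<open>The derivative of the system\<close>

definition low_poly :: "nat \<Rightarrow> cvec \<Rightarrow> complex poly" where
  "low_poly N v = (\<Sum>i<N. monom (v i) i)"

lemma coeff_low_poly: "coeff (low_poly N v) i = (if i < N then v i else 0)"
  by (auto simp: low_poly_def coeff_sum)

lemma dlt_low_poly: "dlt (low_poly N v) N"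
  by (simp add: dlt_iff_coeff coeff_low_poly)

lemma low_poly_coeff: "dlt p N \<Longrightarrow> (\<And>i. i < N \<Longrightarrow> v i = coeff p i) \<Longrightarrow> low_poly N v = p"
  by (auto simp: poly_eq_iff coeff_low_poly dlt_iff_coeff)

lemma monic_poly_line: "monic_poly N (\<lambda>i. x i + t * v i) = monic_poly N x + smult t (low_poly N v)"
  by (simp add: poly_eq_iff coeff_monic_poly coeff_low_poly)

text \<open>The derivative of P^2 - D Q^2 in the direction v = (d, p, q). The components have degree
  below those of D, P, Q, since the latter stay monic.\<close>

definition pell_linear :: "nat \<Rightarrow> nat \<Rightarrow> cvec \<Rightarrow> cvec \<Rightarrow> complex poly" where
  "pell_linear g n x v = 2 * dec_P g n x * low_poly n (\<lambda>i. v (2 * g + 2 + i))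
     - low_poly (2 * g + 2) v * (dec_Q g n x)\<^sup>2
     - 2 * monic_poly (2 * g + 2) x * dec_Q g n x * low_poly (n - g - 1) (\<lambda>i. v (2 * g + 2 + n + i))"

text \<open>In an arbitrary commutative ring T may be the constant polynomial t; the bracket
  separates the linear term from the terms of higher order in T.\<close>

lemma norm_expansion:
  fixes P :: "'a :: comm_ring_1"
  shows "(P + T * p)\<^sup>2 - (D + T * d) * (Q + T * q)\<^sup>2 - (P\<^sup>2 - D * Q\<^sup>2) =
    T * ((2 * P * p - d * Q\<^sup>2 - 2 * D * Q * q) + T * ((p\<^sup>2 - D * q\<^sup>2 - 2 * d * Q * q) - T * (d * q\<^sup>2)))"
  by (simp add: algebra_simps power2_eq_square)

text \<open>Whatever gradient the equation has, its value on v is the limit of the difference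
  quotients along x + t v, which the expansion in powers of t computes.\<close>

lemma pell_system_gradient:
  assumes x: "x \<in> cspace (sol_dim g n)" and v: "v \<in> cspace (sol_dim g n)"
    and c: "has_grad (sol_dim g n) (\<lambda>x. pell_system g n k x j) c x"
  shows "(\<Sum>i<sol_dim g n. c i * v i) = (if j < 2 * n - 1 then coeff (pell_linear g n x v) (j + 1)
    else if j = 2 * n - 1 then v (2 * g + 1) else v k)"
    (is "_ = ?R")
proof -
  define D where "D = monic_poly (2 * g + 2) x"
  define P where "P = dec_P g n x"
  define Q where "Q = dec_Q g n x"
  define d where "d = low_poly (2 * g + 2) v"
  define p where "p = low_poly n (\<lambda>i. v (2 * g + 2 + i))"
  define q where "q = low_poly (n - g - 1) (\<lambda>i. v (2 * g + 2 + n + i))"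
  let ?x = "\<lambda>t i. x i + t * v i"
  have line: "monic_poly (2 * g + 2) (?x t) = D + smult t d" "dec_P g n (?x t) = P + smult t p"
    "dec_Q g n (?x t) = Q + smult t q" for t
    unfolding D_def P_def Q_def d_def p_def q_def dec_P_def dec_Q_def by (simp_all add: monic_poly_line)
  define A where "A = p\<^sup>2 - D * q\<^sup>2 - 2 * d * Q * q"
  have expand: "(P + smult t p)\<^sup>2 - (D + smult t d) * (Q + smult t q)\<^sup>2 - (P\<^sup>2 - D * Q\<^sup>2) =
     smult t (pell_linear g n x v + smult t (A - smult t (d * q\<^sup>2)))" for t
  proof -
    have s: "smult t r = [:t:] * r" for r :: "complex poly" by simp
    show ?thesis
      unfolding pell_linear_def A_def D_def[symmetric] P_def[symmetric] Q_def[symmetric]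
        d_def[symmetric] p_def[symmetric] q_def[symmetric] s
      by (rule norm_expansion)
  qed
  have quot: "(pell_system g n k (?x t) j - pell_system g n k x j) / t = (if j < 2 * n - 1
      then coeff (pell_linear g n x v) (j + 1) + t * (coeff A (j + 1) - t * coeff (d * q\<^sup>2) (j + 1)) else ?R)"
    if "t \<noteq> 0" for t
  proof (cases "j < 2 * n - 1")
    case True
    have "pell_system g n k (?x t) j - pell_system g n k x j =
      coeff ((P + smult t p)\<^sup>2 - (D + smult t d) * (Q + smult t q)\<^sup>2 - (P\<^sup>2 - D * Q\<^sup>2)) (j + 1)"
      using True by (simp only: pell_system_def line D_def[symmetric] P_def[symmetric] Q_def[symmetric] if_True coeff_diff)
    also have "\<dots> = t * (coeff (pell_linear g n x v) (j + 1) + t * (coeff A (j + 1) - t * coeff (d * q\<^sup>2) (j + 1)))"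
      unfolding expand by simp
    finally show ?thesis using True that by simp
  qed (use that in \<open>simp add: pell_system_def\<close>)
  have "((\<lambda>t. if j < 2 * n - 1
      then coeff (pell_linear g n x v) (j + 1) + t * (coeff A (j + 1) - t * coeff (d * q\<^sup>2) (j + 1)) else ?R) \<longlongrightarrow> ?R) (at 0)"
  proof (cases "j < 2 * n - 1")
    case True
    have "((\<lambda>t. coeff (pell_linear g n x v) (j + 1) + t * (coeff A (j + 1) - t * coeff (d * q\<^sup>2) (j + 1))) \<longlongrightarrow>
       coeff (pell_linear g n x v) (j + 1) + 0 * (coeff A (j + 1) - 0 * coeff (d * q\<^sup>2) (j + 1))) (at 0)"
      by (intro tendsto_intros)
    then show ?thesis using True by simp
  qed simp
  moreover have "\<forall>\<^sub>F t in at 0. (if j < 2 * n - 1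
      then coeff (pell_linear g n x v) (j + 1) + t * (coeff A (j + 1) - t * coeff (d * q\<^sup>2) (j + 1)) else ?R) =
      (pell_system g n k (?x t) j - pell_system g n k x j) / t"
    using eventually_neq_at_within[of 0 0 UNIV] by (rule eventually_mono) (rule quot[symmetric])
  ultimately have "((\<lambda>t. (pell_system g n k (?x t) j - pell_system g n k x j) / t) \<longlongrightarrow> ?R) (at 0)"
    by (rule Lim_transform_eventually)
  from tendsto_unique[OF at_neq_bot has_grad_directional[OF x v c] this] show ?thesis .
qed

lemma dlt_pell_linear:
  assumes "g < n" shows "dlt (pell_linear g n x v) (2 * n)"
proof -
  have d: "degree (dec_P g n x) = n" "degree (dec_Q g n x) = n - g - 1"
    by (simp_all add: dec_P_def dec_Q_def)
  have "degree (2 * dec_P g n x) \<le> n" using d degree_mult_le[of 2 "dec_P g n x"] by (simp add: numeral_poly)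
  then have 1: "dlt (2 * dec_P g n x * low_poly n (\<lambda>i. v (2 * g + 2 + i))) (2 * n)"
    by (intro dlt_mult[OF dlt_low_poly]) auto
  have "degree ((dec_Q g n x)\<^sup>2) \<le> 2 * (n - g - 1)" using degree_power_le[of "dec_Q g n x" 2] d by simp
  then have "dlt ((dec_Q g n x)\<^sup>2 * low_poly (2 * g + 2) v) (2 * n)"
    using assms by (intro dlt_mult[OF dlt_low_poly]) auto
  then have 2: "dlt (low_poly (2 * g + 2) v * (dec_Q g n x)\<^sup>2) (2 * n)" by (simp add: mult.commute)
  have "degree (2 * monic_poly (2 * g + 2) x * dec_Q g n x) \<le> (2 * g + 2) + (n - g - 1)"
    using degree_mult_le[of "2 * monic_poly (2 * g + 2) x" "dec_Q g n x"] degree_mult_le[of 2 "monic_poly (2 * g + 2) x"] d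
    by (simp add: numeral_poly)
  then have 3: "dlt (2 * monic_poly (2 * g + 2) x * dec_Q g n x * low_poly (n - g - 1) (\<lambda>i. v (2 * g + 2 + n + i))) (2 * n)"
    using assms by (intro dlt_mult[OF dlt_low_poly]) auto
  show ?thesis unfolding pell_linear_def by (intro dlt_diff 1 2 3)
qed

text \<open>This makes the projection of the solution set to D an immersion. Only the degrees 1 to 2
  n - 1 are controlled, so the linearised norm is a constant e, and the infinitesimal uniqueness
  above applies.\<close>

lemma pell_linear_kernel:
  assumes H: "monic_poly (2 * g + 2) x \<in> H_tilde g"
    and s: "monic_solution g n (monic_poly (2 * g + 2) x) (dec_P g n x) (dec_Q g n x)"
    and v: "v \<in> cspace (sol_dim g n)" "\<And>i. i < 2 * g + 2 \<Longrightarrow> v i = 0"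
    and 0: "\<And>j. j < 2 * n - 1 \<Longrightarrow> coeff (pell_linear g n x v) (j + 1) = 0"
  shows "v = 0"
proof -
  have n: "g < n" using s by (simp add: monic_solution_def)
  have "low_poly (2 * g + 2) v = 0" using v(2) by (simp add: poly_eq_iff coeff_low_poly)
  then have lin: "pell_linear g n x v = 2 * dec_P g n x * low_poly n (\<lambda>i. v (2 * g + 2 + i))
     - 2 * monic_poly (2 * g + 2) x * dec_Q g n x * low_poly (n - g - 1) (\<lambda>i. v (2 * g + 2 + n + i))"
    by (simp add: pell_linear_def)
  have "coeff (pell_linear g n x v) i = 0" if "i > 0" for i
  proof (cases "i \<ge> 2 * n")
    case True
    then show ?thesis using dlt_pell_linear[OF n] by (simp add: dlt_iff_coeff)
  next
    case False
    then have "i - 1 < 2 * n - 1" "i - 1 + 1 = i" using that by auto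
    then show ?thesis using 0 by metis
  qed
  then have "degree (pell_linear g n x v) = 0" by (metis bot_nat_0.extremum degree_le le_antisym)
  then obtain e where "pell_linear g n x v = [:e:]" by (rule degree_eq_zeroE)
  from linearization_kernel[OF H s dlt_low_poly dlt_low_poly this[unfolded lin]]
  have P0: "low_poly n (\<lambda>i. v (2 * g + 2 + i)) = 0" and Q0: "low_poly (n - g - 1) (\<lambda>i. v (2 * g + 2 + n + i)) = 0" .
  have "v i = 0" if "i < sol_dim g n" for i
  proof -
    consider "i < 2 * g + 2" | l where "i = 2 * g + 2 + l" "l < n" | l where "i = 2 * g + 2 + n + l" "l < n - g - 1"
    proof -
      have "i < 2 * g + 2 \<or> (\<exists>l<n. i = 2 * g + 2 + l) \<or> (\<exists>l<n - g - 1. i = 2 * g + 2 + n + l)"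
        using \<open>i < sol_dim g n\<close> unfolding sol_dim_def by presburger
      then show thesis using that by blast
    qed
    then show ?thesis
    proof cases
      case (2 l)
      then show ?thesis using arg_cong[OF P0, of "\<lambda>p. coeff p l"] by (simp add: coeff_low_poly)
    next
      case (3 l)
      then show ?thesis using arg_cong[OF Q0, of "\<lambda>p. coeff p l"] by (simp add: coeff_low_poly)
    qed (rule v(2))
  qed
  then show ?thesis using v(1) by (intro cspace_eqI[of v "sol_dim g n" 0]) auto
qed

lemma pell_linear_lift_with:
  assumes "dlt Dd (2 * g + 2)" "dlt Pd n" "dlt Qd (n - g - 1)"
  shows "pell_linear g n x (lift_with g n (coeff Dd) Pd Qd) =
    2 * dec_P g n x * Pd - Dd * (dec_Q g n x)\<^sup>2 - 2 * monic_poly (2 * g + 2) x * dec_Q g n x * Qd"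
proof -
  have 1: "low_poly (2 * g + 2) (lift_with g n (coeff Dd) Pd Qd) = Dd"
    by (rule low_poly_coeff[OF assms(1)]) (simp add: lift_with_def)
  have 2: "low_poly n (\<lambda>i. lift_with g n (coeff Dd) Pd Qd (2 * g + 2 + i)) = Pd"
    by (rule low_poly_coeff[OF assms(2)]) (simp add: lift_with_def)
  have 3: "low_poly (n - g - 1) (\<lambda>i. lift_with g n (coeff Dd) Pd Qd (2 * g + 2 + n + i)) = Qd"
    by (rule low_poly_coeff[OF assms(3)]) (simp add: lift_with_def sol_dim_def)
  show ?thesis unfolding pell_linear_def 1 2 3 ..
qed

text \<open>The polynomial structure yields continuous difference coefficients without an explicit
  formula. On the diagonal they form a gradient, and its values along lines are those of
  \<open>pell_linear\<close>.\<close>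

lemma pell_gradients:
  assumes k: "k < 2 * g + 2"
  obtains \<Phi> where
    "\<forall>x\<in>cspace (sol_dim g n). \<forall>y\<in>cspace (sol_dim g n). \<forall>j.
       pell_system g n k x j - pell_system g n k y j = (\<Sum>i<sol_dim g n. \<Phi> x y j i * (x i - y i))"
    "\<forall>j. \<forall>i<sol_dim g n. continuous_on UNIV (\<lambda>(x, y). \<Phi> x y j i)"
    "\<forall>x\<in>cspace (sol_dim g n). \<forall>v\<in>cspace (sol_dim g n). \<forall>j.
       (\<Sum>i<sol_dim g n. \<Phi> x x j i * v i) = (if j < 2 * n - 1 then coeff (pell_linear g n x v) (j + 1)
         else if j = 2 * n - 1 then v (2 * g + 1) else v k)"
proof -
  let ?M = "sol_dim g n"
  have "\<exists>\<phi>. (\<forall>i<?M. continuous_on UNIV (\<lambda>(x, y). \<phi> x y i)) \<and>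
     (\<forall>x\<in>cspace ?M. \<forall>y\<in>cspace ?M. pell_system g n k x j - pell_system g n k y j = (\<Sum>i<?M. \<phi> x y i * (x i - y i)))" for j
    using strictly_diff_pell_system[OF k, of n j] unfolding strictly_diff_def by (rule conjunct2)
  then have "\<forall>j. \<exists>\<phi>. (\<forall>i<?M. continuous_on UNIV (\<lambda>(x, y). \<phi> x y i)) \<and>
     (\<forall>x\<in>cspace ?M. \<forall>y\<in>cspace ?M. pell_system g n k x j - pell_system g n k y j = (\<Sum>i<?M. \<phi> x y i * (x i - y i)))" ..
  from choice[OF this] obtain \<phi> where
    p: "\<forall>j. (\<forall>i<?M. continuous_on UNIV (\<lambda>(x, y). \<phi> j x y i)) \<and>
     (\<forall>x\<in>cspace ?M. \<forall>y\<in>cspace ?M. pell_system g n k x j - pell_system g n k y j = (\<Sum>i<?M. \<phi> j x y i * (x i - y i)))" ..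
  define \<Phi> where "\<Phi> x y j i = \<phi> j x y i" for x y j i
  have 1: "pell_system g n k x j - pell_system g n k y j = (\<Sum>i<?M. \<Phi> x y j i * (x i - y i))"
    if "x \<in> cspace ?M" "y \<in> cspace ?M" for x y j
    unfolding \<Phi>_def using p that by blast
  have 2: "continuous_on UNIV (\<lambda>(x, y). \<Phi> x y j i)" if "i < ?M" for j i
    unfolding \<Phi>_def using p that by blast
  have 3: "has_grad ?M (\<lambda>x. pell_system g n k x j) (\<Phi> x x j) x" if x: "x \<in> cspace ?M" for x j
  proof (rule has_gradI)
    fix i assume "i < ?M"
    then have "isCont (\<lambda>(x, y). \<Phi> x y j i) (x, x)"
      using 2 continuous_on_eq_continuous_at[OF open_UNIV] by blast
    moreover have "((\<lambda>w. w) \<longlongrightarrow> x) (nb ?M x)" by (simp add: nb_def filterlim_def filtermap_ident)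
    ultimately show "((\<lambda>w. \<Phi> w x j i) \<longlongrightarrow> \<Phi> x x j i) (nb ?M x)"
      using isCont_tendsto_compose[OF _ tendsto_Pair[OF _ tendsto_const], of x x "\<lambda>(x, y). \<Phi> x y j i" "\<lambda>w. w" "nb ?M x"]
      by simp
  next
    show "\<forall>\<^sub>F w in nb ?M x. pell_system g n k w j - pell_system g n k x j = (\<Sum>i<?M. \<Phi> w x j i * (w i - x i))"
      using eventually_nb_cspace by (rule eventually_mono) (rule 1[OF _ x])
  qed
  show ?thesis
    by (rule that[of \<Phi>]; intro ballI allI impI) (rule 1 2 pell_system_gradient[OF _ _ 3]; assumption)+
qed

lemma pell_linear_surj:
  assumes H: "monic_poly (2 * g + 2) x \<in> H_tilde g"
    and s: "monic_solution g n (monic_poly (2 * g + 2) x) (dec_P g n x) (dec_Q g n x)"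
  shows "\<exists>v\<in>cspace (sol_dim g n). \<forall>j<2 * n - 1. coeff (pell_linear g n x v) (j + 1) = y j"
proof -
  define Y where "Y = (\<Sum>j<2 * n - 1. monom (y j) (j + 1))"
  have cY: "coeff Y (j + 1) = y j" if "j < 2 * n - 1" for j
    using that by (simp add: Y_def coeff_sum)
  have "dlt Y (2 * n)"
    unfolding dlt_iff_coeff Y_def by (auto simp: coeff_sum intro!: sum.neutral)
  from linearization_surjective[OF H s this] obtain Dd Pd Qd where
    d: "dlt Dd (2 * g + 2)" "dlt Pd n" "dlt Qd (n - g - 1)" and
    eq: "2 * dec_P g n x * Pd - Dd * (dec_Q g n x)\<^sup>2 - 2 * monic_poly (2 * g + 2) x * dec_Q g n x * Qd = Y"
    by blast
  have "pell_linear g n x (lift_with g n (coeff Dd) Pd Qd) = Y"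
    unfolding pell_linear_lift_with[OF d] eq ..
  then show ?thesis using cY by (intro bexI[of _ "lift_with g n (coeff Dd) Pd Qd"]) simp_all
qed

text \<open>The infinitesimal translation and (below) dilation are tangent to the solution set; they show that
  the slice equations are independent of the others.\<close>

lemma pell_tangent_translation:
  assumes s: "monic_solution g n (monic_poly (2 * g + 2) x) (dec_P g n x) (dec_Q g n x)"
  shows "\<exists>v\<in>cspace (sol_dim g n). pell_linear g n x v = 0 \<and> v (2 * g + 1) = of_nat (2 * g + 2)"
proof -
  let ?D = "monic_poly (2 * g + 2) x" and ?P = "dec_P g n x" and ?Q = "dec_Q g n x"
  have dl: "dlt (pderiv p) N" if "degree p = N" for p N
    using that by (auto simp: dlt_iff_coeff coeff_pderiv coeff_eq_0)
  have d: "dlt (pderiv ?D) (2 * g + 2)" "dlt (pderiv ?P) n" "dlt (pderiv ?Q) (n - g - 1)"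
    by (auto intro!: dl simp: dec_P_def dec_Q_def)
  let ?v = "lift_with g n (coeff (pderiv ?D)) (pderiv ?P) (pderiv ?Q)"
  obtain c where c: "?P\<^sup>2 - ?D * ?Q\<^sup>2 = [:c:]"
    using s degree_eq_zeroE unfolding monic_solution_def by blast
  have "pell_linear g n x ?v = pderiv (?P\<^sup>2 - ?D * ?Q\<^sup>2)"
    unfolding pell_linear_lift_with[OF d] by (simp add: power2_eq_square pderiv_diff pderiv_mult algebra_simps)
  also have "\<dots> = 0" unfolding c by (simp add: pderiv_pCons)
  finally have "pell_linear g n x ?v = 0" .
  moreover have "?v (2 * g + 1) = of_nat (2 * g + 2)"
    using coeff_monic_poly_self[of "2 * g + 2" x] by (simp add: lift_with_def coeff_pderiv)
  ultimately show ?thesis by (intro bexI[of _ ?v]) simp_all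
qed

lemma euler_expansion:
  fixes P :: "'a :: comm_ring_1"
  shows "2 * P * (X * P' - n * P) - (X * D' - N * D) * Q\<^sup>2 - 2 * D * Q * (X * Q' - m * Q) =
    X * (2 * P * P' - (D' * Q\<^sup>2 + 2 * D * Q * Q')) - (2 * n) * P\<^sup>2 + (N + 2 * m) * (D * Q\<^sup>2)"
  by (simp add: algebra_simps power2_eq_square)

text \<open>The derivative at a = 1 of a^(-N) p(a x). On monic polynomials of degree N it kills the
  leading term.\<close>

definition euler_op :: "nat \<Rightarrow> complex poly \<Rightarrow> complex poly" where
  "euler_op N p = [:0, 1:] * pderiv p - of_nat N * p"

lemma coeff_euler_op: "coeff (euler_op N p) i = (of_nat i - of_nat N) * coeff p i"
  by (cases i) (simp_all add: euler_op_def coeff_pderiv of_nat_poly algebra_simps)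

text \<open>Dilation also rescales the constant c = P^2 - D Q^2, with weight 2 n, so the linearised
  norm is the constant -2 n c. The constant coefficient is not among the equations, so the vector is
  tangent nevertheless.\<close>

lemma pell_tangent_euler:
  assumes s: "monic_solution g n (monic_poly (2 * g + 2) x) (dec_P g n x) (dec_Q g n x)"
  shows "\<exists>v\<in>cspace (sol_dim g n). degree (pell_linear g n x v) = 0 \<and>
     (\<forall>i<2 * g + 2. v i = (of_nat i - of_nat (2 * g + 2)) * x i)"
proof -
  let ?D = "monic_poly (2 * g + 2) x" and ?P = "dec_P g n x" and ?Q = "dec_Q g n x"
  have n: "g < n" using s by (simp add: monic_solution_def)
  have dl: "dlt (euler_op N p) N" if "degree p = N" for p N
    using that by (auto simp: dlt_iff_coeff coeff_euler_op coeff_eq_0) (metis le_degree coeff_eq_0 le_neq_implies_less)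
  have d: "dlt (euler_op (2 * g + 2) ?D) (2 * g + 2)" "dlt (euler_op n ?P) n" "dlt (euler_op (n - g - 1) ?Q) (n - g - 1)"
    by (auto intro!: dl simp: dec_P_def dec_Q_def)
  let ?v = "lift_with g n (coeff (euler_op (2 * g + 2) ?D)) (euler_op n ?P) (euler_op (n - g - 1) ?Q)"
  obtain c where c: "?P\<^sup>2 - ?D * ?Q\<^sup>2 = [:c:]"
    using s degree_eq_zeroE unfolding monic_solution_def by blast
  have w: "of_nat (2 * n) = (of_nat (2 * g + 2) + 2 * of_nat (n - g - 1) :: complex poly)"
    using n by (simp add: of_nat_diff)
  have "pell_linear g n x ?v = [:0, 1:] * pderiv (?P\<^sup>2 - ?D * ?Q\<^sup>2) - of_nat (2 * n) * ?P\<^sup>2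
      + (of_nat (2 * g + 2) + 2 * of_nat (n - g - 1)) * (?D * ?Q\<^sup>2)"
  proof -
    have p: "pderiv (?P\<^sup>2 - ?D * ?Q\<^sup>2) = 2 * ?P * pderiv ?P - (pderiv ?D * ?Q\<^sup>2 + 2 * ?D * ?Q * pderiv ?Q)"
      by (simp add: power2_eq_square pderiv_diff pderiv_mult algebra_simps)
    show ?thesis
      unfolding pell_linear_lift_with[OF d] p of_nat_mult[of 2 n] of_nat_numeral
      unfolding euler_op_def by (rule euler_expansion)
  qed
  also have "\<dots> = - of_nat (2 * n) * [:c:]"
  proof -
    have "pderiv (?P\<^sup>2 - ?D * ?Q\<^sup>2) = 0" unfolding c by (simp add: pderiv_pCons)
    then show ?thesis unfolding w[symmetric] c[symmetric] by (simp only: right_diff_distrib mult_zero_right) simp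
  qed
  finally have "degree (pell_linear g n x ?v) = 0" by (simp add: of_nat_poly)
  moreover have "?v i = (of_nat i - of_nat (2 * g + 2)) * x i" if "i < 2 * g + 2" for i
    using that by (simp add: lift_with_def coeff_euler_op coeff_monic_poly)
  ultimately show ?thesis by (intro bexI[of _ ?v]) simp_all
qed

lemma pell_linear_add: "pell_linear g n x (v + w) = pell_linear g n x v + pell_linear g n x w"
proof -
  have 1: "low_poly N (\<lambda>i. v (a + i) + w (a + i)) = low_poly N (\<lambda>i. v (a + i)) + low_poly N (\<lambda>i. w (a + i))" for N a v w
    by (simp add: poly_eq_iff coeff_low_poly)
  have 2: "low_poly N (v + w) = low_poly N v + low_poly N w" for N v w
    by (simp add: poly_eq_iff coeff_low_poly)
  show ?thesis unfolding pell_linear_def plus_fun_apply 1 2 by (simp add: algebra_simps)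
qed

lemma pell_linear_scale: "pell_linear g n x (\<lambda>i. a * v i) = smult a (pell_linear g n x v)"
proof -
  have 1: "low_poly N (\<lambda>i. a * v (b + i)) = smult a (low_poly N (\<lambda>i. v (b + i)))" for N b v
    by (simp add: poly_eq_iff coeff_low_poly)
  have 2: "low_poly N (\<lambda>i. a * v i) = smult a (low_poly N v)" for N v
    by (simp add: poly_eq_iff coeff_low_poly)
  show ?thesis unfolding pell_linear_def 1 2 by (simp add: smult_diff_right)
qed

text \<open>A preimage for the first 2 n - 1 equations is corrected by the two tangent vectors.
  Translation moves the coefficient of index 2 g + 1 by 2 g + 2. At a centred point dilation fixes
  that coefficient and moves the k-th one, which is 1 there, by k - (2 g + 2), a nonzero
  number.\<close>

lemma pell_slice_linear_surj:
  assumes H: "monic_poly (2 * g + 2) x \<in> H_tilde g"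
    and s: "monic_solution g n (monic_poly (2 * g + 2) x) (dec_P g n x) (dec_Q g n x)"
    and x: "x (2 * g + 1) = 0" "x k = 1" and k: "k < 2 * g + 1"
  shows "\<exists>v\<in>cspace (sol_dim g n). (\<forall>j<2 * n - 1. coeff (pell_linear g n x v) (j + 1) = y j) \<and>
     v (2 * g + 1) = a \<and> v k = b"
proof -
  obtain v0 where v0: "v0 \<in> cspace (sol_dim g n)" "\<And>j. j < 2 * n - 1 \<Longrightarrow> coeff (pell_linear g n x v0) (j + 1) = y j"
    using pell_linear_surj[OF H s] by blast
  obtain t where t: "t \<in> cspace (sol_dim g n)" "pell_linear g n x t = 0" "t (2 * g + 1) = of_nat (2 * g + 2)"
    using pell_tangent_translation[OF s] by blast
  obtain e where e: "e \<in> cspace (sol_dim g n)" "degree (pell_linear g n x e) = 0"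
    "\<And>i. i < 2 * g + 2 \<Longrightarrow> e i = (of_nat i - of_nat (2 * g + 2)) * x i"
    using pell_tangent_euler[OF s] by blast
  have e1: "e (2 * g + 1) = 0" using e(3)[of "2 * g + 1"] x(1) by simp
  have "(of_nat k :: complex) \<noteq> of_nat (2 * g + 2)" using k by (metis less_irrefl less_Suc_eq add_2_eq_Suc' add.commute less_trans Suc_eq_plus1 of_nat_eq_iff)
  then have ek: "e k \<noteq> 0" using e(3)[of k] x(2) k by simp
  have N: "(of_nat (2 * g + 2) :: complex) \<noteq> 0" by (metis of_nat_eq_0_iff add_is_0 zero_neq_numeral)
  define \<alpha> where "\<alpha> = (a - v0 (2 * g + 1)) / of_nat (2 * g + 2)"
  define \<beta> where "\<beta> = (b - v0 k - \<alpha> * t k) / e k"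
  define v where "v = v0 + (\<lambda>i. \<alpha> * t i) + (\<lambda>i. \<beta> * e i)"
  have "v \<in> cspace (sol_dim g n)" unfolding v_def using v0(1) t(1) e(1) by auto
  moreover have "coeff (pell_linear g n x v) (j + 1) = y j" if "j < 2 * n - 1" for j
    unfolding v_def pell_linear_add pell_linear_scale t(2) using v0(2)[OF that] e(2) by (simp add: coeff_eq_0)
  moreover have "v (2 * g + 1) = a" unfolding v_def using t(3) e1 N by (simp add: \<alpha>_def del: of_nat_add of_nat_mult of_nat_Suc)
  moreover have "v k = b" unfolding v_def using ek by (simp add: \<beta>_def)
  ultimately show ?thesis by blast
qed

text \<open>K = 2 n - 1 gives the whole space and K = 2 n + 1 a slice, so that one parametrisation
  lemma serves both. The equations concern the triple, while the elements are coefficient vectors of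
  D.\<close>

definition pell_part :: "nat \<Rightarrow> nat \<Rightarrow> nat \<Rightarrow> nat \<Rightarrow> cvec set" where
  "pell_part g n k K = {z \<in> A_tilde_coeffs g n. \<forall>j<K. pell_system g n k (the_lift g n z) j = 0}"

lemma the_lift_in_cspace [simp]: "the_lift g n z \<in> cspace (sol_dim g n)"
  by (simp add: the_lift_def Let_def)

lemma the_lift_props:
  assumes n: "n \<ge> 1" and z: "z \<in> A_tilde_coeffs g n"
  shows "truncate (2 * g + 2) (the_lift g n z) = z" "monic_poly (2 * g + 2) (the_lift g n z) = monic_poly (2 * g + 2) z"
    "monic_solution g n (monic_poly (2 * g + 2) z) (dec_P g n (the_lift g n z)) (dec_Q g n (the_lift g n z))"
proof -
  obtain P Q where s: "monic_solution g n (monic_poly (2 * g + 2) z) P Q"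
    and H: "monic_poly (2 * g + 2) z \<in> H_tilde g" and zc: "z \<in> cspace (2 * g + 2)"
    using z unfolding A_tilde_coeffs_iff[OF n] reduced_def by blast
  have e: "the_lift g n z = lift_with g n z P Q" by (rule the_lift_eq[OF H s])
  show t: "truncate (2 * g + 2) (the_lift g n z) = z" unfolding e by (rule truncate_lift[OF zc])
  show "monic_poly (2 * g + 2) (the_lift g n z) = monic_poly (2 * g + 2) z"
    using monic_poly_truncate[of "2 * g + 2" "the_lift g n z"] unfolding t by simp
  show "monic_solution g n (monic_poly (2 * g + 2) z) (dec_P g n (the_lift g n z)) (dec_Q g n (the_lift g n z))"
    unfolding e dec_lift_with[OF s] by (rule s)
qed

lemma truncate_solution:
  assumes n: "n \<ge> 1" and x: "x \<in> cspace (sol_dim g n)" and r: "reduced g n (truncate (2 * g + 2) x)"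
    and s: "monic_solution g n (monic_poly (2 * g + 2) x) (dec_P g n x) (dec_Q g n x)"
  shows "truncate (2 * g + 2) x \<in> A_tilde_coeffs g n" "the_lift g n (truncate (2 * g + 2) x) = x"
proof -
  have "truncate (2 * g + 2) x \<in> cspace (2 * g + 2)" by simp
  then show "truncate (2 * g + 2) x \<in> A_tilde_coeffs g n"
    unfolding A_tilde_coeffs_iff[OF n] monic_poly_truncate using r s by blast
  have "monic_poly (2 * g + 2) (truncate (2 * g + 2) x) \<in> H_tilde g" using r by (simp add: reduced_def)
  from the_lift_eq[OF this, of n "dec_P g n x" "dec_Q g n x"] s
  show "the_lift g n (truncate (2 * g + 2) x) = x"
    using lift_with_dec[OF x] by simp
qed

section \<open>Local parametrisations of the space and of its slices\<close>

lemma holomorphic_map_jacobian: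
  assumes "holomorphic_map m k U f" "z \<in> U"
  obtains J where "has_jacobian m k f J z"
  using assms unfolding holomorphic_map_def by blast

lemma holomorphic_map_dom: "holomorphic_map m k U f \<Longrightarrow> z \<in> U \<Longrightarrow> z \<in> cspace m"
  and holomorphic_map_ran: "holomorphic_map m k U f \<Longrightarrow> z \<in> U \<Longrightarrow> f z \<in> cspace k"
  and holomorphic_map_nbhd: "holomorphic_map m k U f \<Longrightarrow> z \<in> U \<Longrightarrow> eventually (\<lambda>w. w \<in> U) (nb m z)"
  unfolding holomorphic_map_def openin_cspace_iff_nb by auto

lemma holomorphic_map_lim:
  assumes f: "holomorphic_map m k U f" and z: "z \<in> U"
  shows "filterlim f (nb k (f z)) (nb m z)"
proof -
  obtain J where "has_jacobian m k f J z" by (rule holomorphic_map_jacobian[OF f z])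
  moreover have "eventually (\<lambda>w. f w \<in> cspace k) (nb m z)"
    using holomorphic_map_nbhd[OF f z] by (rule eventually_mono) (rule holomorphic_map_ran[OF f])
  ultimately show ?thesis
    by (intro has_jacobian_continuous[where f = f, OF holomorphic_map_dom[OF f z] holomorphic_map_ran[OF f z]])
qed

lemma continuous_on_coords:
  assumes U: "U \<subseteq> cspace m" and f: "\<And>z i. z \<in> U \<Longrightarrow> ((\<lambda>w. f w i) \<longlongrightarrow> f z i) (nb m z)"
  shows "continuous_on U (f :: cvec \<Rightarrow> cvec)"
proof (rule continuous_on_coordinatewise_then_product)
  fix i show "continuous_on U (\<lambda>x. f x i)"
    by (rule continuous_on_nb[OF U]) (rule f)
qed

lemma filterlim_nb_coord:
  assumes "filterlim f (nb k c) F" shows "((\<lambda>w. f w i) \<longlongrightarrow> c i) F"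
  using filterlim_compose[OF tendsto_nb_coord assms] .

lemma holomorphic_map_continuous:
  assumes f: "holomorphic_map m k U f" shows "continuous_on U f"
proof (rule continuous_on_coords)
  show "U \<subseteq> cspace m" using holomorphic_map_dom[OF f] by blast
  show "((\<lambda>w. f w i) \<longlongrightarrow> f z i) (nb m z)" if "z \<in> U" for z i
    by (rule filterlim_nb_coord[OF holomorphic_map_lim[OF f that]])
qed

lemma the_lift_tendsto:
  assumes n: "n \<ge> 1" and z: "z \<in> A_tilde_coeffs g n"
  shows "filterlim (the_lift g n) (nb (sol_dim g n) (the_lift g n z)) (at z within A_tilde_coeffs g n)"
proof -
  have "((\<lambda>w. the_lift g n w j) \<longlongrightarrow> the_lift g n z j) (at z within A_tilde_coeffs g n)" for j
    using the_lift_continuous[OF n, of g j] z unfolding continuous_on_def by blast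
  then show ?thesis by (simp add: filterlim_nb_iff)
qed

text \<open>The zero set is parametrised in the space of triples and then projected to D. The
  projection stays immersive because a vector in the kernel of the linearised equations with zero
  D-component vanishes; openness of the image and continuity of the inverse come from continuity of
  \<open>the_lift\<close>.\<close>

lemma pell_part_param:
  assumes n: "n \<ge> 1" and k: "k < 2 * g + 2" and K: "2 * n - 1 \<le> K"
    and z: "z \<in> pell_part g n k K"
    and surj: "\<And>y. \<exists>v\<in>cspace (sol_dim g n). \<forall>j<K. (if j < 2 * n - 1
         then coeff (pell_linear g n (the_lift g n z) v) (j + 1)
         else if j = 2 * n - 1 then v (2 * g + 1) else v k) = y j"
    and d: "d = sol_dim g n - K"
  obtains V \<psi> where "submanifold_param (2 * g + 2) d (pell_part g n k K) V \<psi>" "z \<in> \<psi> ` V"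
proof -
  let ?M = "sol_dim g n" and ?N = "2 * g + 2" and ?S = "pell_part g n k K"
  let ?F = "pell_system g n k"
  define p where "p = the_lift g n z"
  have zA: "z \<in> A_tilde_coeffs g n" and F0: "\<And>j. j < K \<Longrightarrow> ?F p j = 0"
    using z by (auto simp: pell_part_def p_def)
  have zc: "z \<in> cspace ?N" and zr: "reduced g n z" using zA unfolding A_tilde_coeffs_iff[OF n] by blast+
  note zl = the_lift_props[OF n zA, folded p_def]
  have gn: "g < n" using zl(3) by (simp add: monic_solution_def)
  obtain \<Phi> where
    P1': "\<forall>x\<in>cspace ?M. \<forall>y\<in>cspace ?M. \<forall>j. ?F x j - ?F y j = (\<Sum>i<?M. \<Phi> x y j i * (x i - y i))"
    and P2': "\<forall>j. \<forall>i<?M. continuous_on UNIV (\<lambda>(x, y). \<Phi> x y j i)"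
    and P3': "\<forall>x\<in>cspace ?M. \<forall>v\<in>cspace ?M. \<forall>j. (\<Sum>i<?M. \<Phi> x x j i * v i) =
        (if j < 2 * n - 1 then coeff (pell_linear g n x v) (j + 1)
         else if j = 2 * n - 1 then v (2 * g + 1) else v k)"
    by (rule pell_gradients[OF k, of n])
  note P1 = P1'[rule_format] and P2 = P2'[rule_format] and P3 = P3'[rule_format]
  have pc: "p \<in> cspace ?M" by (simp add: p_def)
  have surj': "mat_apply ?M K (\<Phi> p p) ` cspace ?M = cspace K"
  proof
    show "mat_apply ?M K (\<Phi> p p) ` cspace ?M \<subseteq> cspace K" by auto
    show "cspace K \<subseteq> mat_apply ?M K (\<Phi> p p) ` cspace ?M"
    proof
      fix y assume y: "y \<in> cspace K"
      obtain v where v: "v \<in> cspace ?M" "\<forall>j<K. (if j < 2 * n - 1 then coeff (pell_linear g n p v) (j + 1)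
         else if j = 2 * n - 1 then v (2 * g + 1) else v k) = y j" using surj[of y] unfolding p_def by blast
      have "mat_apply ?M K (\<Phi> p p) v = y"
      proof (rule cspace_eqI[OF mat_apply_in_cspace y])
        fix j assume "j < K"
        then show "mat_apply ?M K (\<Phi> p p) v j = y j"
          using P3[OF pc v(1), of j] v(2) by (simp add: mat_apply_def)
      qed
      then show "y \<in> mat_apply ?M K (\<Phi> p p) ` cspace ?M" using v(1) by blast
    qed
  qed
  \<comment> \<open>Exclusion of smaller degrees is open, so it can be imposed on the whole
    parametrised neighbourhood; every zero of the system there is the lift of a point of the
    space.\<close>
  have ok: "eventually (\<lambda>x. reduced g n (truncate ?N x)) (nb ?M p)"
  proof -
    have "filterlim (truncate ?N) (nb ?N (truncate ?N p)) (nb ?M p)"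
      unfolding filterlim_nb_iff[OF truncate_in_cspace]
      using tendsto_nb_coord[of _ p ?M] by (simp add: truncate_in_cspace) (simp add: truncate_def)
    from eventually_compose_filterlim[OF reduced_open[OF zr zc] this[unfolded zl(1)]] show ?thesis .
  qed
  obtain V \<psi> \<rho> where V: "openin (top_of_set (cspace d)) V" and KM: "K \<le> ?M"
    and psi': "\<forall>t\<in>V. \<psi> t \<in> cspace ?M \<and> reduced g n (truncate ?N (\<psi> t)) \<and> (\<forall>j<K. ?F (\<psi> t) j = 0)"
    and pV: "p \<in> \<psi> ` V"
    and nbh: "\<forall>x\<in>\<psi> ` V. eventually (\<lambda>x. (\<forall>j<K. ?F x j = 0) \<longrightarrow> x \<in> \<psi> ` V) (nb ?M x)"
    and rho': "\<forall>t\<in>V. \<rho> (\<psi> t) = t \<and> filterlim \<rho> (nb d t) (nb ?M (\<psi> t))"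
    and jac': "\<forall>t\<in>V. \<exists>J. has_jacobian d ?M \<psi> J t"
    and ij: "\<forall>t\<in>V. \<forall>J. has_jacobian d ?M \<psi> J t \<longrightarrow> inj_on (mat_apply d ?M J) (cspace d) \<and>
       (\<forall>v\<in>cspace d. mat_apply ?M K (\<Phi> (\<psi> t) (\<psi> t)) (mat_apply d ?M J v) = 0)"
    by (rule implicit_parametrization[where F = ?F and \<Phi> = \<Phi> and K = K and Ok = "\<lambda>x. reduced g n (truncate ?N x)",
          OF pc P1 P2 F0 surj' d ok])
  have psi: "\<psi> t \<in> cspace ?M" "reduced g n (truncate ?N (\<psi> t))" "\<And>j. j < K \<Longrightarrow> ?F (\<psi> t) j = 0" if "t \<in> V" for t
    using psi' that by blast+
  have rho: "\<rho> (\<psi> t) = t" "filterlim \<rho> (nb d t) (nb ?M (\<psi> t))" if "t \<in> V" for t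
    using rho' that by blast+
  note jac = jac'[rule_format]
  have inj: "inj_on (mat_apply d ?M J) (cspace d)" if "t \<in> V" "has_jacobian d ?M \<psi> J t" for t J
    using ij that by blast
  have ker: "mat_apply ?M K (\<Phi> (\<psi> t) (\<psi> t)) (mat_apply d ?M J v) = 0"
    if "t \<in> V" "has_jacobian d ?M \<psi> J t" "v \<in> cspace d" for t J v
    using ij that by blast
  define f where "f t = truncate ?N (\<psi> t)" for t
  have sol: "monic_solution g n (monic_poly ?N (\<psi> t)) (dec_P g n (\<psi> t)) (dec_Q g n (\<psi> t))" if "t \<in> V" for t
    unfolding monic_solution_iff_pell_system[OF gn, of _ k] using psi(3)[OF that] K by simp
  have fA: "f t \<in> A_tilde_coeffs g n" and lf: "the_lift g n (f t) = \<psi> t" if "t \<in> V" for t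
    unfolding f_def using truncate_solution[OF n psi(1,2)[OF that] sol[OF that]] by auto
  have fS: "f t \<in> ?S" if "t \<in> V" for t
    using fA[OF that] psi(3)[OF that] by (simp add: pell_part_def lf[OF that])
  have V_sub: "V \<subseteq> cspace d" using V openin_imp_subset by blast
  have fjac: "has_jacobian d ?N f J t" if t: "t \<in> V" and J: "has_jacobian d ?M \<psi> J t" for t J
  proof -
    have tc: "t \<in> cspace d" using V_sub t by blast
    show ?thesis
      unfolding has_jacobian_iff_grad[OF tc]
    proof (intro allI impI)
      fix j assume j: "j < ?N"
      then have "j < ?M" by (simp add: sol_dim_def)
      then have "has_grad d (\<lambda>w. \<psi> w j) (J j) t" using J unfolding has_jacobian_iff_grad[OF tc] by blast
      then show "has_grad d (\<lambda>w. f w j) (J j) t" using j by (simp add: f_def truncate_def)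
    qed
  qed
  have hol: "holomorphic_map d ?N V f"
    unfolding holomorphic_map_def
  proof (intro conjI V ballI)
    show "f ` V \<subseteq> cspace ?N" by (auto simp: f_def)
    fix t assume t: "t \<in> V"
    obtain J where "has_jacobian d ?M \<psi> J t" using jac[OF t] by blast
    from fjac[OF t this] show "\<exists>J. has_jacobian d ?N f J t" by blast
  qed
  have imm: "holomorphic_immersion d ?N V f"
    unfolding holomorphic_immersion_def
  proof (intro conjI hol ballI allI impI)
    fix t J' assume t: "t \<in> V" and J': "has_jacobian d ?N f J' t"
    have tc: "t \<in> cspace d" using V_sub t by blast
    obtain J where J: "has_jacobian d ?M \<psi> J t" using jac[OF t] by blast
    show "inj_on (mat_apply d ?N J') (cspace d)"
    proof (rule inj_onI)
      fix v w assume v: "v \<in> cspace d" "w \<in> cspace d" and eq: "mat_apply d ?N J' v = mat_apply d ?N J' w"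
      define u where "u = v - w"
      have u: "u \<in> cspace d" using v by (auto simp: u_def)
      have "mat_apply d ?N J' u = 0" unfolding u_def mat_apply_diff eq by simp
      then have Ju: "mat_apply d ?N J u = 0"
        using has_jacobian_unique[OF tc u J' fjac[OF t J]] by simp
      define b where "b = mat_apply d ?M J u"
      \<comment> \<open>The D-component of b is the projected Jacobian applied to u, which is zero;
        differentiating the equations along \<psi> puts b into the kernel of the linearised
        system.\<close>
      have "b = 0"
      proof (rule pell_linear_kernel)
        show "monic_poly ?N (\<psi> t) \<in> H_tilde g" using psi(2)[OF t] by (simp add: reduced_def)
        show "monic_solution g n (monic_poly ?N (\<psi> t)) (dec_P g n (\<psi> t)) (dec_Q g n (\<psi> t))" by (rule sol[OF t])
        show bc: "b \<in> cspace ?M" by (simp add: b_def)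
        show "b i = 0" if "i < ?N" for i
          using fun_cong[OF Ju, of i] that by (simp add: b_def mat_apply_def sol_dim_def)
        show "coeff (pell_linear g n (\<psi> t) b) (j + 1) = 0" if "j < 2 * n - 1" for j
          using fun_cong[OF ker[OF t J u], of j] P3[OF psi(1)[OF t] bc, of j] that K by (simp add: b_def mat_apply_def)
      qed
      moreover have "mat_apply d ?M J 0 = 0" by simp
      ultimately have "u = 0" using inj_onD[OF inj[OF t J], of u 0] u by (simp add: b_def)
      then show "v = w" by (simp add: u_def)
    qed
  qed
  have inv: "\<rho> (the_lift g n (f t)) = t" if "t \<in> V" for t using lf[OF that] rho(1)[OF that] by simp
  \<comment> \<open>The range of \<psi> contains all zeros near \<psi> t. By continuity of
    \<open>the_lift\<close>, a point of the set near f t has its lift near \<psi> t, hence in that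
    range.\<close>
  have opn: "openin (top_of_set ?S) (f ` V)"
  proof (subst openin_subopen, intro ballI)
    fix w assume "w \<in> f ` V"
    then obtain t where t: "t \<in> V" "w = f t" by blast
    have "eventually (\<lambda>x. (\<forall>j<K. ?F x j = 0) \<longrightarrow> x \<in> \<psi> ` V) (nb ?M (\<psi> t))" using nbh t(1) by blast
    then obtain T where T: "open T" "\<psi> t \<in> T" "\<And>x. x \<in> T \<Longrightarrow> x \<in> cspace ?M \<Longrightarrow> (\<forall>j<K. ?F x j = 0) \<Longrightarrow> x \<in> \<psi> ` V"
      unfolding nb_def eventually_inf_principal eventually_nhds by blast
    have "continuous_on (A_tilde_coeffs g n) (the_lift g n)"
      by (rule continuous_on_coordinatewise_then_product) (rule the_lift_continuous[OF n])
    then have "continuous_on ?S (the_lift g n)" by (rule continuous_on_subset) (auto simp: pell_part_def)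
    from continuous_openin_preimage_gen[OF this T(1)]
    have "openin (top_of_set ?S) (?S \<inter> the_lift g n -` T)" .
    moreover have "w \<in> ?S \<inter> the_lift g n -` T" using t T(2) fS lf by simp
    moreover have "?S \<inter> the_lift g n -` T \<subseteq> f ` V"
    proof
      fix q assume q: "q \<in> ?S \<inter> the_lift g n -` T"
      then have "the_lift g n q \<in> \<psi> ` V" by (intro T(3)) (auto simp: pell_part_def)
      then obtain t' where t': "t' \<in> V" "the_lift g n q = \<psi> t'" by blast
      have "q = f t'" unfolding f_def t'(2)[symmetric] using the_lift_props(1)[OF n] q by (simp add: pell_part_def)
      then show "q \<in> f ` V" using t'(1) by blast
    qed
    ultimately show "\<exists>T. openin (top_of_set ?S) T \<and> w \<in> T \<and> T \<subseteq> f ` V" by blast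
  qed
  have "homeomorphic_maps (top_of_set V) (top_of_set (f ` V)) f (\<lambda>w. \<rho> (the_lift g n w))"
    unfolding homeomorphic_maps_def
  proof (intro conjI)
    show "continuous_map (top_of_set V) (top_of_set (f ` V)) f"
      using holomorphic_map_continuous[OF hol] by (simp add: continuous_map_in_subtopology)
    have "continuous_on (f ` V) (\<lambda>w. \<rho> (the_lift g n w))"
    proof (rule continuous_on_coordinatewise_then_product)
      fix i
      show "continuous_on (f ` V) (\<lambda>w. \<rho> (the_lift g n w) i)"
        unfolding continuous_on_def
      proof
        fix w assume "w \<in> f ` V"
        then obtain t where t: "t \<in> V" "w = f t" by blast
        have "((\<lambda>w. \<rho> (the_lift g n w) i) \<longlongrightarrow> t i) (at (f t) within A_tilde_coeffs g n)"
          using filterlim_compose[OF filterlim_nb_coord[OF rho(2)[OF t(1)]] the_lift_tendsto[OF n fA[OF t(1)], unfolded lf[OF t(1)]]] .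
        then have "((\<lambda>w. \<rho> (the_lift g n w) i) \<longlongrightarrow> t i) (at (f t) within f ` V)"
          by (rule tendsto_within_subset) (use fA in blast)
        then show "((\<lambda>w. \<rho> (the_lift g n w) i) \<longlongrightarrow> \<rho> (the_lift g n w) i) (at w within f ` V)"
          unfolding t(2) inv[OF t(1)] .
      qed
    qed
    then show "continuous_map (top_of_set (f ` V)) (top_of_set V) (\<lambda>w. \<rho> (the_lift g n w))"
      using inv by (auto simp: continuous_map_in_subtopology)
    show "\<forall>x\<in>topspace (top_of_set V). \<rho> (the_lift g n (f x)) = x" using inv by simp
    show "\<forall>y\<in>topspace (top_of_set (f ` V)). f (\<rho> (the_lift g n y)) = y" using inv by auto
  qed
  then have "homeomorphic_map (top_of_set V) (top_of_set (f ` V)) f"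
    unfolding homeomorphic_map_maps by blast
  with imm opn have "submanifold_param ?N d ?S V f" by (simp add: submanifold_param_def)
  moreover have "z \<in> f ` V"
  proof -
    obtain t where "t \<in> V" "p = \<psi> t" using pV by blast
    then show ?thesis using zl(1) by (auto simp: f_def)
  qed
  ultimately show ?thesis using that by blast
qed

definition slice :: "nat \<Rightarrow> nat \<Rightarrow> nat \<Rightarrow> cvec set" where
  "slice g n k = {z \<in> A_tilde_coeffs g n. z (2 * g + 1) = 0 \<and> z k = 1}"

lemma A_tilde_submanifold:
  assumes n: "n \<ge> 1"
  shows "complex_submanifold (2 * g + 2) (g + 2) (A_tilde_coeffs g n)"
  unfolding complex_submanifold_def
proof (intro conjI ballI)
  show "A_tilde_coeffs g n \<subseteq> cspace (2 * g + 2)" by (auto simp: A_tilde_coeffs_def)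
  fix z assume z: "z \<in> A_tilde_coeffs g n"
  \<comment> \<open>For K = 2 n - 1 only the Pell equations are imposed, and lifts of points of the
    space satisfy them.\<close>
  have part: "pell_part g n 0 (2 * n - 1) = A_tilde_coeffs g n"
  proof -
    have "pell_system g n 0 (the_lift g n w) j = 0" if "w \<in> A_tilde_coeffs g n" "j < 2 * n - 1" for w j
    proof -
      note l = the_lift_props[OF n that(1)]
      have "g < n" using l(3) by (simp add: monic_solution_def)
      from monic_solution_iff_pell_system[OF this, of "the_lift g n w" 0] l that(2) show ?thesis by simp
    qed
    then show ?thesis by (auto simp: pell_part_def)
  qed
  note l = the_lift_props[OF n z]
  have gn: "g < n" using l(3) by (simp add: monic_solution_def)
  have H: "monic_poly (2 * g + 2) z \<in> H_tilde g" using z by (simp add: A_tilde_coeffs_iff[OF n] reduced_def)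
  have sj: "\<exists>v\<in>cspace (sol_dim g n). \<forall>j<2 * n - 1. (if j < 2 * n - 1
         then coeff (pell_linear g n (the_lift g n z) v) (j + 1)
         else if j = 2 * n - 1 then v (2 * g + 1) else v 0) = y j" for y
    using pell_linear_surj[of g "the_lift g n z" n y] H l by simp
  have dm: "g + 2 = sol_dim g n - (2 * n - 1)" using gn by (simp add: sol_dim_def)
  obtain V \<psi> where "submanifold_param (2 * g + 2) (g + 2) (pell_part g n 0 (2 * n - 1)) V \<psi>" "z \<in> \<psi> ` V"
    by (rule pell_part_param[OF n _ order_refl z[folded part] sj dm]) simp
  then show "\<exists>V \<psi>. submanifold_param (2 * g + 2) (g + 2) (A_tilde_coeffs g n) V \<psi> \<and> z \<in> \<psi> ` V"
    unfolding part by blast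
qed

lemma slice_submanifold:
  assumes n: "n \<ge> 1" and k: "k < 2 * g + 1"
  shows "complex_submanifold (2 * g + 2) g (slice g n k)"
  unfolding complex_submanifold_def
proof (intro conjI ballI)
  show "slice g n k \<subseteq> cspace (2 * g + 2)" by (auto simp: slice_def A_tilde_coeffs_def)
  fix z assume zs: "z \<in> slice g n k"
  have coord: "the_lift g n w i = w i" if "w \<in> A_tilde_coeffs g n" "i < 2 * g + 2" for w i
    using fun_cong[OF the_lift_props(1)[OF n that(1)], of i] that(2) by (simp add: truncate_def)
  \<comment> \<open>Index 2 n - 1 centres the polynomial and index 2 n normalises the k-th
    coefficient; the smaller indices are the Pell equations, satisfied by every lift.\<close>
  have part: "pell_part g n k (2 * n + 1) = slice g n k"
  proof -
    have "(\<forall>j<2 * n + 1. pell_system g n k (the_lift g n w) j = 0) \<longleftrightarrow> w (2 * g + 1) = 0 \<and> w k = 1"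
      if "w \<in> A_tilde_coeffs g n" for w
    proof -
      note l = the_lift_props[OF n that]
      have "g < n" using l(3) by (simp add: monic_solution_def)
      from monic_solution_iff_pell_system[OF this, of "the_lift g n w" k] l
      have 1: "pell_system g n k (the_lift g n w) j = 0" if "j < 2 * n - 1" for j using that by simp
      have 2: "pell_system g n k (the_lift g n w) (2 * n - 1) = w (2 * g + 1)"
        using coord[OF that, of "2 * g + 1"] by (simp add: pell_system_def)
      have 3: "pell_system g n k (the_lift g n w) (2 * n) = w k - 1"
      proof -
        have "\<not> 2 * n < 2 * n - 1" "2 * n \<noteq> 2 * n - 1" using n by auto
        then show ?thesis
          using coord[OF that, of k] k unfolding pell_system_def by (simp only: if_False)
      qed
      have "j < 2 * n + 1 \<longleftrightarrow> j < 2 * n - 1 \<or> j = 2 * n - 1 \<or> j = 2 * n" for j using n by auto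
      then show ?thesis using 1 2 3 by (metis eq_iff_diff_eq_0)
    qed
    then show ?thesis by (auto simp: pell_part_def slice_def)
  qed
  have z: "z \<in> A_tilde_coeffs g n" "z (2 * g + 1) = 0" "z k = 1" using zs by (auto simp: slice_def)
  note l = the_lift_props[OF n z(1)]
  have gn: "g < n" using l(3) by (simp add: monic_solution_def)
  have H: "monic_poly (2 * g + 2) z \<in> H_tilde g" using z by (simp add: A_tilde_coeffs_iff[OF n] reduced_def)
  have sj: "\<exists>v\<in>cspace (sol_dim g n). \<forall>j<2 * n + 1. (if j < 2 * n - 1
         then coeff (pell_linear g n (the_lift g n z) v) (j + 1)
         else if j = 2 * n - 1 then v (2 * g + 1) else v k) = y j" for y
  proof -
    have x: "the_lift g n z (2 * g + 1) = 0" "the_lift g n z k = 1"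
      using coord[OF z(1)] z(2,3) k by auto
    obtain v where v: "v \<in> cspace (sol_dim g n)"
      "\<And>j. j < 2 * n - 1 \<Longrightarrow> coeff (pell_linear g n (the_lift g n z) v) (j + 1) = y j"
      "v (2 * g + 1) = y (2 * n - 1)" "v k = y (2 * n)"
      using pell_slice_linear_surj[of g "the_lift g n z" n k y "y (2 * n - 1)" "y (2 * n)", OF _ _ x k] H l by auto
    show ?thesis
    proof (intro bexI[of _ v] allI impI v(1))
      fix j assume "j < 2 * n + 1"
      then consider "j < 2 * n - 1" | "j = 2 * n - 1" | "j = 2 * n" "\<not> j < 2 * n - 1" "j \<noteq> 2 * n - 1"
        using n by linarith
      then show "(if j < 2 * n - 1 then coeff (pell_linear g n (the_lift g n z) v) (j + 1)
         else if j = 2 * n - 1 then v (2 * g + 1) else v k) = y j"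
        by cases (use v in auto)
    qed
  qed
  have dm: "g = sol_dim g n - (2 * n + 1)" using gn by (simp add: sol_dim_def)
  obtain V \<psi> where "submanifold_param (2 * g + 2) g (pell_part g n k (2 * n + 1)) V \<psi>" "z \<in> \<psi> ` V"
    by (rule pell_part_param[OF n _ _ zs[folded part] sj dm]) (use k in simp_all)
  then show "\<exists>V \<psi>. submanifold_param (2 * g + 2) g (slice g n k) V \<psi> \<and> z \<in> \<psi> ` V"
    unfolding part by blast
qed

section \<open>The affine action and its slices\<close>

lemma degree_pcompose_linear: "a \<noteq> 0 \<Longrightarrow> degree (pcompose p [:b, a:]) = degree (p :: complex poly)"
  by (simp add: degree_pcompose)

lemma degree_affine_act: "a \<noteq> 0 \<Longrightarrow> degree (affine_act a b D) = degree D"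
  by (simp add: affine_act_def degree_pcompose)

text \<open>Substitution acts from the right: (a', b') first and (a, b) second amounts to inserting
  a' (a x + b) + b'.\<close>

lemma affine_act_compose:
  assumes "a' \<noteq> 0"
  shows "affine_act a b (affine_act a' b' D) = affine_act (a' * a) (a' * b + b') D"
proof -
  have "pcompose (pcompose D [:b', a':]) [:b, a:] = pcompose D [:a' * b + b', a' * a:]"
    by (simp add: pcompose_assoc[symmetric] pcompose_pCons algebra_simps)
  then show ?thesis
    using degree_affine_act[OF assms, of b' D]
    by (simp add: affine_act_def pcompose_smult power_mult_distrib mult.commute)
qed

lemma affine_act_id [simp]: "affine_act 1 0 D = D"
  by (simp add: affine_act_def pcompose_idR)

lemma lead_coeff_affine_act:
  assumes "a \<noteq> 0" shows "lead_coeff (affine_act a b D) = lead_coeff D"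
proof -
  have "lead_coeff (pcompose D [:b, a:]) = lead_coeff D * a ^ degree D"
    using lead_coeff_comp[of "[:b, a:]" D] assms by simp
  then have "lead_coeff (affine_act a b D) = inverse a ^ degree D * (lead_coeff D * a ^ degree D)"
    by (simp only: affine_act_def lead_coeff_smult)
  then show ?thesis using assms by (simp add: power_inverse)
qed

lemma affine_act_inverse:
  assumes "a \<noteq> 0"
  shows "affine_act (inverse a) (- b / a) (affine_act a b D) = D"
  using affine_act_compose[OF assms, of "inverse a" "- b / a" b D] assms by simp

lemma affine_act_H_tilde:
  assumes a: "a \<noteq> 0" and D: "D \<in> H_tilde g"
  shows "affine_act a b D \<in> H_tilde g"
proof -
  have "\<not> (poly (affine_act a b D) x = 0 \<and> poly (pderiv (affine_act a b D)) x = 0)" for x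
  proof
    assume R: "poly (affine_act a b D) x = 0 \<and> poly (pderiv (affine_act a b D)) x = 0"
    have "poly D (b + x * a) = 0" using R a by (simp add: affine_act_def poly_pcompose)
    moreover have "poly (pderiv D) (b + x * a) = 0"
      using R a by (simp add: affine_act_def pderiv_smult pderiv_pcompose poly_pcompose pderiv_pCons)
    ultimately show False using D unfolding H_tilde_def rsquarefree_roots by blast
  qed
  then have "rsquarefree (affine_act a b D)" by (simp add: rsquarefree_roots)
  moreover have "lead_coeff (affine_act a b D) = 1" "degree (affine_act a b D) = 2 * g + 2"
    by (rule trans[OF lead_coeff_affine_act[OF a] H_tildeD(1)[OF D]] trans[OF degree_affine_act[OF a] H_tildeD(2)[OF D]])+
  ultimately show ?thesis unfolding H_tilde_def by blast
qed

text \<open>The factor a^(- deg D) is absorbed by Q: since deg D = 2 (g + 1) is even, multiplying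
  Q(a x + b) by a^(g+1) restores the equation.\<close>

lemma pell_abel_affine_act:
  assumes a: "a \<noteq> 0" and D: "D \<in> H_tilde g" and p: "pell_abel D P Q"
  shows "\<exists>P' Q'. pell_abel (affine_act a b D) P' Q' \<and> degree P' = degree P"
proof -
  let ?l = "[:b, a:]"
  have dD: "degree D = 2 * (g + 1)" using H_tildeD(2)[OF D] by simp
  have "affine_act a b D * (smult (a ^ (g + 1)) (pcompose Q ?l))\<^sup>2 = pcompose D ?l * (pcompose Q ?l)\<^sup>2"
  proof -
    have "(a ^ (g + 1))\<^sup>2 = a ^ degree D" unfolding dD by (simp only: power_mult[symmetric] mult.commute)
    then have 1: "inverse a ^ degree D * (a ^ (g + 1))\<^sup>2 = 1" using a by (simp add: power_inverse)
    have "smult k X * (smult c Y)\<^sup>2 = smult (k * c\<^sup>2) (X * Y\<^sup>2)" for k c and X Y :: "complex poly"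
      by (simp add: smult_power mult.commute)
    then show ?thesis unfolding affine_act_def 1 by (simp only: 1 smult_1_left)
  qed
  then have "(pcompose P ?l)\<^sup>2 - affine_act a b D * (smult (a ^ (g + 1)) (pcompose Q ?l))\<^sup>2 = pcompose (P\<^sup>2 - D * Q\<^sup>2) ?l"
    by (simp add: pcompose_diff pcompose_mult power2_eq_square)
  also have "\<dots> = 1" using p by (simp add: pell_abel_def pcompose_1)
  finally have "pell_abel (affine_act a b D) (pcompose P ?l) (smult (a ^ (g + 1)) (pcompose Q ?l))"
    by (simp add: pell_abel_def)
  then show ?thesis using degree_pcompose_linear[OF a] by blast
qed

text \<open>Minimality survives because any competing solution can be carried back by the inverse
  affine map without change of degree.\<close>

lemma affine_act_A_tilde:
  assumes a: "a \<noteq> 0" and D: "D \<in> A_tilde g n"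
  shows "affine_act a b D \<in> A_tilde g n"
proof -
  obtain P Q where H: "D \<in> H_tilde g" and p: "primitive_solution D P Q" "degree P = n"
    using D by (auto simp: A_tilde_def)
  note H' = affine_act_H_tilde[OF a H, of b]
  obtain P' Q' where p': "pell_abel (affine_act a b D) P' Q'" "degree P' = n"
    using pell_abel_affine_act[OF a H] p unfolding primitive_solution_def by metis
  have "primitive_solution (affine_act a b D) P' Q'"
    unfolding primitive_solution_def
  proof (intro conjI allI impI)
    show "degree P' > 0" using p p' by (simp add: primitive_solution_def)
    fix P2 Q2 assume 2: "pell_abel (affine_act a b D) P2 Q2 \<and> degree P2 > 0"
    have "inverse a \<noteq> 0" using a by simp
    from pell_abel_affine_act[OF this H' conjunct1[OF 2], of "- b / a"] obtain P3 Q3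
      where "pell_abel D P3 Q3" "degree P3 = degree P2" unfolding affine_act_inverse[OF a] by blast
    then show "degree P' \<le> degree P2" using p p'(2) 2 unfolding primitive_solution_def by metis
  qed (rule p')
  then show ?thesis using H' p' by (auto simp: A_tilde_def)
qed

definition aff :: "nat \<Rightarrow> complex \<Rightarrow> complex \<Rightarrow> cvec \<Rightarrow> cvec" where
  "aff g a b z = (\<lambda>i. if i < 2 * g + 2 then coeff (affine_act a b (monic_poly (2 * g + 2) z)) i else 0)"

lemma aff_in_cspace [simp]: "aff g a b z \<in> cspace (2 * g + 2)"
  by (simp add: aff_def cspace_def)

lemma monic_poly_aff:
  assumes "a \<noteq> 0"
  shows "monic_poly (2 * g + 2) (aff g a b z) = affine_act a b (monic_poly (2 * g + 2) z)"
proof (rule monic_poly_eqI)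
  show "lead_coeff (affine_act a b (monic_poly (2 * g + 2) z)) = 1"
    unfolding lead_coeff_affine_act[OF assms] by simp
  show "degree (affine_act a b (monic_poly (2 * g + 2) z)) = 2 * g + 2"
    unfolding degree_affine_act[OF assms] by simp
qed (simp add: aff_def)

lemma aff_compose:
  assumes "a' \<noteq> 0"
  shows "aff g a b (aff g a' b' z) = aff g (a' * a) (a' * b + b') z"
  unfolding aff_def[of g a b "aff g a' b' z"] monic_poly_aff[OF assms] affine_act_compose[OF assms]
  by (simp add: aff_def)

lemma aff_id: "z \<in> cspace (2 * g + 2) \<Longrightarrow> aff g 1 0 z = z"
  by (auto simp: aff_def coeff_monic_poly cspace_def fun_eq_iff)

lemma aff_inverse:
  assumes "a \<noteq> 0" "z \<in> cspace (2 * g + 2)"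
  shows "aff g (inverse a) (- b / a) (aff g a b z) = z"
  using aff_compose[OF assms(1), of g "inverse a" "- b / a" b z] assms aff_id by simp

lemma aff_A_tilde_coeffs: "a \<noteq> 0 \<Longrightarrow> z \<in> A_tilde_coeffs g n \<Longrightarrow> aff g a b z \<in> A_tilde_coeffs g n"
  unfolding A_tilde_coeffs_def using aff_in_cspace affine_act_A_tilde[of a "monic_poly (2 * g + 2) z" g n b]
    monic_poly_aff[of a g b z] by auto

lemma A_proj_eq_iff:
  assumes "z \<in> cspace (2 * g + 2)" "w \<in> cspace (2 * g + 2)"
  shows "A_proj g z = A_proj g w \<longleftrightarrow> (\<exists>a b. a \<noteq> 0 \<and> w = aff g a b z)"
proof
  assume eq: "A_proj g z = A_proj g w"
  have "affine_act 1 0 (monic_poly (2 * g + 2) w) \<in> A_proj g w"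
    unfolding A_proj_def affine_orbit_def by (intro CollectI exI[of _ 1] exI[of _ 0]) simp
  then have "monic_poly (2 * g + 2) w \<in> A_proj g z" unfolding eq by simp
  then obtain a b where ab: "a \<noteq> 0" "monic_poly (2 * g + 2) w = affine_act a b (monic_poly (2 * g + 2) z)"
    unfolding A_proj_def affine_orbit_def by blast
  have "w = aff g a b z"
  proof (rule cspace_eqI[OF assms(2) aff_in_cspace])
    fix i assume "i < 2 * g + 2"
    then show "w i = aff g a b z i"
      using arg_cong[OF ab(2), of "\<lambda>p. coeff p i"] by (simp add: aff_def coeff_monic_poly)
  qed
  then show "\<exists>a b. a \<noteq> 0 \<and> w = aff g a b z" using ab(1) by blast
next
  assume "\<exists>a b. a \<noteq> 0 \<and> w = aff g a b z"
  then obtain a b where ab: "a \<noteq> 0" "w = aff g a b z" by blast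
  have z: "z = aff g (inverse a) (- b / a) w" using aff_inverse[OF ab(1) assms(1)] ab(2) by simp
  have sub: "A_proj g (aff g c d u) \<subseteq> A_proj g u" if c0: "c \<noteq> 0" for c d u
  proof
    fix D assume "D \<in> A_proj g (aff g c d u)"
    then obtain a' b' where "a' \<noteq> 0" "D = affine_act a' b' (affine_act c d (monic_poly (2 * g + 2) u))"
      unfolding A_proj_def affine_orbit_def monic_poly_aff[OF c0] by blast
    then have "c * a' \<noteq> 0" "D = affine_act (c * a') (c * b' + d) (monic_poly (2 * g + 2) u)"
      using c0 affine_act_compose[OF c0] by auto
    then show "D \<in> A_proj g u" unfolding A_proj_def affine_orbit_def by blast
  qed
  have "inverse a \<noteq> 0" using ab(1) by simp
  from sub[OF ab(1), of b z] sub[OF this, of "- b / a" w] show "A_proj g z = A_proj g w"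
    unfolding ab(2)[symmetric] z[symmetric] by blast
qed

lemma coeff_pcompose_linear:
  fixes p :: "complex poly"
  assumes "degree p \<le> N"
  shows "coeff (pcompose p [:b, a:]) i = (\<Sum>l\<le>N. coeff p l * (of_nat (l choose i) * a ^ i * b ^ (l - i)))"
proof -
  have "coeff ([:b, a:] ^ l) i = of_nat (l choose i) * a ^ i * b ^ (l - i)" for l
  proof (cases "i \<le> l")
    case True
    then show ?thesis by (rule coeff_linear_poly_power)
  next
    case False
    moreover have "degree ([:b, a:] ^ l) \<le> l" using degree_power_le[of "[:b, a:]" l] by (simp split: if_splits)
    ultimately have "coeff ([:b, a:] ^ l) i = 0" by (intro coeff_eq_0) simp
    then show ?thesis using False by simp
  qed
  note c = this
  have p: "p = (\<Sum>l\<le>N. monom (coeff p l) l)"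
    using assms by (auto simp: poly_eq_iff coeff_sum coeff_eq_0)
  have "pcompose p [:b, a:] = (\<Sum>l\<le>N. smult (coeff p l) ([:b, a:] ^ l))"
  proof -
    have "pcompose (q ^ l) r = (pcompose q r) ^ l" for q r :: "complex poly" and l
      by (induction l) (simp_all add: pcompose_mult pcompose_1)
    then show ?thesis by (subst p) (simp add: pcompose_sum monom_altdef pcompose_smult pcompose_pCons)
  qed
  then show ?thesis by (simp add: coeff_sum c)
qed

text \<open>In coordinates the action is polynomial in b and the coefficients and, for a \<noteq> 0,
  rational in a without poles. Holomorphy in all data together is read off from this
  formula.\<close>

lemma aff_formula:
  assumes "i < 2 * g + 2"
  shows "aff g a b z i = inverse a ^ (2 * g + 2) *
    (\<Sum>l\<le>2 * g + 2. (if l < 2 * g + 2 then z l else 1) * (of_nat (l choose i) * a ^ i * b ^ (l - i)))"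
proof -
  have "coeff (pcompose (monic_poly (2 * g + 2) z) [:b, a:]) i =
     (\<Sum>l\<le>2 * g + 2. coeff (monic_poly (2 * g + 2) z) l * (of_nat (l choose i) * a ^ i * b ^ (l - i)))"
    by (rule coeff_pcompose_linear) simp
  also have "\<dots> = (\<Sum>l\<le>2 * g + 2. (if l < 2 * g + 2 then z l else 1) * (of_nat (l choose i) * a ^ i * b ^ (l - i)))"
    by (intro sum.cong refl) (auto simp: coeff_monic_poly)
  finally show ?thesis using assms by (simp add: aff_def affine_act_def)
qed

lemma inverse_power_diff: "(a::complex) \<noteq> 0 \<Longrightarrow> i \<le> N \<Longrightarrow> inverse a ^ N * a ^ i = inverse a ^ (N - i)"
  by (simp add: power_diff field_simps)

text \<open>With b = 0 only the term l = i survives, where the exponent of b is 0. Coefficient i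
  thus has weight 2 g + 2 - i, which is positive for all non-leading coefficients.\<close>

lemma aff_scale:
  assumes "a \<noteq> 0" "i < 2 * g + 2"
  shows "aff g a 0 z i = inverse a ^ (2 * g + 2 - i) * z i"
proof -
  have "(\<Sum>l\<le>2 * g + 2. (if l < 2 * g + 2 then z l else 1) * (of_nat (l choose i) * a ^ i * 0 ^ (l - i))) =
     (\<Sum>l\<in>{i}. z i * a ^ i)"
  proof (rule sum.mono_neutral_cong_right)
    show "\<forall>l\<in>{..2 * g + 2} - {i}. (if l < 2 * g + 2 then z l else 1) * (of_nat (l choose i) * a ^ i * 0 ^ (l - i)) = 0"
    proof
      fix l assume "l \<in> {..2 * g + 2} - {i}"
      then consider "l < i" | "l - i > 0" by force
      then show "(if l < 2 * g + 2 then z l else 1) * (of_nat (l choose i) * a ^ i * 0 ^ (l - i)) = 0"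
        by cases (simp_all add: binomial_eq_0)
    qed
  qed (use assms(2) in auto)
  then have "aff g a 0 z i = inverse a ^ (2 * g + 2) * a ^ i * z i"
    unfolding aff_formula[OF assms(2)] by simp
  also have "inverse a ^ (2 * g + 2) * a ^ i = inverse a ^ (2 * g + 2 - i)"
    using assms by (intro inverse_power_diff) auto
  finally show ?thesis .
qed

lemma aff_centre_coeff:
  assumes "a \<noteq> 0"
  shows "aff g a b z (2 * g + 1) = inverse a * (z (2 * g + 1) + of_nat (2 * g + 2) * b)"
proof -
  let ?i = "2 * g + 1"
  have "(\<Sum>l\<le>2 * g + 2. (if l < 2 * g + 2 then z l else 1) * (of_nat (l choose ?i) * a ^ ?i * b ^ (l - ?i))) =
     (\<Sum>l\<in>{?i, ?i + 1}. (if l < 2 * g + 2 then z l else 1) * (of_nat (l choose ?i) * a ^ ?i * b ^ (l - ?i)))"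
    by (rule sum.mono_neutral_right) (auto simp: binomial_eq_0)
  also have "\<dots> = a ^ ?i * (z ?i + of_nat (2 * g + 2) * b)"
    by (simp add: algebra_simps)
  finally have "aff g a b z ?i = (inverse a ^ (2 * g + 2) * a ^ ?i) * (z ?i + of_nat (2 * g + 2) * b)"
    using aff_formula[of ?i g a b z] by simp
  also have "inverse a ^ (2 * g + 2) * a ^ ?i = inverse a ^ (2 * g + 2 - ?i)"
    using assms by (intro inverse_power_diff) auto
  finally show ?thesis by simp
qed

section \<open>Holomorphy of functions built from coordinates and the action\<close>

definition cdiff :: "nat \<Rightarrow> (cvec \<Rightarrow> complex) \<Rightarrow> cvec \<Rightarrow> bool" where
  "cdiff m f z \<longleftrightarrow> (\<exists>c. has_grad m f c z)"

lemma cdiff_const: "cdiff m (\<lambda>w. a) z"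
  unfolding cdiff_def using has_grad_const by blast

lemma cdiff_coord: "z \<in> cspace m \<Longrightarrow> cdiff m (\<lambda>w. w l) z"
proof (cases "l < m")
  case True
  then show ?thesis unfolding cdiff_def using has_grad_coord by blast
next
  case False
  assume z: "z \<in> cspace m"
  have "eventually (\<lambda>w. 0 = w l) (nb m z)"
    using eventually_nb_cspace by (rule eventually_mono) (use False in \<open>simp add: cspace_def\<close>)
  from has_grad_cong[OF z this has_grad_const] show ?thesis unfolding cdiff_def by blast
qed

lemma cdiff_add: "cdiff m f z \<Longrightarrow> cdiff m h z \<Longrightarrow> cdiff m (\<lambda>w. f w + h w) z"
  unfolding cdiff_def using has_grad_add by blast

lemma cdiff_mult: "cdiff m f z \<Longrightarrow> cdiff m h z \<Longrightarrow> cdiff m (\<lambda>w. f w * h w) z"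
  unfolding cdiff_def using has_grad_mult by blast

lemma cdiff_power: "cdiff m f z \<Longrightarrow> cdiff m (\<lambda>w. f w ^ n) z"
  by (induction n) (auto intro: cdiff_const cdiff_mult)

lemma cdiff_sum: "(\<And>i. i \<in> A \<Longrightarrow> cdiff m (f i) z) \<Longrightarrow> cdiff m (\<lambda>w. \<Sum>i\<in>A. f i w) z"
  by (induction A rule: infinite_finite_induct) (auto intro: cdiff_const cdiff_add)

lemma cdiff_compose: "cdiff m f z \<Longrightarrow> (h has_field_derivative d) (at (f z)) \<Longrightarrow> cdiff m (\<lambda>w. h (f w)) z"
  unfolding cdiff_def using has_grad_DERIV by blast

lemma cdiff_if: "cdiff m f z \<Longrightarrow> cdiff m h z \<Longrightarrow> cdiff m (\<lambda>w. if P then f w else h w) z"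
  by (cases P) simp_all

lemma cdiff_inverse: "cdiff m f z \<Longrightarrow> f z \<noteq> 0 \<Longrightarrow> cdiff m (\<lambda>w. inverse (f w)) z"
  by (rule cdiff_compose[OF _ DERIV_inverse]) auto

lemma cdiff_aff:
  assumes "cdiff m a z" "cdiff m b z" "\<And>i. cdiff m (\<lambda>w. s w i) z" "a z \<noteq> 0"
  shows "cdiff m (\<lambda>w. aff g (a w) (b w) (s w) i) z"
proof (cases "i < 2 * g + 2")
  case True
  show ?thesis
    unfolding aff_formula[OF True]
    by (intro cdiff_mult cdiff_power cdiff_inverse cdiff_sum cdiff_if cdiff_const assms)
next
  case False
  then show ?thesis by (simp add: aff_def cdiff_const)
qed

lemma holomorphic_mapI:
  assumes "openin (top_of_set (cspace m)) U" "\<And>z. z \<in> U \<Longrightarrow> f z \<in> cspace k"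
    "\<And>z j. z \<in> U \<Longrightarrow> j < k \<Longrightarrow> cdiff m (\<lambda>w. f w j) z"
  shows "holomorphic_map m k U f"
  unfolding holomorphic_map_def
proof (intro conjI ballI assms(1))
  show "f ` U \<subseteq> cspace k" using assms(2) by blast
  fix z assume z: "z \<in> U"
  have zc: "z \<in> cspace m" using assms(1) z openin_imp_subset by blast
  have "\<forall>j. \<exists>c. j < k \<longrightarrow> has_grad m (\<lambda>w. f w j) c z"
    using assms(3)[OF z] unfolding cdiff_def by blast
  from choice[OF this] obtain J where "\<forall>j. j < k \<longrightarrow> has_grad m (\<lambda>w. f w j) (J j) z" ..
  then show "\<exists>J. has_jacobian m k f J z" unfolding has_jacobian_iff_grad[OF zc] by blast
qed

section \<open>Parametrisations of submanifolds\<close>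

context
  fixes N d S V \<psi>
  assumes sp: "submanifold_param N d S V \<psi>"
begin

lemma param_holomorphic: "holomorphic_map d N V \<psi>"
  using sp by (simp add: submanifold_param_def holomorphic_immersion_def)

lemma param_inj_jacobian: "u \<in> V \<Longrightarrow> has_jacobian d N \<psi> J u \<Longrightarrow> inj_on (mat_apply d N J) (cspace d)"
  using sp by (simp add: submanifold_param_def holomorphic_immersion_def)

lemma param_open_image: "openin (top_of_set S) (\<psi> ` V)"
  using sp by (simp add: submanifold_param_def)

lemma param_image_subset: "\<psi> ` V \<subseteq> S"
  using param_open_image openin_imp_subset by blast

lemma param_domain_open: "openin (top_of_set (cspace d)) V"
  using param_holomorphic by (simp add: holomorphic_map_def)

lemma param_domain_subset: "V \<subseteq> cspace d"
  using param_domain_open openin_imp_subset by blast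

lemma param_inj: "inj_on \<psi> V"
proof -
  have "homeomorphic_map (top_of_set V) (top_of_set (\<psi> ` V)) \<psi>" using sp by (simp add: submanifold_param_def)
  then show ?thesis using homeomorphic_imp_injective_map by fastforce
qed

lemma param_inv: "u \<in> V \<Longrightarrow> inv_into V \<psi> (\<psi> u) = u"
  using param_inj by (rule inv_into_f_f)

lemma param_inv_continuous: "continuous_on (\<psi> ` V) (inv_into V \<psi>)"
proof -
  have "homeomorphic_map (top_of_set V) (top_of_set (\<psi> ` V)) \<psi>" using sp by (simp add: submanifold_param_def)
  then obtain h where h: "homeomorphic_maps (top_of_set V) (top_of_set (\<psi> ` V)) \<psi> h"
    using homeomorphic_map_maps by blast
  then have "continuous_on (\<psi> ` V) h" "\<And>u. u \<in> V \<Longrightarrow> h (\<psi> u) = u"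
    unfolding homeomorphic_maps_def by (auto simp: continuous_map_in_subtopology)
  moreover have "h y = inv_into V \<psi> y" if "y \<in> \<psi> ` V" for y
    using that param_inv \<open>\<And>u. u \<in> V \<Longrightarrow> h (\<psi> u) = u\<close> by (elim imageE) simp
  ultimately show ?thesis by (rule_tac continuous_on_eq)
qed

lemma param_continuous: "continuous_on V \<psi>"
  by (rule holomorphic_map_continuous[OF param_holomorphic])

lemma param_image_open:
  assumes U: "openin (top_of_set (cspace d)) U" "U \<subseteq> V"
  shows "openin (top_of_set S) (\<psi> ` U)"
proof -
  obtain T where T: "open T" "U = cspace d \<inter> T" using U(1) by (auto simp: openin_open)
  have "openin (top_of_set (\<psi> ` V)) (\<psi> ` V \<inter> inv_into V \<psi> -` T)"
    by (rule continuous_openin_preimage_gen[OF param_inv_continuous T(1)])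
  moreover have "\<psi> ` V \<inter> inv_into V \<psi> -` T = \<psi> ` U"
    using T(2) U(2) param_inv param_domain_subset by auto
  ultimately show ?thesis using openin_trans[OF _ param_open_image] by simp
qed

lemma param_preimage_open:
  assumes O: "openin (top_of_set S) O'"
  shows "openin (top_of_set (cspace d)) {u \<in> V. \<psi> u \<in> O'}"
proof -
  obtain T where T: "open T" "O' = S \<inter> T" using O by (auto simp: openin_open)
  have "openin (top_of_set V) (V \<inter> \<psi> -` T)"
    by (rule continuous_openin_preimage_gen[OF param_continuous T(1)])
  moreover have "V \<inter> \<psi> -` T = {u \<in> V. \<psi> u \<in> O'}" using T(2) param_image_subset by auto
  ultimately show ?thesis using openin_trans[OF _ param_domain_open] by simp
qed

lemma param_restrict:
  assumes U: "openin (top_of_set (cspace d)) U" "U \<subseteq> V"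
  shows "submanifold_param N d S U \<psi>"
proof -
  have "holomorphic_map d N U \<psi>"
    unfolding holomorphic_map_def
    using U param_holomorphic unfolding holomorphic_map_def by blast
  then have "holomorphic_immersion d N U \<psi>"
    using U param_inj_jacobian unfolding holomorphic_immersion_def by blast
  moreover have "homeomorphic_maps (top_of_set U) (top_of_set (\<psi> ` U)) \<psi> (inv_into V \<psi>)"
    unfolding homeomorphic_maps_def
  proof (intro conjI)
    show "continuous_map (top_of_set U) (top_of_set (\<psi> ` U)) \<psi>"
      using continuous_on_subset[OF param_continuous U(2)] by (simp add: continuous_map_in_subtopology)
    have "\<psi> ` U \<subseteq> \<psi> ` V" using U(2) by blast
    from continuous_on_subset[OF param_inv_continuous this]
    show "continuous_map (top_of_set (\<psi> ` U)) (top_of_set U) (inv_into V \<psi>)"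
      using U(2) param_inv by (auto simp: continuous_map_in_subtopology)
    show "\<forall>x\<in>topspace (top_of_set U). inv_into V \<psi> (\<psi> x) = x" using U(2) param_inv by auto
    show "\<forall>y\<in>topspace (top_of_set (\<psi> ` U)). \<psi> (inv_into V \<psi> y) = y" using U(2) param_inv by auto
  qed
  then have "homeomorphic_map (top_of_set U) (top_of_set (\<psi> ` U)) \<psi>"
    unfolding homeomorphic_map_maps by blast
  ultimately show ?thesis using param_image_open[OF U] by (simp add: submanifold_param_def)
qed

end

text \<open>Continuity of the lifted map comes from the homeomorphism property of the
  parametrisation, its derivative from a left inverse of the injective Jacobian. The holomorphic
  maps into charts below arise in this way.\<close>

lemma holomorphic_map_lift:
  assumes sp: "submanifold_param N d S V \<psi>" and s: "holomorphic_map m N W s" and sub: "s ` W \<subseteq> \<psi> ` V"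
  shows "holomorphic_map m d W (\<lambda>t. inv_into V \<psi> (s t))"
  unfolding holomorphic_map_def
proof (intro conjI ballI)
  let ?c = "\<lambda>t. inv_into V \<psi> (s t)"
  have W: "openin (top_of_set (cspace m)) W" using s by (simp add: holomorphic_map_def)
  then show "openin (top_of_set (cspace m)) W" .
  have cV: "?c t \<in> V" "\<psi> (?c t) = s t" if "t \<in> W" for t
    using sub that inv_into_into[of "s t" \<psi> V] f_inv_into_f[of "s t" \<psi> V] by blast+
  then have cd: "?c t \<in> cspace d" if "t \<in> W" for t
    using param_domain_subset[OF sp] that by blast
  then show "?c ` W \<subseteq> cspace d" by blast
  fix t assume t: "t \<in> W"
  have tc: "t \<in> cspace m" by (rule holomorphic_map_dom[OF s t])
  have evW: "eventually (\<lambda>w. w \<in> W) (nb m t)" by (rule holomorphic_map_nbhd[OF s t])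
  obtain S' where S': "has_jacobian m N s S' t" by (rule holomorphic_map_jacobian[OF s t])
  obtain J where J: "has_jacobian d N \<psi> J (?c t)"
    by (rule holomorphic_map_jacobian[OF param_holomorphic[OF sp] cV(1)[OF t]])
  obtain \<Lambda> where L: "\<And>v. v \<in> cspace d \<Longrightarrow> mat_apply N d \<Lambda> (mat_apply d N J v) = v"
    using mat_left_inverse[OF param_inj_jacobian[OF sp cV(1)[OF t] J]] by blast
  have cont: "continuous_on W ?c"
    by (rule continuous_on_compose2[OF param_inv_continuous[OF sp] holomorphic_map_continuous[OF s] sub])
  have lim: "filterlim ?c (nb d (?c t)) (nb m t)"
    unfolding filterlim_nb_iff[OF cd[OF t]]
  proof (intro conjI allI impI)
    show "\<forall>\<^sub>F x in nb m t. ?c x \<in> cspace d" using evW by (rule eventually_mono) (rule cd)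
    fix j
    have "continuous_on W (\<lambda>x. ?c x j)" using cont by (rule continuous_on_product_then_coordinatewise)
    then have l: "((\<lambda>x. ?c x j) \<longlongrightarrow> ?c t j) (at t within W)" using t by (simp add: continuous_on_def)
    \<comment> \<open>The limit within W is a punctured one. As W is a neighbourhood of t and
      nothing has to be shown at t itself, it extends to \<open>nb\<close>.\<close>
    show "((\<lambda>x. ?c x j) \<longlongrightarrow> ?c t j) (nb m t)"
    proof (rule tendstoI)
      fix e :: real assume "e > 0"
      from tendstoD[OF l this] have "\<forall>\<^sub>F x in nhds t. x \<noteq> t \<longrightarrow> x \<in> W \<longrightarrow> dist (?c x j) (?c t j) < e"
        by (simp add: eventually_at_filter)
      then have "\<forall>\<^sub>F x in nb m t. x \<noteq> t \<longrightarrow> x \<in> W \<longrightarrow> dist (?c x j) (?c t j) < e"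
        unfolding nb_def eventually_inf_principal by (rule eventually_mono) blast
      with evW show "\<forall>\<^sub>F x in nb m t. dist (?c x j) (?c t j) < e"
      proof eventually_elim
        case (elim x)
        then show ?case using \<open>e > 0\<close> by (cases "x = t") auto
      qed
    qed
  qed
  have eq: "\<forall>\<^sub>F x in nb m t. \<psi> (?c x) = s x" using evW by (rule eventually_mono) (rule cV(2))
  have "has_jacobian m d ?c (mat_mul N \<Lambda> S') t"
    by (rule has_jacobian_lift[OF tc cd[OF t] J L lim eq S'])
  then show "\<exists>J. has_jacobian m d ?c J t" by blast
qed

lemma holomorphic_map_compose:
  assumes f: "holomorphic_map m k U f" and h: "holomorphic_map k l V h" and sub: "f ` U \<subseteq> V"
  shows "holomorphic_map m l U (\<lambda>x. h (f x))"
  unfolding holomorphic_map_def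
proof (intro conjI ballI)
  show "openin (top_of_set (cspace m)) U" using f by (simp add: holomorphic_map_def)
  show "(\<lambda>x. h (f x)) ` U \<subseteq> cspace l" using holomorphic_map_ran[OF h] sub by blast
  fix z assume z: "z \<in> U"
  then have fz: "f z \<in> V" using sub by blast
  obtain J where J: "has_jacobian m k f J z" by (rule holomorphic_map_jacobian[OF f z])
  obtain A where A: "has_jacobian k l h A (f z)" by (rule holomorphic_map_jacobian[OF h fz])
  have "\<forall>\<^sub>F w in nb m z. f w \<in> cspace k"
    using holomorphic_map_nbhd[OF f z] by (rule eventually_mono) (rule holomorphic_map_ran[OF f])
  from has_jacobian_chain[OF holomorphic_map_dom[OF f z] holomorphic_map_ran[OF f z] this J A]
  show "\<exists>J. has_jacobian m l (\<lambda>x. h (f x)) J z" by (auto simp: o_def)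
qed

lemma holomorphic_map_subset:
  assumes "holomorphic_map m k V f" "openin (top_of_set (cspace m)) U" "U \<subseteq> V"
  shows "holomorphic_map m k U f"
  using assms unfolding holomorphic_map_def by blast

lemma holomorphic_map_cong:
  assumes f: "holomorphic_map m k U f" and eq: "\<And>x. x \<in> U \<Longrightarrow> f x = f' x"
  shows "holomorphic_map m k U f'"
  unfolding holomorphic_map_def
proof (intro conjI ballI)
  show "openin (top_of_set (cspace m)) U" using f by (simp add: holomorphic_map_def)
  show "f' ` U \<subseteq> cspace k" using f eq by (auto simp: holomorphic_map_def)
  fix z assume z: "z \<in> U"
  obtain J where J: "has_jacobian m k f J z" by (rule holomorphic_map_jacobian[OF f z])
  have "\<forall>\<^sub>F w in nb m z. f w = f' w" using holomorphic_map_nbhd[OF f z] by (rule eventually_mono) (rule eq)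
  from has_jacobian_cong[OF holomorphic_map_dom[OF f z] this J] show "\<exists>J. has_jacobian m k f' J z" by blast
qed

lemma holomorphic_preimage_open:
  assumes f: "holomorphic_map m k U f" and V: "openin (top_of_set (cspace k)) V"
  shows "openin (top_of_set (cspace m)) {x \<in> U. f x \<in> V}"
  unfolding openin_cspace_iff_nb
proof (intro conjI ballI)
  show "{x \<in> U. f x \<in> V} \<subseteq> cspace m" using holomorphic_map_dom[OF f] by blast
  fix z assume "z \<in> {x \<in> U. f x \<in> V}"
  then have z: "z \<in> U" "f z \<in> V" by auto
  have "eventually (\<lambda>y. y \<in> V) (nb k (f z))" using V z(2) by (auto simp: openin_cspace_iff_nb)
  from eventually_compose_filterlim[OF this holomorphic_map_lim[OF f z(1)]] holomorphic_map_nbhd[OF f z(1)]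
  show "\<forall>\<^sub>F w in nb m z. w \<in> {x \<in> U. f x \<in> V}" by eventually_elim simp
qed

text \<open>The mean of the roots of D. Used as the translation part, it makes the coefficient of
  index 2 g + 1 vanish for every scaling factor.\<close>

definition cent :: "nat \<Rightarrow> cvec \<Rightarrow> complex" where
  "cent g z = - z (2 * g + 1) / of_nat (2 * g + 2)"

definition centred_coeff :: "nat \<Rightarrow> nat \<Rightarrow> cvec \<Rightarrow> complex" where
  "centred_coeff g k z = aff g 1 (cent g z) z k"

text \<open>The principal branch, with value 1 at 1. Written as an exponential it never vanishes, so
  \<open>normalise\<close> acts by an invertible affine map at every point.\<close>

definition root_of :: "nat \<Rightarrow> complex \<Rightarrow> complex" where
  "root_of w x = exp (Ln x / of_nat w)"

text \<open>The affine map that moves a polynomial into the slice, with the branch of the root that is trivial on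
  the slice itself; it is holomorphic on \<open>norm_domain\<close> defined below.\<close>

definition normalise :: "nat \<Rightarrow> nat \<Rightarrow> cvec \<Rightarrow> cvec" where
  "normalise g k z = aff g (root_of (2 * g + 2 - k) (centred_coeff g k z)) (cent g z) z"

text \<open>The half-plane contains the value 1 taken on the slice and avoids the cut of
  \<open>Ln\<close>.\<close>

definition norm_domain :: "nat \<Rightarrow> nat \<Rightarrow> cvec set" where
  "norm_domain g k = {z \<in> cspace (2 * g + 2). Re (centred_coeff g k z) > 0}"

lemma root_of_nonzero [simp]: "root_of w x \<noteq> 0"
  by (simp add: root_of_def)

lemma root_of_power: "w > 0 \<Longrightarrow> x \<noteq> 0 \<Longrightarrow> root_of w x ^ w = x"
  by (simp add: root_of_def exp_of_nat_mult[symmetric])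

lemma root_of_1 [simp]: "root_of w 1 = 1"
  by (simp add: root_of_def)

lemma of_nat_degree_nonzero: "(of_nat (2 * g + 2) :: complex) \<noteq> 0"
  by (metis of_nat_eq_0_iff add_is_0 zero_neq_numeral)

lemma aff_cent_top: "a \<noteq> 0 \<Longrightarrow> aff g a (cent g z) z (2 * g + 1) = 0"
  unfolding aff_centre_coeff cent_def using of_nat_degree_nonzero[of g] by (simp add: aff_centre_coeff)

lemma aff_cent_coeff:
  assumes "a \<noteq> 0" "k < 2 * g + 2"
  shows "aff g a (cent g z) z k = inverse a ^ (2 * g + 2 - k) * centred_coeff g k z"
proof -
  have "aff g a (cent g z) z = aff g a 0 (aff g 1 (cent g z) z)"
    using aff_compose[of 1 g a 0 "cent g z" z] by simp
  then show ?thesis using aff_scale[OF assms] by (simp add: centred_coeff_def)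
qed

lemma normalise_slice:
  assumes z: "z \<in> A_tilde_coeffs g n" and k: "k < 2 * g + 2" and c: "centred_coeff g k z \<noteq> 0"
  shows "normalise g k z \<in> slice g n k"
proof -
  let ?a = "root_of (2 * g + 2 - k) (centred_coeff g k z)"
  have "?a ^ (2 * g + 2 - k) = centred_coeff g k z" using k c by (intro root_of_power) auto
  then have "inverse ?a ^ (2 * g + 2 - k) * centred_coeff g k z = 1"
    using c by (simp add: power_inverse)
  then have "aff g ?a (cent g z) z k = 1" using aff_cent_coeff[OF root_of_nonzero k, of _ _ z] by simp
  moreover have "aff g ?a (cent g z) z (2 * g + 1) = 0" by (rule aff_cent_top) simp
  moreover have "aff g ?a (cent g z) z \<in> A_tilde_coeffs g n" by (rule aff_A_tilde_coeffs[OF root_of_nonzero z])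
  ultimately show ?thesis unfolding normalise_def slice_def by blast
qed

lemma slice_cspace: "z \<in> slice g n k \<Longrightarrow> z \<in> cspace (2 * g + 2)"
  unfolding slice_def A_tilde_coeffs_def by blast

lemma slice_A_tilde: "z \<in> slice g n k \<Longrightarrow> z \<in> A_tilde_coeffs g n"
  by (simp add: slice_def)

lemma slice_cent: "z \<in> slice g n k \<Longrightarrow> cent g z = 0"
  by (simp add: slice_def cent_def)

lemma slice_centred_coeff: "z \<in> slice g n k \<Longrightarrow> centred_coeff g l z = z l"
  by (simp add: centred_coeff_def slice_cent aff_id[OF slice_cspace])

lemma slice_one: "z \<in> slice g n k \<Longrightarrow> z k = 1"
  by (simp add: slice_def)

lemma normalise_id: "z \<in> slice g n k \<Longrightarrow> normalise g k z = z"
  by (simp add: normalise_def slice_cent slice_centred_coeff slice_one aff_id[OF slice_cspace])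

lemma slice_norm_domain: "z \<in> slice g n k \<Longrightarrow> z \<in> norm_domain g k"
  using slice_cspace[of z g n k] unfolding norm_domain_def by (simp add: slice_centred_coeff slice_one)

lemma centred_coeff_aff:
  assumes z: "z (2 * g + 1) = 0" and a: "a \<noteq> 0" and k: "k < 2 * g + 2"
  shows "centred_coeff g k (aff g a b z) = inverse a ^ (2 * g + 2 - k) * z k"
    "a * cent g (aff g a b z) + b = 0"
proof -
  have "cent g (aff g a b z) = - (inverse a * (of_nat (2 * g + 2) * b)) / of_nat (2 * g + 2)"
    unfolding cent_def aff_centre_coeff[OF a] z by simp
  also have "\<dots> = - (inverse a * b)"
    unfolding mult.left_commute[of "inverse a"] minus_divide_left[symmetric]
      nonzero_mult_div_cancel_left[OF of_nat_degree_nonzero] ..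
  finally show c: "a * cent g (aff g a b z) + b = 0" using a by simp
  show "centred_coeff g k (aff g a b z) = inverse a ^ (2 * g + 2 - k) * z k"
    unfolding centred_coeff_def aff_compose[OF a] c mult_1_right by (rule aff_scale[OF a k])
qed

text \<open>A point of a slice is already centred, so normalising its image under an affine map
  undoes the translation. Only a scaling remains, whose factor can be tracked explicitly through
  compositions.\<close>

lemma normalise_aff:
  assumes z: "z \<in> slice g n l" and a: "a \<noteq> 0" and k: "k < 2 * g + 2"
  shows "normalise g k (aff g a b z) = aff g (a * root_of (2 * g + 2 - k) (inverse a ^ (2 * g + 2 - k) * z k)) 0 z"
proof -
  have z0: "z (2 * g + 1) = 0" using z by (simp add: slice_def)
  show ?thesis
    unfolding normalise_def centred_coeff_aff(1)[where z = z, OF z0 a k] aff_compose[OF a]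
      centred_coeff_aff(2)[where z = z, OF z0 a k] ..
qed

text \<open>Both polynomials have root mean 0, which excludes a translation.\<close>

lemma aff_between_slices:
  assumes z: "z \<in> slice g n k" and w: "aff g a b z \<in> slice g n l" and a: "a \<noteq> 0"
  shows "b = 0"
proof -
  have "aff g a b z (2 * g + 1) = 0" "z (2 * g + 1) = 0" using z w by (auto simp: slice_def)
  then show ?thesis using a of_nat_degree_nonzero[of g] unfolding aff_centre_coeff[OF a] by (metis add_0 inverse_nonzero_iff_nonzero mult_eq_0_iff)
qed

lemma aff_same_slice:
  assumes z: "z \<in> slice g n k" and w: "aff g a b z \<in> slice g n k" and a: "a \<noteq> 0" and k: "k < 2 * g + 2"
  shows "b = 0" "a ^ (2 * g + 2 - k) = 1"
proof -
  show b: "b = 0" by (rule aff_between_slices[OF z w a])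
  have "inverse a ^ (2 * g + 2 - k) * z k = 1" using slice_one[OF w] unfolding b aff_scale[OF a k] .
  then show "a ^ (2 * g + 2 - k) = 1" using slice_one[OF z] by (simp add: power_inverse)
qed

lemma scale_slice:
  assumes z: "z \<in> slice g n k" and a: "a ^ (2 * g + 2 - k) = 1" and k: "k < 2 * g + 2"
  shows "aff g a 0 z \<in> slice g n k"
proof -
  have a0: "a \<noteq> 0" using a k by (metis power_0_left zero_neq_one zero_less_diff less_numeral_extra(3))
  have "aff g a 0 z k = 1" unfolding aff_scale[OF a0 k] using slice_one[OF z] a by (simp add: power_inverse)
  moreover have "aff g a 0 z (2 * g + 1) = 0" using z by (simp add: aff_scale[OF a0] slice_def)
  ultimately show ?thesis using aff_A_tilde_coeffs[OF a0 slice_A_tilde[OF z]] by (simp add: slice_def)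
qed

section \<open>Holomorphy of the normalisation\<close>

lemma cdiff_cent: "z \<in> cspace (2 * g + 2) \<Longrightarrow> cdiff (2 * g + 2) (cent g) z"
proof -
  assume z: "z \<in> cspace (2 * g + 2)"
  have "cdiff (2 * g + 2) (\<lambda>z. (- 1 / of_nat (2 * g + 2)) * z (2 * g + 1)) z"
    by (intro cdiff_mult cdiff_const cdiff_coord z)
  then show ?thesis by (simp add: cent_def[abs_def])
qed

lemma cdiff_centred_coeff: "z \<in> cspace (2 * g + 2) \<Longrightarrow> cdiff (2 * g + 2) (centred_coeff g k) z"
  unfolding centred_coeff_def[abs_def] by (intro cdiff_aff cdiff_const cdiff_cent cdiff_coord) auto

lemma norm_domain_open: "openin (top_of_set (cspace (2 * g + 2))) (norm_domain g k)"
  unfolding openin_cspace_iff_nb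
proof (intro conjI ballI)
  show "norm_domain g k \<subseteq> cspace (2 * g + 2)" by (auto simp: norm_domain_def)
  fix z assume "z \<in> norm_domain g k"
  then have z: "z \<in> cspace (2 * g + 2)" "Re (centred_coeff g k z) > 0" by (auto simp: norm_domain_def)
  obtain c where "has_grad (2 * g + 2) (centred_coeff g k) c z" using cdiff_centred_coeff[OF z(1)] unfolding cdiff_def by blast
  from tendsto_Re[OF has_grad_isCont[OF this]] have "\<forall>\<^sub>F w in nb (2 * g + 2) z. 0 < Re (centred_coeff g k w)"
    using z(2) by (rule order_tendstoD(1))
  with eventually_nb_cspace show "\<forall>\<^sub>F w in nb (2 * g + 2) z. w \<in> norm_domain g k"
    by eventually_elim (simp add: norm_domain_def)
qed

lemma normalise_holomorphic: "holomorphic_map (2 * g + 2) (2 * g + 2) (norm_domain g k) (normalise g k)"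
proof (rule holomorphic_mapI[OF norm_domain_open])
  show "normalise g k z \<in> cspace (2 * g + 2)" for z unfolding normalise_def by (rule aff_in_cspace)
  fix z j assume "z \<in> norm_domain g k"
  then have z: "z \<in> cspace (2 * g + 2)" "Re (centred_coeff g k z) > 0" by (auto simp: norm_domain_def)
  then have "centred_coeff g k z \<notin> \<real>\<^sub>\<le>\<^sub>0" by (auto simp: complex_nonpos_Reals_iff)
  then have "((\<lambda>x. exp (Ln x / of_nat (2 * g + 2 - k))) has_field_derivative
      exp (Ln (centred_coeff g k z) / of_nat (2 * g + 2 - k)) * (inverse (centred_coeff g k z) / of_nat (2 * g + 2 - k)))
      (at (centred_coeff g k z))"
    by (intro DERIV_fun_exp DERIV_cdivide has_field_derivative_Ln)
  from cdiff_compose[OF cdiff_centred_coeff[OF z(1)] this]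
  have "cdiff (2 * g + 2) (\<lambda>w. root_of (2 * g + 2 - k) (centred_coeff g k w)) z" by (simp add: root_of_def)
  then show "cdiff (2 * g + 2) (\<lambda>w. normalise g k w j) z"
    unfolding normalise_def by (intro cdiff_aff cdiff_cent cdiff_coord z) simp_all
qed

lemma aff_holomorphic: "a \<noteq> 0 \<Longrightarrow> holomorphic_map (2 * g + 2) (2 * g + 2) (cspace (2 * g + 2)) (aff g a b)"
  by (rule holomorphic_mapI[OF openin_subtopology_self aff_in_cspace]) (intro cdiff_aff cdiff_const cdiff_coord; assumption)

lemma aff_continuous: "a \<noteq> 0 \<Longrightarrow> continuous_on (cspace (2 * g + 2)) (aff g a b)"
  by (rule holomorphic_map_continuous[OF aff_holomorphic])

text \<open>A norm ball is star-shaped about its centre: it is the union of segments that share the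
  centre, hence connected.\<close>

lemma cspace_ball:
  assumes u0: "u0 \<in> V" and V: "openin (top_of_set (cspace m)) V"
  obtains B where "openin (top_of_set (cspace m)) B" "connected B" "u0 \<in> B" "B \<subseteq> V"
proof -
  have uc: "u0 \<in> cspace m" using u0 V openin_imp_subset by blast
  obtain \<delta> where d: "\<delta> > 0" "\<forall>w\<in>cspace m. nm m (w - u0) < \<delta> \<longrightarrow> w \<in> V"
    using V u0 unfolding openin_cspace_iff by blast
  define B where "B = {w \<in> cspace m. nm m (w - u0) < \<delta>}"
  have "openin (top_of_set (cspace m)) B"
    unfolding openin_cspace_iff
  proof (intro conjI ballI)
    show "B \<subseteq> cspace m" by (auto simp: B_def)
    fix z assume z: "z \<in> B"
    show "\<exists>\<delta>>0. \<forall>w\<in>cspace m. nm m (w - z) < \<delta> \<longrightarrow> w \<in> B"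
    proof (intro exI[of _ "\<delta> - nm m (z - u0)"] conjI ballI impI)
      show "\<delta> - nm m (z - u0) > 0" using z by (simp add: B_def)
      fix w assume "w \<in> cspace m" "nm m (w - z) < \<delta> - nm m (z - u0)"
      then show "w \<in> B" using nm_triangle_diff[of m w u0 z] by (simp add: B_def)
    qed
  qed
  moreover have "connected B"
  proof -
    define seg where "seg w = (\<lambda>t i. u0 i + of_real t * (w i - u0 i)) ` {0..1::real}" for w :: cvec
    have "connected (seg w)" for w
      unfolding seg_def
    proof (rule connected_continuous_image)
      show "continuous_on {0..1} (\<lambda>t i. u0 i + complex_of_real t * (w i - u0 i))"
        by (rule continuous_on_coordinatewise_then_product) (intro continuous_intros)
    qed simp
    moreover have "u0 \<in> seg w" "w \<in> seg w" for w
    proof -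
      show "u0 \<in> seg w" unfolding seg_def by (rule image_eqI[of _ _ 0]) (auto simp: fun_eq_iff)
      show "w \<in> seg w" unfolding seg_def by (rule image_eqI[of _ _ 1]) (auto simp: fun_eq_iff)
    qed
    moreover have "seg w \<subseteq> B" if "w \<in> B" for w
    proof
      fix v assume "v \<in> seg w"
      then obtain t where t: "t \<in> {0..1}" "v = (\<lambda>i. u0 i + of_real t * (w i - u0 i))" unfolding seg_def by blast
      have "v - u0 = (\<lambda>i. of_real t * (w - u0) i)" unfolding t(2) by auto
      then have "nm m (v - u0) = t * nm m (w - u0)" using nm_scale[of m "of_real t" "w - u0"] t(1) by simp
      also have "\<dots> \<le> 1 * nm m (w - u0)" using t(1) by (intro mult_right_mono) auto
      finally have "nm m (v - u0) < \<delta>" using that by (simp add: B_def)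
      moreover have "v \<in> cspace m" using t(2) uc that by (simp add: B_def cspace_def)
      ultimately show "v \<in> B" by (simp add: B_def)
    qed
    ultimately have "B = \<Union> (seg ` B)" by blast
    moreover have "connected (\<Union> (seg ` B))"
    proof (rule connected_Union)
      show "connected X" if "X \<in> seg ` B" for X using that \<open>\<And>w. connected (seg w)\<close> by blast
      have "u0 \<in> \<Inter> (seg ` B)" using \<open>\<And>w. u0 \<in> seg w\<close> by blast
      then show "\<Inter> (seg ` B) \<noteq> {}" by blast
    qed
    ultimately show ?thesis by simp
  qed
  moreover have "u0 \<in> B" using uc d(1) by (simp add: B_def)
  moreover have "B \<subseteq> V" using d(2) by (auto simp: B_def)
  ultimately show ?thesis by (rule that)
qed

text \<open>The last condition says that a root of unity either preserves the piece or moves it off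
  itself. Points of the piece in the same orbit are then related by an element of the group of that
  piece.\<close>

definition slice_chart :: "nat \<Rightarrow> nat \<Rightarrow> nat \<Rightarrow> cvec set \<Rightarrow> (cvec \<Rightarrow> cvec) \<Rightarrow> bool" where
  "slice_chart g n k U \<psi> \<longleftrightarrow> submanifold_param (2 * g + 2) g (slice g n k) U \<psi> \<and> connected U \<and>
     (\<forall>a. a ^ (2 * g + 2 - k) = 1 \<and> aff g a 0 ` \<psi> ` U \<inter> \<psi> ` U \<noteq> {} \<longrightarrow> aff g a 0 ` \<psi> ` U = \<psi> ` U)"

lemma root_of_unity_nonzero: "w > 0 \<Longrightarrow> (a::complex) ^ w = 1 \<Longrightarrow> a \<noteq> 0"
  by (metis power_0_left zero_neq_one less_numeral_extra(3))

lemma aff_scale_compose: "a' \<noteq> 0 \<Longrightarrow> aff g a 0 (aff g a' 0 z) = aff g (a' * a) 0 z"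
  using aff_compose[of a' g a 0 0 z] by simp

text \<open>Translates of a small connected neighbourhood under the stabiliser of the point are glued
  together; the other roots of unity move the neighbourhood off itself.\<close>

lemma slice_chart_exists:
  assumes n: "n \<ge> 1" and k: "k < 2 * g + 1" and p: "p \<in> slice g n k"
  obtains U \<psi> where "slice_chart g n k U \<psi>" "p \<in> \<psi> ` U"
proof -
  let ?S = "slice g n k" and ?w = "2 * g + 2 - k"
  define \<mu> where "\<mu> = {a::complex. a ^ ?w = 1}"
  define St where "St = {a \<in> \<mu>. aff g a 0 p = p}"
  have k2: "k < 2 * g + 2" and w: "?w > 0" using k by auto
  have fin: "finite \<mu>" unfolding \<mu>_def by (rule finite_roots_unity) (use w in simp)
  have nz: "a \<noteq> 0" if "a \<in> \<mu>" for a using that root_of_unity_nonzero[OF w] by (simp add: \<mu>_def)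
  have mu_slice: "aff g a 0 z \<in> ?S" if "a \<in> \<mu>" "z \<in> ?S" for a z
    using scale_slice[OF that(2) _ k2] that(1) by (simp add: \<mu>_def)
  have pc: "p \<in> cspace (2 * g + 2)" by (rule slice_cspace[OF p])
  obtain V \<psi> where sp: "submanifold_param (2 * g + 2) g ?S V \<psi>" and pV: "p \<in> \<psi> ` V"
    using slice_submanifold[OF n k] p unfolding complex_submanifold_def by blast
  obtain u0 where u0: "u0 \<in> V" "\<psi> u0 = p" using pV by blast
  have Sc: "?S \<subseteq> cspace (2 * g + 2)" using slice_cspace by blast
  have psiS: "\<psi> u \<in> ?S" if "u \<in> V" for u using param_image_subset[OF sp] that by blast
  have cont: "continuous_on ?S (aff g a 0)" if "a \<in> \<mu>" for a
    by (rule continuous_on_subset[OF aff_continuous[OF nz[OF that]] Sc])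
  have pre: "openin (top_of_set ?S) {z \<in> ?S. aff g a 0 z \<in> Q}" if a: "a \<in> \<mu>" and Q: "openin (top_of_set ?S) Q" for a Q
  proof -
    obtain T where T: "open T" "Q = ?S \<inter> T" using Q by (auto simp: openin_open)
    have "openin (top_of_set ?S) (?S \<inter> aff g a 0 -` T)" by (rule continuous_openin_preimage_gen[OF cont[OF a] T(1)])
    moreover have "?S \<inter> aff g a 0 -` T = {z \<in> ?S. aff g a 0 z \<in> Q}" using T(2) mu_slice[OF a] by auto
    ultimately show ?thesis by simp
  qed
  \<comment> \<open>A root outside the stabiliser moves p. Separating p from its image gives a
    neighbourhood of p that is disjoint from its own image.\<close>
  have sep: "\<exists>Q. openin (top_of_set ?S) Q \<and> p \<in> Q \<and> (\<forall>z\<in>Q. aff g a 0 z \<notin> Q)" if a: "a \<in> \<mu> - St" for a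
  proof -
    have "p \<noteq> aff g a 0 p" using a by (auto simp: St_def)
    then obtain T1 T2 where T: "open T1" "open T2" "p \<in> T1" "aff g a 0 p \<in> T2" "T1 \<inter> T2 = {}"
      using hausdorff by metis
    have am: "a \<in> \<mu>" using a by simp
    have "openin (top_of_set ?S) (?S \<inter> T2)" using T(2) by (simp add: openin_open_Int)
    from openin_Int[OF openin_open_Int[OF T(1)] pre[OF am this]]
    have "openin (top_of_set ?S) ((?S \<inter> T1) \<inter> {z \<in> ?S. aff g a 0 z \<in> ?S \<inter> T2})" .
    moreover have "p \<in> (?S \<inter> T1) \<inter> {z \<in> ?S. aff g a 0 z \<in> ?S \<inter> T2}" using p T mu_slice[OF am p] by simp
    moreover have "\<forall>z\<in>(?S \<inter> T1) \<inter> {z \<in> ?S. aff g a 0 z \<in> ?S \<inter> T2}. aff g a 0 z \<notin> (?S \<inter> T1) \<inter> {z \<in> ?S. aff g a 0 z \<in> ?S \<inter> T2}"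
      using T(5) by blast
    ultimately show ?thesis by (intro exI conjI)
  qed
  then have "\<forall>a. \<exists>Q. a \<in> \<mu> - St \<longrightarrow> openin (top_of_set ?S) Q \<and> p \<in> Q \<and> (\<forall>z\<in>Q. aff g a 0 z \<notin> Q)" by blast
  from choice[OF this] obtain Q where Q: "\<forall>a. a \<in> \<mu> - St \<longrightarrow>
      openin (top_of_set ?S) (Q a) \<and> p \<in> Q a \<and> (\<forall>z\<in>Q a. aff g a 0 z \<notin> Q a)" ..
  \<comment> \<open>Finitely many open conditions: roots outside the stabiliser move the
    neighbourhood off itself, and roots inside keep it within the parametrised piece, where inverse
    parameters exist.\<close>
  define R where "R = \<Inter> (insert (\<psi> ` V) (Q ` (\<mu> - St) \<union> (\<lambda>a. {z \<in> ?S. aff g a 0 z \<in> \<psi> ` V}) ` St))"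
  have Ropen: "openin (top_of_set ?S) R"
    unfolding R_def
  proof (rule openin_Inter)
    show "finite (insert (\<psi> ` V) (Q ` (\<mu> - St) \<union> (\<lambda>a. {z \<in> ?S. aff g a 0 z \<in> \<psi> ` V}) ` St))"
      using fin by (simp add: St_def)
    fix X assume "X \<in> insert (\<psi> ` V) (Q ` (\<mu> - St) \<union> (\<lambda>a. {z \<in> ?S. aff g a 0 z \<in> \<psi> ` V}) ` St)"
    then consider "X = \<psi> ` V" | a where "a \<in> \<mu> - St" "X = Q a" | a where "a \<in> St" "X = {z \<in> ?S. aff g a 0 z \<in> \<psi> ` V}"
      by blast
    then show "openin (top_of_set ?S) X"
    proof cases
      case 1 then show ?thesis using param_open_image[OF sp] by simp
    next
      case (2 a) then show ?thesis using Q by blast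
    next
      case (3 a)
      then have "a \<in> \<mu>" by (simp add: St_def)
      from pre[OF this param_open_image[OF sp]] show ?thesis using 3(2) by simp
    qed
  qed simp
  have pR: "p \<in> R" using Q pV p by (auto simp: R_def St_def)
  have o1: "openin (top_of_set (cspace g)) {u \<in> V. \<psi> u \<in> R}" by (rule param_preimage_open[OF sp Ropen])
  have o2: "u0 \<in> {u \<in> V. \<psi> u \<in> R}" using u0 pR by simp
  obtain B where B: "openin (top_of_set (cspace g)) B" "connected B" "u0 \<in> B" "B \<subseteq> {u \<in> V. \<psi> u \<in> R}"
    by (rule cspace_ball[OF o2 o1])
  have BV: "B \<subseteq> V" and BR: "\<psi> ` B \<subseteq> R" using B(4) by auto
  have RV: "aff g a 0 x \<in> \<psi> ` V" if "a \<in> St" "x \<in> R" for a x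
  proof -
    have "x \<in> {z \<in> ?S. aff g a 0 z \<in> \<psi> ` V}" using that(2) unfolding R_def by (rule InterD) (use that(1) in simp)
    then show ?thesis by simp
  qed
  define move where "move a u = inv_into V \<psi> (aff g a 0 (\<psi> u))" for a u
  have move: "move a u \<in> V" "\<psi> (move a u) = aff g a 0 (\<psi> u)" if "a \<in> St" "u \<in> B" for a u
  proof -
    have *: "aff g a 0 (\<psi> u) \<in> \<psi> ` V" using RV[OF that(1)] BR that(2) by blast
    show "move a u \<in> V" unfolding move_def by (rule inv_into_into[OF *])
    show "\<psi> (move a u) = aff g a 0 (\<psi> u)" unfolding move_def by (rule f_inv_into_f[OF *])
  qed
  \<comment> \<open>B itself need not be invariant, but the union of its images under the stabiliser
    is; it is connected because every image contains u0.\<close>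
  define U where "U = (\<Union>a\<in>St. move a ` B)"
  have UV: "U \<subseteq> V" unfolding U_def using move(1) by blast
  have psiU: "\<psi> ` U = (\<Union>a\<in>St. aff g a 0 ` \<psi> ` B)"
    unfolding U_def image_UN using move(2) by (auto simp: image_image)
  have psiB: "openin (top_of_set ?S) (\<psi> ` B)" by (rule param_image_open[OF sp B(1) BV])
  have St_inv: "inverse a \<in> St" if "a \<in> St" for a
  proof -
    have a: "a \<in> \<mu>" "aff g a 0 p = p" using that by (auto simp: St_def)
    have "aff g (inverse a) 0 (aff g a 0 p) = p" using aff_inverse[OF nz[OF a(1)] pc, of 0] by simp
    then show ?thesis using a by (simp add: St_def \<mu>_def power_inverse)
  qed
  have St_mult: "a * b \<in> St" if "a \<in> St" "b \<in> St" for a b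
  proof -
    have a: "a \<in> \<mu>" "aff g a 0 p = p" and b: "b \<in> \<mu>" "aff g b 0 p = p" using that by (auto simp: St_def)
    have "aff g (a * b) 0 p = p" using aff_scale_compose[OF nz[OF a(1)], of g b p] a(2) b(2) by simp
    then show ?thesis using a(1) b(1) by (simp add: St_def \<mu>_def power_mult_distrib)
  qed
  have one: "1 \<in> St" using aff_id[OF pc] by (simp add: St_def \<mu>_def)
  have "openin (top_of_set (cspace g)) U"
    unfolding U_def
  proof (intro openin_Union ballI, elim imageE, clarify)
    fix a assume a: "a \<in> St"
    then have am: "a \<in> \<mu>" "inverse a \<in> \<mu>" using St_inv by (auto simp: St_def)
    \<comment> \<open>Written as a preimage under the inverse scaling, the translate is visibly
      open.\<close>
    have "move a ` B = {u \<in> V. \<psi> u \<in> {z \<in> ?S. aff g (inverse a) 0 z \<in> \<psi> ` B}}"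
    proof
      show "move a ` B \<subseteq> {u \<in> V. \<psi> u \<in> {z \<in> ?S. aff g (inverse a) 0 z \<in> \<psi> ` B}}"
      proof
        fix v assume "v \<in> move a ` B"
        then obtain u where u: "u \<in> B" "v = move a u" by blast
        have uS: "\<psi> u \<in> ?S" using u(1) BV psiS by blast
        have "aff g (inverse a) 0 (aff g a 0 (\<psi> u)) = \<psi> u"
          using aff_inverse[OF nz[OF am(1)] slice_cspace[OF uS], of 0] by simp
        then show "v \<in> {u \<in> V. \<psi> u \<in> {z \<in> ?S. aff g (inverse a) 0 z \<in> \<psi> ` B}}"
          using move[OF a u(1)] u mu_slice[OF am(1) uS] by simp
      qed
      show "{u \<in> V. \<psi> u \<in> {z \<in> ?S. aff g (inverse a) 0 z \<in> \<psi> ` B}} \<subseteq> move a ` B"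
      proof
        fix v assume "v \<in> {u \<in> V. \<psi> u \<in> {z \<in> ?S. aff g (inverse a) 0 z \<in> \<psi> ` B}}"
        then obtain u where v: "v \<in> V" and u: "u \<in> B" "aff g (inverse a) 0 (\<psi> v) = \<psi> u" by auto
        have "aff g a 0 (\<psi> u) = \<psi> v"
          unfolding u(2)[symmetric] using aff_inverse[OF nz[OF am(2)] slice_cspace[OF psiS[OF v]], of 0] by simp
        then have "move a u = v" unfolding move_def using param_inv[OF sp v] by simp
        then show "v \<in> move a ` B" using u(1) by blast
      qed
    qed
    then show "openin (top_of_set (cspace g)) (move a ` B)"
      using param_preimage_open[OF sp pre[OF am(2) psiB]] by simp
  qed
  moreover have "connected U"
    unfolding U_def
  proof (rule connected_Union)
    show "connected X" if X: "X \<in> (\<lambda>a. move a ` B) ` St" for X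
    proof -
      obtain a where a: "a \<in> St" "X = move a ` B" using X by blast
      have am: "a \<in> \<mu>" using a(1) by (simp add: St_def)
      have "continuous_on B (\<lambda>u. aff g a 0 (\<psi> u))"
        by (rule continuous_on_compose2[OF cont[OF am] continuous_on_subset[OF param_continuous[OF sp] BV]])
           (use BV psiS in blast)
      then have "continuous_on B (move a)"
        unfolding move_def by (rule continuous_on_compose2[OF param_inv_continuous[OF sp]])
          (use BR RV[OF a(1)] in blast)
      then show ?thesis unfolding a(2) using B(2) by (rule connected_continuous_image)
    qed
    have "move a u0 = u0" if "a \<in> St" for a
      using that u0 param_inv[OF sp u0(1)] by (simp add: move_def St_def)
    then have "u0 \<in> \<Inter> ((\<lambda>a. move a ` B) ` St)" using B(3) by (metis (no_types, lifting) INT_I image_eqI)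
    then show "\<Inter> ((\<lambda>a. move a ` B) ` St) \<noteq> {}" by blast
  qed
  moreover have "aff g a 0 ` \<psi> ` U = \<psi> ` U" if a: "a ^ ?w = 1" and meet: "aff g a 0 ` \<psi> ` U \<inter> \<psi> ` U \<noteq> {}" for a
  proof -
    have am: "a \<in> \<mu>" using a by (simp add: \<mu>_def)
    obtain c b y y' where cb: "c \<in> St" "b \<in> St" "y \<in> \<psi> ` B" "y' \<in> \<psi> ` B"
      and eq: "aff g a 0 (aff g c 0 y) = aff g b 0 y'"
      using meet unfolding psiU by blast
    have cm: "c \<in> \<mu>" "b \<in> \<mu>" using cb by (auto simp: St_def)
    have yc: "y' \<in> cspace (2 * g + 2)" using cb(4) BV psiS slice_cspace by blast
    have "aff g (inverse b) 0 (aff g b 0 y') = y'" using aff_inverse[OF nz[OF cm(2)] yc, of 0] by simp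
    \<comment> \<open>When two translates meet, the combined root c a / b carries a point of B to a
      point of B. By the choice of R it lies in the stabiliser, and then so does a.\<close>
    then have y': "aff g (c * a * inverse b) 0 y = y'"
      using eq aff_scale_compose[of "c * a" g "inverse b" y] aff_scale_compose[of c g a y] nz am cm by simp
    have "c * a * inverse b \<in> \<mu>" using cm am by (simp add: \<mu>_def power_mult_distrib power_inverse)
    moreover have "c * a * inverse b \<notin> \<mu> - St"
    proof
      assume m: "c * a * inverse b \<in> \<mu> - St"
      have "x \<in> Q (c * a * inverse b)" if "x \<in> R" for x
        using that unfolding R_def by (rule InterD) (use m in simp)
      then have "y \<in> Q (c * a * inverse b)" "y' \<in> Q (c * a * inverse b)" using BR cb(3,4) by blast+
      then show False using Q m y' by blast
    qed
    ultimately have "c * a * inverse b \<in> St" by blast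
    then have "inverse c * ((c * a * inverse b) * b) \<in> St" using cb St_inv St_mult by blast
    moreover have "inverse c * ((c * a * inverse b) * b) = a" using nz[OF cm(1)] nz[OF cm(2)] by (simp add: field_simps)
    ultimately have aS: "a \<in> St" by simp
    have sub: "aff g e 0 ` \<psi> ` U \<subseteq> \<psi> ` U" if e: "e \<in> St" for e
    proof
      fix x assume "x \<in> aff g e 0 ` \<psi> ` U"
      then obtain f y where f: "f \<in> St" "y \<in> \<psi> ` B" "x = aff g e 0 (aff g f 0 y)" unfolding psiU by blast
      have "f \<noteq> 0" using f(1) nz by (simp add: St_def)
      then have "x = aff g (f * e) 0 y" using f(3) aff_scale_compose by simp
      then show "x \<in> \<psi> ` U" unfolding psiU using f(2) St_mult[OF f(1) e] by blast
    qed
    show ?thesis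
    proof
      show "aff g a 0 ` \<psi> ` U \<subseteq> \<psi> ` U" by (rule sub[OF aS])
      show "\<psi> ` U \<subseteq> aff g a 0 ` \<psi> ` U"
      proof
        fix x assume x: "x \<in> \<psi> ` U"
        then have xc: "x \<in> cspace (2 * g + 2)" using UV psiS slice_cspace by blast
        have "aff g (inverse a) 0 x \<in> \<psi> ` U" using sub[OF St_inv[OF aS]] x by blast
        moreover have "aff g a 0 (aff g (inverse a) 0 x) = x"
          using aff_inverse[OF nz xc, of "inverse a" 0] St_inv[OF aS] by (simp add: St_def)
        ultimately show "x \<in> aff g a 0 ` \<psi> ` U" by (metis imageI)
      qed
    qed
  qed
  moreover have "u0 \<in> U"
  proof -
    have "move 1 u0 = u0" using u0 aff_id[OF pc] param_inv[OF sp u0(1)] by (simp add: move_def)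
    then show ?thesis unfolding U_def using one B(3) by (metis UN_I image_eqI)
  qed
  ultimately have "slice_chart g n k U \<psi>" "p \<in> \<psi> ` U"
    unfolding slice_chart_def using param_restrict[OF sp _ UV] u0 by auto
  then show ?thesis by (rule that)
qed

section \<open>The topology of the quotient\<close>

lemma second_countable_euclidean: "second_countable (euclidean :: 'a::second_countable_topology topology)"
proof -
  obtain B :: "'a set set" where B: "countable B" "topological_basis B" using ex_countable_basis by blast
  show ?thesis
    unfolding second_countable_def
  proof (intro exI[of _ B] conjI allI ballI impI)
    show "openin euclidean V" if "V \<in> B" for V using topological_basis_open[OF B(2) that] by simp
    show "\<exists>V\<in>B. x \<in> V \<and> V \<subseteq> U" if "openin euclidean U \<and> x \<in> U" for U x
      using topological_basisE[OF B(2), of U x] that by (metis open_openin)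
  qed (rule B(1))
qed

lemma topspace_A_quot: "topspace (A_quot g n) = A_proj g ` A_tilde_coeffs g n"
  using quotient_map_quotient_topology[of "top_of_set (A_tilde_coeffs g n)" "A_proj g"]
  by (simp add: quotient_map_def A_quot_def)

lemma openin_A_quot: "openin (A_quot g n) V \<longleftrightarrow> V \<subseteq> A_proj g ` A_tilde_coeffs g n \<and>
    openin (top_of_set (A_tilde_coeffs g n)) {z \<in> A_tilde_coeffs g n. A_proj g z \<in> V}"
  by (simp add: A_quot_def openin_quotient_topology)

lemma A_tilde_coeffs_cspace: "z \<in> A_tilde_coeffs g n \<Longrightarrow> z \<in> cspace (2 * g + 2)"
  unfolding A_tilde_coeffs_def by blast

lemma A_proj_aff: "z \<in> cspace (2 * g + 2) \<Longrightarrow> a \<noteq> 0 \<Longrightarrow> A_proj g (aff g a b z) = A_proj g z"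
  using A_proj_eq_iff[OF _ aff_in_cspace, of z g a b z] by blast

lemma aff_preimage_open:
  assumes Q: "openin (top_of_set (A_tilde_coeffs g n)) Q" and a: "a \<noteq> 0"
  shows "openin (top_of_set (A_tilde_coeffs g n)) {z \<in> A_tilde_coeffs g n. aff g a b z \<in> Q}"
proof -
  let ?A = "A_tilde_coeffs g n"
  obtain T where T: "open T" "Q = ?A \<inter> T" using Q by (auto simp: openin_open)
  have "continuous_on ?A (aff g a b)"
    by (rule continuous_on_subset[OF aff_continuous[OF a]]) (use A_tilde_coeffs_cspace in blast)
  from continuous_openin_preimage_gen[OF this T(1)]
  have "openin (top_of_set ?A) (?A \<inter> aff g a b -` T)" .
  moreover have "?A \<inter> aff g a b -` T = {z \<in> ?A. aff g a b z \<in> Q}" using T(2) aff_A_tilde_coeffs[OF a] by auto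
  ultimately show ?thesis by simp
qed

text \<open>The saturation of an open set is the union of its preimages under all group elements, so
  the projection is an open map.\<close>

lemma A_proj_saturation_open:
  assumes Q: "openin (top_of_set (A_tilde_coeffs g n)) Q"
  shows "openin (A_quot g n) (A_proj g ` Q)"
proof -
  let ?A = "A_tilde_coeffs g n"
  have QA: "Q \<subseteq> ?A" using Q openin_imp_subset by blast
  have "{z \<in> ?A. A_proj g z \<in> A_proj g ` Q} = (\<Union>(a, b)\<in>{(a, b). a \<noteq> 0}. {z \<in> ?A. aff g a b z \<in> Q})"
  proof (rule Set.set_eqI, rule iffI)
    fix z assume "z \<in> {z \<in> ?A. A_proj g z \<in> A_proj g ` Q}"
    then obtain w where w: "z \<in> ?A" "w \<in> Q" "A_proj g z = A_proj g w" by auto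
    then have "z \<in> cspace (2 * g + 2)" "w \<in> cspace (2 * g + 2)" using QA A_tilde_coeffs_cspace by blast+
    from A_proj_eq_iff[OF this] w(3) obtain a b where "a \<noteq> 0" "w = aff g a b z" by blast
    then show "z \<in> (\<Union>(a, b)\<in>{(a, b). a \<noteq> 0}. {z \<in> ?A. aff g a b z \<in> Q})" using w(1,2) by auto
  next
    fix z assume "z \<in> (\<Union>(a, b)\<in>{(a, b). a \<noteq> 0}. {z \<in> ?A. aff g a b z \<in> Q})"
    then obtain a b where ab: "a \<noteq> 0" "z \<in> ?A" "aff g a b z \<in> Q" by auto
    have "A_proj g z = A_proj g (aff g a b z)" using A_proj_aff[OF A_tilde_coeffs_cspace[OF ab(2)] ab(1)] by simp
    then show "z \<in> {z \<in> ?A. A_proj g z \<in> A_proj g ` Q}" using ab by blast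
  qed
  moreover have "openin (top_of_set ?A) (\<Union>(a, b)\<in>{(a, b). a \<noteq> 0}. {z \<in> ?A. aff g a b z \<in> Q})"
    by (rule openin_Union) (use aff_preimage_open[OF Q] in auto)
  ultimately show ?thesis using QA unfolding openin_A_quot by auto
qed

lemma normalise_preimage_open:
  assumes k: "k < 2 * g + 2" and Q: "openin (top_of_set (slice g n k)) Q"
  shows "openin (top_of_set (A_tilde_coeffs g n)) {z \<in> A_tilde_coeffs g n. z \<in> norm_domain g k \<and> normalise g k z \<in> Q}"
proof -
  let ?A = "A_tilde_coeffs g n" and ?N = "2 * g + 2"
  obtain T where T: "open T" "Q = slice g n k \<inter> T" using Q by (auto simp: openin_open)
  have "openin (top_of_set (cspace ?N)) (cspace ?N \<inter> T)" using T(1) by (rule openin_open_Int)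
  from holomorphic_preimage_open[OF normalise_holomorphic this]
  have "openin (top_of_set (cspace ?N)) {z \<in> norm_domain g k. normalise g k z \<in> cspace ?N \<inter> T}" .
  then obtain T' where T': "open T'" "{z \<in> norm_domain g k. normalise g k z \<in> cspace ?N \<inter> T} = cspace ?N \<inter> T'"
    by (auto simp: openin_open)
  have "{z \<in> ?A. z \<in> norm_domain g k \<and> normalise g k z \<in> Q} = ?A \<inter> T'"
  proof (rule Set.set_eqI, rule iffI)
    fix z assume z: "z \<in> {z \<in> ?A. z \<in> norm_domain g k \<and> normalise g k z \<in> Q}"
    then have "normalise g k z \<in> cspace ?N \<inter> T" using T(2) slice_cspace by blast
    then show "z \<in> ?A \<inter> T'" using T'(2) z by blast
  next
    fix z assume z: "z \<in> ?A \<inter> T'"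
    then have "z \<in> {z \<in> norm_domain g k. normalise g k z \<in> cspace ?N \<inter> T}" using T'(2) A_tilde_coeffs_cspace by blast
    then have 1: "z \<in> norm_domain g k" "normalise g k z \<in> T" by auto
    then have "centred_coeff g k z \<noteq> 0" by (auto simp: norm_domain_def)
    then have "normalise g k z \<in> slice g n k" using z by (intro normalise_slice[OF _ k]) auto
    then show "z \<in> {z \<in> ?A. z \<in> norm_domain g k \<and> normalise g k z \<in> Q}" using z 1 T(2) by blast
  qed
  then show ?thesis using T'(1) by (simp add: openin_open_Int)
qed

text \<open>An open part of a slice need not be open in the whole space, but its saturation equals
  that of its preimage under \<open>normalise\<close>, which is open.\<close>

lemma slice_saturation_open:
  assumes k: "k < 2 * g + 2" and Q: "openin (top_of_set (slice g n k)) Q"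
  shows "openin (A_quot g n) (A_proj g ` Q)"
proof -
  let ?A = "A_tilde_coeffs g n"
  define G where "G = {z \<in> ?A. z \<in> norm_domain g k \<and> normalise g k z \<in> Q}"
  have QS: "Q \<subseteq> slice g n k" using Q openin_imp_subset by blast
  have "A_proj g ` Q = A_proj g ` G"
  proof
    show "A_proj g ` Q \<subseteq> A_proj g ` G"
    proof (rule image_mono, rule subsetI)
      fix z assume z: "z \<in> Q"
      then have zs: "z \<in> slice g n k" using QS by blast
      show "z \<in> G" unfolding G_def using slice_A_tilde[OF zs] slice_norm_domain[OF zs] normalise_id[OF zs] z by simp
    qed
    show "A_proj g ` G \<subseteq> A_proj g ` Q"
    proof
      fix x assume "x \<in> A_proj g ` G"
      then obtain z where z: "z \<in> G" "x = A_proj g z" by blast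
      have "z \<in> cspace (2 * g + 2)" using z(1) A_tilde_coeffs_cspace by (auto simp: G_def)
      then have "A_proj g (normalise g k z) = A_proj g z" unfolding normalise_def by (rule A_proj_aff) simp
      then show "x \<in> A_proj g ` Q" using z by (auto simp: G_def intro: rev_image_eqI)
    qed
  qed
  moreover have "openin (top_of_set ?A) G" unfolding G_def by (rule normalise_preimage_open[OF k Q])
  ultimately show ?thesis using A_proj_saturation_open by simp
qed

lemma A_proj_quotient: "quotient_map (top_of_set (A_tilde_coeffs g n)) (A_quot g n) (A_proj g)"
  unfolding A_quot_def by (rule quotient_map_quotient_topology)

lemma A_proj_open_map: "open_map (top_of_set (A_tilde_coeffs g n)) (A_quot g n) (A_proj g)"
  unfolding open_map_def using A_proj_saturation_open by blast

lemma second_countable_A_quot: "second_countable (A_quot g n)"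
  by (rule second_countable_open_map_image[OF quotient_imp_continuous_map[OF A_proj_quotient] A_proj_open_map])
     (simp_all add: topspace_A_quot second_countable_subtopology second_countable_euclidean)

text \<open>Otherwise D would be x^(2g+2), which has a multiple root at 0.\<close>

lemma centred_nonzero_coeff:
  assumes z: "z \<in> A_tilde_coeffs g n" and c: "z (2 * g + 1) = 0"
  obtains i where "i < 2 * g + 1" "z i \<noteq> 0"
proof -
  have "\<exists>i<2 * g + 1. z i \<noteq> 0"
  proof (rule ccontr)
    assume "\<not> ?thesis"
    then have z0: "z i = 0" if "i < 2 * g + 2" for i
      using c that by (cases "i = 2 * g + 1") auto
    have "monic_poly (2 * g + 2) z = monom 1 (2 * g + 2)"
      using z0 by (auto simp: poly_eq_iff coeff_monic_poly)
    moreover have "poly (monom 1 (2 * g + 2)) (0::complex) = 0" by (simp add: poly_monom)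
    moreover have "poly (pderiv (monom 1 (2 * g + 2))) (0::complex) = 0" by (simp add: pderiv_monom poly_monom)
    moreover have "rsquarefree (monic_poly (2 * g + 2) z)" using z by (simp add: A_tilde_coeffs_def A_tilde_def H_tilde_def)
    ultimately show False unfolding rsquarefree_roots by metis
  qed
  then show ?thesis using that by blast
qed

text \<open>The action of the scalings on centred polynomials has positive weights, so a scaling that moves
  a point near another given orbit is bounded and bounded away from zero.\<close>

lemma scale_limit:
  assumes z: "z \<in> A_tilde_coeffs g n" "z (2 * g + 1) = 0" and w: "w \<in> A_tilde_coeffs g n" "w (2 * g + 1) = 0"
    and Z: "\<And>i. (\<lambda>j. Z j i) \<longlonglongrightarrow> z i" and W: "\<And>i. (\<lambda>j. W j i) \<longlonglongrightarrow> w i"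
    and eq: "\<And>j i. i < 2 * g + 2 \<Longrightarrow> W j i = \<alpha> j ^ (2 * g + 2 - i) * Z j i"
  shows "\<exists>a. a \<noteq> 0 \<and> w = aff g a 0 z"
proof -
  \<comment> \<open>A nonzero coefficient of z bounds the scalings, since a positive power of them
    converges to w p / z p. A nonzero coefficient of w keeps a limit of the scalings from being
    0.\<close>
  obtain p where p: "p < 2 * g + 1" "z p \<noteq> 0" by (rule centred_nonzero_coeff[OF z])
  obtain q where q: "q < 2 * g + 1" "w q \<noteq> 0" by (rule centred_nonzero_coeff[OF w])
  define e where "e = 2 * g + 2 - p"
  have e: "e > 0" using p by (simp add: e_def)
  have "(\<lambda>j. W j p / Z j p) \<longlonglongrightarrow> w p / z p" by (intro tendsto_divide W Z p)
  moreover have "\<forall>\<^sub>F j in sequentially. Z j p \<noteq> 0" using tendsto_imp_eventually_ne[OF Z p(2)] .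
  then have "\<forall>\<^sub>F j in sequentially. W j p / Z j p = \<alpha> j ^ e"
    by (rule eventually_mono) (use eq[of p] p in \<open>simp add: e_def\<close>)
  ultimately have "(\<lambda>j. \<alpha> j ^ e) \<longlonglongrightarrow> w p / z p" by (rule Lim_transform_eventually)
  then have "Bseq (\<lambda>j. \<alpha> j ^ e)" using convergentI convergent_imp_Bseq by blast
  then obtain C where "\<forall>j. norm (\<alpha> j ^ e) \<le> C" by (rule BseqE)
  then have C: "cmod (\<alpha> j) ^ e \<le> C" for j by (simp add: norm_power)
  have "cmod (\<alpha> j) \<le> max 1 C" for j
  proof (cases "cmod (\<alpha> j) \<le> 1")
    case False
    then have "cmod (\<alpha> j) \<le> cmod (\<alpha> j) ^ e" using e self_le_power[of "cmod (\<alpha> j)" e] by simp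
    then show ?thesis using C[of j] by simp
  qed simp
  then have "bounded (range \<alpha>)" unfolding bounded_iff by blast
  then obtain l \<sigma> where l: "strict_mono (\<sigma> :: nat \<Rightarrow> nat)" "(\<alpha> \<circ> \<sigma>) \<longlonglongrightarrow> l"
    using bounded_imp_convergent_subsequence[of \<alpha>] by blast
  have wl: "w i = l ^ (2 * g + 2 - i) * z i" if "i < 2 * g + 2" for i
  proof -
    have "(\<lambda>j. \<alpha> (\<sigma> j) ^ (2 * g + 2 - i) * Z (\<sigma> j) i) \<longlonglongrightarrow> l ^ (2 * g + 2 - i) * z i"
      using l(2) LIMSEQ_subseq_LIMSEQ[OF Z l(1)] by (intro tendsto_mult tendsto_power) (simp_all add: o_def)
    moreover have "(\<lambda>j. W (\<sigma> j) i) \<longlonglongrightarrow> w i" using LIMSEQ_subseq_LIMSEQ[OF W l(1)] by (simp add: o_def)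
    ultimately show ?thesis using eq[OF that] LIMSEQ_unique by simp
  qed
  have "l \<noteq> 0"
  proof
    assume "l = 0"
    then show False using wl[of q] q by simp
  qed
  have "w = aff g (inverse l) 0 z"
  proof (rule cspace_eqI[OF A_tilde_coeffs_cspace[OF w(1)] aff_in_cspace])
    fix i assume "i < 2 * g + 2"
    then show "w i = aff g (inverse l) 0 z i" using wl \<open>l \<noteq> 0\<close> by (simp add: aff_scale)
  qed
  then show ?thesis using \<open>l \<noteq> 0\<close> by (intro exI[of _ "inverse l"]) simp
qed

text \<open>After centring, an affine map acts as the scaling by its linear part. The translations
  of a sequence of affine maps thereby drop out of the limit argument.\<close>

lemma aff_cent_aff:
  assumes a: "a \<noteq> 0"
  shows "aff g 1 (cent g (aff g a b z)) (aff g a b z) = aff g a 0 (aff g 1 (cent g z) z)"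
proof -
  let ?t = "a * cent g (aff g a b z) + b"
  have l: "aff g 1 (cent g (aff g a b z)) (aff g a b z) = aff g a ?t z" using aff_compose[OF a, of g 1] by simp
  have "aff g a ?t z (2 * g + 1) = 0" unfolding l[symmetric] by (rule aff_cent_top) simp
  then have "z (2 * g + 1) + of_nat (2 * g + 2) * ?t = 0" using a unfolding aff_centre_coeff[OF a] by simp
  then have "?t = cent g z"
    unfolding cent_def using of_nat_degree_nonzero[of g] by (simp only: nonzero_eq_divide_eq eq_neg_iff_add_eq_0 not_False_eq_True) (simp add: algebra_simps)
  then show ?thesis unfolding l using aff_compose[of 1 g a 0 "cent g z" z] by simp
qed

text \<open>Balls around z and w have open images. If the images met for all radii 1/(j+1), centring
  would give sequences that are related by scalings and converge to the centred points, and these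
  would lie in one orbit.\<close>

lemma Hausdorff_A_quot: "Hausdorff_space (A_quot g n)"
  unfolding Hausdorff_space_def topspace_A_quot
proof (intro allI impI, elim conjE imageE)
  let ?A = "A_tilde_coeffs g n" and ?N = "2 * g + 2"
  fix x y z w assume xy: "x \<noteq> y" and z: "x = A_proj g z" "z \<in> ?A" and w: "y = A_proj g w" "w \<in> ?A"
  have zc: "z \<in> cspace ?N" and wc: "w \<in> cspace ?N" using z w A_tilde_coeffs_cspace by blast+
  let ?B = "\<lambda>z j. {u \<in> ?A. nm ?N (u - z) < 1 / real (Suc j)}"
  have Bopen: "openin (top_of_set ?A) (?B p j)" if pc: "p \<in> cspace ?N" for p j
  proof -
    have "openin (top_of_set (cspace ?N)) {u \<in> cspace ?N. nm ?N (u - p) < 1 / real (Suc j)}"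
      unfolding openin_cspace_iff_nb
    proof (intro conjI ballI)
      fix u assume u: "u \<in> {u \<in> cspace ?N. nm ?N (u - p) < 1 / real (Suc j)}"
      then have "\<forall>\<^sub>F v in nb ?N u. nm ?N (v - u) < 1 / real (Suc j) - nm ?N (u - p)"
        by (intro order_tendstoD(2)[OF tendsto_nm_nb]) auto
      with eventually_nb_cspace show "\<forall>\<^sub>F v in nb ?N u. v \<in> {u \<in> cspace ?N. nm ?N (u - p) < 1 / real (Suc j)}"
      proof eventually_elim
        case (elim v)
        then show ?case using nm_triangle_diff[of ?N v p u] by simp
      qed
    qed auto
    then obtain T where T: "open T" "{u \<in> cspace ?N. nm ?N (u - p) < 1 / real (Suc j)} = cspace ?N \<inter> T"
      by (auto simp: openin_open)
    have "?B p j = ?A \<inter> T" using T(2) A_tilde_coeffs_cspace by blast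
    then show ?thesis using T(1) by (simp add: openin_open_Int)
  qed
  have "\<exists>j. disjnt (A_proj g ` ?B z j) (A_proj g ` ?B w j)"
  proof (rule ccontr)
    assume "\<not> ?thesis"
    then have "\<forall>j. \<exists>uv. fst uv \<in> ?B z j \<and> snd uv \<in> ?B w j \<and> A_proj g (fst uv) = A_proj g (snd uv)"
      unfolding disjnt_def by fastforce
    from choice[OF this] obtain uv where
      uv: "\<And>j. fst (uv j) \<in> ?B z j" "\<And>j. snd (uv j) \<in> ?B w j" "\<And>j. A_proj g (fst (uv j)) = A_proj g (snd (uv j))" by blast
    define Z where "Z j = fst (uv j)" for j
    define W where "W j = snd (uv j)" for j
    have ZA: "Z j \<in> ?A" "nm ?N (Z j - z) < 1 / real (Suc j)" and WA: "W j \<in> ?A" "nm ?N (W j - w) < 1 / real (Suc j)" for j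
      using uv(1,2)[of j] by (auto simp: Z_def W_def)
    have lim: "filterlim S (nb ?N s) sequentially" if sc: "s \<in> cspace ?N" and S: "\<And>j. S j \<in> ?A" "\<And>j. nm ?N (S j - s) < 1 / real (Suc j)" for S s
      unfolding filterlim_nb_nm[OF sc]
    proof (intro conjI always_eventually allI)
      show "S j \<in> cspace ?N" for j using S(1) A_tilde_coeffs_cspace by blast
      show "(\<lambda>j. nm ?N (S j - s)) \<longlonglongrightarrow> 0"
      proof (rule Lim_null_comparison)
        show "(\<lambda>j. 1 / real (Suc j)) \<longlonglongrightarrow> 0" by (rule LIMSEQ_Suc[OF lim_1_over_n])
        show "\<forall>\<^sub>F j in sequentially. norm (nm ?N (S j - s)) \<le> 1 / real (Suc j)"
          using S(2) by (intro always_eventually allI) (simp add: less_imp_le)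
      qed
    qed
    have "\<forall>j. \<exists>ab. fst ab \<noteq> 0 \<and> W j = aff g (fst ab) (snd ab) (Z j)"
    proof
      fix j
      have "Z j \<in> cspace ?N" "W j \<in> cspace ?N" using ZA(1) WA(1) A_tilde_coeffs_cspace by blast+
      from A_proj_eq_iff[OF this] uv(3)[of j] show "\<exists>ab. fst ab \<noteq> 0 \<and> W j = aff g (fst ab) (snd ab) (Z j)"
        unfolding Z_def W_def by auto
    qed
    from choice[OF this] obtain ab where ab: "\<And>j. fst (ab j) \<noteq> 0" "\<And>j. W j = aff g (fst (ab j)) (snd (ab j)) (Z j)" by blast
    let ?c = "\<lambda>u. aff g 1 (cent g u) u"
    have climit: "(\<lambda>j. ?c (S j) i) \<longlonglongrightarrow> ?c s i" if sc: "s \<in> cspace ?N" and S: "filterlim S (nb ?N s) sequentially" for S s i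
    proof -
      have "cdiff ?N (\<lambda>u. ?c u i) s" by (intro cdiff_aff cdiff_const cdiff_cent cdiff_coord sc) simp
      then obtain c where "has_grad ?N (\<lambda>u. ?c u i) c s" unfolding cdiff_def ..
      from filterlim_compose[OF has_grad_isCont[OF this] S] show ?thesis .
    qed
    have "\<exists>a. a \<noteq> 0 \<and> ?c w = aff g a 0 (?c z)"
    proof (rule scale_limit[where Z = "\<lambda>j. ?c (Z j)" and W = "\<lambda>j. ?c (W j)" and \<alpha> = "\<lambda>j. inverse (fst (ab j))"])
      show "?c z \<in> ?A" "?c w \<in> ?A" using aff_A_tilde_coeffs z(2) w(2) by simp_all
      show "?c z (2 * g + 1) = 0" "?c w (2 * g + 1) = 0" using aff_cent_top[of 1 g] by simp_all
      show "(\<lambda>j. ?c (Z j) i) \<longlonglongrightarrow> ?c z i" for i by (rule climit[OF zc lim[OF zc ZA]])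
      show "(\<lambda>j. ?c (W j) i) \<longlonglongrightarrow> ?c w i" for i by (rule climit[OF wc lim[OF wc WA]])
      show "?c (W j) i = inverse (fst (ab j)) ^ (2 * g + 2 - i) * ?c (Z j) i" if "i < 2 * g + 2" for i j
        unfolding ab(2)[of j] aff_cent_aff[OF ab(1)] by (rule aff_scale[OF ab(1) that])
    qed
    then obtain a where a: "a \<noteq> 0" "?c w = aff g a 0 (?c z)" by blast
    have "A_proj g w = A_proj g (?c w)" using A_proj_aff[OF wc, of 1] by simp
    also have "\<dots> = A_proj g (?c z)" unfolding a(2) by (rule A_proj_aff[OF aff_in_cspace a(1)])
    also have "\<dots> = A_proj g z" using A_proj_aff[OF zc, of 1] by simp
    finally show False using xy z(1) w(1) by simp
  qed
  then obtain j where j: "disjnt (A_proj g ` ?B z j) (A_proj g ` ?B w j)" by blast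
  have "openin (A_quot g n) (A_proj g ` ?B z j)" "openin (A_quot g n) (A_proj g ` ?B w j)"
    using A_proj_saturation_open Bopen zc wc by blast+
  moreover have "z \<in> ?B z j" "w \<in> ?B w j" using z(2) w(2) by simp_all
  then have "x \<in> A_proj g ` ?B z j" "y \<in> A_proj g ` ?B w j" unfolding z(1) w(1) by (blast intro: imageI)+
  ultimately show "\<exists>U V. openin (A_quot g n) U \<and> openin (A_quot g n) V \<and> x \<in> U \<and> y \<in> V \<and> disjnt U V"
    using j by blast
qed

section \<open>Orbifold charts\<close>

definition chart_roots :: "nat \<Rightarrow> nat \<Rightarrow> cvec set \<Rightarrow> (cvec \<Rightarrow> cvec) \<Rightarrow> complex set" where
  "chart_roots g k U \<psi> = {a. a ^ (2 * g + 2 - k) = 1 \<and> aff g a 0 ` \<psi> ` U = \<psi> ` U}"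

text \<open>The value outside U is fixed by \<open>restrict\<close>, as membership in
  \<open>Bij\<close> requires.\<close>

definition chart_move :: "nat \<Rightarrow> cvec set \<Rightarrow> (cvec \<Rightarrow> cvec) \<Rightarrow> complex \<Rightarrow> cvec \<Rightarrow> cvec" where
  "chart_move g U \<psi> a = restrict (\<lambda>u. inv_into U \<psi> (aff g a 0 (\<psi> u))) U"

text \<open>Passing from roots of unity to maps identifies roots that act alike on U, so the group
  acts effectively.\<close>

definition chart_group :: "nat \<Rightarrow> nat \<Rightarrow> cvec set \<Rightarrow> (cvec \<Rightarrow> cvec) \<Rightarrow> (cvec \<Rightarrow> cvec) set" where
  "chart_group g k U \<psi> = chart_move g U \<psi> ` chart_roots g k U \<psi>"

context
  fixes g n k :: nat and U \<psi>
  assumes k: "k < 2 * g + 1" and sc: "slice_chart g n k U \<psi>"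
begin

lemma chart_param: "submanifold_param (2 * g + 2) g (slice g n k) U \<psi>"
  using sc by (simp add: slice_chart_def)

lemma chart_slice: "u \<in> U \<Longrightarrow> \<psi> u \<in> slice g n k"
  using param_image_subset[OF chart_param] by blast

lemma chart_A_tilde: "u \<in> U \<Longrightarrow> \<psi> u \<in> A_tilde_coeffs g n"
  by (rule slice_A_tilde[OF chart_slice])

lemma chart_cspace: "u \<in> U \<Longrightarrow> \<psi> u \<in> cspace (2 * g + 2)"
  by (rule slice_cspace[OF chart_slice])

lemma chart_roots_nonzero: "a \<in> chart_roots g k U \<psi> \<Longrightarrow> a \<noteq> 0"
  using root_of_unity_nonzero[of "2 * g + 2 - k" a] k by (simp add: chart_roots_def)

lemma chart_roots_one: "1 \<in> chart_roots g k U \<psi>"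
proof -
  have "aff g 1 0 ` \<psi> ` U = \<psi> ` U" using aff_id[OF chart_cspace] by (auto simp: image_iff)
  then show ?thesis by (simp add: chart_roots_def)
qed

lemma chart_roots_mult:
  assumes a: "a \<in> chart_roots g k U \<psi>" and b: "b \<in> chart_roots g k U \<psi>"
  shows "b * a \<in> chart_roots g k U \<psi>"
proof -
  have "aff g (b * a) 0 ` \<psi> ` U = aff g a 0 ` aff g b 0 ` \<psi> ` U"
    using aff_scale_compose[OF chart_roots_nonzero[OF b], of g a] by (simp add: image_image)
  also have "\<dots> = \<psi> ` U" using a b by (simp add: chart_roots_def)
  finally show ?thesis using a b by (simp add: chart_roots_def power_mult_distrib)
qed

lemma chart_roots_inverse:
  assumes a: "a \<in> chart_roots g k U \<psi>"
  shows "inverse a \<in> chart_roots g k U \<psi>"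
proof -
  have "aff g (inverse a) 0 ` \<psi> ` U = aff g (inverse a) 0 ` aff g a 0 ` \<psi> ` U"
    using a by (simp add: chart_roots_def)
  also have "\<dots> = \<psi> ` U"
    using aff_inverse[OF chart_roots_nonzero[OF a] chart_cspace, of _ 0] by (simp add: image_image cong: image_cong)
  finally show ?thesis using a by (simp add: chart_roots_def power_inverse)
qed

lemma chart_move:
  assumes a: "a \<in> chart_roots g k U \<psi>" and u: "u \<in> U"
  shows "chart_move g U \<psi> a u \<in> U" "\<psi> (chart_move g U \<psi> a u) = aff g a 0 (\<psi> u)"
proof -
  have *: "aff g a 0 (\<psi> u) \<in> \<psi> ` U" using a u unfolding chart_roots_def by blast
  show "chart_move g U \<psi> a u \<in> U" using inv_into_into[OF *] u by (simp add: chart_move_def)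
  show "\<psi> (chart_move g U \<psi> a u) = aff g a 0 (\<psi> u)" using f_inv_into_f[OF *] u by (simp add: chart_move_def)
qed

lemma chart_move_eqI: "u \<in> U \<Longrightarrow> v \<in> U \<Longrightarrow> \<psi> v = aff g a 0 (\<psi> u) \<Longrightarrow> chart_move g U \<psi> a u = v"
  using param_inv[OF chart_param, of v] by (simp add: chart_move_def)

lemma chart_move_compose:
  assumes a: "a \<in> chart_roots g k U \<psi>" and b: "b \<in> chart_roots g k U \<psi>" and u: "u \<in> U"
  shows "chart_move g U \<psi> a (chart_move g U \<psi> b u) = chart_move g U \<psi> (b * a) u"
  using chart_move(2)[OF a chart_move(1)[OF b u]] chart_move(2)[OF b u]
    aff_scale_compose[OF chart_roots_nonzero[OF b], of g a]
  by (intro chart_move_eqI[symmetric] u chart_move(1) a b) simp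

lemma chart_move_one: "u \<in> U \<Longrightarrow> chart_move g U \<psi> 1 u = u"
  by (intro chart_move_eqI) (simp_all add: aff_id[OF chart_cspace])

lemma chart_move_inverse:
  assumes a: "a \<in> chart_roots g k U \<psi>" and u: "u \<in> U"
  shows "chart_move g U \<psi> a (chart_move g U \<psi> (inverse a) u) = u"
    "chart_move g U \<psi> (inverse a) (chart_move g U \<psi> a u) = u"
  using chart_roots_nonzero[OF a] chart_move_one[OF u]
  by (simp_all add: chart_move_compose[OF a chart_roots_inverse[OF a] u]
    chart_move_compose[OF chart_roots_inverse[OF a] a u])

lemma chart_move_bij:
  assumes a: "a \<in> chart_roots g k U \<psi>"
  shows "bij_betw (chart_move g U \<psi> a) U U"
  by (rule bij_betw_byWitness[where f' = "chart_move g U \<psi> (inverse a)"])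
     (use chart_move_inverse[OF a] chart_move(1)[OF a] chart_move(1)[OF chart_roots_inverse[OF a]] in auto)

lemma chart_move_Bij:
  assumes a: "a \<in> chart_roots g k U \<psi>"
  shows "chart_move g U \<psi> a \<in> Bij U"
  using chart_move_bij[OF a] by (simp add: Bij_def chart_move_def)

lemma chart_move_holomorphic:
  assumes a: "a \<in> chart_roots g k U \<psi>"
  shows "holomorphic_map g g U (chart_move g U \<psi> a)"
proof (rule holomorphic_map_cong)
  have "holomorphic_map g (2 * g + 2) U (\<lambda>u. aff g a 0 (\<psi> u))"
    by (rule holomorphic_map_compose[OF param_holomorphic[OF chart_param] aff_holomorphic[OF chart_roots_nonzero[OF a]]])
       (use chart_cspace in blast)
  moreover have "(\<lambda>u. aff g a 0 (\<psi> u)) ` U \<subseteq> \<psi> ` U" using a by (auto simp: chart_roots_def)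
  ultimately show "holomorphic_map g g U (\<lambda>u. inv_into U \<psi> (aff g a 0 (\<psi> u)))"
    by (rule holomorphic_map_lift[OF chart_param])
qed (simp add: chart_move_def)

lemma chart_move_biholomorphism:
  assumes a: "a \<in> chart_roots g k U \<psi>"
  shows "biholomorphism g U U (chart_move g U \<psi> a)"
proof -
  have "chart_move g U \<psi> (inverse a) u = inv_into U (chart_move g U \<psi> a) u" if u: "u \<in> U" for u
    using inv_into_f_f[OF bij_betw_imp_inj_on[OF chart_move_bij[OF a]] chart_move(1)[OF chart_roots_inverse[OF a] u]]
    by (simp add: chart_move_inverse(1)[OF a u])
  then have "holomorphic_map g g U (inv_into U (chart_move g U \<psi> a))"
    by (rule holomorphic_map_cong[OF chart_move_holomorphic[OF chart_roots_inverse[OF a]]])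
  then show ?thesis
    using chart_move_bij[OF a] chart_move_holomorphic[OF a] by (simp add: biholomorphism_def)
qed

lemma chart_group_mult:
  assumes a: "a \<in> chart_roots g k U \<psi>" and b: "b \<in> chart_roots g k U \<psi>"
  shows "mult (BijGroup U) (chart_move g U \<psi> a) (chart_move g U \<psi> b) = chart_move g U \<psi> (b * a)"
proof -
  have "mult (BijGroup U) (chart_move g U \<psi> a) (chart_move g U \<psi> b) =
      compose U (chart_move g U \<psi> a) (chart_move g U \<psi> b)"
    using chart_move_Bij a b by (simp add: BijGroup_def)
  also have "\<dots> = chart_move g U \<psi> (b * a)"
  proof
    fix u
    show "compose U (chart_move g U \<psi> a) (chart_move g U \<psi> b) u = chart_move g U \<psi> (b * a) u"
    proof (cases "u \<in> U")
      case True then show ?thesis using chart_move_compose[OF a b] by (simp add: compose_eq)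
    next
      case False then show ?thesis by (simp add: compose_def chart_move_def)
    qed
  qed
  finally show ?thesis .
qed

lemma chart_group_subgroup: "subgroup (chart_group g k U \<psi>) (BijGroup U)"
proof -
  interpret B: group "BijGroup U" by (rule group_BijGroup)
  have one: "chart_move g U \<psi> 1 = one (BijGroup U)"
  proof
    fix u show "chart_move g U \<psi> 1 u = one (BijGroup U) u"
      using chart_move_one[of u] by (cases "u \<in> U") (simp_all add: BijGroup_def chart_move_def)
  qed
  have car: "chart_move g U \<psi> a \<in> carrier (BijGroup U)" if "a \<in> chart_roots g k U \<psi>" for a
    using chart_move_Bij[OF that] by (simp add: BijGroup_def)
  have inv: "m_inv (BijGroup U) (chart_move g U \<psi> a) = chart_move g U \<psi> (inverse a)"
    if a: "a \<in> chart_roots g k U \<psi>" for a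
  proof (rule B.inv_equality)
    show "mult (BijGroup U) (chart_move g U \<psi> (inverse a)) (chart_move g U \<psi> a) = one (BijGroup U)"
      unfolding chart_group_mult[OF chart_roots_inverse[OF a] a] using chart_roots_nonzero[OF a] one by simp
  qed (use car a chart_roots_inverse in blast)+
  show ?thesis
  proof (rule B.subgroupI)
    show "chart_group g k U \<psi> \<subseteq> carrier (BijGroup U)" using car by (auto simp: chart_group_def)
    show "chart_group g k U \<psi> \<noteq> {}" using chart_roots_one by (auto simp: chart_group_def)
    show "m_inv (BijGroup U) c \<in> chart_group g k U \<psi>" if "c \<in> chart_group g k U \<psi>" for c
      using that inv chart_roots_inverse by (auto simp: chart_group_def)
    show "mult (BijGroup U) c d \<in> chart_group g k U \<psi>"
      if "c \<in> chart_group g k U \<psi>" "d \<in> chart_group g k U \<psi>" for c d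
      using that chart_group_mult chart_roots_mult by (auto simp: chart_group_def)
  qed
qed

text \<open>Points of one slice in the same orbit differ by a root of unity. It carries a point of
  the piece into the piece, and therefore preserves the piece.\<close>

lemma chart_group_orbits:
  assumes u: "u \<in> U" and v: "v \<in> U"
  shows "A_proj g (\<psi> u) = A_proj g (\<psi> v) \<longleftrightarrow> (\<exists>\<gamma>\<in>chart_group g k U \<psi>. v = \<gamma> u)"
proof
  assume "A_proj g (\<psi> u) = A_proj g (\<psi> v)"
  with A_proj_eq_iff[OF chart_cspace[OF u] chart_cspace[OF v]]
  obtain a b where ab: "a \<noteq> 0" "\<psi> v = aff g a b (\<psi> u)" by blast
  have k2: "k < 2 * g + 2" using k by simp
  have "aff g a b (\<psi> u) \<in> slice g n k" using chart_slice[OF v] ab(2) by simp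
  note * = aff_same_slice[OF chart_slice[OF u] this ab(1) k2]
  have psi: "\<psi> v = aff g a 0 (\<psi> u)" using ab(2) *(1) by simp
  then have "aff g a 0 ` \<psi> ` U \<inter> \<psi> ` U \<noteq> {}" using u v by blast
  then have "a \<in> chart_roots g k U \<psi>" using sc *(2) by (simp add: slice_chart_def chart_roots_def)
  moreover have "v = chart_move g U \<psi> a u" using chart_move_eqI[OF u v psi] by simp
  ultimately show "\<exists>\<gamma>\<in>chart_group g k U \<psi>. v = \<gamma> u" unfolding chart_group_def by blast
next
  assume "\<exists>\<gamma>\<in>chart_group g k U \<psi>. v = \<gamma> u"
  then obtain a where a: "a \<in> chart_roots g k U \<psi>" "v = chart_move g U \<psi> a u" unfolding chart_group_def by blast
  then have "\<psi> v = aff g a 0 (\<psi> u)" using chart_move(2)[OF a(1) u] by simp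
  then show "A_proj g (\<psi> u) = A_proj g (\<psi> v)"
    using A_proj_aff[OF chart_cspace[OF u] chart_roots_nonzero[OF a(1)]] by simp
qed

text \<open>The chart map is open because saturations of open parts of the slice are open; together
  with continuity this makes it a quotient map onto its image.\<close>

lemma slice_orbifold_chart: "orbifold_chart g (A_quot g n) (U, chart_group g k U \<psi>, A_proj g \<circ> \<psi>)"
proof -
  let ?X = "A_quot g n" and ?\<phi> = "A_proj g \<circ> \<psi>"
  have k2: "k < 2 * g + 2" using k by simp
  have open_image: "openin ?X (?\<phi> ` V)" if "openin (top_of_set (cspace g)) V" "V \<subseteq> U" for V
    using slice_saturation_open[OF k2 param_image_open[OF chart_param that]] by (simp add: image_comp)
  have U: "openin (top_of_set (cspace g)) U" by (rule param_domain_open[OF chart_param])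
  have "finite {a::complex. a ^ (2 * g + 2 - k) = 1}" by (rule finite_roots_unity) (use k in simp)
  then have fin: "finite (chart_group g k U \<psi>)"
    unfolding chart_group_def chart_roots_def by (intro finite_imageI) simp
  have quot: "quotient_map (top_of_set U) (subtopology ?X (?\<phi> ` U)) ?\<phi>"
  proof (rule continuous_open_imp_quotient_map)
    have "continuous_map (top_of_set U) (top_of_set (A_tilde_coeffs g n)) \<psi>"
      using param_continuous[OF chart_param] chart_A_tilde by (auto simp: continuous_map_in_subtopology)
    from continuous_map_compose[OF this quotient_imp_continuous_map[OF A_proj_quotient]]
    show "continuous_map (top_of_set U) (subtopology ?X (?\<phi> ` U)) ?\<phi>"
      by (simp add: continuous_map_in_subtopology)
    show "open_map (top_of_set U) (subtopology ?X (?\<phi> ` U)) ?\<phi>"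
      unfolding open_map_def
    proof (intro allI impI)
      fix V assume V: "openin (top_of_set U) V"
      then have VU: "V \<subseteq> U" using openin_imp_subset by blast
      have "openin ?X (?\<phi> ` V)" by (rule open_image[OF openin_trans[OF V U] VU])
      moreover have "?\<phi> ` V = ?\<phi> ` V \<inter> ?\<phi> ` U" using VU by blast
      ultimately show "openin (subtopology ?X (?\<phi> ` U)) (?\<phi> ` V)" unfolding openin_subtopology by blast
    qed
    have "?\<phi> ` U \<subseteq> topspace ?X" using openin_subset[OF open_image[OF U]] by simp
    then show "?\<phi> ` topspace (top_of_set U) = topspace (subtopology ?X (?\<phi> ` U))"
      by (simp add: Int_absorb1)
  qed
  have "connected U" using sc by (simp add: slice_chart_def)
  moreover have "\<forall>\<gamma>\<in>chart_group g k U \<psi>. biholomorphism g U U \<gamma>"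
    using chart_move_biholomorphism by (auto simp: chart_group_def)
  moreover have "\<forall>u\<in>U. \<forall>v\<in>U. ?\<phi> u = ?\<phi> v \<longleftrightarrow> (\<exists>\<gamma>\<in>chart_group g k U \<psi>. v = \<gamma> u)"
    using chart_group_orbits by simp
  ultimately show ?thesis
    unfolding orbifold_chart_def prod.case
    using U fin chart_group_subgroup open_image[OF U order_refl] quot by (intro conjI)
qed

end

text \<open>The principal root of r^(-w) is r^(-1) as long as w * Ln r stays in the strip |Im| < pi,
  which holds near r = 1.\<close>

lemma eventually_root_of_inverse:
  assumes w: "w > 0"
  shows "\<forall>\<^sub>F r in nhds (1::complex). r * root_of w (inverse r ^ w) = 1"
proof -
  have "(Ln \<longlongrightarrow> Ln 1) (nhds (1::complex))"
    by (rule tendsto_Ln[OF filterlim_ident]) simp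
  then have "((\<lambda>r. of_nat w * Ln r) \<longlongrightarrow> of_nat w * Ln 1) (nhds (1::complex))" by (intro tendsto_mult tendsto_const)
  then have "((\<lambda>r. norm (of_nat w * Ln r)) \<longlongrightarrow> 0) (nhds (1::complex))" by (intro tendsto_norm_zero) simp
  then have "\<forall>\<^sub>F r in nhds (1::complex). norm (of_nat w * Ln r) < pi" by (rule order_tendstoD(2)) simp
  moreover have "\<forall>\<^sub>F r in nhds (1::complex). r \<noteq> 0" by (rule t1_space_nhds) simp
  ultimately show ?thesis
  proof eventually_elim
    case (elim r)
    have "\<bar>Im (- (of_nat w * Ln r))\<bar> < pi"
      using le_less_trans[OF abs_Im_le_cmod elim(1)] by simp
    then have "Ln (exp (- (of_nat w * Ln r))) = - (of_nat w * Ln r)" by (intro Ln_exp) linarith+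
    moreover have "exp (- (of_nat w * Ln r)) = inverse r ^ w"
      using elim(2) by (simp add: exp_minus exp_of_nat_mult power_inverse)
    ultimately have "root_of w (inverse r ^ w) = exp (- Ln r)" using w by (simp add: root_of_def)
    then show ?case using elim(2) by (simp add: exp_minus)
  qed
qed

lemma eventually_nb_open:
  assumes "eventually P (nb m u)" "u \<in> cspace m"
  obtains B where "openin (top_of_set (cspace m)) B" "u \<in> B" "\<forall>w\<in>B. P w"
proof -
  obtain T where T: "open T" "u \<in> T" "\<forall>w\<in>T. w \<in> cspace m \<longrightarrow> P w"
    using assms(1) unfolding nb_def eventually_inf_principal eventually_nhds by blast
  show ?thesis
  proof (rule that)
    show "openin (top_of_set (cspace m)) (cspace m \<inter> T)" using T(1) by (rule openin_open_Int)
  qed (use T assms(2) in auto)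
qed

text \<open>Maps that are mutually inverse near a pair of points become inverse bijections once each
  neighbourhood is cut down to the points whose image lies in the other one.\<close>

lemma local_biholomorphism:
  assumes H: "holomorphic_map m m E H" and H': "holomorphic_map m m E' H'"
    and u: "u \<in> cspace m" "H u = u'" and u': "u' \<in> cspace m" "H' u' = u"
    and ev: "\<forall>\<^sub>F w in nb m u. w \<in> E \<and> H' (H w) = w"
    and ev': "\<forall>\<^sub>F w in nb m u'. w \<in> E' \<and> H (H' w) = w"
  obtains W W' where "u \<in> W" "W \<subseteq> E" "u' \<in> W'" "W' \<subseteq> E'" "biholomorphism m W W' H"
proof -
  obtain B where B: "openin (top_of_set (cspace m)) B" "u \<in> B" "\<forall>w\<in>B. w \<in> E \<and> H' (H w) = w"
    by (rule eventually_nb_open[OF ev u(1)])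
  obtain B' where B': "openin (top_of_set (cspace m)) B'" "u' \<in> B'" "\<forall>w\<in>B'. w \<in> E' \<and> H (H' w) = w"
    by (rule eventually_nb_open[OF ev' u'(1)])
  define W where "W = {w \<in> B. H w \<in> B'}"
  define W' where "W' = {w \<in> B'. H' w \<in> B}"
  have BE: "holomorphic_map m m B H" by (rule holomorphic_map_subset[OF H B(1)]) (use B(3) in blast)
  have BE': "holomorphic_map m m B' H'" by (rule holomorphic_map_subset[OF H' B'(1)]) (use B'(3) in blast)
  have inv: "H' (H w) = w" "H w \<in> W'" if "w \<in> W" for w using that B(3) by (auto simp: W_def W'_def)
  have inv': "H (H' w) = w" "H' w \<in> W" if "w \<in> W'" for w using that B'(3) by (auto simp: W_def W'_def)
  have bij: "bij_betw H W W'" by (rule bij_betw_byWitness[where f' = H']) (use inv inv' in auto)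
  have "holomorphic_map m m W H" unfolding W_def
    by (rule holomorphic_map_subset[OF BE holomorphic_preimage_open[OF BE B'(1)]]) blast
  moreover have "holomorphic_map m m W' (inv_into W H)"
  proof (rule holomorphic_map_cong)
    show "holomorphic_map m m W' H'" unfolding W'_def
      by (rule holomorphic_map_subset[OF BE' holomorphic_preimage_open[OF BE' B(1)]]) blast
    show "H' w = inv_into W H w" if "w \<in> W'" for w
      using inv_into_f_f[OF bij_betw_imp_inj_on[OF bij] inv'(2)[OF that]] inv'(1)[OF that] by simp
  qed
  ultimately have "biholomorphism m W W' H" using bij by (simp add: biholomorphism_def)
  moreover have "u \<in> W" "u' \<in> W'" using B(2) B'(2) u(2) u'(2) by (simp_all add: W_def W'_def)
  moreover have "W \<subseteq> E" "W' \<subseteq> E'" using B(3) B'(3) by (auto simp: W_def W'_def)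
  ultimately show ?thesis by (intro that)
qed

definition trans_dom :: "nat \<Rightarrow> nat \<Rightarrow> nat \<Rightarrow> cvec set \<Rightarrow> (cvec \<Rightarrow> cvec) \<Rightarrow> complex \<Rightarrow> complex \<Rightarrow> cvec set" where
  "trans_dom g n k U \<psi> a b =
     {q \<in> A_tilde_coeffs g n. aff g a b q \<in> norm_domain g k \<and> normalise g k (aff g a b q) \<in> \<psi> ` U}"

text \<open>A fixed affine map brings q close to the slice, normalisation moves it onto the slice,
  and inverting the parametrisation gives chart coordinates. On the whole space this lifts the
  projection locally; composed with the parametrisation of another slice it is a change of
  charts.\<close>

definition transition :: "nat \<Rightarrow> nat \<Rightarrow> cvec set \<Rightarrow> (cvec \<Rightarrow> cvec) \<Rightarrow> complex \<Rightarrow> complex \<Rightarrow> cvec \<Rightarrow> cvec" where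
  "transition g k U \<psi> a b q = inv_into U \<psi> (normalise g k (aff g a b q))"

lemma holomorphic_relative_preimage_open:
  assumes s: "holomorphic_map m N W s" and S: "s ` W \<subseteq> S" "S \<subseteq> cspace N" and Q: "openin (top_of_set S) Q"
  shows "openin (top_of_set (cspace m)) {t \<in> W. s t \<in> Q}"
proof -
  obtain T where T: "open T" "Q = S \<inter> T" using Q by (auto simp: openin_open)
  have "openin (top_of_set (cspace m)) {t \<in> W. s t \<in> cspace N \<inter> T}"
    by (rule holomorphic_preimage_open[OF s openin_open_Int[OF T(1)]])
  moreover have "{t \<in> W. s t \<in> cspace N \<inter> T} = {t \<in> W. s t \<in> Q}" using S T(2) by blast
  ultimately show ?thesis by simp
qed

context
  fixes g n k :: nat and U \<psi>
  assumes k: "k < 2 * g + 1" and sc: "slice_chart g n k U \<psi>"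
begin

lemma trans_dom_open:
  assumes a: "a \<noteq> 0"
  shows "openin (top_of_set (A_tilde_coeffs g n)) (trans_dom g n k U \<psi> a b)"
proof -
  have k2: "k < 2 * g + 2" using k by simp
  from aff_preimage_open[OF normalise_preimage_open[OF k2 param_open_image[OF chart_param[OF k sc]]] a, of b]
  show ?thesis
    by (rule back_subst[of "openin (top_of_set (A_tilde_coeffs g n))"])
       (use aff_A_tilde_coeffs[OF a] in \<open>auto simp: trans_dom_def\<close>)
qed

lemma transition:
  assumes "q \<in> trans_dom g n k U \<psi> a b"
  shows "transition g k U \<psi> a b q \<in> U" "\<psi> (transition g k U \<psi> a b q) = normalise g k (aff g a b q)"
proof -
  have *: "normalise g k (aff g a b q) \<in> \<psi> ` U" using assms by (simp add: trans_dom_def)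
  show "transition g k U \<psi> a b q \<in> U" unfolding transition_def by (rule inv_into_into[OF *])
  show "\<psi> (transition g k U \<psi> a b q) = normalise g k (aff g a b q)"
    unfolding transition_def by (rule f_inv_into_f[OF *])
qed

lemma transition_proj:
  assumes q: "q \<in> trans_dom g n k U \<psi> a b" and a: "a \<noteq> 0"
  shows "A_proj g (\<psi> (transition g k U \<psi> a b q)) = A_proj g q"
proof -
  have "q \<in> cspace (2 * g + 2)" using q A_tilde_coeffs_cspace by (auto simp: trans_dom_def)
  then show ?thesis
    unfolding transition(2)[OF q] normalise_def using A_proj_aff[OF aff_in_cspace root_of_nonzero] A_proj_aff[OF _ a] by simp
qed

lemma transition_at:
  assumes u: "u \<in> U" and p: "p \<in> A_tilde_coeffs g n" and eq: "\<psi> u = aff g a b p"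
  shows "p \<in> trans_dom g n k U \<psi> a b" "transition g k U \<psi> a b p = u"
proof -
  note s = chart_slice[OF k sc u]
  show "p \<in> trans_dom g n k U \<psi> a b"
  proof -
    have "aff g a b p \<in> norm_domain g k \<and> normalise g k (aff g a b p) \<in> \<psi> ` U"
      unfolding eq[symmetric] using slice_norm_domain[OF s] normalise_id[OF s] u by simp
    then show ?thesis using p by (simp add: trans_dom_def)
  qed
  show "transition g k U \<psi> a b p = u"
    unfolding transition_def eq[symmetric] normalise_id[OF s] by (rule param_inv[OF chart_param[OF k sc] u])
qed

lemma transition_holomorphic:
  assumes a: "a \<noteq> 0" and s: "holomorphic_map m (2 * g + 2) W s" and sA: "s ` W \<subseteq> A_tilde_coeffs g n"
  shows "holomorphic_map m g {t \<in> W. s t \<in> trans_dom g n k U \<psi> a b} (\<lambda>t. transition g k U \<psi> a b (s t))"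
proof -
  let ?W = "{t \<in> W. s t \<in> trans_dom g n k U \<psi> a b}"
  have "A_tilde_coeffs g n \<subseteq> cspace (2 * g + 2)" using A_tilde_coeffs_cspace by blast
  from holomorphic_relative_preimage_open[OF s sA this trans_dom_open[OF a]]
  have "holomorphic_map m (2 * g + 2) ?W s" by (rule holomorphic_map_subset[OF s]) blast
  then have "holomorphic_map m (2 * g + 2) ?W (\<lambda>t. aff g a b (s t))"
    by (rule holomorphic_map_compose[OF _ aff_holomorphic[OF a]]) (use sA A_tilde_coeffs_cspace in blast)
  then have "holomorphic_map m (2 * g + 2) ?W (\<lambda>t. normalise g k (aff g a b (s t)))"
    by (rule holomorphic_map_compose[OF _ normalise_holomorphic]) (auto simp: trans_dom_def)
  from holomorphic_map_lift[OF chart_param[OF k sc] this]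
  show ?thesis unfolding transition_def by (auto simp: trans_dom_def)
qed

end

lemma transition_round_trip:
  assumes k: "k < 2 * g + 1" and sc: "slice_chart g n k U \<psi>"
    and k': "k' < 2 * g + 1" and sc': "slice_chart g n k' U' \<psi>'"
    and a: "a \<noteq> 0" and u: "u \<in> U" and u': "u' \<in> U'" and eq: "\<psi>' u' = aff g a 0 (\<psi> u)"
  defines "E \<equiv> {w \<in> U. \<psi> w \<in> trans_dom g n k' U' \<psi>' a 0}"
    and "H \<equiv> \<lambda>w. transition g k' U' \<psi>' a 0 (\<psi> w)"
    and "H' \<equiv> \<lambda>w. transition g k U \<psi> (inverse a) 0 (\<psi>' w)"
  shows "\<forall>\<^sub>F w in nb g u. w \<in> E \<and> H' (H w) = w"
proof -
  let ?v = "2 * g + 2 - k" and ?v' = "2 * g + 2 - k'"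
  \<comment> \<open>The additional scaling caused by normalising in the slice of index k'. It tends
    to 1 at u, whose scaled image already lies in that slice. Near 1 the principal root chosen on
    the way back cancels it exactly.\<close>
  define r where "r w = root_of ?v' (inverse a ^ ?v' * \<psi> w k')" for w
  have k2: "k < 2 * g + 2" "k' < 2 * g + 2" using k k' by auto
  have psi: "holomorphic_map g (2 * g + 2) U \<psi>" by (rule param_holomorphic[OF chart_param[OF k sc]])
  have psi': "holomorphic_map g (2 * g + 2) U' \<psi>'" by (rule param_holomorphic[OF chart_param[OF k' sc']])
  have HE: "holomorphic_map g g E H"
    unfolding E_def H_def by (rule transition_holomorphic[OF k' sc' a psi]) (use chart_A_tilde[OF k sc] in blast)
  have ia: "inverse a \<noteq> 0" using a by simp
  define E' where "E' = {w \<in> U'. \<psi>' w \<in> trans_dom g n k U \<psi> (inverse a) 0}"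
  have HE': "holomorphic_map g g E' H'"
    unfolding E'_def H'_def by (rule transition_holomorphic[OF k sc ia psi']) (use chart_A_tilde[OF k' sc'] in blast)
  have uE: "u \<in> E" "H u = u'"
    unfolding E_def H_def using transition_at[OF k' sc' u' chart_A_tilde[OF k sc u] eq] u by simp_all
  have "\<psi> u = aff g (inverse a) 0 (\<psi>' u')"
    unfolding eq using aff_inverse[OF a chart_cspace[OF k sc u], of 0] by simp
  then have "u' \<in> E'" unfolding E'_def using transition_at(1)[OF k sc u chart_A_tilde[OF k' sc' u']] u' by simp
  then have "\<forall>\<^sub>F w in nb g u'. w \<in> E'" by (rule holomorphic_map_nbhd[OF HE'])
  with holomorphic_map_lim[OF HE uE(1)] have ev1: "\<forall>\<^sub>F w in nb g u. H w \<in> E'"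
    unfolding uE(2) filterlim_iff by blast
  have ev2: "\<forall>\<^sub>F w in nb g u. w \<in> E" by (rule holomorphic_map_nbhd[OF HE uE(1)])
  have one: "inverse a ^ ?v' * \<psi> u k' = 1"
    using aff_scale[OF a k2(2), of "\<psi> u"] slice_one[OF chart_slice[OF k' sc' u']] eq by simp
  have "((\<lambda>w. \<psi> w k') \<longlongrightarrow> \<psi> u k') (nb g u)"
    using holomorphic_map_lim[OF psi u] k2 unfolding filterlim_nb_iff[OF chart_cspace[OF k sc u]] by blast
  then have x: "((\<lambda>w. inverse a ^ ?v' * \<psi> w k') \<longlongrightarrow> 1) (nb g u)"
    using tendsto_mult[OF tendsto_const[of "inverse a ^ ?v'"]] one by metis
  have v0: "(of_nat ?v' :: complex) \<noteq> 0" using k' by (subst of_nat_eq_0_iff) simp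
  have "((\<lambda>w. exp (Ln (inverse a ^ ?v' * \<psi> w k') / of_nat ?v')) \<longlongrightarrow> exp (Ln 1 / of_nat ?v')) (nb g u)"
    by (intro tendsto_exp tendsto_divide[OF _ _ v0] tendsto_const tendsto_Ln x) simp
  then have "(r \<longlongrightarrow> 1) (nb g u)" unfolding r_def root_of_def by simp
  from eventually_compose_filterlim[OF eventually_root_of_inverse this, of ?v]
  have "\<forall>\<^sub>F w in nb g u. r w * root_of ?v (inverse (r w) ^ ?v) = 1" using k by simp
  with ev1 ev2 show ?thesis
  proof eventually_elim
    case (elim w)
    then have w: "w \<in> U" "\<psi> w \<in> trans_dom g n k' U' \<psi>' a 0" "\<psi>' (H w) \<in> trans_dom g n k U \<psi> (inverse a) 0"
      by (simp_all add: E_def E'_def)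
    note s = chart_slice[OF k sc w(1)]
    have r0: "r w \<noteq> 0" by (simp add: r_def)
    have "\<psi>' (H w) = aff g (a * r w) 0 (\<psi> w)"
      unfolding H_def transition(2)[OF k' sc' w(2)] r_def by (rule normalise_aff[OF s a k2(2)])
    then have "aff g (inverse a) 0 (\<psi>' (H w)) = aff g (r w) 0 (\<psi> w)"
      using aff_scale_compose[of "a * r w" g "inverse a" "\<psi> w"] a r0 by (simp add: field_simps)
    then have "\<psi> (H' (H w)) = aff g (r w * root_of ?v (inverse (r w) ^ ?v * \<psi> w k)) 0 (\<psi> w)"
      unfolding H'_def transition(2)[OF k sc w(3)] using normalise_aff[OF s r0 k2(1), of 0] by simp
    also have "\<dots> = \<psi> w" using elim(3) slice_one[OF s] aff_id[OF slice_cspace[OF s]] by simp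
    finally have "\<psi> (H' (H w)) = \<psi> w" .
    moreover have "H' (H w) \<in> U" unfolding H'_def by (rule transition(1)[OF k sc w(3)])
    ultimately have "H' (H w) = w" using param_inv[OF chart_param[OF k sc]] w(1) by metis
    then show ?case using elim(2) by simp
  qed
qed

lemma slice_charts_compatible:
  assumes k: "k < 2 * g + 1" and sc: "slice_chart g n k U \<psi>"
    and k': "k' < 2 * g + 1" and sc': "slice_chart g n k' U' \<psi>'"
  shows "compatible_charts g (U, \<Gamma>, A_proj g \<circ> \<psi>) (U', \<Gamma>', A_proj g \<circ> \<psi>')"
  unfolding compatible_charts_def prod.case
proof (intro ballI impI)
  fix u u' assume u: "u \<in> U" and u': "u' \<in> U'" and "(A_proj g \<circ> \<psi>) u = (A_proj g \<circ> \<psi>') u'"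
  then obtain a b where a: "a \<noteq> 0" and ab: "\<psi>' u' = aff g a b (\<psi> u)"
    using A_proj_eq_iff[OF chart_cspace[OF k sc u] chart_cspace[OF k' sc' u']] by auto
  have "aff g a b (\<psi> u) \<in> slice g n k'" using chart_slice[OF k' sc' u'] ab by simp
  from aff_between_slices[OF chart_slice[OF k sc u] this a] have eq: "\<psi>' u' = aff g a 0 (\<psi> u)" using ab by simp
  have eq': "\<psi> u = aff g (inverse a) 0 (\<psi>' u')"
    unfolding eq using aff_inverse[OF a chart_cspace[OF k sc u], of 0] by simp
  have ia: "inverse a \<noteq> 0" using a by simp
  let ?H = "\<lambda>w. transition g k' U' \<psi>' a 0 (\<psi> w)" and ?E = "{w \<in> U. \<psi> w \<in> trans_dom g n k' U' \<psi>' a 0}"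
  let ?H' = "\<lambda>w. transition g k U \<psi> (inverse a) 0 (\<psi>' w)" and ?E' = "{w \<in> U'. \<psi>' w \<in> trans_dom g n k U \<psi> (inverse a) 0}"
  have H: "holomorphic_map g g ?E ?H"
    by (rule transition_holomorphic[OF k' sc' a param_holomorphic[OF chart_param[OF k sc]]])
       (use chart_A_tilde[OF k sc] in blast)
  have H': "holomorphic_map g g ?E' ?H'"
    by (rule transition_holomorphic[OF k sc ia param_holomorphic[OF chart_param[OF k' sc']]])
       (use chart_A_tilde[OF k' sc'] in blast)
  have uc: "u \<in> cspace g" "u' \<in> cspace g"
    using u u' param_domain_subset[OF chart_param[OF k sc]] param_domain_subset[OF chart_param[OF k' sc']] by blast+
  have Hu: "?H u = u'" by (rule transition_at(2)[OF k' sc' u' chart_A_tilde[OF k sc u] eq])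
  have Hu': "?H' u' = u" by (rule transition_at(2)[OF k sc u chart_A_tilde[OF k' sc' u'] eq'])
  have ev: "\<forall>\<^sub>F w in nb g u. w \<in> ?E \<and> ?H' (?H w) = w" by (rule transition_round_trip[OF k sc k' sc' a u u' eq])
  have ev': "\<forall>\<^sub>F w in nb g u'. w \<in> ?E' \<and> ?H (?H' w) = w"
    using transition_round_trip[OF k' sc' k sc ia u' u eq'] by simp
  obtain W W' where W: "u \<in> W" "W \<subseteq> ?E" "u' \<in> W'" "W' \<subseteq> ?E'" "biholomorphism g W W' ?H"
    by (rule local_biholomorphism[OF H H' uc(1) Hu uc(2) Hu' ev ev'])
  have "(A_proj g \<circ> \<psi>') (?H w) = (A_proj g \<circ> \<psi>) w" if "w \<in> W" for w
    using transition_proj[OF k' sc' _ a] W(2) that by auto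
  with W Hu show "\<exists>W W' h. u \<in> W \<and> W \<subseteq> U \<and> u' \<in> W' \<and> W' \<subseteq> U' \<and> biholomorphism g W W' h \<and> h u = u' \<and>
      (\<forall>w\<in>W. (A_proj g \<circ> \<psi>') (h w) = (A_proj g \<circ> \<psi>) w)"
    by (intro exI[of _ W] exI[of _ W'] exI[of _ ?H]) auto
qed

text \<open>Through every point of the domain runs a holomorphic local section, obtained by undoing
  a fixed affine map on the slice. As the composite is the identity, the derivative of the
  transition map is surjective in any parametrisation of the space.\<close>

lemma transition_submersion:
  assumes k: "k < 2 * g + 1" and sc: "slice_chart g n k U \<psi>" and a: "a \<noteq> 0"
  shows "submanifold_submersion (2 * g + 2) (g + 2) (A_tilde_coeffs g n) g
    (trans_dom g n k U \<psi> a b) (transition g k U \<psi> a b)"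
  unfolding submanifold_submersion_def holomorphic_submersion_def
proof (intro conjI allI impI ballI; (elim conjE)?)
  let ?A = "A_tilde_coeffs g n" and ?D = "trans_dom g n k U \<psi> a b" and ?f = "transition g k U \<psi> a b"
  let ?w = "2 * g + 2 - k" and ?N = "2 * g + 2"
  show "openin (top_of_set ?A) ?D" by (rule trans_dom_open[OF k sc a])
  fix V \<theta> assume sp: "submanifold_param ?N (g + 2) ?A V \<theta>" and VD: "\<theta> ` V \<subseteq> ?D"
  have "{t \<in> V. \<theta> t \<in> ?D} = V" using VD by blast
  then show "holomorphic_map (g + 2) g V (?f \<circ> \<theta>)"
    using transition_holomorphic[OF k sc a param_holomorphic[OF sp] param_image_subset[OF sp], of b] by (simp add: o_def)
  fix v0 J assume v0: "v0 \<in> V" and J: "has_jacobian (g + 2) g (?f \<circ> \<theta>) J v0"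
  have k2: "k < ?N" and w: "?w > 0" using k by auto
  have q: "\<theta> v0 \<in> ?D" using VD v0 by blast
  have qA: "\<theta> v0 \<in> ?A" using param_image_subset[OF sp] v0 by blast
  define u1 where "u1 = ?f (\<theta> v0)"
  define y where "y = centred_coeff g k (aff g a b (\<theta> v0))"
  define \<alpha> where "\<alpha> = root_of ?w y"
  define e where "e = cent g (aff g a b (\<theta> v0))"
  \<comment> \<open>With \<alpha> and e frozen at the given point, (c, d) is the affine map that
    sends \<theta> v0 to the slice. Its inverse, applied to all of the slice piece, will be the
    section.\<close>
  define c where "c = a * \<alpha>"
  define d where "d = a * e + b"
  have \<alpha>: "\<alpha> \<noteq> 0" by (simp add: \<alpha>_def)
  have c: "c \<noteq> 0" using a \<alpha> by (simp add: c_def)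
  have "y \<noteq> 0" using q by (auto simp: trans_dom_def norm_domain_def y_def)
  then have "\<alpha> ^ ?w = y" unfolding \<alpha>_def by (rule root_of_power[OF w])
  \<comment> \<open>\<alpha> is itself a principal root, so taking its power and then the root
    returns it. This makes the section exact on all of U and not only near u1.\<close>
  then have \<alpha>1: "inverse \<alpha> * root_of ?w (inverse (inverse \<alpha>) ^ ?w) = 1" using \<alpha> by (simp add: \<alpha>_def)
  have u1: "u1 \<in> U" "\<psi> u1 = aff g c d (\<theta> v0)"
    unfolding u1_def using transition[OF k sc q] aff_compose[OF a, of g \<alpha> e b "\<theta> v0"]
    by (simp_all add: normalise_def c_def d_def \<alpha>_def e_def y_def)
  define s where "s x = aff g (inverse c) (- d / c) (\<psi> x)" for x
  have ic: "inverse c \<noteq> 0" using c by simp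
  have s: "holomorphic_map g ?N U s"
    unfolding s_def by (rule holomorphic_map_compose[OF param_holomorphic[OF chart_param[OF k sc]] aff_holomorphic[OF ic]])
      (use chart_cspace[OF k sc] in blast)
  have sA: "s x \<in> ?A" if "x \<in> U" for x unfolding s_def by (rule aff_A_tilde_coeffs[OF ic chart_A_tilde[OF k sc that]])
  have s1: "s u1 = \<theta> v0" unfolding s_def u1(2) by (rule aff_inverse[OF c A_tilde_coeffs_cspace[OF qA]])
  have fs: "?f (s x) = x" if x: "x \<in> U" for x
  proof -
    have "inverse c * a = inverse \<alpha>" using a by (simp add: c_def)
    then have "aff g a b (s x) = aff g (inverse \<alpha>) (inverse c * b + - d / c) (\<psi> x)"
      unfolding s_def using aff_compose[OF ic, of g a b "- d / c" "\<psi> x"] by simp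
    moreover have "normalise g k (aff g (inverse \<alpha>) (inverse c * b + - d / c) (\<psi> x)) = \<psi> x"
      using normalise_aff[OF chart_slice[OF k sc x] _ k2, of "inverse \<alpha>" "inverse c * b + - d / c"] \<alpha> \<alpha>1
        slice_one[OF chart_slice[OF k sc x]] aff_id[OF chart_cspace[OF k sc x]] by simp
    ultimately show ?thesis unfolding transition_def using param_inv[OF chart_param[OF k sc] x] by simp
  qed
  define X where "X = {x \<in> U. s x \<in> \<theta> ` V}"
  have "openin (top_of_set (cspace g)) X"
    unfolding X_def by (rule holomorphic_relative_preimage_open[OF s _ _ param_open_image[OF sp]])
      (use sA A_tilde_coeffs_cspace in blast)+
  then have "holomorphic_map g ?N X s" by (rule holomorphic_map_subset[OF s]) (auto simp: X_def)
  then have C: "holomorphic_map g (g + 2) X (\<lambda>x. inv_into V \<theta> (s x))"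
    by (rule holomorphic_map_lift[OF sp]) (auto simp: X_def)
  let ?C = "\<lambda>x. inv_into V \<theta> (s x)"
  have u1X: "u1 \<in> X" using u1(1) s1 v0 by (simp add: X_def)
  have C1: "?C u1 = v0" using s1 param_inv[OF sp v0] by simp
  have fC: "(?f \<circ> \<theta>) (?C x) = x" if "x \<in> X" for x
    using that f_inv_into_f[of "s x" \<theta> V] fs by (simp add: X_def)
  obtain K where K: "has_jacobian g (g + 2) ?C K u1" by (rule holomorphic_map_jacobian[OF C u1X])
  have u1c: "u1 \<in> cspace g" by (rule holomorphic_map_dom[OF C u1X])
  have ev: "\<forall>\<^sub>F x in nb g u1. x \<in> X" by (rule holomorphic_map_nbhd[OF C u1X])
  have evC: "\<forall>\<^sub>F x in nb g u1. ?C x \<in> cspace (g + 2)" using ev by eventually_elim (rule holomorphic_map_ran[OF C])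
  have "has_jacobian g g ((?f \<circ> \<theta>) \<circ> ?C) (mat_mul (g + 2) J K) u1"
    by (rule has_jacobian_chain[OF u1c holomorphic_map_ran[OF C u1X] evC K]) (use J C1 in simp)
  then have id: "has_jacobian g g (\<lambda>x. x) (mat_mul (g + 2) J K) u1"
    by (rule has_jacobian_cong[OF u1c, rotated]) (use ev in \<open>eventually_elim, use fC in simp\<close>)
  have "v \<in> mat_apply (g + 2) g J ` cspace (g + 2)" if v: "v \<in> cspace g" for v
  proof
    show "v = mat_apply (g + 2) g J (mat_apply g (g + 2) K v)"
      using has_jacobian_unique[OF u1c v id has_jacobian_id[OF u1c]] v by (simp add: mat_apply_mat_mul mat_apply_id)
  qed simp
  then show "mat_apply (g + 2) g J ` cspace (g + 2) = cspace g" by auto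
qed

definition slice_atlas :: "nat \<Rightarrow> nat \<Rightarrow> complex poly set orbifold_chart set" where
  "slice_atlas g n =
     {(U, chart_group g k U \<psi>, A_proj g \<circ> \<psi>) | U k \<psi>. k < 2 * g + 1 \<and> slice_chart g n k U \<psi>}"

lemma slice_atlas_cover:
  assumes n: "n \<ge> 1"
  shows "(\<Union>(U, \<Gamma>, \<phi>)\<in>slice_atlas g n. \<phi> ` U) = topspace (A_quot g n)"
  unfolding topspace_A_quot
proof
  show "(\<Union>(U, \<Gamma>, \<phi>)\<in>slice_atlas g n. \<phi> ` U) \<subseteq> A_proj g ` A_tilde_coeffs g n"
    using chart_A_tilde by (fastforce simp: slice_atlas_def)
  show "A_proj g ` A_tilde_coeffs g n \<subseteq> (\<Union>(U, \<Gamma>, \<phi>)\<in>slice_atlas g n. \<phi> ` U)"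
  proof
    fix x assume "x \<in> A_proj g ` A_tilde_coeffs g n"
    then obtain z where z: "z \<in> A_tilde_coeffs g n" "x = A_proj g z" by blast
    have "aff g 1 (cent g z) z \<in> A_tilde_coeffs g n" "aff g 1 (cent g z) z (2 * g + 1) = 0"
      using aff_A_tilde_coeffs[OF _ z(1)] aff_cent_top[of 1 g z] by simp_all
    then obtain k where k: "k < 2 * g + 1" "aff g 1 (cent g z) z k \<noteq> 0" by (rule centred_nonzero_coeff)
    have "normalise g k z \<in> slice g n k"
      by (rule normalise_slice[OF z(1)]) (use k in \<open>simp_all add: centred_coeff_def\<close>)
    then obtain U \<psi> where U: "slice_chart g n k U \<psi>" "normalise g k z \<in> \<psi> ` U"
      by (rule slice_chart_exists[OF n k(1)])
    have "A_proj g (normalise g k z) = x"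
      unfolding z(2) normalise_def by (rule A_proj_aff[OF A_tilde_coeffs_cspace[OF z(1)]]) simp
    then have "x \<in> (A_proj g \<circ> \<psi>) ` U" using U(2) by auto
    moreover have "(U, chart_group g k U \<psi>, A_proj g \<circ> \<psi>) \<in> slice_atlas g n"
      unfolding slice_atlas_def using k(1) U(1) by blast
    ultimately show "x \<in> (\<Union>(U, \<Gamma>, \<phi>)\<in>slice_atlas g n. \<phi> ` U)" by blast
  qed
qed

lemma A_quot_orbifold:
  assumes n: "n \<ge> 1"
  shows "complex_orbifold g (A_quot g n) (slice_atlas g n)"
  unfolding complex_orbifold_def
proof (intro conjI ballI)
  fix c assume "c \<in> slice_atlas g n"
  then obtain U k \<psi> where c: "c = (U, chart_group g k U \<psi>, A_proj g \<circ> \<psi>)" "k < 2 * g + 1" "slice_chart g n k U \<psi>"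
    unfolding slice_atlas_def by blast
  show "orbifold_chart g (A_quot g n) c" unfolding c(1) by (rule slice_orbifold_chart[OF c(2,3)])
  fix c' assume "c' \<in> slice_atlas g n"
  then obtain U' k' \<psi>' where c': "c' = (U', chart_group g k' U' \<psi>', A_proj g \<circ> \<psi>')" "k' < 2 * g + 1" "slice_chart g n k' U' \<psi>'"
    unfolding slice_atlas_def by blast
  show "compatible_charts g c c'" unfolding c(1) c'(1) by (rule slice_charts_compatible[OF c(2,3) c'(2,3)])
qed (rule Hausdorff_A_quot second_countable_A_quot slice_atlas_cover[OF n])+

text \<open>For a prescribed chart value u over p, the affine map that carries p to the slice point
  of u selects the transition map with value u at p.\<close>

lemma A_proj_submersion:
  "orbifold_submersion (2 * g + 2) (g + 2) (A_tilde_coeffs g n) g (slice_atlas g n) (A_proj g)"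
  unfolding orbifold_submersion_def
proof (clarify)
  fix U \<Gamma> \<phi> u p
  assume "(U, \<Gamma>, \<phi>) \<in> slice_atlas g n" and u: "u \<in> U" and p: "p \<in> A_tilde_coeffs g n" and eq: "A_proj g p = \<phi> u"
  then obtain k \<psi> where c: "\<phi> = A_proj g \<circ> \<psi>" "k < 2 * g + 1" "slice_chart g n k U \<psi>"
    unfolding slice_atlas_def by blast
  obtain a b where a: "a \<noteq> 0" and ab: "\<psi> u = aff g a b p"
    using A_proj_eq_iff[OF A_tilde_coeffs_cspace[OF p] chart_cspace[OF c(2,3) u]] eq c(1) by auto
  let ?D = "trans_dom g n k U \<psi> a b" and ?f = "transition g k U \<psi> a b"
  have "\<forall>q\<in>?D. \<phi> (?f q) = A_proj g q" using transition_proj[OF c(2,3) _ a] c(1) by simp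
  moreover have "?f ` ?D \<subseteq> U" using transition(1)[OF c(2,3)] by blast
  ultimately show "\<exists>W f. p \<in> W \<and> submanifold_submersion (2 * g + 2) (g + 2) (A_tilde_coeffs g n) g W f \<and>
      f ` W \<subseteq> U \<and> f p = u \<and> (\<forall>q\<in>W. \<phi> (f q) = A_proj g q)"
    using transition_at[OF c(2,3) u p ab] transition_submersion[OF c(2,3) a, of b] by blast
qed

theorem theorem1p1:
  fixes g n :: nat
  assumes "n \<ge> 1"
  shows "(\<forall>a b D. a \<noteq> 0 \<and> D \<in> A_tilde g n \<longrightarrow> affine_act a b D \<in> A_tilde g n) \<and>
    complex_submanifold (2 * g + 2) (g + 2) (A_tilde_coeffs g n) \<and>
    (\<exists>\<A>. complex_orbifold g (A_quot g n) \<A> \<and>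
         orbifold_submersion (2 * g + 2) (g + 2) (A_tilde_coeffs g n) g \<A> (A_proj g))"
  using affine_act_A_tilde A_tilde_submanifold[OF assms] A_quot_orbifold[OF assms] A_proj_submersion by blast

end
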